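(* Let $D$ be a $3$-dicritical digraph. Then \begin{itemize} \item $\rho(D) = 1$ if $D$ is a bidirected odd cycle, \item $\rho(D) = -1$ if $D$ is an odd $3$-wheel, \item $\rho(D) \leq -2$ otherwise. \end{itemize}
   Context: Digraphs are finite, have no loops and no parallel arcs; two opposite arcs are allowed. A digon $[x,y]$ is a pair of opposite arcs $xy,yx$. For a digraph $D$, $n(D)$ is its number of vertices and $m(D)$ its number of arcs (a digon counts for two arcs). A subdigraph $D'$ of $D$ satisfies $V(D')\subseteq V(D)$, $A(D')\subseteq A(D)$; it is proper if $V(D')\neq V(D)$ or $A(D')\neq A(D)$. A $k$-dicolouring of a digraph is a colouring of its vertices with colours in $\{1,\dots,k\}$ such that each colour class induces an acyclic subdigraph (a digon is a directed cycle of length $2$). The dichromatic number $\vec{\chi}(D)$ is the least $k$ such that $D$ has a $k$-dicolouring. $D$ is $k$-dicritical if $\vec{\chi}(D)=k$ and $\vec{\chi}(D')<k$ for every proper subdigraph $D'$ of $D$. $B(D)$ is the undirected graph on $V(D)$ in which $uv$ is an edge if and only if $[u,v]$ is a digon of $D$, and $\pi(D)$ is the maximum size of a matching in $B(D)$. The potential of $D$ is $\rho(D) = 7n(D)-3m(D)-2\pi(D)$. A bidirected path (resp. bidirected cycle) is a digraph obtained from an undirected path (resp. undirected cycle of length at least $3$) by replacing every edge by a digon; its length is the length of the underlying path (resp. cycle). It is odd if its length is odd. An odd $3$-wheel is a digraph obtained by connecting a vertex $c$ to the vertices of a directed $3$-cycle $(x,y,z,x)$ by three bidirected paths of odd length (one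 from $c$ to each of $x,y,z$) that are pairwise disjoint except in $c$ (and meet the directed $3$-cycle only at their end-vertex). *)

theory Defs
  imports Graph_Theory.Digraph_Component
begin

text \<open>
  Digraphs are of type \<open>'a pair_pre_digraph\<close>, with arcs being ordered pairs of vertices, so that there
  are no parallel arcs; the locale \<open>pair_digraph\<close> adds well-formedness, finiteness and the absence of loops.
\<close>

text \<open>The length-two walk along a digon is a cycle in the sense of \<open>pre_digraph.cycle\<close>.\<close>

definition acyclic_digraph :: "('a, 'b) pre_digraph \<Rightarrow> bool" where
  "acyclic_digraph G \<longleftrightarrow> \<not> (\<exists>p. pre_digraph.cycle G p)"

definition dicolouring :: "'a pair_pre_digraph \<Rightarrow> nat \<Rightarrow> ('a \<Rightarrow> nat) \<Rightarrow> bool" where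
  "dicolouring D k c \<longleftrightarrow>
     (\<forall>v \<in> pverts D. c v \<in> {1..k}) \<and>
     (\<forall>i \<in> {1..k}. acyclic_digraph (with_proj D \<restriction> {v \<in> pverts D. c v = i}))"

text \<open>
  A finite loopless digraph has a dicolouring (with one colour per vertex), so the least
  number of colours is meaningful there.
\<close>

definition dichromatic_number :: "'a pair_pre_digraph \<Rightarrow> nat" where
  "dichromatic_number D = (LEAST k. \<exists>c. dicolouring D k c)"

definition proper_subdigraph :: "'a pair_pre_digraph \<Rightarrow> 'a pair_pre_digraph \<Rightarrow> bool" where
  "proper_subdigraph H D \<longleftrightarrow>
     subgraph (with_proj H) (with_proj D) \<and> (pverts H \<noteq> pverts D \<or> parcs H \<noteq> parcs D)"

definition dicritical :: "nat \<Rightarrow> 'a pair_pre_digraph \<Rightarrow> bool" where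
  "dicritical k D \<longleftrightarrow>
     dichromatic_number D = k \<and> (\<forall>H. proper_subdigraph H D \<longrightarrow> dichromatic_number H < k)"

text \<open>The edges of the undirected graph $B(D)$, as two-element sets.\<close>

definition digon_edges :: "'a pair_pre_digraph \<Rightarrow> 'a set set" where
  "digon_edges D = {{u, v} | u v. (u, v) \<in> parcs D \<and> (v, u) \<in> parcs D}"

definition matching :: "'a set set \<Rightarrow> 'a set set \<Rightarrow> bool" where
  "matching E M \<longleftrightarrow> M \<subseteq> E \<and> pairwise disjnt M"

definition digon_matching_number :: "'a pair_pre_digraph \<Rightarrow> nat" where
  "digon_matching_number D = Max (card ` {M. matching (digon_edges D) M})"

definition potential :: "'a pair_pre_digraph \<Rightarrow> int" where
  "potential D =
     7 * int (card (pverts D)) - 3 * int (card (parcs D)) - 2 * int (digon_matching_number D)"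

text \<open>
  An undirected path is given by the list of its (distinct) vertices, so its length is one less than
  the length of the list. An undirected cycle is given by the list of its distinct vertices in cyclic
  order, so its length is that of the list.
\<close>

definition path_edges :: "'a list \<Rightarrow> 'a set set" where
  "path_edges vs = {{vs ! i, vs ! Suc i} | i. Suc i < length vs}"

definition cycle_edges :: "'a list \<Rightarrow> 'a set set" where
  "cycle_edges vs = insert {last vs, hd vs} (path_edges vs)"

definition digons :: "'a set set \<Rightarrow> 'a rel" where
  "digons E = {(u, v). {u, v} \<in> E}"

definition bidirected_odd_cycle :: "'a pair_pre_digraph \<Rightarrow> bool" where
  "bidirected_odd_cycle D \<longleftrightarrow>
     (\<exists>vs. distinct vs \<and> 3 \<le> length vs \<and> odd (length vs) \<and>
           D = \<lparr> pverts = set vs, parcs = digons (cycle_edges vs) \<rparr>)"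

definition odd_path :: "'a \<Rightarrow> 'a list \<Rightarrow> 'a \<Rightarrow> bool" where
  "odd_path u vs v \<longleftrightarrow>
     vs \<noteq> [] \<and> distinct vs \<and> hd vs = u \<and> last vs = v \<and> odd (length vs - 1)"

definition odd_3_wheel :: "'a pair_pre_digraph \<Rightarrow> bool" where
  "odd_3_wheel D \<longleftrightarrow>
     (\<exists>c x y z P Q R.
        distinct [x, y, z] \<and>
        odd_path c P x \<and> odd_path c Q y \<and> odd_path c R z \<and>
        set P \<inter> set Q = {c} \<and> set P \<inter> set R = {c} \<and> set Q \<inter> set R = {c} \<and>
        set P \<inter> {x, y, z} = {x} \<and> set Q \<inter> {x, y, z} = {y} \<and> set R \<inter> {x, y, z} = {z} \<and>
        D = \<lparr> pverts = set P \<union> set Q \<union> set R,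
              parcs = {(x, y), (y, z), (z, x)} \<union>
                      digons (path_edges P \<union> path_edges Q \<union> path_edges R) \<rparr>)"

end

theory Submission
  imports Defs
begin

text \<open>
  A digraph that is 3-dicritical has no isolated vertices, so it is determined by its set of arcs
  and the theorem is a statement about critical arc sets. Cycles and wheels arise by subdividing
  digons, which keeps the potential; this gives the values 1 and -1. For the bound consider a
  counterexample with as few vertices as possible. Reversing all arcs gives another one.

  The main tool is contraction. Colour the subdigraph on a proper set R of vertices and
  contract its two colour classes to two vertices joined by a digon. The result is not colourable, and
  a critical part of it is smaller, so its potential is known. Expanding it again shows that some set of
  vertices has a potential smaller than that of R by at least five (lemmas
  \<open>contr_not_colourable\<close>, \<open>fold_pot\<close>, \<open>gain_bound\<close>). Hence proper sets have potential at least 4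
  (\<open>pot_ge4\<close>). After excluding certain vertices of degree four, sets that miss two vertices
  have potential at least 5 (\<open>pot_ge5\<close>).

  All degrees are at least 2. If 12 rho is expressed by counting arcs, the positive contribution comes
  from the low arcs, whose tail has out-degree 2 and whose head has in-degree 2. Deleting a
  low arc with its ends and letting the second in-neighbour of the head inherit the out-arcs of
  the head gives a smaller digraph that is not colourable either. Either this determines the degrees
  around the low arc, or the low arc enters a core: a cycle or wheel in which one vertex has been
  split in two (\<open>low_arc_core\<close>). The vertices next to the split vertex have large degrees
  (\<open>core_indeg\<close>, \<open>core_outdeg\<close>, \<open>core_tail_outdeg\<close>), which produces high arcs, with a tail of out-degree
  and a head of in-degree at least 3; these contribute negatively. A discharging argument (\<open>count\<close>)
  shows that the potential can only be -1 or more if there are no digons and no cores, if all degrees are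
  at most 3 and if there is at most one high arc (\<open>few_high_arcs\<close>). Such a digraph is coloured
  directly (\<open>contradiction\<close>).
\<close>

section \<open>Acyclic relations\<close>

text \<open>
  A cycle of r is mapped to a closed walk of s, so it stays in one fibre of f, where it would be
  a cycle of t. Most colourings below are checked in this way.
\<close>

lemma acyclic_lex:
  assumes "acyclic s" "acyclic t"
    and "\<And>a b. (a, b) \<in> r \<Longrightarrow> (f a, f b) \<in> s \<or> f a = f b \<and> (a, b) \<in> t"
  shows "acyclic r"
proof -
  have "(f a, f b) \<in> s\<^sup>+ \<or> f a = f b \<and> (a, b) \<in> t\<^sup>+" if "(a, b) \<in> r\<^sup>+" for a b
    using that
  proof induction
    case (base y)
    then show ?case using assms(3) by blast
  next
    case (step y z)
    then show ?case using assms(3)[of y z] by (metis trancl.trancl_into_trancl trancl.r_into_trancl)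
  qed
  then show ?thesis using assms(1,2) unfolding acyclic_def by blast
qed

lemma acyclic_no_return:
  assumes "acyclic {(a, b) \<in> r. a \<noteq> v \<and> b \<noteq> v}" "(v, v) \<notin> r"
    and no: "\<And>a b. (v, a) \<in> r \<Longrightarrow> (b, v) \<in> r \<Longrightarrow> (a, b) \<notin> {(a, b) \<in> r. a \<noteq> v \<and> b \<noteq> v}\<^sup>*"
  shows "acyclic r"
proof -
  let ?r = "{(a, b) \<in> r. a \<noteq> v \<and> b \<noteq> v}"
  have from_v: "q \<noteq> v \<and> (\<exists>a. (v, a) \<in> r \<and> (a, q) \<in> ?r\<^sup>*)" if "(v, q) \<in> r\<^sup>+" for q
    using that
  proof induction
    case (base y)
    then show ?case using assms(2) by blast
  next
    case (step y z)
    then obtain a where a: "(v, a) \<in> r" "(a, y) \<in> ?r\<^sup>*" "y \<noteq> v" by blast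
    have "z \<noteq> v" using no[OF a(1)] a(2) step(2) by blast
    moreover from this have "(y, z) \<in> ?r" using a(3) step(2) by blast
    ultimately show ?case using a by (meson rtrancl.rtrancl_into_rtrancl)
  qed
  have "(p, q) \<in> ?r\<^sup>+ \<or> (p, v) \<in> r\<^sup>* \<and> (v, q) \<in> r\<^sup>*" if "(p, q) \<in> r\<^sup>+" for p q
    using that
  proof induction
    case (base y)
    then show ?case by (cases "p = v \<or> y = v") auto
  next
    case (step y z)
    show ?case
    proof (cases "y = v \<or> z = v")
      case True
      moreover have "(p, y) \<in> r\<^sup>*" "(p, z) \<in> r\<^sup>*" using step(1,2) by auto
      ultimately show ?thesis using step(2) by blast
    next
      case False
      then have "(y, z) \<in> ?r" using step(2) by blast
      then show ?thesis using step
        by (meson rtrancl.rtrancl_into_rtrancl trancl.trancl_into_trancl)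
    qed
  qed
  moreover have "\<not> ((p, v) \<in> r\<^sup>* \<and> (v, p) \<in> r\<^sup>*)" if "(p, p) \<in> r\<^sup>+" for p
    using from_v[of v] that by (meson rtrancl_trancl_trancl trancl_rtrancl_trancl)
  ultimately show ?thesis using assms(1) unfolding acyclic_def by blast
qed

section \<open>Colourings and critical arc sets\<close>

text \<open>
  A critical digraph has no isolated vertices, so it is determined by its arcs. Colouring is
  therefore studied for arc sets; the colours are the truth values.
\<close>

definition mono_arcs :: "('a \<Rightarrow> bool) \<Rightarrow> 'a rel \<Rightarrow> 'a rel" where
  "mono_arcs c A = {(a, b) \<in> A. c a = c b}"

definition proper_col :: "('a \<Rightarrow> bool) \<Rightarrow> 'a rel \<Rightarrow> bool" where
  "proper_col c A \<longleftrightarrow> acyclic (mono_arcs c A)"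

definition colourable :: "'a rel \<Rightarrow> bool" where
  "colourable A \<longleftrightarrow> (\<exists>c. proper_col c A)"

definition crit :: "'a rel \<Rightarrow> bool" where
  "crit A \<longleftrightarrow> finite A \<and> irrefl A \<and> \<not> colourable A \<and> (\<forall>e\<in>A. colourable (A - {e}))"

definition ind :: "'a rel \<Rightarrow> 'a set \<Rightarrow> 'a rel" where
  "ind A R = {(a, b) \<in> A. a \<in> R \<and> b \<in> R}"

lemma mem_ind[simp]: "(a, b) \<in> ind A R \<longleftrightarrow> (a, b) \<in> A \<and> a \<in> R \<and> b \<in> R"
  unfolding ind_def by auto

lemma mem_mono_arcs[simp]: "(a, b) \<in> mono_arcs c A \<longleftrightarrow> (a, b) \<in> A \<and> c a = c b"
  unfolding mono_arcs_def by auto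

lemma ind_subset: "ind A R \<subseteq> A" unfolding ind_def by auto

lemma finite_ind[simp]: "finite A \<Longrightarrow> finite (ind A R)"
  using ind_subset finite_subset by metis

lemma Field_ind: "Field (ind A R) \<subseteq> Field A \<inter> R" unfolding Field_def ind_def by auto

lemma ind_Field: "Field A \<subseteq> R \<Longrightarrow> ind A R = A" unfolding Field_def ind_def by auto

lemma ind_mono: "A \<subseteq> B \<Longrightarrow> R \<subseteq> S \<Longrightarrow> ind A R \<subseteq> ind B S" unfolding ind_def by auto

lemma irrefl_ind: "irrefl A \<Longrightarrow> irrefl (ind A R)" unfolding irrefl_def by auto

lemma proper_col_subset: "proper_col c B \<Longrightarrow> A \<subseteq> B \<Longrightarrow> proper_col c A"
  unfolding proper_col_def by (rule acyclic_subset) (auto simp: mono_arcs_def)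

lemma colourable_subset: "colourable B \<Longrightarrow> A \<subseteq> B \<Longrightarrow> colourable A"
  unfolding colourable_def using proper_col_subset by blast

lemma proper_col_digon: "proper_col c A \<Longrightarrow> (a, b) \<in> A \<Longrightarrow> (b, a) \<in> A \<Longrightarrow> c a \<noteq> c b"
proof
  assume "proper_col c A" "(a, b) \<in> A" "(b, a) \<in> A" "c a = c b"
  then have "(a, b) \<in> mono_arcs c A" "(b, a) \<in> mono_arcs c A" by auto
  then have "(a, a) \<in> (mono_arcs c A)\<^sup>+" by (rule trancl.trancl_into_trancl[OF trancl.r_into_trancl])
  with \<open>proper_col c A\<close> show False unfolding proper_col_def acyclic_def by blast
qed

text \<open>
  The path closes up to a monochromatic cycle.
\<close>

lemma proper_col_path: "proper_col c A \<Longrightarrow> (a, b) \<in> (mono_arcs c A)\<^sup>* \<Longrightarrow> (b, a) \<in> A \<Longrightarrow> c a \<noteq> c b"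
proof
  assume *: "proper_col c A" "(a, b) \<in> (mono_arcs c A)\<^sup>*" "(b, a) \<in> A" "c a = c b"
  then have "(b, b) \<in> (mono_arcs c A)\<^sup>+" by (metis mem_mono_arcs rtrancl_into_trancl2)
  with * show False unfolding proper_col_def acyclic_def by blast
qed

lemma exists_crit:
  assumes "finite A" "irrefl A" "\<not> colourable A"
  shows "\<exists>B\<subseteq>A. crit B"
  using assms
proof (induction A rule: finite_psubset_induct)
  case (psubset A)
  show ?case
  proof (cases "\<forall>e\<in>A. colourable (A - {e})")
    case True
    then show ?thesis using psubset unfolding crit_def by blast
  next
    case False
    then obtain e where e: "e \<in> A" "\<not> colourable (A - {e})" by blast
    have "irrefl (A - {e})" using psubset(3) unfolding irrefl_def by blast
    with e obtain B where "B \<subseteq> A - {e}" "crit B" using psubset(2)[of "A - {e}"] by blast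
    then show ?thesis by blast
  qed
qed

lemma crit_subset_eq: "crit A \<Longrightarrow> B \<subseteq> A \<Longrightarrow> \<not> colourable B \<Longrightarrow> B = A"
  unfolding crit_def using colourable_subset
  by (metis Diff_insert_absorb Diff_mono empty_subsetI insert_Diff subsetI subset_antisym subset_insert)

lemma crit_del: "crit A \<Longrightarrow> v \<in> Field A \<Longrightarrow> colourable (ind A (- {v}))"
proof -
  assume A: "crit A" "v \<in> Field A"
  then obtain e where "e \<in> A" "e \<notin> ind A (- {v})" unfolding Field_def by auto
  then show ?thesis using A(1) ind_subset[of A "- {v}"] colourable_subset
    by (metis crit_subset_eq)
qed

text \<open>
  Giving the deleted vertex v the colour k must create a monochromatic cycle, which passes
  through v. Many non-colourability arguments for modified digraphs start from such a path.
\<close>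

lemma blocked:
  assumes "\<not> colourable A" "irrefl A" "proper_col c (ind A (- {v}))"
  shows "\<exists>a b. (v, a) \<in> A \<and> (b, v) \<in> A \<and> c a = k \<and> c b = k \<and> (a, b) \<in> (mono_arcs c (ind A (- {v})))\<^sup>*"
proof (rule ccontr)
  assume no: "\<not> ?thesis"
  let ?c = "c(v := k)"
  let ?r = "mono_arcs ?c A"
  have eq: "{(a, b) \<in> ?r. a \<noteq> v \<and> b \<noteq> v} = mono_arcs c (ind A (- {v}))" by auto
  have "acyclic ?r"
  proof (rule acyclic_no_return[where v = v])
    show "acyclic {(a, b) \<in> ?r. a \<noteq> v \<and> b \<noteq> v}" using assms(3) unfolding eq proper_col_def .
    show "(v, v) \<notin> ?r" using assms(2) unfolding irrefl_def by auto
    fix a b assume "(v, a) \<in> ?r" "(b, v) \<in> ?r"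
    moreover from this have "a \<noteq> v" "b \<noteq> v" using assms(2) unfolding irrefl_def by auto
    ultimately have "(v, a) \<in> A" "(b, v) \<in> A" "c a = k" "c b = k" by auto
    then show "(a, b) \<notin> {(a, b) \<in> ?r. a \<noteq> v \<and> b \<noteq> v}\<^sup>*" unfolding eq using no by blast
  qed
  then show False using assms(1) unfolding colourable_def proper_col_def by blast
qed

text \<open>
  A monochromatic cycle through v has both an in-arc and an out-arc of its colour at v.
\<close>

lemma proper_col_ignore:
  assumes "proper_col c (ind A (- {v}))" "irrefl A"
    and "(\<forall>a. (v, a) \<in> A \<longrightarrow> c a \<noteq> c v) \<or> (\<forall>a. (a, v) \<in> A \<longrightarrow> c a \<noteq> c v)"
  shows "proper_col c A"
  unfolding proper_col_def
proof (rule acyclic_no_return[where v = v])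
  have "{(a, b) \<in> mono_arcs c A. a \<noteq> v \<and> b \<noteq> v} = mono_arcs c (ind A (- {v}))" by auto
  then show "acyclic {(a, b) \<in> mono_arcs c A. a \<noteq> v \<and> b \<noteq> v}"
    using assms(1) unfolding proper_col_def by simp
qed (use assms(2,3) in \<open>auto simp: irrefl_def\<close>)

definition outdeg :: "'a rel \<Rightarrow> 'a \<Rightarrow> nat" where "outdeg A v = card (A `` {v})"
definition indeg :: "'a rel \<Rightarrow> 'a \<Rightarrow> nat" where "indeg A v = card (A\<inverse> `` {v})"

lemma finite_nbrs: "finite A \<Longrightarrow> finite (A `` {v})" "finite A \<Longrightarrow> finite (A\<inverse> `` {v})"
  by (auto intro: finite_subset[of _ "Field A"] simp: finite_Field FieldI1 FieldI2)

lemma mono_arcs_converse: "mono_arcs c (A\<inverse>) = (mono_arcs c A)\<inverse>" unfolding mono_arcs_def by auto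

lemma proper_col_converse[simp]: "proper_col c (A\<inverse>) \<longleftrightarrow> proper_col c A"
  unfolding proper_col_def mono_arcs_converse by (simp add: acyclic_converse)

lemma colourable_converse[simp]: "colourable (A\<inverse>) \<longleftrightarrow> colourable A"
  unfolding colourable_def by simp

lemma crit_converse[simp]: "crit (A\<inverse>) \<longleftrightarrow> crit A"
proof -
  have "crit (A\<inverse>)" if "crit A" for A :: "'a rel"
  proof -
    have "colourable (A\<inverse> - {e})" if "e \<in> A\<inverse>" for e
    proof -
      obtain a b where e: "e = (a, b)" by (cases e)
      have "colourable ((A - {(b, a)})\<inverse>)" using that \<open>crit A\<close> e unfolding crit_def by auto
      moreover have "(A - {(b, a)})\<inverse> = A\<inverse> - {e}" using e by auto
      ultimately show ?thesis by simp
    qed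
    then show ?thesis using \<open>crit A\<close> unfolding crit_def irrefl_def by auto
  qed
  from this[of A] this[of "A\<inverse>"] show ?thesis by auto
qed

text \<open>
  A vertex with at most one out-neighbour can take the colour that this neighbour does not have.
\<close>

lemma crit_outdeg:
  assumes "crit A" "v \<in> Field A"
  shows "2 \<le> outdeg A v"
proof (rule ccontr)
  assume "\<not> 2 \<le> outdeg A v"
  then have "card (A `` {v}) \<le> 1" unfolding outdeg_def by simp
  moreover have fin: "finite (A `` {v})" using assms(1) finite_nbrs(1)[of A v] unfolding crit_def by simp
  ultimately have "\<forall>a\<in>A `` {v}. \<forall>b\<in>A `` {v}. a = b"
    using card_le_Suc0_iff_eq[OF fin] by simp
  then obtain w where w: "A `` {v} \<subseteq> {w}" by blast
  obtain c where c: "proper_col c (ind A (- {v}))"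
    using crit_del[OF assms] unfolding colourable_def by blast
  let ?c = "c(v := (\<not> c w))"
  have irr: "irrefl A" using assms(1) unfolding crit_def by blast
  have "mono_arcs ?c (ind A (- {v})) = mono_arcs c (ind A (- {v}))" by auto
  then have c': "proper_col ?c (ind A (- {v}))" using c unfolding proper_col_def by simp
  have "a = w \<and> a \<noteq> v" if "(v, a) \<in> A" for a using that w irr unfolding irrefl_def by blast
  then have "\<forall>a. (v, a) \<in> A \<longrightarrow> ?c a \<noteq> ?c v" by simp
  then have "proper_col ?c A" using c' irr by (blast intro: proper_col_ignore)
  then show False using assms(1) unfolding crit_def colourable_def by blast
qed

lemma outdeg_converse[simp]: "outdeg (A\<inverse>) v = indeg A v" and indeg_converse[simp]: "indeg (A\<inverse>) v = outdeg A v"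
  unfolding outdeg_def indeg_def by simp_all

lemma crit_indeg: "crit A \<Longrightarrow> v \<in> Field A \<Longrightarrow> 2 \<le> indeg A v"
  using crit_outdeg[of "A\<inverse>" v] by simp

lemma outdeg2E:
  assumes "outdeg A v = 2" "(v, a) \<in> A"
  obtains b where "A `` {v} = {a, b}" "a \<noteq> b"
proof -
  from assms(1) obtain p q where "A `` {v} = {p, q}" "p \<noteq> q"
    unfolding outdeg_def by (auto simp: card_2_iff)
  then show ?thesis using assms(2) that[of q] that[of p] by (metis Image_singleton_iff doubleton_eq_iff insertE insert_commute singletonD)
qed

lemma indeg2E:
  assumes "indeg A v = 2" "(a, v) \<in> A"
  obtains b where "A\<inverse> `` {v} = {a, b}" "a \<noteq> b"
  using outdeg2E[of "A\<inverse>" v a] assms by auto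

section \<open>Digon matchings\<close>

definition dg :: "'a rel \<Rightarrow> 'a set set" where
  "dg A = {{u, v} | u v. (u, v) \<in> A \<and> (v, u) \<in> A}"

definition pm :: "'a rel \<Rightarrow> nat" where
  "pm A = Max (card ` {M. matching (dg A) M})"

lemma finite_dg: "finite A \<Longrightarrow> finite (dg A)"
proof -
  assume "finite A"
  moreover have "dg A \<subseteq> (\<lambda>(u, v). {u, v}) ` A" unfolding dg_def by auto
  ultimately show ?thesis by (meson finite_imageI finite_subset)
qed

lemma finite_matchings: "finite A \<Longrightarrow> finite {M. matching (dg A) M}"
  by (rule finite_subset[of _ "Pow (dg A)"]) (auto simp: matching_def finite_dg)

lemma pm_ge: "finite A \<Longrightarrow> matching (dg A) M \<Longrightarrow> card M \<le> pm A"
  unfolding pm_def by (rule Max_ge) (auto simp: finite_matchings)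

lemma pm_obtain:
  assumes "finite A"
  obtains M where "matching (dg A) M" "card M = pm A"
proof -
  have "{} \<in> {M. matching (dg A) M}" unfolding matching_def by simp
  then have "pm A \<in> card ` {M. matching (dg A) M}"
    unfolding pm_def using assms by (intro Max_in) (auto simp: finite_matchings)
  then show ?thesis using that by auto
qed

lemma pm_mono: "finite B \<Longrightarrow> A \<subseteq> B \<Longrightarrow> pm A \<le> pm B"
proof -
  assume "finite B" "A \<subseteq> B"
  then obtain M where M: "matching (dg A) M" "card M = pm A"
    using pm_obtain finite_subset by metis
  have "dg A \<subseteq> dg B" using \<open>A \<subseteq> B\<close> unfolding dg_def by blast
  then have "matching (dg B) M" using M unfolding matching_def by blast
  then show ?thesis using pm_ge \<open>finite B\<close> M(2) by metis
qed

lemma dg_subset_Field: "e \<in> dg A \<Longrightarrow> e \<subseteq> Field A" unfolding dg_def Field_def by auto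

lemma dg_nonempty: "e \<in> dg A \<Longrightarrow> e \<noteq> {}" unfolding dg_def by auto

lemma matching_finite: "finite A \<Longrightarrow> matching (dg A) M \<Longrightarrow> finite M"
  unfolding matching_def using finite_dg finite_subset by blast

lemma pm_disjoint:
  assumes "finite A" "A1 \<subseteq> A" "A2 \<subseteq> A" "Field A1 \<inter> Field A2 = {}"
  shows "pm A1 + pm A2 \<le> pm A"
proof -
  have fin: "finite A1" "finite A2"
    using finite_subset[OF assms(2,1)] finite_subset[OF assms(3,1)] by auto
  obtain M1 where M1: "matching (dg A1) M1" "card M1 = pm A1" using pm_obtain fin by metis
  obtain M2 where M2: "matching (dg A2) M2" "card M2 = pm A2" using pm_obtain fin by metis
  have d: "disjnt e f" if "e \<in> M1" "f \<in> M2" for e f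
    using that M1(1) M2(1) dg_subset_Field[of e A1] dg_subset_Field[of f A2] assms(4)
    unfolding matching_def disjnt_def by blast
  have sub: "dg A1 \<union> dg A2 \<subseteq> dg A" using assms unfolding dg_def by blast
  have "matching (dg A) (M1 \<union> M2)"
    using M1(1) M2(1) sub d unfolding matching_def pairwise_def by (auto simp: disjnt_sym)
  moreover have "M1 \<inter> M2 = {}"
  proof -
    have "e \<noteq> {}" if "e \<in> M1" for e using M1(1) that dg_nonempty[of e A1] unfolding matching_def by auto
    then show ?thesis using d unfolding disjnt_def by auto
  qed
  then have "card (M1 \<union> M2) = pm A1 + pm A2"
    using M1 M2 matching_finite fin by (metis card_Un_disjoint)
  ultimately show ?thesis using pm_ge[OF assms(1)] by metis
qed

lemma pm_del1: "finite A \<Longrightarrow> pm A \<le> pm (ind A (- {v})) + 1"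
proof -
  assume fin: "finite A"
  obtain M where M: "matching (dg A) M" "card M = pm A" using pm_obtain fin by metis
  let ?M = "{e \<in> M. v \<notin> e}"
  have "{e \<in> M. v \<in> e} \<subseteq> {e}" if "e \<in> M" "v \<in> e" for e
    using M(1) that unfolding matching_def pairwise_def disjnt_def by blast
  then have "card {e \<in> M. v \<in> e} \<le> 1"
    by (metis (no_types, lifting) card.empty card_mono card_1_singleton_iff One_nat_def equals0I finite.emptyI finite_insert le0 mem_Collect_eq)
  moreover have "M = ?M \<union> {e \<in> M. v \<in> e}" by auto
  ultimately have "card M \<le> card ?M + 1"
    by (metis (no_types, lifting) add_left_mono card_Un_le le_trans)
  moreover have "matching (dg (ind A (- {v}))) ?M"
    using M(1) unfolding matching_def pairwise_def dg_def by (auto simp: subset_iff) (metis insert_iff)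
  ultimately show ?thesis using pm_ge[of "ind A (- {v})" ?M] fin M(2) by simp
qed

lemma ind_ind: "ind (ind A R) S = ind A (R \<inter> S)" unfolding ind_def by auto

lemma pm_del: "finite A \<Longrightarrow> finite X \<Longrightarrow> pm A \<le> pm (ind A (- X)) + card X"
proof -
  assume fin: "finite A" "finite X"
  show ?thesis using fin(2)
  proof (induction X)
    case empty
    then show ?case by (simp add: ind_def)
  next
    case (insert v X)
    have "ind A (- insert v X) = ind (ind A (- X)) (- {v})" unfolding ind_ind by (rule arg_cong2[of _ _ _ _ ind]) auto
    then show ?case using pm_del1[of "ind A (- X)" v] insert fin(1) by simp
  qed
qed

lemma pm_edge:
  assumes "finite A" "A1 \<subseteq> A" "(u, v) \<in> A" "(v, u) \<in> A" "u \<notin> Field A1" "v \<notin> Field A1"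
  shows "pm A1 + 1 \<le> pm A"
proof -
  have "matching (dg {(u, v), (v, u)}) {{u, v}}" unfolding matching_def dg_def by auto
  then have "1 \<le> pm {(u, v), (v, u)}" using pm_ge[of "{(u, v), (v, u)}" "{{u, v}}"] by simp
  moreover have "pm A1 + pm {(u, v), (v, u)} \<le> pm A"
    by (rule pm_disjoint) (use assms in \<open>auto simp: Field_def\<close>)
  ultimately show ?thesis by simp
qed

lemma dg_converse[simp]: "dg (A\<inverse>) = dg A" unfolding dg_def by auto

lemma pm_converse[simp]: "pm (A\<inverse>) = pm A" unfolding pm_def by simp

section \<open>Digons and recursion for the matching number\<close>

abbreviation dig :: "'a \<Rightarrow> 'a \<Rightarrow> 'a rel" where "dig a b \<equiv> {(a, b), (b, a)}"

lemma matching_remove: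
  assumes "matching (dg A) M" "{a, b} \<in> M"
  shows "matching (dg (ind A (- {a, b}))) (M - {{a, b}})"
proof -
  have "e \<in> dg (ind A (- {a, b}))" if "e \<in> M" "e \<noteq> {a, b}" for e
  proof -
    have "disjnt e {a, b}" using assms that pairwiseD[of disjnt M e "{a, b}"] unfolding matching_def by simp
    moreover have "e \<in> dg A" using assms(1) that unfolding matching_def by blast
    then obtain u v where "e = {u, v}" "(u, v) \<in> A" "(v, u) \<in> A" unfolding dg_def by blast
    ultimately show ?thesis unfolding dg_def disjnt_def by auto
  qed
  then show ?thesis using assms(1) unfolding matching_def pairwise_def by auto
qed

lemma pm_rec_digon:
  assumes "finite A"
  shows "pm A \<le> pm (A - dig a b) \<or>
    (a, b) \<in> A \<and> (b, a) \<in> A \<and> pm A \<le> pm (ind A (- {a, b})) + 1"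
proof -
  obtain M where M: "matching (dg A) M" "card M = pm A" using pm_obtain assms by metis
  show ?thesis
  proof (cases "{a, b} \<in> M")
    case True
    have "(a, b) \<in> A" "(b, a) \<in> A"
      using True M(1) unfolding matching_def dg_def by (auto simp: doubleton_eq_iff)
    moreover have "card (M - {{a, b}}) \<le> pm (ind A (- {a, b}))"
      using pm_ge[OF _ matching_remove[OF M(1) True]] assms by simp
    moreover have "card M \<le> card (M - {{a, b}}) + 1" by (simp add: card_Diff_singleton_if True)
    ultimately show ?thesis using M(2) by simp
  next
    case False
    have "M \<subseteq> dg (A - dig a b)"
    proof
      fix e assume e: "e \<in> M"
      then obtain u v where "e = {u, v}" "(u, v) \<in> A" "(v, u) \<in> A"
        using M(1) unfolding matching_def dg_def by blast
      moreover from this have "(u, v) \<in> A - dig a b" "(v, u) \<in> A - dig a b"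
        using e False by (auto simp: insert_commute)
      ultimately show "e \<in> dg (A - dig a b)" unfolding dg_def by blast
    qed
    then have "matching (dg (A - dig a b)) M" using M(1) unfolding matching_def by blast
    then show ?thesis using pm_ge[of "A - dig a b" M] assms M(2) by simp
  qed
qed

text \<open>
  Either a maximum matching misses v or it contains one digon at v.
\<close>

lemma pm_rec_vertex:
  assumes "finite A"
  shows "pm A \<le> pm (ind A (- {v})) \<or>
    (\<exists>u. (u, v) \<in> A \<and> (v, u) \<in> A \<and> pm A \<le> pm (ind A (- {u, v})) + 1)"
proof -
  obtain M where M: "matching (dg A) M" "card M = pm A" using pm_obtain assms by metis
  show ?thesis
  proof (cases "\<exists>u. {u, v} \<in> M")
    case True
    then obtain u where u: "{u, v} \<in> M" by blast
    have "(u, v) \<in> A" "(v, u) \<in> A"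
      using u M(1) unfolding matching_def dg_def by (auto simp: doubleton_eq_iff)
    moreover have "card (M - {{u, v}}) \<le> pm (ind A (- {u, v}))"
      using pm_ge[OF _ matching_remove[OF M(1) u]] assms by simp
    moreover have "card M \<le> card (M - {{u, v}}) + 1" by (simp add: card_Diff_singleton_if u)
    ultimately show ?thesis using M(2) by auto
  next
    case False
    have "M \<subseteq> dg (ind A (- {v}))"
    proof
      fix e assume e: "e \<in> M"
      then obtain a b where ab: "e = {a, b}" "(a, b) \<in> A" "(b, a) \<in> A"
        using M(1) unfolding matching_def dg_def by blast
      then have "a \<noteq> v" "b \<noteq> v" using e False by (auto simp: insert_commute)
      then show "e \<in> dg (ind A (- {v}))" using ab unfolding dg_def by auto
    qed
    then have "matching (dg (ind A (- {v}))) M" using M(1) unfolding matching_def by blast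
    then show ?thesis using pm_ge[of "ind A (- {v})" M] assms M(2) by simp
  qed
qed

text \<open>
  Every edge of a matching contains an element of the cover, and different edges contain
  different ones.
\<close>

lemma pm_cover:
  assumes "finite A" "finite E" "\<And>u v. (u, v) \<in> A \<Longrightarrow> (v, u) \<in> A \<Longrightarrow> u \<in> E \<or> v \<in> E"
  shows "pm A \<le> card E"
proof -
  obtain M where M: "matching (dg A) M" "card M = pm A" using pm_obtain assms(1) by metis
  have "\<exists>v. v \<in> e \<inter> E" if "e \<in> M" for e
  proof -
    obtain u v where "e = {u, v}" "(u, v) \<in> A" "(v, u) \<in> A"
      using M(1) \<open>e \<in> M\<close> unfolding matching_def dg_def by blast
    then show ?thesis using assms(3) by blast
  qed
  then obtain g where g: "\<And>e. e \<in> M \<Longrightarrow> g e \<in> e \<inter> E" by metis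
  have "inj_on g M"
  proof (rule inj_onI, rule ccontr)
    fix e f assume ef: "e \<in> M" "f \<in> M" "g e = g f" "e \<noteq> f"
    then have "disjnt e f" using M(1) unfolding matching_def pairwise_def by blast
    then show False using g[OF ef(1)] g[OF ef(2)] ef(3) unfolding disjnt_def by auto
  qed
  moreover have "g ` M \<subseteq> E" using g by blast
  ultimately show ?thesis using card_inj_on_le[of g M E] assms(2) M(2) by simp
qed

lemma pm_empty[simp]: "pm {} = 0"
  using pm_cover[of "{}" "{}"] by simp

section \<open>Potentials\<close>

definition rho :: "'a rel \<Rightarrow> int" where
  "rho A = 7 * int (card (Field A)) - 3 * int (card A) - 2 * int (pm A)"

definition pot :: "'a rel \<Rightarrow> 'a set \<Rightarrow> int" where
  "pot A R = 7 * int (card R) - 3 * int (card (ind A R)) - 2 * int (pm (ind A R))"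

lemma pot_Field: "pot A (Field A) = rho A" unfolding pot_def rho_def by (simp add: ind_Field)

lemma rho_converse[simp]: "rho (A\<inverse>) = rho A"
  unfolding rho_def by (simp add: card_inverse)

lemma ind_converse: "ind (A\<inverse>) R = (ind A R)\<inverse>" by auto

lemma pot_converse[simp]: "pot (A\<inverse>) R = pot A R"
  unfolding pot_def ind_converse by (simp add: card_inverse)

section \<open>Subdividing a digon\<close>

text \<open>
  Subdividing a digon twice adds two vertices, four arcs and one matching edge: this changes the
  potential by 14 - 12 - 2 = 0 and keeps the parity of bidirected paths.
\<close>

definition subdiv :: "'a rel \<Rightarrow> 'a \<Rightarrow> 'a \<Rightarrow> 'a \<Rightarrow> 'a \<Rightarrow> 'a rel" where
  "subdiv A a b p q = A - dig a b \<union> (dig a p \<union> dig p q \<union> dig q b)"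

locale subdivision =
  fixes A :: "'a rel" and a b p q :: 'a
  assumes fin: "finite A" and irr: "irrefl A"
    and ab: "(a, b) \<in> A" "(b, a) \<in> A" and pq: "p \<notin> Field A" "q \<notin> Field A" "p \<noteq> q"
begin

lemma neq: "a \<noteq> b" "a \<noteq> p" "a \<noteq> q" "b \<noteq> p" "b \<noteq> q" "b \<noteq> a" "p \<noteq> a" "q \<noteq> a" "p \<noteq> b" "q \<noteq> b" "q \<noteq> p"
  using ab pq irr unfolding irrefl_def Field_def by auto

lemma no_pq: "(p, v) \<notin> A" "(v, p) \<notin> A" "(q, v) \<notin> A" "(v, q) \<notin> A"
  using pq(1,2) unfolding Field_def by auto

lemma Field_subdiv: "Field (subdiv A a b p q) = insert p (insert q (Field A))"
proof -
  have "a \<in> Field A" "b \<in> Field A" using ab unfolding Field_def by auto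
  moreover have "v \<in> Field (subdiv A a b p q) \<longleftrightarrow> v \<in> Field A - {a, b} \<or> v \<in> {a, b, p, q}" for v
  proof (cases "v \<in> {a, b, p, q}")
    case True
    then show ?thesis unfolding subdiv_def Field_def by auto
  next
    case False
    then show ?thesis unfolding subdiv_def Field_def Domain_unfold Range_iff by auto
  qed
  ultimately show ?thesis by auto
qed

lemma finite_subdiv: "finite (subdiv A a b p q)" using fin unfolding subdiv_def by simp

lemma irrefl_subdiv: "irrefl (subdiv A a b p q)" using irr neq pq(3) unfolding subdiv_def irrefl_def by auto

lemma card_subdiv: "card (subdiv A a b p q) = card A + 4"
proof -
  have "card (A - dig a b) + 2 = card A"
  proof -
    have "card (dig a b) \<le> card A" by (rule card_mono) (use fin ab in auto)
    moreover have "card (A - dig a b) = card A - card (dig a b)" by (rule card_Diff_subset) (use ab in auto)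
    moreover have "card (dig a b) = 2" using neq by simp
    ultimately show ?thesis by simp
  qed
  moreover have "card (dig a p \<union> dig p q \<union> dig q b) = 6" using neq pq(3) by (simp add: card_insert_if)
  moreover have "(A - dig a b) \<inter> (dig a p \<union> dig p q \<union> dig q b) = {}" using no_pq by auto
  moreover have "finite (A - dig a b)" "finite (dig a p \<union> dig p q \<union> dig q b)" using fin by auto
  ultimately show ?thesis unfolding subdiv_def by (subst card_Un_disjoint) (assumption | linarith)+
qed

lemma colouring_subdiv:
  assumes "proper_col c (subdiv A a b p q)"
  shows "proper_col c A"
proof -
  have "c x \<noteq> c y" if "(x, y) \<in> dig a p \<union> dig p q \<union> dig q b" for x y
    using proper_col_digon[OF assms, of x y] that unfolding subdiv_def by auto
  then have "c a \<noteq> c p" "c p \<noteq> c q" "c q \<noteq> c b" by auto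
  then have "mono_arcs c A \<subseteq> mono_arcs c (subdiv A a b p q)" unfolding subdiv_def by auto
  then show ?thesis using assms unfolding proper_col_def by (rule acyclic_subset[rotated])
qed

lemma not_colourable_subdiv: "\<not> colourable A \<Longrightarrow> \<not> colourable (subdiv A a b p q)"
  using colouring_subdiv unfolding colourable_def by blast

lemma pm_sub_dig:
  assumes "B \<subseteq> A - dig a b"
  shows "pm B + 1 \<le> pm (subdiv A a b p q)"
  by (rule pm_edge[OF finite_subdiv, of _ p q]) (use assms pq in \<open>auto simp: subdiv_def Field_def\<close>)

lemma pm_sub_ends:
  assumes "B \<subseteq> ind A (- {a, b})"
  shows "pm B + 2 \<le> pm (subdiv A a b p q)"
proof -
  have FB: "Field B \<subseteq> Field A - {a, b}" using mono_Field[OF assms] Field_ind[of A "- {a, b}"] by blast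
  have "B \<union> dig q b \<subseteq> subdiv A a b p q" using assms unfolding subdiv_def by auto
  moreover have fin': "finite (B \<union> dig q b)" using calculation finite_subdiv finite_subset by blast
  moreover have "pm B + 1 \<le> pm (B \<union> dig q b)"
    by (rule pm_edge[OF fin', of _ q b]) (use FB pq in auto)
  moreover have "pm (B \<union> dig q b) + 1 \<le> pm (subdiv A a b p q)"
    by (rule pm_edge[OF finite_subdiv, of _ a p])
      (use calculation(1) FB pq neq in \<open>auto simp: subdiv_def\<close>)
  ultimately show ?thesis by simp
qed

lemma pm_subdiv: "pm (subdiv A a b p q) = pm A + 1"
proof (rule antisym)
  let ?S = "subdiv A a b p q"
  show "pm A + 1 \<le> pm ?S"
    using pm_rec_digon[OF fin, of a b] pm_sub_dig[OF order_refl] pm_sub_ends[OF order_refl] by auto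
  have S1: "pm (ind ?S (- {p})) \<le> pm A + 1"
  proof -
    have "ind (ind ?S (- {p})) (- {q}) \<subseteq> A" unfolding subdiv_def by auto
    then have "pm (ind (ind ?S (- {p})) (- {q})) \<le> pm A" using fin pm_mono by blast
    then show ?thesis using pm_del1[of "ind ?S (- {p})" q] finite_subdiv by simp
  qed
  have S2: "pm (ind ?S (- {u, p})) \<le> pm A" if "u = a \<or> u = q" for u
    using that
  proof
    assume u: "u = q"
    have "ind ?S (- {u, p}) \<subseteq> A" unfolding subdiv_def u by auto
    then show ?thesis using fin pm_mono by blast
  next
    assume u: "u = a"
    let ?T = "ind ?S (- {a, p})"
    have f: "finite ?T" using finite_subdiv by simp
    from pm_rec_vertex[OF f, of q] show ?thesis
    proof (elim disjE exE conjE)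
      assume *: "pm ?T \<le> pm (ind ?T (- {q}))"
      have "ind ?T (- {q}) \<subseteq> A" unfolding subdiv_def by auto
      then show ?thesis using * fin pm_mono u by (meson le_trans)
    next
      fix v assume v: "(v, q) \<in> ?T" "(q, v) \<in> ?T" and *: "pm ?T \<le> pm (ind ?T (- {v, q})) + 1"
      have "v = b" using v no_pq neq unfolding subdiv_def by auto
      then have "ind ?T (- {v, q}) \<subseteq> ind A (- {a, b})" unfolding subdiv_def by auto
      then have "pm (ind ?T (- {v, q})) + 1 \<le> pm A"
        by (intro pm_edge[OF fin _ ab]) (auto simp: Field_def)
      then show ?thesis using * u by simp
    qed
  qed
  from pm_rec_vertex[OF finite_subdiv, of p] show "pm ?S \<le> pm A + 1"
  proof (elim disjE exE conjE)
    assume "pm ?S \<le> pm (ind ?S (- {p}))"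
    then show ?thesis using S1 by simp
  next
    fix u assume u: "(u, p) \<in> ?S" "(p, u) \<in> ?S" "pm ?S \<le> pm (ind ?S (- {u, p})) + 1"
    then have "u = a \<or> u = q" using no_pq neq unfolding subdiv_def by auto
    then show ?thesis using S2 u(3) by fastforce
  qed
qed

lemma rho_subdiv: "rho (subdiv A a b p q) = rho A"
  unfolding rho_def Field_subdiv card_subdiv pm_subdiv using pq fin by (simp add: finite_Field)

text \<open>
  A matching containing the digon between a and b gets the digons at a and b instead, and any
  other one gets the digon between p and q.
\<close>

lemma pm_subdiv_del:
  assumes "v \<notin> {p, q}"
  shows "pm (ind A (- {v})) + 1 \<le> pm (ind (subdiv A a b p q) (- {v}))"
proof -
  let ?S = "ind (subdiv A a b p q) (- {v})" and ?A = "ind A (- {v})"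
  have f: "finite ?S" "finite ?A" using finite_subdiv fin by auto
  have *: "pm (?A - dig a b) + 1 \<le> pm ?S"
    by (rule pm_edge[OF f(1), of _ p q]) (use assms pq in \<open>auto simp: subdiv_def Field_def\<close>)
  from pm_rec_digon[OF f(2), of a b] show ?thesis
  proof (elim disjE conjE)
    assume "pm ?A \<le> pm (?A - dig a b)"
    then show ?thesis using * by simp
  next
    assume "(a, b) \<in> ?A" and le: "pm ?A \<le> pm (ind ?A (- {a, b})) + 1"
    then have v: "v \<noteq> a" "v \<noteq> b" by auto
    interpret A': subdivision ?A a b p q
      by standard (use fin irr ab pq v in \<open>auto simp: Field_def irrefl_def\<close>)
    have "pm (ind ?A (- {a, b})) + 2 \<le> pm (subdiv ?A a b p q)" by (rule A'.pm_sub_ends) simp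
    moreover have "subdiv ?A a b p q \<subseteq> ?S" using v assms unfolding subdiv_def by auto
    then have "pm (subdiv ?A a b p q) \<le> pm ?S" using pm_mono[OF f(1)] by blast
    ultimately show ?thesis using le by linarith
  qed
qed

lemma pm_subdiv_del_q: "pm (ind A (- {a})) + 1 \<le> pm (ind (subdiv A a b p q) (- {q}))"
  by (rule pm_edge[of _ _ p a]) (use finite_subdiv neq pq in \<open>auto simp: subdiv_def Field_def\<close>)

lemma pm_subdiv_del_p: "pm (ind A (- {b})) + 1 \<le> pm (ind (subdiv A a b p q) (- {p}))"
  by (rule pm_edge[of _ _ q b]) (use finite_subdiv neq pq in \<open>auto simp: subdiv_def Field_def\<close>)

lemma out_subdiv: "subdiv A a b p q `` {p} = {a, q}" "subdiv A a b p q `` {q} = {p, b}"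
    "subdiv A a b p q `` {a} = insert p (A `` {a} - {b})" "subdiv A a b p q `` {b} = insert q (A `` {b} - {a})"
    "v \<notin> {a, b, p, q} \<Longrightarrow> subdiv A a b p q `` {v} = A `` {v}"
  using no_pq neq unfolding subdiv_def by auto

lemma converse_subdiv: "(subdiv A a b p q)\<inverse> = subdiv (A\<inverse>) a b p q"
  unfolding subdiv_def by auto

lemma subdivision_converse: "subdivision (A\<inverse>) a b p q"
  by standard (use fin irr ab pq in \<open>auto simp: irrefl_def\<close>)

lemma swap: "subdiv A b a q p = subdiv A a b p q" unfolding subdiv_def by auto

lemma subdivision_swap: "subdivision A b a q p"
  by standard (use fin irr ab pq in auto)

lemma outdeg_subdiv: "v \<in> Field A \<Longrightarrow> outdeg (subdiv A a b p q) v = outdeg A v"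
proof -
  assume v: "v \<in> Field A"
  have f: "finite (A `` {v})" by (rule finite_nbrs(1)[OF fin])
  consider "v = a" | "v = b" | "v \<notin> {a, b, p, q}" using v pq by blast
  then show ?thesis
  proof cases
    case 1
    have "b \<in> A `` {a}" using ab by simp
    then have "Suc (card (A `` {a} - {b})) = card (A `` {a})" using f unfolding 1 by (intro card_Suc_Diff1)
    then show ?thesis unfolding outdeg_def 1 out_subdiv using f no_pq 1 by simp
  next
    case 2
    have "a \<in> A `` {b}" using ab by simp
    then have "Suc (card (A `` {b} - {a})) = card (A `` {b})" using f unfolding 2 by (intro card_Suc_Diff1)
    then show ?thesis unfolding outdeg_def 2 out_subdiv using f no_pq 2 by simp
  next
    case 3
    then show ?thesis unfolding outdeg_def by (simp only: out_subdiv(5)[OF 3])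
  qed
qed

lemma outdeg_subdiv_new: "outdeg (subdiv A a b p q) p = 2" "outdeg (subdiv A a b p q) q = 2"
  unfolding outdeg_def out_subdiv using neq by auto

end

text \<open>
  Bidirected odd cycles are the subdivisions of the bidirected triangle, and odd wheels are the
  subdivisions of the wheel with four vertices. Their properties are proved by induction along
  subdivisions; the descriptions by lists of vertices serve to recognise them.
\<close>

inductive subdivided :: "('a rel \<Rightarrow> bool) \<Rightarrow> 'a rel \<Rightarrow> bool" for P where
  base: "P A \<Longrightarrow> subdivided P A"
| step: "subdivided P A \<Longrightarrow> subdivision A a b p q \<Longrightarrow> subdivided P (subdiv A a b p q)"

definition triangle3 :: "'a rel \<Rightarrow> bool" where
  "triangle3 A \<longleftrightarrow> (\<exists>a b c. distinct [a, b, c] \<and> A = dig a b \<union> dig b c \<union> dig a c)"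

definition wheel3 :: "'a rel \<Rightarrow> bool" where
  "wheel3 A \<longleftrightarrow> (\<exists>c x y z. distinct [c, x, y, z] \<and>
     A = {(x, y), (y, z), (z, x)} \<union> (dig c x \<union> dig c y \<union> dig c z))"

definition cyc :: "'a rel \<Rightarrow> bool" where "cyc = subdivided triangle3"
definition wheel :: "'a rel \<Rightarrow> bool" where "wheel = subdivided wheel3"

lemma cyc_induct[consumes 1, case_names base step]:
  assumes "cyc A" "\<And>a b c. distinct [a, b, c] \<Longrightarrow> P (dig a b \<union> dig b c \<union> dig a c)"
    and "\<And>A a b p q. cyc A \<Longrightarrow> P A \<Longrightarrow> subdivision A a b p q \<Longrightarrow> P (subdiv A a b p q)"
  shows "P A"
  using assms(1)[unfolded cyc_def]
  by induction (use assms(2,3) in \<open>auto simp: cyc_def triangle3_def\<close>)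

lemma wheel_induct[consumes 1, case_names base step]:
  assumes "wheel A" "\<And>c x y z. distinct [c, x, y, z] \<Longrightarrow>
      P ({(x, y), (y, z), (z, x)} \<union> (dig c x \<union> dig c y \<union> dig c z))"
    and "\<And>A a b p q. wheel A \<Longrightarrow> P A \<Longrightarrow> subdivision A a b p q \<Longrightarrow> P (subdiv A a b p q)"
  shows "P A"
  using assms(1)[unfolded wheel_def]
  by induction (use assms(2,3) in \<open>auto simp: wheel_def wheel3_def\<close>)

lemma cyc_subdiv: "cyc A \<Longrightarrow> subdivision A a b p q \<Longrightarrow> cyc (subdiv A a b p q)"
  unfolding cyc_def by (rule subdivided.step)

lemma wheel_subdiv: "wheel A \<Longrightarrow> subdivision A a b p q \<Longrightarrow> wheel (subdiv A a b p q)"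
  unfolding wheel_def by (rule subdivided.step)

section \<open>Properties of bidirected odd cycles\<close>

lemma triangle_not_colourable: "\<not> colourable (dig a b \<union> dig b c \<union> dig a c)"
proof
  let ?A = "dig a b \<union> dig b c \<union> dig a c"
  assume "colourable ?A"
  then obtain k where k: "proper_col k ?A" unfolding colourable_def by blast
  have "k a \<noteq> k b" "k b \<noteq> k c" "k a \<noteq> k c"
    using proper_col_digon[OF k, of a b] proper_col_digon[OF k, of b c] proper_col_digon[OF k, of a c] by auto
  then show False by auto
qed

lemma pm_1I: "finite A \<Longrightarrow> (a, b) \<in> A \<Longrightarrow> (b, a) \<in> A \<Longrightarrow> 1 \<le> pm A"
  using pm_edge[of A "{}" a b] by simp

lemma pm_triangle: "distinct [a, b, c] \<Longrightarrow> pm (dig a b \<union> dig b c \<union> dig a c) = 1"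
proof (rule antisym)
  let ?A = "dig a b \<union> dig b c \<union> dig a c"
  assume d: "distinct [a, b, c]"
  have f: "finite ?A" by simp
  show "1 \<le> pm ?A" by (rule pm_1I[of _ a b]) auto
  have "ind ?A (- {a, b}) = {}" "ind ?A (- {b, c}) = {}" "ind ?A (- {a, c}) = {}" using d by auto
  then have e: "ind ?A (- {u, v}) = {}" if "(u, v) \<in> ?A" for u v using that by (auto simp: insert_commute)
  have x: "ind ?A (- {a}) - dig b c = {}" "ind (ind ?A (- {a})) (- {b, c}) = {}" using d by auto
  have h: "pm X \<le> 1" if "X - dig b c = {}" "ind X (- {b, c}) = {}" "finite X" for X
    using pm_rec_digon[OF that(3), of b c] that(1,2) by auto
  have "pm (ind ?A (- {a})) \<le> 1" by (rule h[OF x finite_ind[OF f]])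
  from pm_rec_vertex[OF f, of a] show "pm ?A \<le> 1"
  proof (elim disjE exE conjE)
    assume "pm ?A \<le> pm (ind ?A (- {a}))"
    with \<open>pm (ind ?A (- {a})) \<le> 1\<close> show ?thesis by (rule order_trans[rotated])
  next
    fix u assume u: "(u, a) \<in> ?A" and le: "pm ?A \<le> pm (ind ?A (- {u, a})) + 1"
    show ?thesis using le[unfolded e[OF u]] by simp
  qed
qed

lemma cyc_basic: "cyc A \<Longrightarrow> finite A \<and> irrefl A \<and> \<not> colourable A \<and> A\<inverse> = A \<and> rho A = 1"
proof (induction rule: cyc_induct)
  case (base a b c)
  have "Field (dig a b \<union> dig b c \<union> dig a c) = {a, b, c}" unfolding Field_def by auto
  then show ?case using base triangle_not_colourable[of a b c] pm_triangle[OF base]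
    unfolding rho_def by (auto simp: irrefl_def card_insert_if)
next
  case (step A a b p q)
  interpret subdivision A a b p q by fact
  show ?case using step finite_subdiv irrefl_subdiv not_colourable_subdiv rho_subdiv converse_subdiv by auto
qed

lemma cyc_outdeg: "cyc A \<Longrightarrow> v \<in> Field A \<Longrightarrow> outdeg A v = 2"
proof (induction arbitrary: v rule: cyc_induct)
  case (base a b c)
  let ?A = "dig a b \<union> dig b c \<union> dig a c"
  have "?A `` {a} = {b, c}" "?A `` {b} = {a, c}" "?A `` {c} = {a, b}" using base by auto
  moreover have "v \<in> {a, b, c}" using base(2) unfolding Field_def by auto
  moreover have "card {b, c} = 2" "card {a, c} = 2" "card {a, b} = 2" using base(1) by auto
  ultimately show ?case unfolding outdeg_def by (elim insertE emptyE) (simp_all only:)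
next
  case (step A a b p q)
  interpret subdivision A a b p q by fact
  show ?case using step.prems step.IH outdeg_subdiv outdeg_subdiv_new unfolding Field_subdiv by auto
qed

lemma cyc_indeg: "cyc A \<Longrightarrow> v \<in> Field A \<Longrightarrow> indeg A v = 2"
  using cyc_outdeg[of A v] cyc_basic[of A] by (metis outdeg_converse)

lemma cyc_digon: "cyc A \<Longrightarrow> (a, b) \<in> A \<longleftrightarrow> (b, a) \<in> A"
  using cyc_basic by (metis converse_iff)

text \<open>
  An odd cycle has a maximum matching missing any given vertex.
\<close>

lemma cyc_pm_del: "cyc A \<Longrightarrow> pm A \<le> pm (ind A (- {v}))"
proof (induction arbitrary: v rule: cyc_induct)
  case (base a b c)
  let ?A = "dig a b \<union> dig b c \<union> dig a c"
  have "1 \<le> pm (ind ?A (- {v}))"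
  proof -
    consider "v \<noteq> a \<and> v \<noteq> b" | "v \<noteq> b \<and> v \<noteq> c" | "v \<noteq> a \<and> v \<noteq> c" using base by auto
    then show ?thesis
    proof cases
      case 1 then show ?thesis by (intro pm_1I[of _ a b]) auto
    next
      case 2 then show ?thesis by (intro pm_1I[of _ b c]) auto
    next
      case 3 then show ?thesis by (intro pm_1I[of _ a c]) auto
    qed
  qed
  then show ?case using pm_triangle[OF base] by simp
next
  case (step A a b p q)
  interpret subdivision A a b p q by fact
  show ?case
    using pm_subdiv pm_subdiv_del[of v] pm_subdiv_del_p pm_subdiv_del_q step.IH[of v] step.IH[of a] step.IH[of b]
    by (cases "v = p"; cases "v = q") auto
qed

section \<open>Properties of odd 3-wheels\<close>

text \<open>
  The vertices at even distance from the centre of an odd wheel are one end of every digon, and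
  every other vertex is missed by a matching that covers them.
\<close>

definition even_side :: "'a rel \<Rightarrow> 'a set \<Rightarrow> bool" where
  "even_side A E \<longleftrightarrow> E \<subseteq> Field A \<and>
     (\<forall>u v. (u, v) \<in> A \<longrightarrow> (v, u) \<in> A \<longrightarrow> (u \<in> E) \<noteq> (v \<in> E)) \<and>
     (\<forall>v\<in>Field A - E. card E \<le> pm (ind A (- {v})) \<and> outdeg A v = 2 \<and> indeg A v = 2) \<and>
     (\<forall>z\<in>E. A `` {z} = A\<inverse> `` {z}) \<and>
     (\<forall>z\<in>E. outdeg A z = 2 \<longrightarrow> (\<exists>u v. (z, u) \<in> A \<and> (u, v) \<in> A \<and> (v, u) \<in> A \<and> v \<noteq> z))"

lemma even_sideD:
  assumes "even_side A E"
  shows "E \<subseteq> Field A"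
    and "\<And>u v. (u, v) \<in> A \<Longrightarrow> (v, u) \<in> A \<Longrightarrow> (u \<in> E) \<noteq> (v \<in> E)"
    and "\<And>v. v \<in> Field A \<Longrightarrow> v \<notin> E \<Longrightarrow> card E \<le> pm (ind A (- {v})) \<and> outdeg A v = 2 \<and> indeg A v = 2"
    and "\<And>z. z \<in> E \<Longrightarrow> A `` {z} = A\<inverse> `` {z}"
    and "\<And>z. z \<in> E \<Longrightarrow> outdeg A z = 2 \<Longrightarrow> \<exists>u v. (z, u) \<in> A \<and> (u, v) \<in> A \<and> (v, u) \<in> A \<and> v \<noteq> z"
proof -
  note D = assms[unfolded even_side_def]
  show "E \<subseteq> Field A" using D[THEN conjunct1] .
  note D = D[THEN conjunct2]
  show "\<And>u v. (u, v) \<in> A \<Longrightarrow> (v, u) \<in> A \<Longrightarrow> (u \<in> E) \<noteq> (v \<in> E)" using D[THEN conjunct1] by blast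
  note D = D[THEN conjunct2]
  show "\<And>v. v \<in> Field A \<Longrightarrow> v \<notin> E \<Longrightarrow> card E \<le> pm (ind A (- {v})) \<and> outdeg A v = 2 \<and> indeg A v = 2"
    using D[THEN conjunct1] by blast
  note D = D[THEN conjunct2]
  show "\<And>z. z \<in> E \<Longrightarrow> A `` {z} = A\<inverse> `` {z}" using D[THEN conjunct1] by blast
  show "\<And>z. z \<in> E \<Longrightarrow> outdeg A z = 2 \<Longrightarrow> \<exists>u v. (z, u) \<in> A \<and> (u, v) \<in> A \<and> (v, u) \<in> A \<and> v \<noteq> z"
    using D[THEN conjunct2] by blast
qed

lemma even_side_subdiv:
  assumes "subdivision A a b p q" "even_side A E" "a \<in> E"
  shows "even_side (subdiv A a b p q) (insert q E)"
proof -
  interpret subdivision A a b p q by fact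
  interpret C: subdivision "A\<inverse>" a b p q by (rule subdivision_converse)
  let ?S = "subdiv A a b p q"
  have conv: "?S\<inverse> = subdiv (A\<inverse>) a b p q" by (rule converse_subdiv)
  note E = even_sideD(1)[OF assms(2)] and e1 = even_sideD(2)[OF assms(2)] and e2 = even_sideD(3)[OF assms(2)]
    and e3 = even_sideD(4)[OF assms(2)] and e4 = even_sideD(5)[OF assms(2)]
  have b: "b \<notin> E" "b \<in> Field A" using e1[OF ab] assms(3) ab unfolding Field_def by auto
  have pqE: "p \<notin> E" "q \<notin> E" using E pq by auto
  have finE: "finite E" using E fin finite_Field finite_subset by metis
  show ?thesis unfolding even_side_def
  proof (intro conjI ballI allI impI)
    show "insert q E \<subseteq> Field ?S" unfolding Field_subdiv using E by auto
  next
    fix u v assume "(u, v) \<in> ?S" "(v, u) \<in> ?S"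
    then have "(u, v) \<in> A \<and> (v, u) \<in> A \<or> (u, v) \<in> dig a p \<union> dig p q \<union> dig q b"
      unfolding subdiv_def by auto
    then show "(u \<in> insert q E) \<noteq> (v \<in> insert q E)"
      using e1[of u v] no_pq neq assms(3) b pqE by auto
  next
    fix v assume v: "v \<in> Field ?S - insert q E"
    have "card E + 1 \<le> pm (ind ?S (- {v}))"
    proof (cases "v = p")
      case True
      then show ?thesis using pm_subdiv_del_p e2[OF b(2,1)] by simp
    next
      case False
      then have "v \<in> Field A" "v \<notin> E" using v unfolding Field_subdiv by auto
      then show ?thesis using pm_subdiv_del[of v] e2[of v] v False by simp
    qed
    then show "card (insert q E) \<le> pm (ind ?S (- {v}))" using pqE finE by simp
    show "outdeg ?S v = 2" using v outdeg_subdiv[of v] outdeg_subdiv_new e2[of v]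
      unfolding Field_subdiv by auto
    have "outdeg (?S\<inverse>) v = 2" using v C.outdeg_subdiv[of v] C.outdeg_subdiv_new e2[of v]
      unfolding Field_subdiv conv by auto
    then show "indeg ?S v = 2" by simp
  next
    fix z assume z: "z \<in> insert q E"
    then consider "z = q" | "z = a" | "z \<in> E" "z \<notin> {a, b, p, q}" using b pqE by blast
    then show "?S `` {z} = ?S\<inverse> `` {z}"
    proof cases
      case 1
      show ?thesis unfolding conv 1 out_subdiv(2) C.out_subdiv(2) ..
    next
      case 2
      have "A `` {a} = A\<inverse> `` {a}" by (rule e3[OF assms(3)])
      then show ?thesis unfolding conv 2 out_subdiv(3) C.out_subdiv(3) by simp
    next
      case 3
      show ?thesis unfolding conv out_subdiv(5)[OF 3(2)] C.out_subdiv(5)[OF 3(2)] by (rule e3[OF 3(1)])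
    qed
  next
    fix z assume z: "z \<in> insert q E" and d: "outdeg ?S z = 2"
    consider "z = q" | "z = a" | "z \<in> E" "z \<notin> {a, b, p, q}" using z b pqE by blast
    then show "\<exists>u v. (z, u) \<in> ?S \<and> (u, v) \<in> ?S \<and> (v, u) \<in> ?S \<and> v \<noteq> z"
    proof cases
      case 1
      then have "(z, p) \<in> ?S \<and> (p, a) \<in> ?S \<and> (a, p) \<in> ?S \<and> a \<noteq> z" using neq unfolding subdiv_def by auto
      then show ?thesis by blast
    next
      case 2
      then have "(z, p) \<in> ?S \<and> (p, q) \<in> ?S \<and> (q, p) \<in> ?S \<and> q \<noteq> z" using neq unfolding subdiv_def by auto
      then show ?thesis by blast
    next
      case 3
      then have "outdeg A z = 2" using d outdeg_subdiv[of z] E by auto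
      then obtain u v where uv: "(z, u) \<in> A" "(u, v) \<in> A" "(v, u) \<in> A" "v \<noteq> z" using e4[OF 3(1)] by blast
      have zu: "(z, u) \<in> ?S" using uv(1) 3 unfolding subdiv_def by auto
      have "u \<notin> E" using e3[OF 3(1)] e1[of z u] uv(1) 3(1) by blast
      then have "u \<noteq> a" using assms(3) by blast
      show ?thesis
      proof (cases "u = b \<and> v = a")
        case True
        then have "(z, u) \<in> ?S \<and> (u, q) \<in> ?S \<and> (q, u) \<in> ?S \<and> q \<noteq> z"
          using zu 3(2) unfolding subdiv_def by auto
        then show ?thesis by blast
      next
        case False
        then have "(u, v) \<in> ?S" "(v, u) \<in> ?S" using uv \<open>u \<noteq> a\<close> unfolding subdiv_def by auto
        then show ?thesis using zu uv(4) by blast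
      qed
    qed
  qed
qed

lemma even_side_wheel3:
  assumes "distinct [c, x, y, z]"
  shows "even_side ({(x, y), (y, z), (z, x)} \<union> (dig c x \<union> dig c y \<union> dig c z)) {c}"
proof -
  let ?A = "{(x, y), (y, z), (z, x)} \<union> (dig c x \<union> dig c y \<union> dig c z)"
  have F: "Field ?A = {c, x, y, z}" unfolding Field_def by auto
  have o: "?A `` {x} = {c, y}" "?A `` {y} = {c, z}" "?A `` {z} = {c, x}" "?A `` {c} = {x, y, z}"
    and i: "?A\<inverse> `` {x} = {c, z}" "?A\<inverse> `` {y} = {c, x}" "?A\<inverse> `` {z} = {c, y}" "?A\<inverse> `` {c} = {x, y, z}"
    using assms by auto
  have deg: "outdeg ?A v = 2 \<and> indeg ?A v = 2" if "v \<in> {x, y, z}" for v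
    using that assms unfolding outdeg_def indeg_def by (elim insertE emptyE) (simp_all only: o i, auto)
  have "outdeg ?A c = 3" unfolding outdeg_def o using assms by simp
  moreover have "1 \<le> pm (ind ?A (- {v}))" if "v \<in> {x, y, z}" for v
  proof (cases "v = x")
    case True
    show ?thesis by (rule pm_1I[of _ c y]) (use that assms True in auto)
  next
    case False
    show ?thesis by (rule pm_1I[of _ c x]) (use that assms False in auto)
  qed
  moreover have "(u \<in> {c}) \<noteq> (v \<in> {c})" if "(u, v) \<in> ?A" "(v, u) \<in> ?A" for u v
    using that assms by auto
  ultimately show ?thesis unfolding even_side_def F using deg i o by auto
qed

lemma wheel3_not_colourable:
  "\<not> colourable ({(x, y), (y, z), (z, x)} \<union> (dig c x \<union> dig c y \<union> dig c z))"
proof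
  let ?A = "{(x, y), (y, z), (z, x)} \<union> (dig c x \<union> dig c y \<union> dig c z)"
  assume "colourable ?A"
  then obtain k where k: "proper_col k ?A" unfolding colourable_def by blast
  have "k c \<noteq> k x" "k c \<noteq> k y" "k c \<noteq> k z"
    using proper_col_digon[OF k, of c x] proper_col_digon[OF k, of c y] proper_col_digon[OF k, of c z] by auto
  then have xyz: "k x = k y" "k y = k z" by auto
  then have "(x, y) \<in> mono_arcs k ?A" "(y, z) \<in> mono_arcs k ?A" by auto
  then have "(x, z) \<in> (mono_arcs k ?A)\<^sup>*" by (meson converse_rtrancl_into_rtrancl r_into_rtrancl)
  with proper_col_path[OF k] show False using xyz by auto
qed

lemma pm_even_side:
  assumes "even_side A E" "finite A"
  shows "pm A \<le> card E"
proof (rule pm_cover[OF assms(2)])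
  show "finite E" using even_sideD(1)[OF assms(1)] finite_Field[OF assms(2)] finite_subset by blast
  show "u \<in> E \<or> v \<in> E" if "(u, v) \<in> A" "(v, u) \<in> A" for u v
    using even_sideD(2)[OF assms(1) that] by blast
qed

lemma wheel_basic: "wheel A \<Longrightarrow> finite A \<and> irrefl A \<and> \<not> colourable A \<and> rho A = -1 \<and> (\<exists>E. even_side A E)"
proof (induction rule: wheel_induct)
  case (base c x y z)
  let ?A = "{(x, y), (y, z), (z, x)} \<union> (dig c x \<union> dig c y \<union> dig c z)"
  have F: "Field ?A = {c, x, y, z}" unfolding Field_def by auto
  have "pm ?A \<le> 1" using pm_even_side[OF even_side_wheel3[OF base]] by simp
  moreover have "1 \<le> pm ?A" by (rule pm_1I[of _ c x]) auto
  moreover have "card ?A = 9" using base by (auto simp: card_insert_if)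
  moreover have "card (Field ?A) = 4" unfolding F using base by simp
  ultimately have "rho ?A = -1" unfolding rho_def by simp
  moreover have "irrefl ?A" using base unfolding irrefl_def by auto
  moreover have "\<exists>E. even_side ?A E" using even_side_wheel3[OF base] by blast
  moreover have "finite ?A" by simp
  ultimately show ?case by (intro conjI wheel3_not_colourable)
next
  case (step A a b p q)
  interpret subdivision A a b p q by fact
  interpret sw: subdivision A b a q p by (rule subdivision_swap)
  from step.IH obtain E where E: "even_side A E" by blast
  have "(a \<in> E) \<noteq> (b \<in> E)" by (rule even_sideD(2)[OF E ab])
  then have "\<exists>E. even_side (subdiv A a b p q) E"
    using even_side_subdiv[OF subdivision_axioms E] even_side_subdiv[OF subdivision_swap E, unfolded swap] by blast
  then show ?case using step finite_subdiv irrefl_subdiv not_colourable_subdiv rho_subdiv by auto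
qed

lemma wheel_converse: "wheel A \<Longrightarrow> wheel (A\<inverse>)"
proof (induction rule: wheel_induct)
  case (base c x y z)
  have "wheel3 (({(x, y), (y, z), (z, x)} \<union> (dig c x \<union> dig c y \<union> dig c z))\<inverse>)"
    unfolding wheel3_def
    by (rule exI[of _ c], rule exI[of _ y], rule exI[of _ x], rule exI[of _ z]) (use base in auto)
  then show ?case unfolding wheel_def by (rule subdivided.base)
next
  case (step A a b p q)
  interpret subdivision A a b p q by fact
  show ?case unfolding converse_subdiv using step.IH subdivision_converse by (rule wheel_subdiv)
qed

lemma wheel_converse_iff[simp]: "wheel (A\<inverse>) \<longleftrightarrow> wheel A"
  using wheel_converse[of A] wheel_converse[of "A\<inverse>"] by auto

lemma cyc_converse_iff[simp]: "cyc (A\<inverse>) \<longleftrightarrow> cyc A"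
  using cyc_basic[of A] cyc_basic[of "A\<inverse>"] by (metis converse_converse)

section \<open>Bidirected paths and cycles as lists\<close>

fun pd :: "'a list \<Rightarrow> 'a rel" where
  "pd (a # b # r) = dig a b \<union> pd (b # r)"
| "pd _ = {}"

lemma path_edges_Cons: "path_edges (a # b # r) = insert {a, b} (path_edges (b # r))"
proof -
  have "e \<in> path_edges (a # b # r) \<longleftrightarrow> e = {a, b} \<or> e \<in> path_edges (b # r)" for e
  proof
    assume "e \<in> path_edges (a # b # r)"
    then obtain i where i: "Suc i < length (a # b # r)" "e = {(a # b # r) ! i, (a # b # r) ! Suc i}"
      unfolding path_edges_def by blast
    show "e = {a, b} \<or> e \<in> path_edges (b # r)"
    proof (cases i)
      case 0
      then show ?thesis using i by simp
    next
      case (Suc j)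
      then have "Suc j < length (b # r)" "e = {(b # r) ! j, (b # r) ! Suc j}" using i by auto
      then show ?thesis unfolding path_edges_def by blast
    qed
  next
    assume "e = {a, b} \<or> e \<in> path_edges (b # r)"
    then show "e \<in> path_edges (a # b # r)"
    proof
      assume "e = {a, b}"
      then have "e = {(a # b # r) ! 0, (a # b # r) ! Suc 0}" "Suc 0 < length (a # b # r)" by auto
      then show ?thesis unfolding path_edges_def by blast
    next
      assume "e \<in> path_edges (b # r)"
      then obtain i where "Suc i < length (b # r)" "e = {(b # r) ! i, (b # r) ! Suc i}"
        unfolding path_edges_def by blast
      then have "Suc (Suc i) < length (a # b # r)" "e = {(a # b # r) ! Suc i, (a # b # r) ! Suc (Suc i)}" by auto
      then show ?thesis unfolding path_edges_def by blast
    qed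
  qed
  then show ?thesis by blast
qed

lemma digons_insert: "digons (insert {a, b} E) = dig a b \<union> digons E"
  unfolding digons_def by (auto simp: doubleton_eq_iff)

lemma digons_Un: "digons (E \<union> F) = digons E \<union> digons F"
  unfolding digons_def by auto

lemma digons_path_edges: "digons (path_edges vs) = pd vs"
proof (induction vs rule: pd.induct)
  case (1 a b r)
  then show ?case by (simp only: path_edges_Cons digons_insert pd.simps)
qed (simp_all add: path_edges_def digons_def)

lemma pd_append: "us \<noteq> [] \<Longrightarrow> ws \<noteq> [] \<Longrightarrow> pd (us @ ws) = pd us \<union> pd ws \<union> dig (last us) (hd ws)"
proof (induction us rule: pd.induct)
  case (1 a b r)
  then show ?case by auto
next
  case ("2_2" v)
  then show ?case by (cases ws) auto
qed auto

lemma pd_rev: "pd (rev vs) = pd vs"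
proof (induction vs rule: pd.induct)
  case (1 a b r)
  have "pd (rev (b # r) @ [a]) = pd (rev (b # r)) \<union> pd [a] \<union> dig (last (rev (b # r))) (hd [a])"
    by (rule pd_append) auto
  then show ?case using 1 by auto
qed auto

lemma pd_set: "(a, b) \<in> pd vs \<Longrightarrow> a \<in> set vs \<and> b \<in> set vs"
  by (induction vs rule: pd.induct) auto

lemma pd_sym: "(a, b) \<in> pd vs \<Longrightarrow> (b, a) \<in> pd vs"
  by (induction vs rule: pd.induct) auto

lemma finite_pd[simp]: "finite (pd vs)"
  by (induction vs rule: pd.induct) auto

lemma Field_pd: "2 \<le> length vs \<Longrightarrow> Field (pd vs) = set vs"
proof (induction vs rule: pd.induct)
  case (1 a b r)
  show ?case
  proof (cases r)
    case Nil
    then show ?thesis unfolding Field_def by auto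
  next
    case (Cons x r')
    then have "Field (pd (b # r)) = set (b # r)" using 1 by simp
    moreover have "Field (pd (a # b # r)) = {a, b} \<union> Field (pd (b # r))" unfolding Field_def by auto
    ultimately have "Field (pd (a # b # r)) = {a, b} \<union> set (b # r)" by (simp only:)
    then show ?thesis by auto
  qed
qed auto

lemma pd_split:
  assumes "(a, b) \<in> pd vs"
  shows "\<exists>xs ys. vs = xs @ a # b # ys \<or> vs = xs @ b # a # ys"
  using assms
proof (induction vs rule: pd.induct)
  case (1 u v r)
  show ?case
  proof (cases "(a, b) \<in> pd (v # r)")
    case True
    then obtain xs ys where "v # r = xs @ a # b # ys \<or> v # r = xs @ b # a # ys" using 1 by blast
    then have "u # v # r = (u # xs) @ a # b # ys \<or> u # v # r = (u # xs) @ b # a # ys" by auto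
    then show ?thesis by blast
  next
    case False
    then have "u = a \<and> v = b \<or> u = b \<and> v = a" using 1 by auto
    then have "u # v # r = [] @ a # b # r \<or> u # v # r = [] @ b # a # r" by auto
    then show ?thesis by blast
  qed
qed auto

lemma pd_splitE:
  assumes "(a, b) \<in> pd vs"
  obtains (1) xs ys where "vs = xs @ a # b # ys" | (2) xs ys where "vs = xs @ b # a # ys"
  using pd_split[OF assms] by (elim exE disjE)

lemma pd_mid: "pd (xs @ a # b # ys) = pd (xs @ [a]) \<union> dig a b \<union> pd (b # ys)"
  using pd_append[of "xs @ [a]" "b # ys"] by auto

lemma pd_diff:
  assumes "distinct (xs @ a # b # ys)"
  shows "pd (xs @ a # b # ys) - dig a b = pd (xs @ [a]) \<union> pd (b # ys)"
proof -
  have "(a, b) \<notin> pd (xs @ [a])" "(b, a) \<notin> pd (xs @ [a])" "(a, b) \<notin> pd (b # ys)" "(b, a) \<notin> pd (b # ys)"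
    using assms pd_set[of a b] pd_set[of b a] by fastforce+
  then show ?thesis unfolding pd_mid by auto
qed

definition cyc_list :: "'a list \<Rightarrow> 'a rel \<Rightarrow> bool" where
  "cyc_list vs A \<longleftrightarrow> distinct vs \<and> 3 \<le> length vs \<and> odd (length vs) \<and> A = pd vs \<union> dig (last vs) (hd vs)"

lemma cyc_list_rotate:
  assumes "cyc_list (us @ ws) A"
  shows "cyc_list (ws @ us) A"
proof (cases "us = [] \<or> ws = []")
  case False
  then have "pd (us @ ws) \<union> dig (last (us @ ws)) (hd (us @ ws)) =
      pd (ws @ us) \<union> dig (last (ws @ us)) (hd (ws @ us))"
    by (subst (1 2) pd_append) auto
  then show ?thesis using assms unfolding cyc_list_def by (auto simp: add.commute)
qed (use assms in auto)

lemma cyc_list_rev: "cyc_list vs A \<Longrightarrow> cyc_list (rev vs) A"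
  unfolding cyc_list_def pd_rev by (cases "vs = []") (auto simp: hd_rev last_rev)

lemma cyc_list_edge:
  assumes "cyc_list vs A" "(a, b) \<in> A"
  shows "\<exists>ws. cyc_list ws A \<and> hd ws = a \<and> last ws = b"
proof -
  have base: ?thesis if ws: "cyc_list ws A" "ws = xs @ b # a # ys" for ws xs ys
  proof -
    have "cyc_list ((xs @ [b]) @ (a # ys)) A" using ws by simp
    then have "cyc_list ((a # ys) @ (xs @ [b])) A" by (rule cyc_list_rotate)
    then show ?thesis by (intro exI[of _ "(a # ys) @ (xs @ [b])"]) simp
  qed
  show ?thesis
  proof (cases "(a, b) \<in> pd vs")
    case True
    then show ?thesis
    proof (cases rule: pd_splitE)
      case (1 xs ys)
      then have "rev vs = rev ys @ b # a # rev xs" by simp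
      then show ?thesis by (rule base[OF cyc_list_rev[OF assms(1)]])
    next
      case (2 xs ys)
      then show ?thesis by (rule base[OF assms(1)])
    qed
  next
    case False
    then have "a = last vs \<and> b = hd vs \<or> a = hd vs \<and> b = last vs"
      using assms unfolding cyc_list_def by auto
    then show ?thesis
    proof
      assume "a = last vs \<and> b = hd vs"
      moreover have "vs \<noteq> []" using assms(1) unfolding cyc_list_def by auto
      ultimately show ?thesis using cyc_list_rev[OF assms(1)]
        by (intro exI[of _ "rev vs"]) (auto simp: hd_rev last_rev)
    qed (use assms(1) in blast)
  qed
qed

lemma cyc_list_ends:
  assumes "cyc_list vs A"
  shows "(hd vs, last vs) \<notin> pd vs" "(last vs, hd vs) \<notin> pd vs"
proof -
  have "(hd vs, last vs) \<notin> pd vs"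
  proof
    assume "(hd vs, last vs) \<in> pd vs"
    have d: "distinct vs" "3 \<le> length vs" using assms unfolding cyc_list_def by auto
    from \<open>(hd vs, last vs) \<in> pd vs\<close> show False
    proof (cases rule: pd_splitE)
      case (1 xs ys)
      note v = this
      have "xs = []"
      proof (rule ccontr)
        assume "xs \<noteq> []"
        then have "hd vs \<in> set xs" using v by (metis hd_append2 hd_in_set)
        moreover have "distinct (xs @ hd vs # last vs # ys)" using d(1) v by (rule subst[rotated])
        ultimately show False by auto
      qed
      moreover have "ys = []"
      proof (rule ccontr)
        assume "ys \<noteq> []"
        then have "last vs = last ys" using v by (metis last_ConsR last_append list.distinct(1))
        then have "last vs \<in> set ys" using \<open>ys \<noteq> []\<close> by simp
        then show False using d(1) v by (metis distinct.simps(2) distinct_append)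
      qed
      ultimately have "length vs = 2" using v by (metis append_Nil length_Cons list.size(3) numeral_2_eq_2)
      then show False using d by simp
    next
      case (2 xs ys)
      note v = this
      have "hd vs = hd (xs @ [last vs])" using v by (metis append.left_neutral hd_append list.sel(1))
      then have "hd vs \<in> set (xs @ [last vs])" by (metis append_is_Nil_conv hd_in_set not_Cons_self2)
      moreover have "distinct ((xs @ [last vs]) @ hd vs # ys)" using d(1) v by (metis append.assoc append_Cons append_Nil)
      ultimately show False by auto
    qed
  qed
  then show "(hd vs, last vs) \<notin> pd vs" "(last vs, hd vs) \<notin> pd vs" using pd_sym[of "last vs" "hd vs" vs] by auto
qed

lemma cyc_imp_list: "cyc A \<Longrightarrow> \<exists>vs. cyc_list vs A"
proof (induction rule: cyc_induct)
  case (base a b c)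
  have "cyc_list [a, b, c] (dig a b \<union> dig b c \<union> dig a c)" using base unfolding cyc_list_def by auto
  then show ?case by blast
next
  case (step A a b p q)
  interpret subdivision A a b p q by fact
  obtain vs where vs: "cyc_list vs A" "hd vs = a" "last vs = b"
  proof -
    from step.IH obtain vs where "cyc_list vs A" ..
    from cyc_list_edge[OF this ab(1)] show ?thesis using that by (elim exE conjE)
  qed
  have ne: "vs \<noteq> []" using vs(1) unfolding cyc_list_def by auto
  have "Field A = set vs"
  proof -
    have "a \<in> set vs" "b \<in> set vs" using vs ne by auto
    moreover have "Field (pd vs) = set vs" using vs(1) unfolding cyc_list_def by (intro Field_pd) auto
    ultimately show ?thesis using vs unfolding cyc_list_def by (auto simp: Field_Un)
  qed
  then have "distinct (vs @ [q, p])" using vs(1) pq unfolding cyc_list_def by auto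
  moreover have "subdiv A a b p q = pd (vs @ [q, p]) \<union> dig (last (vs @ [q, p])) (hd (vs @ [q, p]))"
  proof -
    have "A - dig a b = pd vs" using cyc_list_ends[OF vs(1)] vs unfolding cyc_list_def by auto
    then show ?thesis unfolding subdiv_def using pd_append[of vs "[q, p]"] ne vs by auto
  qed
  ultimately have "cyc_list (vs @ [q, p]) (subdiv A a b p q)" using vs(1) unfolding cyc_list_def by auto
  then show ?case by blast
qed

lemma list_imp_cyc: "cyc_list vs A \<Longrightarrow> cyc A"
proof (induction "length vs" arbitrary: vs A rule: less_induct)
  case less
  have v: "distinct vs" "3 \<le> length vs" "odd (length vs)" "A = pd vs \<union> dig (last vs) (hd vs)"
    using less.prems unfolding cyc_list_def by auto
  show ?case
  proof (cases "length vs = 3")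
    case True
    then obtain a b c where abc: "vs = [a, b, c]" by (auto simp: numeral_eq_Suc length_Suc_conv)
    have "triangle3 A" unfolding triangle3_def
      by (rule exI[of _ a], rule exI[of _ b], rule exI[of _ c]) (use v abc in auto)
    then show ?thesis unfolding cyc_def by (rule subdivided.base)
  next
    case False
    then have "length vs \<ge> 5" using v(2,3) by presburger
    then obtain x p q y z r where vs: "vs = x # p # q # y # z # r"
      by (auto simp: numeral_eq_Suc Suc_le_length_iff)
    let ?ws = "x # y # z # r"
    let ?B = "pd ?ws \<union> dig (last ?ws) (hd ?ws)"
    have B: "cyc_list ?ws ?B" unfolding cyc_list_def using v vs by auto
    then have "cyc ?B" by (rule less.hyps[rotated]) (simp add: vs)
    moreover have "subdivision ?B x y p q"
    proof
      show "finite ?B" by (metis finite_Un finite_pd finite.emptyI finite.insertI)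
      show "irrefl ?B" using cyc_basic \<open>cyc ?B\<close> by blast
      have "a \<in> set ?ws" if "a \<in> Field ?B" for a
        using that pd_set[of _ _ ?ws] last_in_set[of ?ws] unfolding Field_def by auto
      moreover have "p \<notin> set ?ws" "q \<notin> set ?ws" using v(1) vs by auto
      ultimately show "p \<notin> Field ?B" "q \<notin> Field ?B" by blast+
    qed (use v vs in auto)
    moreover have "subdiv ?B x y p q = A"
    proof -
      let ?C = "pd (y # z # r) \<union> dig (last (z # r)) x"
      have "(x, y) \<notin> ?C" "(y, x) \<notin> ?C"
        using pd_set[of x y "y # z # r"] pd_set[of y x "y # z # r"] v(1) vs last_in_set[of "z # r"] by auto
      moreover have "?B = dig x y \<union> ?C" by auto
      ultimately have "?B - dig x y = ?C" by blast
      then show ?thesis unfolding subdiv_def v(4) vs by auto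
    qed
    ultimately show ?thesis using cyc_subdiv by metis
  qed
qed

section \<open>Odd 3-wheels as three lists\<close>

definition wheel_list :: "'a \<Rightarrow> 'a \<Rightarrow> 'a \<Rightarrow> 'a \<Rightarrow> 'a list \<Rightarrow> 'a list \<Rightarrow> 'a list \<Rightarrow> 'a rel \<Rightarrow> bool" where
  "wheel_list c x y z P Q R A \<longleftrightarrow>
     distinct [x, y, z] \<and> odd_path c P x \<and> odd_path c Q y \<and> odd_path c R z \<and>
     set P \<inter> set Q = {c} \<and> set P \<inter> set R = {c} \<and> set Q \<inter> set R = {c} \<and>
     set P \<inter> {x, y, z} = {x} \<and> set Q \<inter> {x, y, z} = {y} \<and> set R \<inter> {x, y, z} = {z} \<and>
     A = {(x, y), (y, z), (z, x)} \<union> (pd P \<union> pd Q \<union> pd R)"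

lemma wheel_list_rotate: "wheel_list c x y z P Q R A \<Longrightarrow> wheel_list c y z x Q R P A"
  unfolding wheel_list_def by (elim conjE, intro conjI) (simp_all add: Int_commute insert_commute Un_ac, blast?)

lemma odd_path_length: "odd_path c P x \<Longrightarrow> 2 \<le> length P \<and> even (length P)"
  unfolding odd_path_def by (cases P) (auto simp: Suc_le_eq elim: oddE)

lemma int_single: "S \<inter> T = {c} \<Longrightarrow> u \<noteq> c \<Longrightarrow> \<not> (u \<in> S \<and> u \<in> T)"
  by blast

lemma wheel_listD:
  assumes "wheel_list c x y z P Q R A"
  shows "c \<noteq> x" "c \<noteq> y" "c \<noteq> z" "x \<notin> set Q" "x \<notin> set R" "y \<notin> set P" "y \<notin> set R" "z \<notin> set P" "z \<notin> set Q"
    "x \<noteq> y" "y \<noteq> z" "x \<noteq> z"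
proof -
  note D = assms[unfolded wheel_list_def]
  show d: "x \<noteq> y" "y \<noteq> z" "x \<noteq> z" using D by auto
  have P: "set P \<inter> {x, y, z} = {x}" and Q: "set Q \<inter> {x, y, z} = {y}" and R: "set R \<inter> {x, y, z} = {z}"
    and PQ: "set P \<inter> set Q = {c}" and PR: "set P \<inter> set R = {c}" using D by blast+
  show "x \<notin> set Q" "x \<notin> set R" "y \<notin> set P" "y \<notin> set R" "z \<notin> set P" "z \<notin> set Q"
    using int_single[OF P, of y] int_single[OF P, of z] int_single[OF Q, of x] int_single[OF Q, of z]
      int_single[OF R, of x] int_single[OF R, of y] d by auto
  moreover have "c \<in> set P" "c \<in> set Q" "c \<in> set R" using PQ PR by auto
  ultimately show "c \<noteq> x" "c \<noteq> y" "c \<noteq> z" by auto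
qed

lemma Field_wheel_list:
  assumes "wheel_list c x y z P Q R A"
  shows "Field A = set P \<union> set Q \<union> set R"
proof -
  have op: "odd_path c P x" "odd_path c Q y" "odd_path c R z"
     and A: "A = {(x, y), (y, z), (z, x)} \<union> (pd P \<union> pd Q \<union> pd R)"
    using assms unfolding wheel_list_def by blast+
  have "x \<in> set P" "y \<in> set Q" "z \<in> set R" using op unfolding odd_path_def by auto
  moreover have "Field (pd P) = set P" "Field (pd Q) = set Q" "Field (pd R) = set R"
    using Field_pd[of P] Field_pd[of Q] Field_pd[of R]
      odd_path_length[OF op(1)] odd_path_length[OF op(2)] odd_path_length[OF op(3)] by simp_all
  ultimately show ?thesis unfolding A by (auto simp: Field_Un)
qed

lemma wheel_list_subdiv_leg:
  assumes "wheel_list c x y z P Q R A" "P = xs @ a # b # ys"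
    and "p \<notin> Field A" "q \<notin> Field A" "p \<noteq> q"
  shows "\<exists>P'. wheel_list c x y z P' Q R (subdiv A a b p q)"
proof -
  note D = assms(1)[unfolded wheel_list_def]
  have dist: "distinct P" using D unfolding odd_path_def by blast
  let ?P = "xs @ a # p # q # b # ys"
  have F: "Field A = set P \<union> set Q \<union> set R" by (rule Field_wheel_list[OF assms(1)])
  have fresh: "p \<notin> set P" "p \<notin> set Q" "p \<notin> set R" "q \<notin> set P" "q \<notin> set Q" "q \<notin> set R"
    using assms(3,4) unfolding F by auto
  have setP: "set ?P = {p, q} \<union> set P" using assms(2) by auto
  have "odd_path c ?P x"
  proof -
    have "odd_path c P x" using D by blast
    moreover have "distinct ?P" using dist fresh assms(2,5) by auto
    moreover have "hd ?P = hd P" using assms(2) by (cases xs) auto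
    moreover have "last ?P = last P" using assms(2) by simp
    ultimately show ?thesis unfolding odd_path_def using assms(2) by auto
  qed
  moreover have in_rim: "x \<in> set P" "y \<in> set Q" "z \<in> set R" using D unfolding odd_path_def by auto
  moreover have "set ?P \<inter> set Q = {c}" "set ?P \<inter> set R = {c}" "set ?P \<inter> {x, y, z} = {x}"
  proof -
    have "set P \<inter> set Q = {c}" "set P \<inter> set R = {c}" "set P \<inter> {x, y, z} = {x}" using D by blast+
    moreover have "p \<notin> {x, y, z}" "q \<notin> {x, y, z}" using fresh in_rim by auto
    ultimately show "set ?P \<inter> set Q = {c}" "set ?P \<inter> set R = {c}" "set ?P \<inter> {x, y, z} = {x}"
      unfolding setP using fresh by auto
  qed
  moreover have "subdiv A a b p q = {(x, y), (y, z), (z, x)} \<union> (pd ?P \<union> pd Q \<union> pd R)"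
  proof -
    have abP: "a \<in> set P" "b \<in> set P" "a \<noteq> b" using assms(2) dist by auto
    have PQ: "set P \<inter> set Q = {c}" "set P \<inter> set R = {c}" using D by blast+
    have "\<not> (a \<in> set Q \<and> b \<in> set Q)" "\<not> (a \<in> set R \<and> b \<in> set R)"
      using abP int_single[OF PQ(1), of a] int_single[OF PQ(1), of b] int_single[OF PQ(2), of a] int_single[OF PQ(2), of b] by auto
    then have "(a, b) \<notin> pd Q" "(b, a) \<notin> pd Q" "(a, b) \<notin> pd R" "(b, a) \<notin> pd R"
      using pd_set[of a b] pd_set[of b a] by blast+
    moreover have "(a, b) \<notin> {(x, y), (y, z), (z, x)}" "(b, a) \<notin> {(x, y), (y, z), (z, x)}"
      using abP wheel_listD[OF assms(1)] by auto
    moreover have "A = {(x, y), (y, z), (z, x)} \<union> (pd P \<union> pd Q \<union> pd R)" using D by blast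
    ultimately have "A - dig a b = {(x, y), (y, z), (z, x)} \<union> ((pd P - dig a b) \<union> pd Q \<union> pd R)" by blast
    also have "pd P - dig a b = pd (xs @ [a]) \<union> pd (b # ys)"
      unfolding assms(2) by (rule pd_diff) (use dist assms(2) in simp)
    finally have s1: "A - dig a b = {(x, y), (y, z), (z, x)} \<union> (pd (xs @ [a]) \<union> pd (b # ys) \<union> pd Q \<union> pd R)" .
    have s2: "pd ?P = pd (xs @ [a]) \<union> (dig a p \<union> dig p q \<union> dig q b) \<union> pd (b # ys)"
      using pd_mid[of xs a p "q # b # ys"] by auto
    show ?thesis unfolding subdiv_def s1 s2 by (simp only: Un_ac)
  qed
  ultimately have "wheel_list c x y z ?P Q R (subdiv A a b p q)"
    using D unfolding wheel_list_def by blast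
  then show ?thesis by blast
qed

lemma wheel_imp_list: "wheel A \<Longrightarrow> \<exists>c x y z P Q R. wheel_list c x y z P Q R A"
proof (induction rule: wheel_induct)
  case (base c x y z)
  have "wheel_list c x y z [c, x] [c, y] [c, z] ({(x, y), (y, z), (z, x)} \<union> (dig c x \<union> dig c y \<union> dig c z))"
    using base unfolding wheel_list_def odd_path_def by auto
  then show ?case by blast
next
  case (step A a b p q)
  interpret subdivision A a b p q by fact
  interpret sw: subdivision A b a q p by (rule subdivision_swap)
  have leg: "\<exists>c x y z P Q R. wheel_list c x y z P Q R (subdiv A a b p q)"
    if w: "wheel_list c x y z P Q R A" and "(a, b) \<in> pd P" for c x y z P Q R
    using \<open>(a, b) \<in> pd P\<close>
  proof (cases rule: pd_splitE)
    case (1 xs ys)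
    show ?thesis using wheel_list_subdiv_leg[OF w 1 pq] by blast
  next
    case (2 xs ys)
    show ?thesis using wheel_list_subdiv_leg[OF w 2 sw.pq] unfolding swap by blast
  qed
  from step.IH obtain c x y z P Q R where w: "wheel_list c x y z P Q R A" by blast
  note w' = wheel_list_rotate[OF w] and w'' = wheel_list_rotate[OF wheel_list_rotate[OF w]]
  have A: "A = {(x, y), (y, z), (z, x)} \<union> (pd P \<union> pd Q \<union> pd R)" using w unfolding wheel_list_def by blast
  have norev: "(y, x) \<notin> A" "(z, y) \<notin> A" "(x, z) \<notin> A"
    using wheel_listD[OF w] pd_set[of y x] pd_set[of z y] pd_set[of x z] unfolding A by auto
  have "(a, b) \<in> pd P \<union> pd Q \<union> pd R"
  proof (rule ccontr)
    assume "(a, b) \<notin> pd P \<union> pd Q \<union> pd R"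
    then have "(a, b) \<in> {(x, y), (y, z), (z, x)}" using ab(1) unfolding A by blast
    then show False using ab(2) norev by blast
  qed
  then show ?case using leg[OF w] leg[OF w'] leg[OF w''] by blast
qed

text \<open>
  Two consecutive inner vertices of a leg of length at least three can be suppressed.
\<close>

lemma wheel_list_shrink:
  assumes "wheel_list c x y z P Q R A" "length P > 2"
  shows "\<exists>P' B a b p q. length P' < length P \<and> wheel_list c x y z P' Q R B \<and> A = subdiv B a b p q \<and>
    (a, b) \<in> B \<and> (b, a) \<in> B \<and> p \<notin> Field B \<and> q \<notin> Field B \<and> p \<noteq> q"
proof -
  note D = assms(1)[unfolded wheel_list_def]
  have op: "odd_path c P x" using D by blast
  have "length P \<ge> 4" using odd_path_length[OF op] assms(2) by presburger
  then obtain p q b ys where "P = hd P # p # q # b # ys" by (auto simp: numeral_eq_Suc Suc_le_length_iff)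
  then have P: "P = c # p # q # b # ys" using op unfolding odd_path_def by auto
  let ?P = "c # b # ys"
  let ?B = "{(x, y), (y, z), (z, x)} \<union> (pd ?P \<union> pd Q \<union> pd R)"
  have dist: "distinct P" "last P = x" using op unfolding odd_path_def by auto
  have setP: "set P = {p, q} \<union> set ?P" using P by auto
  have xP: "x \<in> set ?P" using dist(2) P by (auto split: if_splits)
  have rim: "set P \<inter> {x, y, z} = {x}" "set P \<inter> set Q = {c}" "set P \<inter> set R = {c}"  using D by blast+
  have cP: "c \<in> set ?P" by simp
  have wB: "wheel_list c x y z ?P Q R ?B"
  proof -
    have "odd_path c ?P x" using op P unfolding odd_path_def by auto
    moreover have "set ?P \<inter> set Q = {c}" "set ?P \<inter> set R = {c}" "set ?P \<inter> {x, y, z} = {x}"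
      using rim setP xP cP by blast+
    ultimately show ?thesis using D unfolding wheel_list_def by blast
  qed
  have pq: "p \<notin> set ?P" "q \<notin> set ?P" "p \<noteq> q" using dist(1) P by auto
  have c: "c \<noteq> p" "c \<noteq> q" using dist(1) P by auto
  have "p \<in> set P" "q \<in> set P" using P by auto
  then have "p \<notin> set Q" "q \<notin> set Q" "p \<notin> set R" "q \<notin> set R"
    using int_single[OF rim(2), of p] int_single[OF rim(2), of q] int_single[OF rim(3), of p] int_single[OF rim(3), of q] c
    by auto
  then have "p \<notin> Field ?B" "q \<notin> Field ?B" using pq unfolding Field_wheel_list[OF wB] by blast+
  moreover have "(c, b) \<in> ?B" "(b, c) \<in> ?B" by auto
  moreover have "A = subdiv ?B c b p q"
  proof -
    have b: "b \<noteq> c" "b \<in> set P" "b \<notin> set (c # ys)" using dist(1) P by auto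
    have "b \<notin> set Q" "b \<notin> set R" using b(1,2) int_single[OF rim(2), of b] int_single[OF rim(3), of b] by auto
    then have "(c, b) \<notin> pd Q" "(b, c) \<notin> pd Q" "(c, b) \<notin> pd R" "(b, c) \<notin> pd R"
      using pd_set[of c b] pd_set[of b c] by blast+
    moreover have "(c, b) \<notin> {(x, y), (y, z), (z, x)}" "(b, c) \<notin> {(x, y), (y, z), (z, x)}"
      using wheel_listD[OF wB] by auto
    moreover have "c \<notin> set (b # ys)" using dist(1) P by auto
    then have "(c, b) \<notin> pd (b # ys)" "(b, c) \<notin> pd (b # ys)" using pd_set[of _ _ "b # ys"] by blast+
    moreover have "pd ?P = dig c b \<union> pd (b # ys)" by simp
    ultimately have s1: "?B - dig c b = {(x, y), (y, z), (z, x)} \<union> (pd (b # ys) \<union> pd Q \<union> pd R)" by blast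
    have s2: "A = {(x, y), (y, z), (z, x)} \<union> (pd P \<union> pd Q \<union> pd R)" using D by blast
    have s3: "pd P = dig c p \<union> dig p q \<union> dig q b \<union> pd (b # ys)" unfolding P by auto
    show ?thesis unfolding subdiv_def s1 unfolding s2 s3 by (simp only: Un_ac)
  qed
  moreover have "length ?P < length P" unfolding P by simp
  ultimately show ?thesis using wB pq(3) by blast
qed

lemma list_imp_wheel: "wheel_list c x y z P Q R A \<Longrightarrow> wheel A"
proof (induction "length P + length Q + length R" arbitrary: c x y z P Q R A rule: less_induct)
  case less
  have shrink: "wheel A" if w: "wheel_list c' x' y' z' P' Q' R' A" "length P' > 2"
    and l: "length P' + length Q' + length R' = length P + length Q + length R" for c' x' y' z' P' Q' R'
  proof -
    obtain P'' B a b p q where B: "length P'' < length P'" "wheel_list c' x' y' z' P'' Q' R' B"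
      "A = subdiv B a b p q" "(a, b) \<in> B" "(b, a) \<in> B" "p \<notin> Field B" "q \<notin> Field B" "p \<noteq> q"
      using wheel_list_shrink[OF w] by blast
    have "wheel B" using less.hyps[OF _ B(2)] B(1) l by simp
    moreover from this have "subdivision B a b p q" using wheel_basic B(4-8) by unfold_locales auto
    ultimately show ?thesis unfolding B(3) by (rule wheel_subdiv)
  qed
  note w = less.prems
  note w' = wheel_list_rotate[OF w] and w'' = wheel_list_rotate[OF wheel_list_rotate[OF w]]
  show ?case
  proof (cases "length P > 2 \<or> length Q > 2 \<or> length R > 2")
    case True
    then show ?thesis using shrink[OF w] shrink[OF w'] shrink[OF w''] by auto
  next
    case False
    have two: "vs = [c, v]" if "odd_path c vs v" "\<not> length vs > 2" for vs v
    proof -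
      have "length vs = 2" using odd_path_length[OF that(1)] that(2) by simp
      then obtain a b where "vs = [a, b]" by (auto simp: numeral_eq_Suc length_Suc_conv)
      then show ?thesis using that(1) unfolding odd_path_def by auto
    qed
    have "odd_path c P x" "odd_path c Q y" "odd_path c R z" using w unfolding wheel_list_def by blast+
    then have PQR: "P = [c, x]" "Q = [c, y]" "R = [c, z]" using two False by blast+
    have "A = {(x, y), (y, z), (z, x)} \<union> (pd P \<union> pd Q \<union> pd R)" using w unfolding wheel_list_def by blast
    then have "wheel3 A" unfolding wheel3_def
      by (intro exI[of _ c] exI[of _ x] exI[of _ y] exI[of _ z])
        (use wheel_listD[OF w] in \<open>simp add: PQR\<close>)
    then show ?thesis unfolding wheel_def by (rule subdivided.base)
  qed
qed

section \<open>Folding a set of vertices\<close>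

text \<open>
  The map f identifies the vertices of R with vertices of X. The digraph B consists of images of
  arcs of A that are not inside R, and of arcs D inside X.
\<close>

locale folding =
  fixes A :: "'a rel" and R :: "'a set" and f :: "'a \<Rightarrow> 'a" and X :: "'a set" and B D :: "'a rel"
  assumes finA: "finite A" and finR: "finite R" and fid: "\<And>v. v \<notin> R \<Longrightarrow> f v = v"
    and fX: "\<And>v. v \<in> R \<Longrightarrow> f v \<in> X" and XR: "X \<subseteq> R"
    and sub: "B \<subseteq> map_prod f f ` (A - ind A R) \<union> D" and D: "D \<subseteq> X \<times> X"
begin

abbreviation W :: "'a set" where "W \<equiv> Field B - X"

lemma lift:
  assumes "(u, v) \<in> B" "(u, v) \<notin> D"
  obtains a b where "(a, b) \<in> A" "u = f a" "v = f b" "a \<in> R \<union> W" "b \<in> R \<union> W" "\<not> (a \<in> R \<and> b \<in> R)"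
proof -
  have "(u, v) \<in> map_prod f f ` (A - ind A R)" using assms sub by blast
  then obtain a b where ab: "(a, b) \<in> A" "(a, b) \<notin> ind A R" "u = f a" "v = f b" by auto
  have F: "u \<in> Field B" "v \<in> Field B" using assms(1) unfolding Field_def by auto
  have in_RW: "s \<in> R \<union> W" if "f s \<in> Field B" for s
    using that fid[of s] XR by (cases "s \<in> R") auto
  show ?thesis using that[OF ab(1,3,4) in_RW in_RW] ab F by auto
qed

lemma W_sub: "W \<subseteq> Field A - R"
proof
  fix v assume v: "v \<in> W"
  then obtain u where "(u, v) \<in> B \<or> (v, u) \<in> B" unfolding Field_def by blast
  then show "v \<in> Field A - R"
  proof
    assume e: "(u, v) \<in> B"
    then have "(u, v) \<notin> D" using v D by blast
    then obtain a b where "(a, b) \<in> A" "v = f b" using lift[OF e] by metis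
    moreover from this have "b \<notin> R" using fX v by auto
    ultimately show ?thesis using fid[of b] unfolding Field_def by auto
  next
    assume e: "(v, u) \<in> B"
    then have "(v, u) \<notin> D" using v D by blast
    then obtain a b where "(a, b) \<in> A" "v = f a" using lift[OF e] by metis
    moreover from this have "a \<notin> R" using fX v by auto
    ultimately show ?thesis using fid[of a] unfolding Field_def by auto
  qed
qed

lemma outer_image: "B - ind B X \<subseteq> map_prod f f ` (ind A (R \<union> W) - ind A R)"
proof
  fix e assume e: "e \<in> B - ind B X"
  obtain u v where uv: "e = (u, v)" by (cases e)
  then have "(u, v) \<in> B" "(u, v) \<notin> D" using e D by auto
  then obtain a b where "(a, b) \<in> A" "u = f a" "v = f b" "a \<in> R \<union> W" "b \<in> R \<union> W" "\<not> (a \<in> R \<and> b \<in> R)"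
    using lift by metis
  then have "(a, b) \<in> ind A (R \<union> W) - ind A R" "e = map_prod f f (a, b)" using uv by auto
  then show "e \<in> map_prod f f ` (ind A (R \<union> W) - ind A R)" by blast
qed

lemma outer_card: "card (B - ind B X) \<le> card (ind A (R \<union> W) - ind A R)"
proof -
  have "finite (ind A (R \<union> W) - ind A R)" using finA by simp
  then show ?thesis using outer_image by (meson card_mono card_image_le finite_imageI le_trans)
qed

lemma finite_B: "finite B"
proof -
  have "finite X" using XR finR finite_subset by blast
  then have "finite D" using D finite_subset by (metis finite_SigmaI)
  then show ?thesis using sub finA finite_subset by (metis finite_Diff finite_UnI finite_imageI)
qed

text \<open>
  The vertices of X in B are replaced by the whole set R. The arcs of B outside X lift to
  distinct arcs of A. Vertices outside Y are not identified with others, so a matching of B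
  avoiding Y is present before folding, and it can be combined with a matching inside R that
  avoids X - Y.
\<close>

lemma fold_pot:
  assumes "Y \<subseteq> X" "\<And>v. f v \<notin> Y \<Longrightarrow> f v = v" "\<And>u v. (u, v) \<in> D \<Longrightarrow> u \<in> Y \<or> v \<in> Y"
  shows "pot A (R \<union> W) + 3 * int (card (ind A (R \<union> W) - ind A R))
    \<le> pot A R + 2 * int (pm (ind A R)) - 2 * int (pm (ind A (R - (X - Y))))
      + rho B - 7 * int (card (X \<inter> Field B)) + 3 * int (card (ind B X))
      + 2 * int (pm B) - 2 * int (pm (ind B (- Y))) + 3 * int (card (B - ind B X))"
proof -
  define Q where "Q = ind A (R \<union> W) - ind A R"
  have fW: "finite W" using finite_B by (simp add: finite_Field)
  have WR: "W \<inter> R = {}" using W_sub by blast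
  have c1: "card (R \<union> W) = card R + card W" using WR fW finR by (simp add: card_Un_disjoint Int_commute)
  have c2: "card (Field B) = card W + card (X \<inter> Field B)"
  proof -
    have "Field B = W \<union> (X \<inter> Field B)" "W \<inter> (X \<inter> Field B) = {}" by auto
    then have "card (Field B) = card (W \<union> (X \<inter> Field B))" by simp
    also have "\<dots> = card W + card (X \<inter> Field B)"
      by (rule card_Un_disjoint) (use fW finite_B finite_Field in auto)
    finally show ?thesis .
  qed
  have c3: "card (ind A (R \<union> W)) = card (ind A R) + card Q"
  proof -
    have "ind A R \<subseteq> ind A (R \<union> W)" by (rule ind_mono) auto
    then show ?thesis unfolding Q_def using finA
      by (simp add: card_Diff_subset card_mono)
  qed
  have c4: "card B = card (B - ind B X) + card (ind B X)"
    using finite_B ind_subset[of B X] by (simp add: card_Diff_subset card_mono)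
  have "pm (ind A (R - (X - Y))) + pm (ind B (- Y)) \<le> pm (ind A (R \<union> W))"
  proof (rule pm_disjoint)
    show "finite (ind A (R \<union> W))" using finA by simp
    show "ind A (R - (X - Y)) \<subseteq> ind A (R \<union> W)" by (rule ind_mono) auto
    show "ind B (- Y) \<subseteq> ind A (R \<union> W)"
    proof
      fix e assume e: "e \<in> ind B (- Y)"
      obtain u v where uv: "e = (u, v)" by (cases e)
      then have *: "(u, v) \<in> B" "u \<notin> Y" "v \<notin> Y" using e by auto
      then have "(u, v) \<notin> D" using assms(3) by blast
      then obtain a b where ab: "(a, b) \<in> A" "u = f a" "v = f b" "a \<in> R \<union> W" "b \<in> R \<union> W"
        using lift[OF *(1)] by metis
      then have "a = u" "b = v" using assms(2)[of a] assms(2)[of b] *(2,3) by auto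
      then show "e \<in> ind A (R \<union> W)" using uv ab by simp
    qed
    have "Field (ind B (- Y)) \<subseteq> W \<union> (X - Y)" using Field_ind[of B "- Y"] by blast
    then show "Field (ind A (R - (X - Y))) \<inter> Field (ind B (- Y)) = {}"
      using Field_ind[of A "R - (X - Y)"] WR by blast
  qed
  then show ?thesis
    unfolding rho_def pot_def Q_def[symmetric] c1 c2 c3 using c4 by simp
qed

end

section \<open>Contracting a coloured set\<close>

text \<open>
  The two colour classes of R are mapped to the two vertices \<open>x1\<close> and
  \<open>x2\<close>.
\<close>

definition cmap :: "'a set \<Rightarrow> ('a \<Rightarrow> bool) \<Rightarrow> 'a \<Rightarrow> 'a \<Rightarrow> 'a \<Rightarrow> 'a" where
  "cmap R c x1 x2 v = (if v \<in> R then if c v then x1 else x2 else v)"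

definition contr :: "'a rel \<Rightarrow> 'a set \<Rightarrow> ('a \<Rightarrow> bool) \<Rightarrow> 'a \<Rightarrow> 'a \<Rightarrow> 'a rel" where
  "contr A R c x1 x2 =
     map_prod (cmap R c x1 x2) (cmap R c x1 x2) ` A - Id \<union> dig x1 x2"

lemma contr_mem: "(a, b) \<in> A \<Longrightarrow> cmap R c x1 x2 a \<noteq> cmap R c x1 x2 b \<Longrightarrow>
    (cmap R c x1 x2 a, cmap R c x1 x2 b) \<in> contr A R c x1 x2"
  unfolding contr_def by force

lemma contr_cases:
  assumes "(u, v) \<in> contr A R c x1 x2"
  obtains (dig) "(u, v) \<in> dig x1 x2"
  | (arc) a b where "(a, b) \<in> A" "u = cmap R c x1 x2 a" "v = cmap R c x1 x2 b" "u \<noteq> v"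
  using assms unfolding contr_def by auto

text \<open>
  In a colouring of the contraction \<open>x1\<close> and \<open>x2\<close> differ, since they
  span a digon. So it can be pulled back: inside R it agrees with c up to exchanging the
  colours, and a cycle leaving R maps to a cycle of the contraction.
\<close>

lemma contr_not_colourable:
  assumes "\<not> colourable A" "irrefl A" "proper_col c (ind A R)" "x1 \<in> R" "x2 \<in> R"
  shows "\<not> colourable (contr A R c x1 x2)"
proof
  let ?f = "cmap R c x1 x2"
  assume "colourable (contr A R c x1 x2)"
  then obtain k where k: "proper_col k (contr A R c x1 x2)" unfolding colourable_def by blast
  have "(x1, x2) \<in> contr A R c x1 x2" "(x2, x1) \<in> contr A R c x1 x2" unfolding contr_def by auto
  then have kx: "k x1 \<noteq> k x2" using proper_col_digon[OF k] by blast
  have "acyclic (mono_arcs (\<lambda>v. k (?f v)) A)"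
  proof (rule acyclic_lex[where f = ?f])
    show "acyclic (mono_arcs k (contr A R c x1 x2))" using k unfolding proper_col_def .
    show "acyclic (mono_arcs c (ind A R))" using assms(3) unfolding proper_col_def .
    fix a b assume "(a, b) \<in> mono_arcs (\<lambda>v. k (?f v)) A"
    then have ab: "(a, b) \<in> A" "k (?f a) = k (?f b)" by auto
    show "(?f a, ?f b) \<in> mono_arcs k (contr A R c x1 x2) \<or> ?f a = ?f b \<and> (a, b) \<in> mono_arcs c (ind A R)"
    proof (cases "?f a = ?f b")
      case True
      have "a \<noteq> b" using ab(1) assms(2) unfolding irrefl_def by auto
      then have "a \<in> R" "b \<in> R" using True assms(4,5) unfolding cmap_def by (auto split: if_splits)
      moreover have "c a = c b" using True kx calculation unfolding cmap_def by (auto split: if_splits)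
      ultimately show ?thesis using ab True by simp
    next
      case False
      then show ?thesis using ab contr_mem[OF ab(1) False] by simp
    qed
  qed
  then show False using assms(1) unfolding colourable_def proper_col_def by blast
qed

lemma contr_finite: "finite A \<Longrightarrow> finite (contr A R c x1 x2)"
  unfolding contr_def by simp

lemma contr_irrefl: "x1 \<noteq> x2 \<Longrightarrow> irrefl (contr A R c x1 x2)"
  unfolding contr_def irrefl_def by auto

lemma contr_outside:
  assumes "(u, v) \<in> contr A R c x1 x2" "x1 \<in> R" "x2 \<in> R"
  shows "(u \<in> R \<longrightarrow> u = x1 \<or> u = x2) \<and> (u \<notin> R \<longrightarrow> u \<in> Field A) \<and>
     (v \<in> R \<longrightarrow> v = x1 \<or> v = x2) \<and> (v \<notin> R \<longrightarrow> v \<in> Field A)"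
  using assms(1)
proof (cases rule: contr_cases)
  case dig
  then show ?thesis using assms by auto
next
  case (arc a b)
  then have "a \<in> Field A" "b \<in> Field A" unfolding Field_def by auto
  then show ?thesis using arc assms unfolding cmap_def by (auto split: if_splits)
qed

lemma contr_Field:
  assumes "B \<subseteq> contr A R c x1 x2" "x1 \<in> R" "x2 \<in> R"
  shows "Field B - {x1, x2} \<subseteq> Field A - R"
proof
  fix v assume v: "v \<in> Field B - {x1, x2}"
  then obtain u where "(u, v) \<in> contr A R c x1 x2 \<or> (v, u) \<in> contr A R c x1 x2"
    using assms(1) unfolding Field_def by blast
  then show "v \<in> Field A - R"
    using contr_outside[of u v A R c x1 x2] contr_outside[of v u A R c x1 x2] v assms(2,3) by blast
qed

lemma contr_lift:
  assumes "B \<subseteq> contr A R c x1 x2" "x1 \<in> R" "x2 \<in> R" "(u, v) \<in> B" "(u, v) \<notin> ind B {x1, x2}"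
  obtains a b where "(a, b) \<in> A" "u = cmap R c x1 x2 a" "v = cmap R c x1 x2 b"
    "a \<in> R \<union> (Field B - {x1, x2})" "b \<in> R \<union> (Field B - {x1, x2})" "\<not> (a \<in> R \<and> b \<in> R)"
proof -
  have "(u, v) \<in> contr A R c x1 x2" using assms by blast
  then show ?thesis
  proof (cases rule: contr_cases)
    case dig
    then show ?thesis using assms(4,5) by auto
  next
    case (arc a b)
    have F: "u \<in> Field B" "v \<in> Field B" using assms(4) unfolding Field_def by auto
    have "a \<in> R \<union> (Field B - {x1, x2})"
      using arc(2) F assms(2,3) unfolding cmap_def by (auto split: if_splits)
    moreover have "b \<in> R \<union> (Field B - {x1, x2})"
      using arc(3) F assms(2,3) unfolding cmap_def by (auto split: if_splits)
    moreover have "\<not> (a \<in> R \<and> b \<in> R)"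
      using arc assms(4,5) unfolding cmap_def by (auto split: if_splits)
    ultimately show ?thesis using that arc by blast
  qed
qed

text \<open>
  The change of potential when X is replaced by a set R of vertices: it is \<open>rho B\<close>
  without the contributions of the vertices and arcs inside X, where matching edges meeting X
  may be lost.
\<close>

definition gain :: "'a rel \<Rightarrow> 'a set \<Rightarrow> int" where
  "gain B X = rho B - 7 * int (card (X \<inter> Field B)) + 3 * int (card (ind B X))
      + 2 * (int (pm B) - int (pm (ind B (- X))))"

lemma contr_folding:
  assumes "finite A" "B \<subseteq> contr A R c x1 x2" "x1 \<in> R" "x2 \<in> R" "finite R"
  shows "folding A R (cmap R c x1 x2) {x1, x2} B (dig x1 x2)"
proof
  show "B \<subseteq> map_prod (cmap R c x1 x2) (cmap R c x1 x2) ` (A - ind A R) \<union> dig x1 x2"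
  proof
    fix e assume e: "e \<in> B"
    obtain u v where uv: "e = (u, v)" by (cases e)
    then have "(u, v) \<in> contr A R c x1 x2" using e assms(2) by blast
    then show "e \<in> map_prod (cmap R c x1 x2) (cmap R c x1 x2) ` (A - ind A R) \<union> dig x1 x2"
    proof (cases rule: contr_cases)
      case (arc a b)
      show ?thesis
      proof (cases "a \<in> R \<and> b \<in> R")
        case True
        then show ?thesis using arc uv unfolding cmap_def by (auto split: if_splits)
      next
        case False
        then have "(a, b) \<in> A - ind A R" "e = map_prod (cmap R c x1 x2) (cmap R c x1 x2) (a, b)"
          using arc uv by auto
        then show ?thesis by blast
      qed
    qed (use uv in auto)
  qed
qed (use assms in \<open>auto simp: cmap_def\<close>)

lemma contr_pot:
  assumes "finite A" "B \<subseteq> contr A R c x1 x2" "x1 \<in> R" "x2 \<in> R" "finite R"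
  shows "pot A (R \<union> (Field B - {x1, x2}))
      + 3 * int (card (ind A (R \<union> (Field B - {x1, x2})) - ind A R))
    \<le> pot A R + gain B {x1, x2} + 3 * int (card (B - ind B {x1, x2}))"
proof -
  interpret folding A R "cmap R c x1 x2" "{x1, x2}" B "dig x1 x2" by (rule contr_folding[OF assms])
  have 1: "cmap R c x1 x2 v = v" if "cmap R c x1 x2 v \<notin> {x1, x2}" for v
    using that unfolding cmap_def by (auto split: if_splits)
  have 2: "u \<in> {x1, x2} \<or> v \<in> {x1, x2}" if "(u, v) \<in> dig x1 x2" for u v using that by auto
  from fold_pot[OF order_refl 1 2] show ?thesis unfolding gain_def by simp
qed

text \<open>
  If the contraction meets X in one vertex, this costs 7 and at most one matching edge. If it
  meets X in two vertices, this costs 14 and at most two edges, but at most two arcs are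
  regained. In cycles and wheels, which have a larger potential, maximum matchings can be chosen
  so that fewer edges are lost.
\<close>

lemma gain_bound:
  assumes "cyc B \<or> wheel B \<or> rho B \<le> -2" "crit B" "x1 \<noteq> x2" "{x1, x2} \<inter> Field B \<noteq> {}"
  shows "gain B {x1, x2} \<le> -5 \<and> (gain B {x1, x2} \<ge> -5 \<longrightarrow> cyc B \<and> (x1, x2) \<in> B \<and> (x2, x1) \<in> B)"
proof -
  let ?X = "{x1, x2}"
  have finB: "finite B" and irr: "irrefl B" using assms(2) unfolding crit_def by auto
  have sub: "ind B ?X \<subseteq> dig x1 x2" using irr unfolding irrefl_def by auto
  have "ind B (- (?X \<inter> Field B)) = ind B (- ?X)" unfolding ind_def Field_def by auto
  then have loss: "pm B \<le> pm (ind B (- ?X)) + card (?X \<inter> Field B)"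
    using pm_del[OF finB, of "?X \<inter> Field B"] by simp
  consider (both) "?X \<subseteq> Field B" "card (?X \<inter> Field B) = 2" "dig x1 x2 \<subseteq> B" "card (ind B ?X) = 2"
    | (two) "card (?X \<inter> Field B) = 2" "card (ind B ?X) \<le> 1"
    | (one) v where "?X \<inter> Field B = {v}" "card (ind B ?X) = 0" "ind B (- ?X) = ind B (- {v})"
  proof (cases "?X \<subseteq> Field B")
    case True
    then have X: "card (?X \<inter> Field B) = 2" using assms(3) by (simp add: Int_absorb2)
    show ?thesis
    proof (cases "dig x1 x2 \<subseteq> B")
      case d: True
      then have "ind B ?X = dig x1 x2" using sub by auto
      then show ?thesis using both True X d assms(3) by simp
    next
      case False
      then have "ind B ?X \<subset> dig x1 x2" using sub ind_subset[of B ?X] by blast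
      then have "card (ind B ?X) < card (dig x1 x2)" by (intro psubset_card_mono) auto
      then show ?thesis using two X assms(3) by simp
    qed
  next
    case False
    then obtain v where v: "?X \<inter> Field B = {v}" using assms(4) by (cases "x1 \<in> Field B") auto
    have "ind B ?X = {}"
    proof -
      have "Field (ind B ?X) \<subseteq> {v}" using Field_ind[of B ?X] v by blast
      then have "\<And>a b. (a, b) \<in> ind B ?X \<Longrightarrow> a = v \<and> b = v" unfolding Field_def by blast
      then show ?thesis using irr unfolding irrefl_def by fastforce
    qed
    moreover have "ind B (- ?X) = ind B (- {v})"
      using \<open>ind B (- (?X \<inter> Field B)) = ind B (- ?X)\<close> v by simp
    ultimately show ?thesis using one v by simp
  qed
  then show ?thesis
  proof cases
    case both
    from assms(1) show ?thesis
    proof (elim disjE)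
      assume "cyc B"
      then have "pm B \<le> pm (ind B (- {x1}))" "rho B = 1" using cyc_pm_del[of B x1] cyc_basic[of B] by auto
      moreover have "pm (ind B (- {x1})) \<le> pm (ind (ind B (- {x1})) (- {x2})) + 1"
        by (rule pm_del1) (use finB in simp)
      moreover have "ind (ind B (- {x1})) (- {x2}) = ind B (- ?X)" unfolding ind_def by auto
      ultimately show ?thesis unfolding gain_def using both \<open>cyc B\<close> by auto
    next
      assume "wheel B"
      then have "rho B = -1" using wheel_basic by blast
      show ?thesis
      proof -
        obtain E where E: "even_side B E" using \<open>wheel B\<close> wheel_basic by blast
        have "(x1 \<in> E) \<noteq> (x2 \<in> E)" by (rule even_sideD(2)[OF E]) (use both in auto)
        then obtain v w where vw: "v \<notin> E" "?X = {v, w}" "v \<in> Field B" using both by blast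
        have "pm B \<le> card E" by (rule pm_even_side[OF E finB])
        also have "card E \<le> pm (ind B (- {v}))" using even_sideD(3)[OF E vw(3,1)] by simp
        also have "\<dots> \<le> pm (ind (ind B (- {v})) (- {w})) + 1" by (rule pm_del1) (use finB in simp)
        also have "ind (ind B (- {v})) (- {w}) = ind B (- ?X)" unfolding vw(2) ind_def by auto
        finally have "pm B \<le> pm (ind B (- ?X)) + 1" .
        then show "?thesis" unfolding gain_def using both \<open>rho B = -1\<close> by auto
      qed
    qed (use both loss in \<open>auto simp: gain_def\<close>)
  next
    case two
    from assms(1) show ?thesis
    proof (elim disjE)
      assume "cyc B"
      then have "rho B = 1" using cyc_basic by blast
      then show ?thesis unfolding gain_def using two loss by auto
    next
      assume "wheel B"
      then have "rho B = -1" using wheel_basic by blast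
      then show ?thesis unfolding gain_def using two loss by auto
    qed (use two loss in \<open>auto simp: gain_def\<close>)
  next
    case (one v)
    from assms(1) show ?thesis
    proof (elim disjE)
      assume "cyc B"
      then have "rho B = 1" "pm B \<le> pm (ind B (- {v}))" using cyc_basic[of B] cyc_pm_del[of B v] by auto
      then show ?thesis unfolding gain_def using one by auto
    next
      assume "wheel B"
      then have "rho B = -1" using wheel_basic by blast
      then show ?thesis unfolding gain_def using one loss by auto
    qed (use one loss in \<open>auto simp: gain_def\<close>)
  qed
qed

section \<open>Adding vertices to a critical set\<close>

text \<open>
  B may contain arcs outside A; each of them costs 3 when it is given up, and every arc of A
  that is gained, collected in E0, pays 3.
\<close>

lemma add_pot:
  assumes "finite A" "finite B" "finite K" "K \<inter> Field B = {}"
    and "E0 \<subseteq> ind A (Field B \<union> K)" "E0 \<inter> B = {}"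
  shows "pot A (Field B \<union> K) \<le> rho B + 7 * int (card K) + 3 * int (card (B - A)) - 3 * int (card E0)
      + 2 * (int (pm B) - int (pm (ind A (Field B \<union> K))))"
proof -
  have c1: "card (Field B \<union> K) = card (Field B) + card K"
    using assms by (simp add: card_Un_disjoint finite_Field Int_commute)
  have c2: "card B = card (B \<inter> A) + card (B - A)"
    using assms(2) by (metis Int_Diff_disjoint Un_Diff_Int Un_commute card_Un_disjoint finite_Diff finite_Int Int_commute)
  have "(B \<inter> A) \<union> E0 \<subseteq> ind A (Field B \<union> K)" using assms(5) unfolding ind_def Field_def by auto
  then have "card ((B \<inter> A) \<union> E0) \<le> card (ind A (Field B \<union> K))" using assms(1) by (intro card_mono) auto
  moreover have "card ((B \<inter> A) \<union> E0) = card (B \<inter> A) + card E0"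
    using assms finite_subset[OF assms(5)] by (intro card_Un_disjoint) auto
  ultimately show ?thesis unfolding pot_def rho_def c1 using c2 by simp
qed

lemma pot_add:
  assumes "finite A" "finite S" "finite K" "K \<inter> S = {}"
    and "E0 \<subseteq> ind A (S \<union> K)" "E0 \<inter> ind A S = {}" "pm (ind A S) + m \<le> pm (ind A (S \<union> K))"
  shows "pot A (S \<union> K) \<le> pot A S + 7 * int (card K) - 3 * int (card E0) - 2 * int m"
proof -
  have c1: "card (S \<union> K) = card S + card K"
    using assms by (simp add: card_Un_disjoint Int_commute)
  have "ind A S \<union> E0 \<subseteq> ind A (S \<union> K)" using assms(5) ind_mono[of A A S "S \<union> K"] by auto
  then have "card (ind A S \<union> E0) \<le> card (ind A (S \<union> K))" using assms(1) by (intro card_mono) auto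
  moreover have "card (ind A S \<union> E0) = card (ind A S) + card E0"
    using assms finite_subset[OF assms(5)] by (intro card_Un_disjoint) auto
  ultimately show ?thesis unfolding pot_def c1 using assms(7) by simp
qed

lemma pm_ind_mono: "finite A \<Longrightarrow> S \<subseteq> T \<Longrightarrow> pm (ind A S) \<le> pm (ind A T)"
  by (intro pm_mono ind_mono) auto

lemma pm_del_dig:
  assumes "finite B"
  shows "pm B \<le> pm (B - dig a b) + 1"
proof -
  have "ind B (- {a, b}) \<subseteq> B - dig a b" by auto
  then have "pm (ind B (- {a, b})) \<le> pm (B - dig a b)" using assms by (intro pm_mono) auto
  then show ?thesis using pm_rec_digon[OF assms, of a b] by auto
qed

text \<open>
  A digon of a cycle or wheel has an end that is missed by some maximum matching.
\<close>

lemma pm_del_dig_exceptional: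
  assumes "cyc B \<or> wheel B"
  shows "pm B \<le> pm (B - dig a b)"
proof (cases "(a, b) \<in> B \<and> (b, a) \<in> B")
  case False
  have "finite B" using assms cyc_basic wheel_basic by blast
  then show ?thesis using pm_rec_digon[of B a b] False by auto
next
  case True
  have finB: "finite B" using assms cyc_basic wheel_basic by blast
  have le: "pm (ind B (- {v})) \<le> pm (B - dig a b)" if "v \<in> {a, b}" for v
    using that finB by (intro pm_mono) auto
  from assms show ?thesis
  proof
    assume "cyc B"
    then have "pm B \<le> pm (ind B (- {a}))" by (rule cyc_pm_del)
    then show ?thesis using le[of a] by simp
  next
    assume "wheel B"
    then obtain E where E: "even_side B E" using wheel_basic by blast
    have "(a \<in> E) \<noteq> (b \<in> E)" using even_sideD(2)[OF E] True by blast
    moreover have "a \<in> Field B" "b \<in> Field B" using True unfolding Field_def by auto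
    ultimately obtain v where v: "v \<in> {a, b}" "v \<notin> E" "v \<in> Field B" by blast
    have "pm B \<le> card E" by (rule pm_even_side[OF E finB])
    also have "card E \<le> pm (ind B (- {v}))" using even_sideD(3)[OF E v(3,2)] by simp
    finally show ?thesis using le[OF v(1)] by simp
  qed
qed

text \<open>
  If no arc is lost in the folding, the arcs at a vertex that is left alone correspond to those
  in the folded digraph.
\<close>

lemma fold_nbrs:
  assumes im: "map_prod f f ` (A - ind A R) = B - ind B X" and inj: "inj_on (map_prod f f) (A - ind A R)"
    and w: "w \<notin> R" "w \<notin> X" "f w = w" "\<And>a. f a = w \<Longrightarrow> a = w"
  shows "f ` (A `` {w}) = B `` {w}" "inj_on f (A `` {w})"
    "f ` (A\<inverse> `` {w}) = B\<inverse> `` {w}" "inj_on f (A\<inverse> `` {w})"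
proof -
  have 1: "(f a, f b) \<in> B" if "(a, b) \<in> A" "a = w \<or> b = w" for a b
  proof -
    have "(a, b) \<in> A - ind A R" using that w(1) by auto
    then have "map_prod f f (a, b) \<in> B - ind B X" using im by blast
    then show ?thesis by simp
  qed
  have 2: "\<exists>a b. (a, b) \<in> A \<and> u = f a \<and> v = f b" if "(u, v) \<in> B" "u = w \<or> v = w" for u v
  proof -
    have "(u, v) \<in> B - ind B X" using that w(2) by auto
    then have "(u, v) \<in> map_prod f f ` (A - ind A R)" using im by blast
    then show ?thesis by auto
  qed
  have 3: "a = a' \<and> b = b'" if "(a, b) \<in> A" "(a', b') \<in> A" "a = w \<or> b = w" "a' = w \<or> b' = w" "f a = f a'" "f b = f b'" for a b a' b'
  proof -
    have "(a, b) \<in> A - ind A R" "(a', b') \<in> A - ind A R" using that w(1) by auto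
    then have "(a, b) = (a', b')" using inj_onD[OF inj, of "(a, b)" "(a', b')"] that by auto
    then show ?thesis by simp
  qed
  show "f ` (A `` {w}) = B `` {w}"
  proof (intro set_eqI iffI)
    fix v assume "v \<in> f ` (A `` {w})"
    then obtain b where "(w, b) \<in> A" "v = f b" by auto
    then show "v \<in> B `` {w}" using 1[of w b] w(3) by simp
  next
    fix v assume "v \<in> B `` {w}"
    then obtain a b where "(a, b) \<in> A" "w = f a" "v = f b" using 2[of w v] by auto
    then show "v \<in> f ` (A `` {w})" using w(4)[of a] by auto
  qed
  show "f ` (A\<inverse> `` {w}) = B\<inverse> `` {w}"
  proof (intro set_eqI iffI)
    fix v assume "v \<in> f ` (A\<inverse> `` {w})"
    then obtain b where "(b, w) \<in> A" "v = f b" by auto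
    then show "v \<in> B\<inverse> `` {w}" using 1[of b w] w(3) by simp
  next
    fix v assume "v \<in> B\<inverse> `` {w}"
    then obtain a b where "(a, b) \<in> A" "v = f a" "w = f b" using 2[of v w] by auto
    then show "v \<in> f ` (A\<inverse> `` {w})" using w(4)[of b] by auto
  qed
  show "inj_on f (A `` {w})" "inj_on f (A\<inverse> `` {w})"
    by (rule inj_onI; use 3 in auto)+
qed

section \<open>Minimal counterexamples\<close>

locale minimal_counterexample =
  fixes A :: "'a rel"
  assumes crit: "crit A" and not_cyc: "\<not> cyc A" and not_wheel: "\<not> wheel A" and rho: "rho A \<ge> -1"
    and IH: "\<And>B :: 'a rel. crit B \<Longrightarrow> card (Field B) < card (Field A) \<Longrightarrow> cyc B \<or> wheel B \<or> rho B \<le> -2"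
begin

abbreviation V :: "'a set" where "V \<equiv> Field A"

lemma fin: "finite A" and irr: "irrefl A" and ncol: "\<not> colourable A"
  using crit unfolding crit_def by auto

lemma finV: "finite V" using fin by (rule finite_Field)

lemma noloop: "(a, a) \<notin> A" using irr unfolding irrefl_def by auto

lemma arcV: "(a, b) \<in> A \<Longrightarrow> a \<in> V \<and> b \<in> V" unfolding Field_def by auto

lemma sub_all: "B \<subseteq> A \<Longrightarrow> \<not> colourable B \<Longrightarrow> B = A"
  using crit_subset_eq[OF crit] by blast

lemma critD: "crit B \<Longrightarrow> finite B \<and> irrefl B \<and> \<not> colourable B" for B :: "'a rel" unfolding crit_def by auto

lemma minimal_counterexample_converse: "minimal_counterexample (A\<inverse>)"
proof
  show "crit (A\<inverse>)" "\<not> cyc (A\<inverse>)" "\<not> wheel (A\<inverse>)" "-1 \<le> rho (A\<inverse>)"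
    using crit not_cyc not_wheel rho by auto
  show "cyc B \<or> wheel B \<or> rho B \<le> -2" if "crit B" "card (Field B) < card (Field (A\<inverse>))" for B :: "'a rel"
    using IH that by simp
qed

lemma ind_colourable:
  assumes "card R < card V" "R \<subseteq> V"
  obtains c where "proper_col c (ind A R)"
proof -
  have "colourable (ind A R)"
  proof (rule ccontr)
    assume "\<not> colourable (ind A R)"
    then have "ind A R = A" by (rule sub_all[OF ind_subset])
    then have "V \<subseteq> R" using Field_ind[of A R] by simp
    then show False using assms by auto
  qed
  then show ?thesis using that unfolding colourable_def by blast
qed

text \<open>
  Contracting a coloured set and choosing a critical part of the result gives a digraph with
  fewer vertices. By induction its potential is small, so expanding it again yields a set of
  vertices whose potential is smaller than that of R by at least five.
\<close>

lemma contract_core: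
  assumes "R \<subseteq> V" "3 \<le> card R" "card R < card V" "x1 \<in> R" "x2 \<in> R" "x1 \<noteq> x2"
    and "A0 \<subseteq> A" "\<not> colourable (contr A0 R c x1 x2)"
  obtains B where "crit B" "B \<subseteq> contr A0 R c x1 x2" "Field B - {x1, x2} \<noteq> {}"
    "Field B - {x1, x2} \<subseteq> V - R"
    "pot A (R \<union> (Field B - {x1, x2}))
      + 3 * int (card (ind A (R \<union> (Field B - {x1, x2})) - ind A R))
      \<le> pot A R + gain B {x1, x2} + 3 * int (card (B - ind B {x1, x2}))"
    "gain B {x1, x2} \<le> -5"
    "gain B {x1, x2} \<ge> -5 \<longrightarrow> cyc B \<and> (x1, x2) \<in> B \<and> (x2, x1) \<in> B"
proof -
  let ?X = "{x1, x2}"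
  have "finite A0" using assms(7) fin finite_subset by blast
  obtain B where B0: "B \<subseteq> contr A0 R c x1 x2" "crit B"
    using exists_crit[OF contr_finite[OF \<open>finite A0\<close>] contr_irrefl[OF assms(6)] assms(8)] by blast
  have "contr A0 R c x1 x2 \<subseteq> contr A R c x1 x2" using assms(7) unfolding contr_def by blast
  then have B: "B \<subseteq> contr A R c x1 x2" "crit B" using B0 by auto
  have sub: "Field B - ?X \<subseteq> V - R" by (rule contr_Field[OF B(1) assms(4,5)])
  have finR: "finite R" using assms(1) finV finite_subset by blast
  have "card (Field B) \<le> card (?X \<union> (V - R))"
    by (rule card_mono) (use sub finV in auto)
  also have "\<dots> \<le> 2 + (card V - card R)"
  proof -
    have "card ?X \<le> 2" by (simp add: assms(6))
    moreover have "card (V - R) = card V - card R" using assms(1) finR by (rule card_Diff_subset[rotated])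
    ultimately show ?thesis using card_Un_le[of ?X "V - R"] by linarith
  qed
  finally have small: "card (Field B) < card V" using assms(2,3) by linarith
  have W: "Field B - ?X \<noteq> {}"
  proof
    assume "Field B - ?X = {}"
    then have F: "a \<in> ?X \<and> b \<in> ?X" if "(a, b) \<in> B" for a b using that unfolding Field_def by blast
    have "proper_col (\<lambda>v. v = x1) B"
    proof -
      have "mono_arcs (\<lambda>v. v = x1) B = {}" using F critD[OF B(2)] assms(6) unfolding irrefl_def by fastforce
      then show ?thesis unfolding proper_col_def by (simp add: wf_acyclic)
    qed
    then show False using critD[OF B(2)] unfolding colourable_def by blast
  qed
  have touch: "?X \<inter> Field B \<noteq> {}"
  proof
    assume no: "?X \<inter> Field B = {}"
    have "B \<subseteq> A"
    proof
      fix e assume e: "e \<in> B"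
      obtain u v where uv: "e = (u, v)" by (cases e)
      have "u \<notin> ?X" "v \<notin> ?X" using no e uv unfolding Field_def by blast+
      have "(u, v) \<in> contr A R c x1 x2" using e uv B by blast
      then show "e \<in> A"
        using \<open>u \<notin> ?X\<close> \<open>v \<notin> ?X\<close>
      proof (cases rule: contr_cases)
        case (arc a b)
        then have "a = u" "b = v" using \<open>u \<notin> ?X\<close> \<open>v \<notin> ?X\<close> unfolding cmap_def by (auto split: if_splits)
        then show ?thesis using arc uv by simp
      qed auto
    qed
    then have "B = A" using sub_all critD[OF B(2)] by blast
    then show False using small by simp
  qed
  note g = gain_bound[OF IH[OF B(2) small] B(2) assms(6) touch]
  show ?thesis
    by (rule that[OF B0(2,1) W sub contr_pot[OF fin B(1) assms(4,5) finR]]) (use g in auto)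
qed

lemma contract_step:
  assumes "R \<subseteq> V" "3 \<le> card R" "card R < card V" "x1 \<in> R" "x2 \<in> R" "x1 \<noteq> x2" "proper_col c (ind A R)"
  obtains B where "crit B" "B \<subseteq> contr A R c x1 x2" "Field B - {x1, x2} \<noteq> {}"
    "Field B - {x1, x2} \<subseteq> V - R"
    "pot A (R \<union> (Field B - {x1, x2}))
      + 3 * int (card (ind A (R \<union> (Field B - {x1, x2})) - ind A R))
      \<le> pot A R + gain B {x1, x2} + 3 * int (card (B - ind B {x1, x2}))"
    "gain B {x1, x2} \<le> -5"
    "gain B {x1, x2} \<ge> -5 \<longrightarrow> cyc B \<and> (x1, x2) \<in> B \<and> (x2, x1) \<in> B"
  using contract_core[OF assms(1-6) order_refl contr_not_colourable[OF ncol irr assms(7,4,5)]] that by blast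

lemma two_elements:
  assumes "2 \<le> card R"
  obtains x1 x2 where "x1 \<in> R" "x2 \<in> R" "x1 \<noteq> x2"
proof -
  have "finite R" using assms by (metis card.infinite not_numeral_le_zero)
  then have "\<not> (\<forall>a\<in>R. \<forall>b\<in>R. a = b)" using card_le_Suc0_iff_eq[of R] assms by auto
  then show ?thesis using that by blast
qed

lemma pot_pair: "x1 \<noteq> x2 \<Longrightarrow> 6 \<le> pot A {x1, x2}"
proof -
  assume ne: "x1 \<noteq> x2"
  have sub: "ind A {x1, x2} \<subseteq> dig x1 x2" using noloop by auto
  then have "card (ind A {x1, x2}) \<le> card (dig x1 x2)" by (intro card_mono) auto
  then have "card (ind A {x1, x2}) \<le> 2" using ne by simp
  moreover have "pm (ind A {x1, x2}) \<le> card {x1}" by (rule pm_cover) (use sub fin noloop in auto)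
  ultimately show ?thesis unfolding pot_def using ne by simp
qed

text \<open>
  Contracting a set of potential at most 3 produces a larger set of potential at most -2. This
  is impossible for the whole digraph by assumption, and for smaller sets by induction on the
  number of vertices outside.
\<close>

lemma pot_ge4: "R \<subseteq> V \<Longrightarrow> 2 \<le> card R \<Longrightarrow> card R < card V \<Longrightarrow> 4 \<le> pot A R"
proof (induction "card V - card R" arbitrary: R rule: less_induct)
  case less
  show ?case
  proof (rule ccontr)
    assume "\<not> 4 \<le> pot A R"
    then have p: "pot A R \<le> 3" by simp
    obtain x1 x2 where x: "x1 \<in> R" "x2 \<in> R" "x1 \<noteq> x2" using two_elements less.prems(2) by metis
    have finR: "finite R" using less.prems(1) finV finite_subset by blast
    have "3 \<le> card R"
    proof (rule ccontr)
      assume "\<not> 3 \<le> card R"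
      then have "card R = card {x1, x2}" using less.prems(2) x by simp
      then have "{x1, x2} = R" using card_subset_eq[OF finR, of "{x1, x2}"] x by simp
      then show False using pot_pair[OF x(3)] p by simp
    qed
    obtain c where c: "proper_col c (ind A R)" using ind_colourable less.prems by metis
    obtain B where B: "Field B - {x1, x2} \<noteq> {}" "Field B - {x1, x2} \<subseteq> V - R"
      "pot A (R \<union> (Field B - {x1, x2}))
      + 3 * int (card (ind A (R \<union> (Field B - {x1, x2})) - ind A R))
      \<le> pot A R + gain B {x1, x2} + 3 * int (card (B - ind B {x1, x2}))" "gain B {x1, x2} \<le> -5" "B \<subseteq> contr A R c x1 x2"
      using contract_step[OF less.prems(1) \<open>3 \<le> card R\<close> less.prems(3) x c] by metis
    let ?T = "R \<union> (Field B - {x1, x2})"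
    have TV: "?T \<subseteq> V" using less.prems(1) B(2) by blast
    have "R \<subset> ?T" using B(1,2) by blast
    then have lt: "card R < card ?T" using TV finV finite_subset psubset_card_mono by metis
    have "card (B - ind B {x1, x2}) \<le> card (ind A ?T - ind A R)"
    proof -
      have "B - ind B {x1, x2} \<subseteq> map_prod (cmap R c x1 x2) (cmap R c x1 x2) ` (ind A ?T - ind A R)"
      proof
        fix e assume e: "e \<in> B - ind B {x1, x2}"
        obtain u v where uv: "e = (u, v)" by (cases e)
        show "e \<in> map_prod (cmap R c x1 x2) (cmap R c x1 x2) ` (ind A ?T - ind A R)"
          by (rule contr_lift[OF B(5) x(1,2), of u v]) (use e uv in \<open>force+\<close>)
      qed
      then show ?thesis using fin by (meson card_mono card_image_le finite_Diff finite_imageI finite_ind le_trans)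
    qed
    then have "int (card (B - ind B {x1, x2})) \<le> int (card (ind A ?T - ind A R))" by simp
    then have pT: "pot A ?T \<le> -2" using B(3,4) p by linarith
    show False
    proof (cases "?T = V")
      case True
      then show False using pT rho pot_Field[of A] by simp
    next
      case False
      then have "card ?T < card V" using TV finV psubset_card_mono by blast
      then have "4 \<le> pot A ?T" using less.hyps[of ?T] TV lt less.prems by simp
      then show False using pT by simp
    qed
  qed
qed

lemma pot_le3: "R \<subseteq> V \<Longrightarrow> 2 \<le> card R \<Longrightarrow> pot A R \<le> 3 \<Longrightarrow> R = V"
  using pot_ge4[of R] finV psubset_card_mono[of V R] by fastforce

lemma pot_neg: "R \<subseteq> V \<Longrightarrow> 2 \<le> card R \<Longrightarrow> pot A R \<le> -2 \<Longrightarrow> False"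
  using pot_le3[of R] rho pot_Field[of A] by simp

text \<open>
  Equality holds throughout the estimate for the contraction if the potential of R is 4: the
  contraction is a bidirected odd cycle, and it contains every arc outside R exactly once.
\<close>

lemma contract_full:
  assumes "R \<subseteq> V" "3 \<le> card R" "card R < card V" "x1 \<in> R" "x2 \<in> R" "x1 \<noteq> x2" "proper_col c (ind A R)"
    and "pot A R \<le> 4"
  obtains B where "cyc B" "(x1, x2) \<in> B" "Field B = V - R \<union> {x1, x2}"
    "map_prod (cmap R c x1 x2) (cmap R c x1 x2) ` (A - ind A R) = B - ind B {x1, x2}"
    "inj_on (map_prod (cmap R c x1 x2) (cmap R c x1 x2)) (A - ind A R)"
proof -
  let ?X = "{x1, x2}" and ?f = "map_prod (cmap R c x1 x2) (cmap R c x1 x2)"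
  obtain B where B: "crit B" "B \<subseteq> contr A R c x1 x2" "Field B - ?X \<noteq> {}"
    "Field B - ?X \<subseteq> V - R"
    "pot A (R \<union> (Field B - ?X))
      + 3 * int (card (ind A (R \<union> (Field B - ?X)) - ind A R))
      \<le> pot A R + gain B ?X + 3 * int (card (B - ind B ?X))"
    "gain B ?X \<le> -5"
    "gain B ?X \<ge> -5 \<longrightarrow> cyc B \<and> (x1, x2) \<in> B \<and> (x2, x1) \<in> B"
    using contract_step[OF assms(1-7)] by metis
  let ?T = "R \<union> (Field B - ?X)"
  have sub: "B - ind B ?X \<subseteq> ?f ` (ind A ?T - ind A R)"
  proof
    fix e assume e: "e \<in> B - ind B ?X"
    obtain u v where uv: "e = (u, v)" by (cases e)
    show "e \<in> ?f ` (ind A ?T - ind A R)"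
      by (rule contr_lift[OF B(2) assms(4,5), of u v]) (use e uv in \<open>force+\<close>)
  qed
  have fQ: "finite (ind A ?T - ind A R)" using fin by simp
  have le: "card (B - ind B ?X) \<le> card (ind A ?T - ind A R)"
    using sub fQ by (meson card_mono card_image_le finite_imageI le_trans)
  have TV: "?T \<subseteq> V" using assms(1) B(4) by blast
  have RT: "card R \<le> card ?T" using TV finV finite_subset by (intro card_mono) blast+
  have le': "int (card (B - ind B ?X)) \<le> int (card (ind A ?T - ind A R))" using le by simp
  then have "pot A ?T \<le> -1" using B(5,6) assms(8) by linarith
  then have T: "?T = V" using pot_le3[OF TV] RT assms(2) by simp
  then have p: "pot A ?T \<ge> -1" using rho pot_Field[of A] by simp
  have "gain B ?X \<ge> -5" using p B(5) le' assms(8) by linarith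
  then have 1: "cyc B" "(x1, x2) \<in> B" using B(7) by auto
  have eq: "card (B - ind B ?X) = card (ind A ?T - ind A R)" using p B(5,6) le' assms(8) by linarith
  have Q: "ind A ?T - ind A R = A - ind A R" unfolding T by (simp add: ind_Field)
  have ci: "card (?f ` (A - ind A R)) \<le> card (A - ind A R)" using fin by (simp add: card_image_le)
  have sub': "B - ind B ?X \<subseteq> ?f ` (A - ind A R)" using sub unfolding Q .
  have eq': "card (B - ind B ?X) = card (A - ind A R)" using eq unfolding Q .
  have fi: "finite (?f ` (A - ind A R))" using fin by simp
  have "B - ind B ?X = ?f ` (A - ind A R)"
    by (rule card_seteq[OF fi sub']) (use ci eq' in simp)
  moreover from this have "inj_on ?f (A - ind A R)"
    using eq' fin by (intro eq_card_imp_inj_on) auto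
  moreover have "Field B = V - R \<union> ?X"
  proof -
    have "x1 \<in> Field B" "x2 \<in> Field B" using 1(2) unfolding Field_def by auto
    moreover have "Field B - ?X = V - R" using T B(4) assms(1) by blast
    ultimately show ?thesis by blast
  qed
  ultimately show ?thesis using that 1 by blast
qed

lemma contract_nbrs:
  assumes "x1 \<in> R" "x2 \<in> R"
    and im: "map_prod (cmap R c x1 x2) (cmap R c x1 x2) ` (A - ind A R) = B - ind B {x1, x2}"
    and inj: "inj_on (map_prod (cmap R c x1 x2) (cmap R c x1 x2)) (A - ind A R)"
    and "w \<notin> R"
  shows "cmap R c x1 x2 ` (A `` {w}) = B `` {w}" "inj_on (cmap R c x1 x2) (A `` {w})"
    "cmap R c x1 x2 ` (A\<inverse> `` {w}) = B\<inverse> `` {w}" "inj_on (cmap R c x1 x2) (A\<inverse> `` {w})"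
proof -
  have w: "w \<notin> {x1, x2}" "cmap R c x1 x2 w = w" using assms unfolding cmap_def by auto
  have "a = w" if "cmap R c x1 x2 a = w" for a
    using that assms(1,2,5) unfolding cmap_def by (auto split: if_splits)
  note nb = fold_nbrs[OF im inj assms(5) w this]
  show "cmap R c x1 x2 ` (A `` {w}) = B `` {w}" by (rule nb(1))
  show "inj_on (cmap R c x1 x2) (A `` {w})" by (rule nb(2))
  show "cmap R c x1 x2 ` (A\<inverse> `` {w}) = B\<inverse> `` {w}" by (rule nb(3))
  show "inj_on (cmap R c x1 x2) (A\<inverse> `` {w})" by (rule nb(4))
qed

lemma image_pair:
  assumes "f ` S = {u, v}" "inj_on f S" "u \<noteq> v"
  obtains a b where "S = {a, b}" "f a = u" "f b = v" "a \<noteq> b"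
proof -
  have "u \<in> f ` S" "v \<in> f ` S" using assms(1) by auto
  then obtain a b where ab: "a \<in> S" "f a = u" "b \<in> S" "f b = v" by auto
  have "s = a \<or> s = b" if "s \<in> S" for s
  proof -
    have "f s = u \<or> f s = v" using that assms(1) by blast
    then show ?thesis using inj_onD[OF assms(2)] ab that by metis
  qed
  then have "S = {a, b}" using ab by blast
  then show ?thesis using that ab assms(3) by metis
qed

end

section \<open>Vertices of degree four\<close>

lemma acyclic_empty: "acyclic {}"
  by (simp add: wf_acyclic)

lemma exceptional_miss:
  assumes "cyc B \<or> wheel B" "(u, v) \<in> B" "(v, u) \<in> B"
  shows "\<exists>t\<in>{u, v}. pm B \<le> pm (ind B (- {t}))"
  using assms(1)
proof
  assume "cyc B"
  then show ?thesis using cyc_pm_del[of B u] by blast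
next
  assume "wheel B"
  then obtain E where E: "even_side B E" and finB: "finite B" using wheel_basic by blast
  have "(u \<in> E) \<noteq> (v \<in> E)" by (rule even_sideD(2)[OF E assms(2,3)])
  moreover have "u \<in> Field B" "v \<in> Field B" using assms unfolding Field_def by auto
  ultimately obtain t where t: "t \<in> {u, v}" "t \<notin> E" "t \<in> Field B" by blast
  have "pm B \<le> card E" by (rule pm_even_side[OF E finB])
  also have "card E \<le> pm (ind B (- {t}))" using even_sideD(3)[OF E t(3,2)] by simp
  finally show ?thesis using t(1) by blast
qed

lemma cyc_card3: "cyc B \<Longrightarrow> 3 \<le> card (Field B)"
proof -
  assume "cyc B"
  then obtain vs where vs: "cyc_list vs B" using cyc_imp_list by blast
  then have "Field (pd vs) = set vs" "distinct vs" "3 \<le> length vs" "pd vs \<subseteq> B"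
    using Field_pd[of vs] unfolding cyc_list_def by auto
  moreover have "Field (pd vs) \<subseteq> Field B" using mono_Field calculation(4) by blast
  moreover have "finite (Field B)" using \<open>cyc B\<close> cyc_basic finite_Field by blast
  ultimately show ?thesis using card_mono[of "Field B" "set vs"] by (simp add: distinct_card)
qed

lemma cyc_list_nbrs:
  assumes "cyc_list (a # b # d # r) B" "r \<noteq> []"
  shows "B `` {b} = {a, d}"
proof -
  have B: "B = pd (a # b # d # r) \<union> dig (last r) a" and d: "distinct (a # b # d # r)"
    using assms unfolding cyc_list_def by auto
  have "b \<noteq> last r" using d assms(2) last_in_set[of r] by auto
  moreover have "(b, v) \<notin> pd (d # r)" for v using pd_set[of b v "d # r"] d by auto
  ultimately show ?thesis unfolding B using d by auto
qed

lemma alternating_colouring: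
  assumes "distinct vs"
  obtains c where "\<And>i. i < length vs \<Longrightarrow> c (vs ! i) = even i" "\<And>u v. (u, v) \<in> pd vs \<Longrightarrow> c u \<noteq> c v"
proof -
  define c where "c v = (\<exists>i<length vs. even i \<and> vs ! i = v)" for v
  have c: "c (vs ! i) = even i" if "i < length vs" for i
    using that assms unfolding c_def by (auto simp: nth_eq_iff_index_eq)
  have "c u \<noteq> c v" if "(u, v) \<in> pd vs" for u v
    using that
  proof (cases rule: pd_splitE)
    case (1 xs ys)
    then have "u = vs ! length xs" "v = vs ! Suc (length xs)" "Suc (length xs) < length vs"
      by (auto simp: nth_append)
    then show ?thesis using c[of "length xs"] c[of "Suc (length xs)"] by auto
  next
    case (2 xs ys)
    then have "v = vs ! length xs" "u = vs ! Suc (length xs)" "Suc (length xs) < length vs"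
      by (auto simp: nth_append)
    then show ?thesis using c[of "length xs"] c[of "Suc (length xs)"] by auto
  qed
  then show ?thesis using that c by blast
qed

text \<open>
  A vertex of degree four on two digons is of type 2, and one on a single digon is of type 1. In
  the case of equality in the contraction estimates, the vertices outside the contracted set
  have degree four.
\<close>

definition type2 :: "'a rel \<Rightarrow> 'a \<Rightarrow> 'a \<Rightarrow> 'a \<Rightarrow> bool" where
  "type2 A p a b \<longleftrightarrow> A `` {p} = {a, b} \<and> A\<inverse> `` {p} = {a, b} \<and> a \<noteq> b"

definition type1 :: "'a rel \<Rightarrow> 'a \<Rightarrow> 'a \<Rightarrow> 'a \<Rightarrow> 'a \<Rightarrow> bool" where
  "type1 A x y s w \<longleftrightarrow> A `` {x} = {y, w} \<and> A\<inverse> `` {x} = {s, w} \<and> y \<noteq> w \<and> s \<noteq> w \<and> s \<noteq> y"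

lemma type2D:
  assumes "type2 A p a b"
  shows "(p, v) \<in> A \<longleftrightarrow> v = a \<or> v = b" "(v, p) \<in> A \<longleftrightarrow> v = a \<or> v = b" "a \<noteq> b"
  using assms unfolding type2_def by auto

lemma type2_swap: "type2 A p a b \<Longrightarrow> type2 A p b a" unfolding type2_def by auto

context minimal_counterexample
begin

lemma no_triangle:
  assumes "distinct [p, q, a]" "dig p q \<subseteq> A" "dig q a \<subseteq> A" "dig p a \<subseteq> A"
  shows False
proof -
  have "dig p q \<union> dig q a \<union> dig p a = A"
    by (rule sub_all[OF _ triangle_not_colourable]) (use assms in blast)
  then have "triangle3 A" unfolding triangle3_def using assms(1) by metis
  then show False using not_cyc unfolding cyc_def by (simp add: subdivided.base)
qed

text \<open>
  Giving up one arc of B costs 3, and a matching edge is lost only if B is neither a cycle nor a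
  wheel. As a proper set has potential at least 4, B must be a cycle, and A has no further arcs
  on its vertices.
\<close>

lemma one_arc:
  assumes "crit B" "card (Field B) < card V" "Field B \<subseteq> V" "B - A \<subseteq> {(a, b)}"
  shows "cyc B \<and> pot A (Field B) = 4 \<and> ind A (Field B) = B - {(a, b)} \<and> (a, b) \<in> B \<and> (a, b) \<notin> A"
proof -
  have finB: "finite B" and irrB: "irrefl B" and ncB: "\<not> colourable B" using critD[OF assms(1)] by auto
  have "\<not> B \<subseteq> A" using sub_all ncB assms(2) by blast
  then have ab: "(a, b) \<in> B" "(a, b) \<notin> A" using assms(4) by auto
  then have N: "B - A = {(a, b)}" using assms(4) by auto
  have "a \<noteq> b" using ab irrB unfolding irrefl_def by auto
  moreover have "{a, b} \<subseteq> Field B" using ab unfolding Field_def by auto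
  ultimately have c2: "2 \<le> card (Field B)" using card_mono[of "Field B" "{a, b}"] finB finite_Field by fastforce
  have sub: "B - dig a b \<subseteq> ind A (Field B)" "B - {(a, b)} \<subseteq> ind A (Field B)"
    using N unfolding Field_def ind_def by auto
  have p4: "4 \<le> pot A (Field B)" by (rule pot_ge4[OF assms(3) c2 assms(2)])
  have ub: "pot A (Field B) \<le> rho B + 3 + 2 * (int (pm B) - int (pm (ind A (Field B))))"
    using add_pot[OF fin finB, of "{}" "{}"] N by simp
  have m: "pm (B - dig a b) \<le> pm (ind A (Field B))" by (rule pm_mono[OF _ sub(1)]) (use fin in simp)
  have cyc: "cyc B"
  proof (rule ccontr)
    assume "\<not> cyc B"
    then consider "wheel B" | "rho B \<le> -2" using IH[OF assms(1,2)] by blast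
    then show False
    proof cases
      case 1
      then have "rho B = -1" "pm B \<le> pm (B - dig a b)" using wheel_basic[of B] pm_del_dig_exceptional[of B] by auto
      then show False using ub m p4 by simp
    next
      case 2
      then show False using ub m p4 pm_del_dig[OF finB, of a b] by simp
    qed
  qed
  then have pmB: "rho B = 1" "pm B \<le> pm (ind A (Field B))"
    using cyc_basic[of B] pm_del_dig_exceptional[of B a b] m by auto
  then have eq4: "pot A (Field B) = 4" using ub p4 by simp
  have "card (B - {(a, b)}) + 1 = card B" using ab finB by (simp add: card_gt_0_iff card_Diff_singleton_if) (metis Suc_pred card_gt_0_iff empty_iff)
  then have "card (ind A (Field B)) \<le> card (B - {(a, b)})"
    using eq4 pmB unfolding pot_def rho_def by linarith
  then have "B - {(a, b)} = ind A (Field B)" by (intro card_seteq[OF _ sub(2)]) (use fin in auto)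
  then show ?thesis using cyc eq4 ab by simp
qed

text \<open>
  Two such vertices lie on a bidirected path a, p, q, b. If a and b are replaced by a digon, the
  result is not colourable. Its critical part either contains the digon, and then A is a
  subdivision of it, or at most one of its arcs, and then adding p and q gives a set of too
  small potential.
\<close>

lemma no_adjacent_type2:
  assumes p: "type2 A p q a" and q: "type2 A q p b"
  shows False
proof (cases "a = b")
  case True
  have "distinct [p, q, a]"
    using type2D(1)[OF p, of p] noloop[of p] type2D(1)[OF q, of q] noloop[of q] type2D(3)[OF p] True by auto
  then show False by (rule no_triangle) (use type2D[OF p] type2D[OF q] True in auto)
next
  case False
  note pD = type2D[OF p] and qD = type2D[OF q]
  have ne: "p \<noteq> q" "a \<noteq> p" "a \<noteq> q" "b \<noteq> p" "b \<noteq> q" using pD qD noloop by metis+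
  let ?A = "ind A (- {p, q}) \<union> dig a b"
  have "\<not> colourable ?A"
  proof
    assume "colourable ?A"
    then obtain c where c: "proper_col c ?A" unfolding colourable_def by blast
    have cab: "c a \<noteq> c b" using proper_col_digon[OF c, of a b] by auto
    let ?c = "c(p := \<not> c a, q := \<not> c b)"
    have "proper_col ?c (ind (ind A (- {p})) (- {q}))"
    proof -
      have "mono_arcs ?c (ind (ind A (- {p})) (- {q})) \<subseteq> mono_arcs c ?A" by auto
      then show ?thesis using c acyclic_subset unfolding proper_col_def by blast
    qed
    then have "proper_col ?c (ind A (- {p}))"
      by (rule proper_col_ignore) (use irrefl_ind irr qD ne in auto)
    then have "proper_col ?c A"
      by (rule proper_col_ignore) (use irr pD ne cab in auto)
    then show False using ncol unfolding colourable_def by blast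
  qed
  moreover have "finite ?A" "irrefl ?A" using fin False noloop unfolding irrefl_def by auto
  ultimately obtain B where B: "B \<subseteq> ?A" "crit B" using exists_crit[of ?A] by blast
  have abV: "a \<in> V" "b \<in> V" "p \<in> V" "q \<in> V" using pD qD arcV by metis+
  have FB: "Field B \<subseteq> V - {p, q}"
    using mono_Field[OF B(1)] Field_ind[of A "- {p, q}"] abV ne by (auto simp: Field_Un)
  have small: "card (Field B) < card V"
    by (rule psubset_card_mono[OF finV]) (use FB abV in blast)
  note trich = IH[OF B(2) small]
  have finB: "finite B" "irrefl B" "\<not> colourable B" using critD[OF B(2)] by auto
  show False
  proof (cases "dig a b \<subseteq> B")
    case True
    interpret S: subdivision B a b p q
      by standard (use finB True FB ne in auto)
    have "subdiv B a b p q \<subseteq> A" unfolding subdiv_def using B(1) pD qD by auto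
    then have eq: "subdiv B a b p q = A" using sub_all S.not_colourable_subdiv[OF finB(3)] by blast
    then show False
      using trich S.rho_subdiv rho not_cyc not_wheel cyc_subdiv[OF _ S.subdivision_axioms]
        wheel_subdiv[OF _ S.subdivision_axioms] by auto
  next
    case no: False
    have "\<exists>u v. {u, v} = {a, b} \<and> B - A \<subseteq> {(u, v)}"
    proof (cases "(a, b) \<in> B")
      case True
      then have "B - A \<subseteq> {(a, b)}" using no B(1) by auto
      then show ?thesis by blast
    next
      case False
      then have "B - A \<subseteq> {(b, a)}" using B(1) by auto
      then show ?thesis by (metis insert_commute)
    qed
    then obtain u v where uv: "{u, v} = {a, b}" "B - A \<subseteq> {(u, v)}" by blast
    have o: "pot A (Field B) = 4" "(u, v) \<in> B"
      using one_arc[OF B(2) small _ uv(2)] FB by auto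
    then have F: "a \<in> Field B" "b \<in> Field B" using uv(1) unfolding Field_def by auto
    let ?E = "dig p q \<union> dig p a \<union> dig q b"
    have "pot A (Field B \<union> {p, q}) \<le> pot A (Field B) + 7 * int (card {p, q}) - 3 * int (card ?E) - 2 * int 1"
    proof (rule pot_add[OF fin])
      show "finite (Field B)" using finB finite_Field by blast
      show "{p, q} \<inter> Field B = {}" using FB by blast
      show "?E \<subseteq> ind A (Field B \<union> {p, q})" using F pD qD by auto
      show "?E \<inter> ind A (Field B) = {}" using FB by auto
      show "pm (ind A (Field B)) + 1 \<le> pm (ind A (Field B \<union> {p, q}))"
        by (rule pm_edge[of _ _ p q]) (use fin pD FB Field_ind[of A "Field B"] in \<open>auto intro: ind_mono[THEN subsetD]\<close>)
    qed simp
    moreover have "card {p, q} = 2" "card ?E = 6" using ne False by (auto simp: card_insert_if)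
    ultimately have "pot A (Field B \<union> {p, q}) \<le> -2" using o(1) by simp
    moreover have "Field B \<union> {p, q} \<subseteq> V" using FB abV by blast
    moreover have "2 \<le> card (Field B \<union> {p, q})"
      using card_mono[of "Field B \<union> {p, q}" "{p, q}"] finB(1) finite_Field \<open>card {p, q} = 2\<close> by fastforce
    ultimately show False using pot_neg by blast
  qed
qed

text \<open>
  The complement of R is a bidirected path of three vertices, whose end-vertices are attached to
  different colour classes of R.
\<close>

definition path3 where
  "path3 R c p p2 p3 a b a' b' \<longleftrightarrow> V - R = {p, p2, p3} \<and> distinct [p, p2, p3] \<and>
     A `` {p} = {b, p2} \<and> A\<inverse> `` {p} = {a, p2} \<and> type2 A p2 p p3 \<and>
     A `` {p3} = {b', p2} \<and> A\<inverse> `` {p3} = {a', p2} \<and> {a, b, a', b'} \<subseteq> R \<and>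
     c a = c b \<and> c a' = c b' \<and> c a \<noteq> (c a' :: bool)"

lemma path3_rev: "path3 R c p p2 p3 a b a' b' \<Longrightarrow> path3 R c p3 p2 p a' b' a b"
  unfolding path3_def by (auto intro: type2_swap)

text \<open>
  The contraction is a bidirected odd cycle, so the vertices outside R form a bidirected path,
  and their number is odd and at least three. With five or more of them, two adjacent ones would
  be of type 2.
\<close>

lemma contract_path3:
  assumes R: "R \<subseteq> V" "3 \<le> card R" "card R + 2 \<le> card V" "pot A R \<le> 4" and c: "proper_col c (ind A R)"
  shows "\<exists>p p2 p3 a b a' b'. path3 R c p p2 p3 a b a' b'"
proof -
  have "card R < card V" using R(3) by simp
  obtain x1 x2 where x: "x1 \<in> R" "x2 \<in> R" "x1 \<noteq> x2" using two_elements[of R] R(2) by auto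
  let ?f = "cmap R c x1 x2"
  obtain B where B: "cyc B" "(x1, x2) \<in> B" "Field B = V - R \<union> {x1, x2}"
    and im: "map_prod ?f ?f ` (A - ind A R) = B - ind B {x1, x2}"
    and inj: "inj_on (map_prod ?f ?f) (A - ind A R)"
    using contract_full[OF R(1,2) \<open>card R < card V\<close> x c R(4)] by metis
  note nb = contract_nbrs[OF x(1,2) im inj]
  have f_in: "?f u = (if c u then x1 else x2)" if "u \<in> R" for u using that unfolding cmap_def by simp
  have f_out: "?f u = u" if "u \<notin> R" for u using that unfolding cmap_def by simp
  have f_x1: "u \<in> R \<and> c u" if "?f u = x1" for u
    using that x unfolding cmap_def by (auto split: if_splits)
  have f_x2: "u \<in> R \<and> \<not> c u" if "?f u = x2" for u
    using that x unfolding cmap_def by (auto split: if_splits)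
  have f_o: "u = v" if "?f u = v" "v \<notin> R" for u v
    using that x unfolding cmap_def by (auto split: if_splits)
  obtain vs0 where "cyc_list vs0 B" using cyc_imp_list[OF B(1)] by blast
  then obtain vs where vs: "cyc_list vs B" "hd vs = x1" "last vs = x2" using cyc_list_edge[OF _ B(2)] by blast
  have FBvs: "Field B = set vs"
  proof -
    have "B = pd vs \<union> dig x2 x1" "2 \<le> length vs" using vs unfolding cyc_list_def by auto
    moreover have "x1 \<in> set vs" "x2 \<in> set vs" using vs \<open>2 \<le> length vs\<close> by (auto intro: hd_in_set last_in_set)
    ultimately show ?thesis using Field_pd[of vs] by (auto simp: Field_Un)
  qed
  have dist: "distinct vs" using vs unfolding cyc_list_def by auto
  have lenc: "card (V - R) + 2 = length vs"
  proof -
    have "card (Field B) = length vs" unfolding FBvs using dist by (rule distinct_card)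
    moreover have "card (Field B) = card (V - R) + card {x1, x2}"
      unfolding B(3) by (rule card_Un_disjoint) (use finV x in auto)
    ultimately show ?thesis using x(3) by simp
  qed
  moreover have "card (V - R) = card V - card R"
    using R(1) finV finite_subset by (intro card_Diff_subset) blast+
  ultimately have "4 \<le> length vs" using R(3) by linarith
  moreover have "odd (length vs)" using vs unfolding cyc_list_def by auto
  ultimately have "5 \<le> length vs" by presburger
  then obtain p p2 p3 z r where "vs = hd vs # p # p2 # p3 # z # r"
    by (auto simp: numeral_eq_Suc Suc_le_length_iff)
  then have vs': "vs = x1 # p # p2 # p3 # z # r" using vs(2) by simp
  have out: "u \<notin> R" if "u \<in> set vs" "u \<noteq> x1" "u \<noteq> x2" for u
    using that B(3) unfolding FBvs[symmetric] by blast
  have lz: "last (z # r) = x2" using vs(3) vs' by simp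
  then have x2r: "x2 \<in> set (z # r)" using last_in_set[of "z # r"] by simp
  have pR: "p \<notin> R" "p2 \<notin> R" "p3 \<notin> R" using out[of p] out[of p2] out[of p3] dist x2r vs' by auto
  have rot: "cyc_list (p # p2 # p3 # z # r @ [x1]) B"
    using cyc_list_rotate[of "[x1]" "p # p2 # p3 # z # r" B] vs(1) vs' by simp
  have rot2: "cyc_list (p2 # p3 # z # r @ [x1, p]) B"
    using cyc_list_rotate[of "[p]" "p2 # p3 # z # r @ [x1]" B] rot by simp
  have Bp: "B `` {p} = {x1, p2}" using cyc_list_nbrs[of x1 p p2 "p3 # z # r" B] vs(1) vs' by simp
  have Bp2: "B `` {p2} = {p, p3}" using cyc_list_nbrs[of p p2 p3 "z # r @ [x1]" B] rot by simp
  have Bp3: "B `` {p3} = {p2, z}" using cyc_list_nbrs[of p2 p3 z "r @ [x1, p]" B] rot2 by simp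
  have Binv: "B\<inverse> = B" using cyc_basic B(1) by blast
  have dp: "p \<noteq> p2" "p \<noteq> p3" "p2 \<noteq> p3" "x1 \<noteq> p2" "p2 \<noteq> z" using dist vs' by auto
  obtain b where b: "A `` {p} = {b, p2}" "b \<in> R" "c b"
  proof -
    have "?f ` (A `` {p}) = {x1, p2}" using nb(1)[OF pR(1)] Bp by simp
    then obtain u v where "A `` {p} = {u, v}" "?f u = x1" "?f v = p2"
      by (rule image_pair[OF _ nb(2)[OF pR(1)] dp(4)])
    then show ?thesis using that f_x1 f_o pR(2) by metis
  qed
  obtain a where a: "A\<inverse> `` {p} = {a, p2}" "a \<in> R" "c a"
  proof -
    have "?f ` (A\<inverse> `` {p}) = {x1, p2}" using nb(3)[OF pR(1)] Bp Binv by simp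
    then obtain u v where "A\<inverse> `` {p} = {u, v}" "?f u = x1" "?f v = p2"
      by (rule image_pair[OF _ nb(4)[OF pR(1)] dp(4)])
    then show ?thesis using that f_x1 f_o pR(2) by metis
  qed
  have t2: "type2 A p2 p p3"
  proof -
    have "?f ` (A `` {p2}) = {p, p3}" using nb(1)[OF pR(2)] Bp2 by simp
    then have "A `` {p2} = {p, p3}"
      by (rule image_pair[OF _ nb(2)[OF pR(2)] dp(2)]) (use f_o pR in metis)
    moreover have "?f ` (A\<inverse> `` {p2}) = {p, p3}" using nb(3)[OF pR(2)] Bp2 Binv by simp
    then have "A\<inverse> `` {p2} = {p, p3}"
      by (rule image_pair[OF _ nb(4)[OF pR(2)] dp(2)]) (use f_o pR in metis)
    ultimately show ?thesis using dp unfolding type2_def by blast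
  qed
  have f3: "?f ` (A `` {p3}) = {p2, z}" using nb(1)[OF pR(3)] Bp3 by simp
  have f3': "?f ` (A\<inverse> `` {p3}) = {p2, z}" using nb(3)[OF pR(3)] Bp3 Binv by simp
  show ?thesis
  proof (cases "z = x2")
    case False
    then have "z \<notin> R" using out[of z] dist vs' by auto
    have "A `` {p3} = {p2, z}"
      by (rule image_pair[OF f3 nb(2)[OF pR(3)] dp(5)]) (use f_o pR \<open>z \<notin> R\<close> in metis)
    moreover have "A\<inverse> `` {p3} = {p2, z}"
      by (rule image_pair[OF f3' nb(4)[OF pR(3)] dp(5)]) (use f_o pR \<open>z \<notin> R\<close> in metis)
    ultimately have "type2 A p3 p2 z" using dp unfolding type2_def by blast
    then show ?thesis using no_adjacent_type2[OF type2_swap[OF t2]] by blast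
  next
    case True
    have "r = []"
    proof (rule ccontr)
      assume "r \<noteq> []"
      then have "x2 \<in> set r" using lz last_in_set[of r] by simp
      then show False using dist vs' True by auto
    qed
    obtain b' where b': "A `` {p3} = {b', p2}" "b' \<in> R" "\<not> c b'"
    proof -
      obtain u v where "A `` {p3} = {u, v}" "?f u = p2" "?f v = z"
        by (rule image_pair[OF f3 nb(2)[OF pR(3)] dp(5)])
      then show ?thesis using that f_x2 f_o pR(2) True by (metis insert_commute)
    qed
    obtain a' where a': "A\<inverse> `` {p3} = {a', p2}" "a' \<in> R" "\<not> c a'"
    proof -
      obtain u v where "A\<inverse> `` {p3} = {u, v}" "?f u = p2" "?f v = z"
        by (rule image_pair[OF f3' nb(4)[OF pR(3)] dp(5)])
      then show ?thesis using that f_x2 f_o pR(2) True by (metis insert_commute)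
    qed
    have "V - R = {p, p2, p3}"
    proof -
      have "V - R \<union> {x1, x2} = {x1, p, p2, p3, x2}" using B(3) FBvs vs' True \<open>r = []\<close> by simp
      then have "V - R = {x1, p, p2, p3, x2} - {x1, x2}" using x by auto
      moreover have "p \<notin> {x1, x2}" "p2 \<notin> {x1, x2}" "p3 \<notin> {x1, x2}" using x pR by auto
      ultimately show ?thesis by auto
    qed
    then have "path3 R c p p2 p3 a b a' b'"
      unfolding path3_def using a b a' b' t2 dp by auto
    then show ?thesis by blast
  qed
qed

text \<open>
  Delete x and add the arc from s to y: a colouring would extend to x, so the result is not
  colourable, and only one arc is new. A critical part is therefore a cycle. If it covered all
  vertices except x, then w would split its path from s to y in two: according to parity A is an
  odd wheel or it has a colouring.
\<close>

lemma type1_cycle: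
  assumes "type1 A x y s w"
  obtains B where "cyc B" "(s, y) \<in> B" "(s, y) \<notin> A" "Field B \<subseteq> V - {x}" "pot A (Field B) = 4"
    "ind A (Field B) = B - {(s, y)}" "Field B \<noteq> V - {x}"
proof -
  have out: "\<And>v. (x, v) \<in> A \<longleftrightarrow> v = y \<or> v = w" and inn: "\<And>v. (v, x) \<in> A \<longleftrightarrow> v = s \<or> v = w"
    and ne: "y \<noteq> w" "s \<noteq> w" "s \<noteq> y"
    using assms unfolding type1_def by auto
  have nx: "y \<noteq> x" "w \<noteq> x" "s \<noteq> x" using out inn noloop by metis+
  have inV: "x \<in> V" "y \<in> V" "w \<in> V" "s \<in> V" using out inn arcV by metis+
  let ?A = "ind A (- {x}) \<union> {(s, y)}"
  have nc: "\<not> colourable ?A"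
  proof
    assume "colourable ?A"
    then obtain c where c: "proper_col c ?A" unfolding colourable_def by blast
    then have "proper_col c (ind A (- {x}))" by (rule proper_col_subset) auto
    then obtain a b where ab: "(x, a) \<in> A" "(b, x) \<in> A" "c a = (\<not> c w)" "c b = (\<not> c w)"
        "(a, b) \<in> (mono_arcs c (ind A (- {x})))\<^sup>*"
      using blocked[OF ncol irr, of c x "\<not> c w"] by blast
    then have "a = y" "b = s" using out inn by auto
    have "mono_arcs c (ind A (- {x})) \<subseteq> mono_arcs c ?A" by auto
    then have "(y, s) \<in> (mono_arcs c ?A)\<^sup>*" using ab(5) \<open>a = y\<close> \<open>b = s\<close> rtrancl_mono by blast
    then have "c y \<noteq> c s" using proper_col_path[OF c, of y s] by simp
    then show False using ab \<open>a = y\<close> \<open>b = s\<close> by simp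
  qed
  moreover have "finite ?A" "irrefl ?A" using fin ne noloop unfolding irrefl_def by auto
  ultimately obtain B where B: "B \<subseteq> ?A" "crit B" using exists_crit[of ?A] nc by blast
  have FB: "Field B \<subseteq> V - {x}"
    using mono_Field[OF B(1)] Field_ind[of A "- {x}"] inV nx by (auto simp: Field_Un)
  have small: "card (Field B) < card V"
    by (rule psubset_card_mono[OF finV]) (use FB inV in blast)
  have "B - A \<subseteq> {(s, y)}" using B(1) by auto
  then have o: "cyc B" "pot A (Field B) = 4" "ind A (Field B) = B - {(s, y)}" "(s, y) \<in> B" "(s, y) \<notin> A"
    using one_arc[OF B(2) small _] FB by blast+
  have "Field B \<noteq> V - {x}"
  proof
    assume F: "Field B = V - {x}"
    obtain vs0 where "cyc_list vs0 B" using cyc_imp_list[OF o(1)] by blast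
    then obtain vs where vs: "cyc_list vs B" "hd vs = s" "last vs = y" using cyc_list_edge[OF _ o(4)] by blast
    have Bvs: "B = pd vs \<union> dig y s" and dist: "distinct vs" and odd: "odd (length vs)" and len: "3 \<le> length vs"
      using vs unfolding cyc_list_def by auto
    have nev: "vs \<noteq> []" using len by auto
    have Fvs: "Field B = set vs"
    proof -
      have "y \<in> set vs" "s \<in> set vs" using vs nev by auto
      then show ?thesis unfolding Bvs using Field_pd[of vs] len by (auto simp: Field_Un)
    qed
    have "(s, y) \<notin> pd vs" using cyc_list_ends[OF vs(1)] vs by simp
    then have iB: "ind A (V - {x}) = pd vs \<union> {(y, s)}" using o(3) F ne Bvs by auto
    have A: "A = {(x, y), (y, s), (s, x)} \<union> (dig w x \<union> pd vs)"
    proof -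
      have "A = ind A (V - {x}) \<union> {(x, y), (s, x)} \<union> dig w x"
      proof (rule set_eqI)
        fix e :: "'a \<times> 'a" obtain u v where e: "e = (u, v)" by (cases e)
        show "e \<in> A \<longleftrightarrow> e \<in> ind A (V - {x}) \<union> {(x, y), (s, x)} \<union> dig w x"
          unfolding e using out[of v] inn[of u] arcV[of u v] nx by auto
      qed
      then show ?thesis unfolding iB by auto
    qed
    have "w \<in> set vs" using inV nx F Fvs by auto
    then obtain P1 P2 where sp: "vs = P1 @ w # P2" by (meson split_list)
    have P: "P1 \<noteq> []" "P2 \<noteq> []" using sp vs ne by auto
    show False
    proof (cases "odd (length P1)")
      case True
      then have o2: "odd (length P2)" using odd sp by auto
      have lP2: "last (w # P2) = y" using vs(3) sp P by simp
      have hP1: "hd P1 = s" using vs(2) sp P by simp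
      let ?R = "rev (P1 @ [w])"
      have pdv: "pd vs = pd ?R \<union> pd (w # P2)"
      proof -
        have "pd (P1 @ w # P2) = pd P1 \<union> pd (w # P2) \<union> dig (last P1) w" using pd_append[OF P(1), of "w # P2"] by simp
        moreover have "pd (P1 @ [w]) = pd P1 \<union> dig (last P1) w" using pd_append[OF P(1), of "[w]"] by simp
        ultimately show ?thesis unfolding sp pd_rev by blast
      qed
      have xs: "x \<notin> set vs" using F Fvs by auto
      have yP2: "y \<in> set P2" "s \<in> set P1" using lP2 hP1 P by auto
      have "wheel_list w x y s [w, x] (w # P2) ?R A"
        unfolding wheel_list_def
      proof (intro conjI)
        show "distinct [x, y, s]" using nx ne by auto
        show "odd_path w [w, x] x" using nx unfolding odd_path_def by auto
        show "odd_path w (w # P2) y" using dist sp lP2 o2 unfolding odd_path_def by auto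
        show "odd_path w ?R s" using dist sp hP1 P True unfolding odd_path_def by (auto simp: last_rev)
        show "set [w, x] \<inter> set (w # P2) = {w}" "set [w, x] \<inter> set ?R = {w}" "set (w # P2) \<inter> set ?R = {w}"
          using xs dist sp by auto
        show "set [w, x] \<inter> {x, y, s} = {x}" "set (w # P2) \<inter> {x, y, s} = {y}" "set ?R \<inter> {x, y, s} = {s}"
          using xs dist sp nx ne yP2 by auto
        show "A = {(x, y), (y, s), (s, x)} \<union> (pd [w, x] \<union> pd (w # P2) \<union> pd ?R)"
          unfolding pdv[unfolded pdv] using A unfolding pdv by auto
      qed
      then have "wheel A" by (rule list_imp_wheel)
      then show False using not_wheel by simp
    next
      case False
      obtain c where c: "\<And>i. i < length vs \<Longrightarrow> c (vs ! i) = even i" "\<And>u v. (u, v) \<in> pd vs \<Longrightarrow> c u \<noteq> c v"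
        using alternating_colouring[OF dist] by blast
      have "s = vs ! 0" using vs(2) nev by (simp add: hd_conv_nth)
      then have cs: "c s" using c(1)[of 0] nev by simp
      have "y = vs ! (length vs - 1)" using vs(3) nev by (simp add: last_conv_nth)
      then have cy: "c y" using c(1)[of "length vs - 1"] nev odd by simp
      have "w = vs ! length P1" "length P1 < length vs" using sp by auto
      then have cw: "c w" using c(1)[of "length P1"] False by simp
      let ?c = "c(x := False)"
      have "x \<notin> set vs" using F Fvs by auto
      then have no: "?c u \<noteq> ?c v" if "(u, v) \<in> pd vs" for u v
        using c(2)[OF that] pd_set[OF that] by auto
      have "mono_arcs ?c A \<subseteq> {(y, s)}"
      proof
        fix e assume e: "e \<in> mono_arcs ?c A"
        obtain u v where uv: "e = (u, v)" by (cases e)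
        have "?c u = ?c v" and "(u, v) \<in> A" using e uv by auto
        then have "(u, v) \<in> {(x, y), (y, s), (s, x)} \<union> dig w x" using no[of u v] unfolding A by blast
        then show "e \<in> {(y, s)}" using \<open>?c u = ?c v\<close> uv cs cy cw nx by auto
      qed
      moreover have "acyclic {(y, s)}" using ne by (auto simp: acyclic_insert acyclic_empty)
      ultimately have "proper_col ?c A" unfolding proper_col_def using acyclic_subset by blast
      then show False using ncol unfolding colourable_def by blast
    qed
  qed
  then show ?thesis using that o FB by blast
qed

text \<open>
  The complement of the cycle found for x is a path x, w, p3. The vertex p3 is of type 1 as well
  and yields a cycle on the same vertices. Both cycles lack the same arc of A, so the ends of
  the path are attached to the same arc, but they are attached to different colour classes.
\<close>

lemma no_type1:
  assumes "type1 A x y s w"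
  shows False
proof -
  \<comment> \<open>the complement of the cycle is a path of three vertices, with the middle one of type 2\<close>
  have path: "\<exists>B c p3 a' b'. cyc B \<and> (s, y) \<in> B \<and> (s, y) \<notin> A \<and> ind A (Field B) = B - {(s, y)} \<and> Field B \<subseteq> V \<and>
      path3 (Field B) c x w p3 s y a' b'"
    if t: "type1 A x y s w" for x y s w
  proof -
    obtain B where B: "cyc B" "(s, y) \<in> B" "(s, y) \<notin> A" "Field B \<subseteq> V - {x}" "pot A (Field B) = 4"
      "ind A (Field B) = B - {(s, y)}" "Field B \<noteq> V - {x}"
      using type1_cycle[OF t] by metis
    have out: "A `` {x} = {y, w}" and inn: "A\<inverse> `` {x} = {s, w}" and ne: "y \<noteq> w" "s \<noteq> w" "s \<noteq> y"
      using t unfolding type1_def by auto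
    have sub: "Field B \<subseteq> V" using B(4) by blast
    have xV: "x \<in> V" using out arcV by blast
    have "Field B \<subset> V - {x}" using B(4,7) by blast
    then have "card (Field B) < card (V - {x})" using finV by (intro psubset_card_mono) auto
    then have card: "card (Field B) + 2 \<le> card V" using xV finV by simp
    then have "card (Field B) < card V" by simp
    then obtain c where c: "proper_col c (ind A (Field B))" using ind_colourable sub by metis
    obtain p p2 p3 a b a' b' where "path3 (Field B) c p p2 p3 a b a' b'"
      using contract_path3[OF sub cyc_card3[OF B(1)] card _ c] B(5) by auto
    moreover from this have "x = p \<or> x = p3"
    proof -
      have "x \<in> V - Field B" using xV B(4) by blast
      then have "x = p \<or> x = p2 \<or> x = p3" using \<open>path3 (Field B) c p p2 p3 a b a' b'\<close> unfolding path3_def by blast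
      moreover have "x \<noteq> p2"
      proof
        assume "x = p2"
        then have "A `` {x} = A\<inverse> `` {x}" using \<open>path3 (Field B) c p p2 p3 a b a' b'\<close> unfolding path3_def type2_def by simp
        then show False using out inn ne by auto
      qed
      ultimately show ?thesis by blast
    qed
    ultimately obtain p2 p3 a b a' b' where pth: "path3 (Field B) c x p2 p3 a b a' b'"
      using path3_rev by metis
    then have D: "A `` {x} = {b, p2}" "A\<inverse> `` {x} = {a, p2}" "p2 \<notin> Field B" "b \<in> Field B" "a \<in> Field B"
      unfolding path3_def by auto
    have "s \<in> Field B" "y \<in> Field B" using B(2) unfolding Field_def by auto
    then have "p2 = w" "b = y" "a = s" using D out inn by (auto simp: doubleton_eq_iff)
    then show ?thesis using pth B sub by blast
  qed
  obtain B c p3 a' b' where B: "cyc B" "(s, y) \<in> B" "(s, y) \<notin> A" "ind A (Field B) = B - {(s, y)}" "Field B \<subseteq> V"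
      "path3 (Field B) c x w p3 s y a' b'" using path[OF assms] by blast
  then have P: "V - Field B = {x, w, p3}" "distinct [x, w, p3]" "type2 A w x p3"
     "A `` {p3} = {b', w}" "A\<inverse> `` {p3} = {a', w}" "{s, y, a', b'} \<subseteq> Field B" "c s \<noteq> c a'"
    unfolding path3_def by auto
  have "w \<notin> Field B" using P(1) by blast
  then have ne: "b' \<noteq> w" "a' \<noteq> w" using P(6) by blast+
  have "a' \<noteq> b'"
  proof
    assume "a' = b'"
    then have "type2 A p3 w b'" using P(4,5) ne unfolding type2_def by auto
    then show False using no_adjacent_type2[OF type2_swap[OF P(3)]] by blast
  qed
  then have "type1 A p3 b' a' w" using P(4,5) ne unfolding type1_def by auto
  then obtain B' c' q3 a2 b2 where B': "cyc B'" "(a', b') \<in> B'" "ind A (Field B') = B' - {(a', b')}"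
      "Field B' \<subseteq> V" "path3 (Field B') c' p3 w q3 a' b' a2 b2" using path by blast
  then have "V - Field B' = {p3, w, q3}" "type2 A w p3 q3" unfolding path3_def by auto
  moreover from this(2) P(3) have "q3 = x" unfolding type2_def using P(2) by (auto simp: doubleton_eq_iff)
  ultimately have "V - Field B' = V - Field B" using P(1) by auto
  then have F: "Field B' = Field B" using B(5) B'(4) by blast
  have ysB: "(y, s) \<in> B" using cyc_digon[OF B(1)] B(2) by blast
  have "s \<noteq> y" using assms unfolding type1_def by blast
  then have "(y, s) \<in> ind A (Field B)" using ysB unfolding B(4) by auto
  then have "(y, s) \<in> B'" using B'(3) unfolding F by auto
  then have "(s, y) \<in> B'" using cyc_digon[OF B'(1)] by blast
  moreover have "(s, y) \<notin> ind A (Field B')" using B(3) by simp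
  ultimately have "(s, y) = (a', b')" unfolding B'(3) by blast
  then show False using P(7) by simp
qed

text \<open>
  A set of potential 4 leaves a bidirected path of three vertices. Its first vertex is of type
  1, or of type 2 and adjacent to another vertex of type 2.
\<close>

lemma pot_ge5:
  assumes "R \<subseteq> V" "3 \<le> card R" "card R + 2 \<le> card V"
  shows "5 \<le> pot A R"
proof (rule ccontr)
  assume no: "\<not> 5 \<le> pot A R"
  have "card R < card V" using assms by simp
  then obtain c where c: "proper_col c (ind A R)" using ind_colourable assms(1) by metis
  obtain p p2 p3 a b a' b' where P: "path3 R c p p2 p3 a b a' b'"
    using contract_path3[OF assms _ c] no by auto
  then have D: "V - R = {p, p2, p3}" "A `` {p} = {b, p2}" "A\<inverse> `` {p} = {a, p2}" "type2 A p2 p p3" "{a, b, a', b'} \<subseteq> R"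
    unfolding path3_def by auto
  then have "p2 \<notin> R" by blast
  then have ne: "a \<noteq> p2" "b \<noteq> p2" using D(5) by blast+
  show False
  proof (cases "a = b")
    case True
    then have "type2 A p p2 b" using D(2,3) ne unfolding type2_def by auto
    then show False using no_adjacent_type2 D(4) by blast
  next
    case False
    then have "type1 A p b a p2" using D(2,3) ne unfolding type1_def by auto
    then show False by (rule no_type1)
  qed
qed

end

section \<open>Low arcs and digons\<close>

lemma sub_indI: "C \<subseteq> A \<Longrightarrow> Field C \<subseteq> T \<Longrightarrow> C \<subseteq> ind A T"
  unfolding Field_def ind_def by auto

text \<open>
  Recolouring v with k fails only because of a monochromatic cycle through v.
\<close>

lemma extend_or_path:
  assumes "irrefl G" "proper_col c (ind G (- {v}))" "\<not> proper_col (c(v := k)) G"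
  shows "\<exists>a b. (v, a) \<in> G \<and> (b, v) \<in> G \<and> c a = k \<and> c b = k \<and> (a, b) \<in> (mono_arcs c (ind G (- {v})))\<^sup>*"
proof (rule ccontr)
  assume no: "\<not> ?thesis"
  let ?r = "mono_arcs (c(v := k)) G"
  have eq: "{(a, b) \<in> ?r. a \<noteq> v \<and> b \<noteq> v} = mono_arcs c (ind G (- {v}))" by auto
  have "acyclic ?r"
  proof (rule acyclic_no_return[where v = v])
    show "acyclic {(a, b) \<in> ?r. a \<noteq> v \<and> b \<noteq> v}" using assms(2) unfolding eq proper_col_def .
    show "(v, v) \<notin> ?r" using assms(1) unfolding irrefl_def by auto
    fix a b assume "(v, a) \<in> ?r" "(b, v) \<in> ?r"
    moreover from this have "a \<noteq> v" "b \<noteq> v" using assms(1) unfolding irrefl_def by auto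
    ultimately have "(v, a) \<in> G" "(b, v) \<in> G" "c a = k" "c b = k" by auto
    then show "(a, b) \<notin> {(a, b) \<in> ?r. a \<noteq> v \<and> b \<noteq> v}\<^sup>*" unfolding eq using no by blast
  qed
  then show False using assms(3) unfolding proper_col_def by blast
qed

text \<open>
  A low arc from x to y: x has out-degree 2, with second out-neighbour w, and y has in-degree 2,
  with second in-neighbour z.
\<close>

definition low :: "'a rel \<Rightarrow> 'a \<Rightarrow> 'a \<Rightarrow> 'a \<Rightarrow> 'a \<Rightarrow> bool" where
  "low A x y w z \<longleftrightarrow> A `` {x} = {y, w} \<and> y \<noteq> w \<and> A\<inverse> `` {y} = {x, z} \<and> x \<noteq> z"

text \<open>
  The situation at a low arc whose reduction uses all other vertices: the low arc is then
  isolated from other low arcs at its tail.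
\<close>

definition spanning_low :: "'a rel \<Rightarrow> 'a \<Rightarrow> 'a \<Rightarrow> 'a \<Rightarrow> bool" where
  "spanning_low A x y w \<longleftrightarrow> indeg A x = 2 \<and> (w, x) \<notin> A \<and> (y, x) \<notin> A \<and>
     (\<forall>s. (s, x) \<in> A \<longrightarrow> 3 \<le> outdeg A s) \<and> 3 \<le> indeg A w"

text \<open>
  In a core, B arises from the digraph induced by U by merging y into z: in A the vertex z keeps
  the in-arcs from J, while its only out-neighbour y in U has the out-arcs to J.
\<close>

definition core :: "'a rel \<Rightarrow> 'a \<Rightarrow> 'a \<Rightarrow> 'a set \<Rightarrow> 'a set \<Rightarrow> 'a rel \<Rightarrow> bool" where
  "core A y z U J B \<longleftrightarrow> (cyc B \<or> wheel B) \<and> crit B \<and> U \<subseteq> Field A \<and> Field B = U - {y} \<and> y \<in> U \<and> z \<in> U \<and>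
     z \<noteq> y \<and> 2 \<le> card J \<and> J = B `` {z} \<and> J = B\<inverse> `` {z} \<and>
     (\<forall>u\<in>J. outdeg B u = 2 \<and> indeg B u = 2) \<and>
     (card J = 2 \<longrightarrow> (\<exists>u\<in>J. \<exists>v. v \<noteq> z \<and> (u, v) \<in> B \<and> (v, u) \<in> B)) \<and>
     ind A U = (B - {z} \<times> J) \<union> {(z, y)} \<union> {y} \<times> J"

text \<open>
  Equality in the bound for sets that miss at least two vertices.
\<close>

definition tight_core :: "'a rel \<Rightarrow> 'a \<Rightarrow> 'a \<Rightarrow> 'a set \<Rightarrow> 'a set \<Rightarrow> 'a rel \<Rightarrow> bool" where
  "tight_core A y z U J B \<longleftrightarrow> core A y z U J B \<and> card U + 2 \<le> card (Field A) \<and> pot A U = 5"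

lemma low_converse[simp]: "low (A\<inverse>) y x z w \<longleftrightarrow> low A x y w z"
  unfolding low_def by auto

lemma crit_subE:
  assumes "finite A" "irrefl A" "\<not> colourable A"
  obtains B where "B \<subseteq> A" "crit B"
  using exists_crit[OF assms] by blast

context minimal_counterexample
begin

lemma out2: "A `` {x} = {y, w} \<Longrightarrow> (x, v) \<in> A \<longleftrightarrow> v = y \<or> v = w" by auto
lemma in2: "A\<inverse> `` {y} = {x, z} \<Longrightarrow> (v, y) \<in> A \<longleftrightarrow> v = x \<or> v = z" by auto

lemma out_ex: "v \<in> V \<Longrightarrow> \<exists>u. (v, u) \<in> A \<and> u \<noteq> a"
proof (rule ccontr)
  assume v: "v \<in> V" "\<not> (\<exists>u. (v, u) \<in> A \<and> u \<noteq> a)"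
  then have "A `` {v} \<subseteq> {a}" by auto
  then have "outdeg A v \<le> 1" unfolding outdeg_def using card_mono[of "{a}" "A `` {v}"] by simp
  then show False using crit_outdeg[OF crit v(1)] by simp
qed

lemma in_ex: "v \<in> V \<Longrightarrow> \<exists>u. (u, v) \<in> A \<and> u \<noteq> a"
  using minimal_counterexample.out_ex[OF minimal_counterexample_converse, of v a] by simp

text \<open>
  Both colours of x are blocked. The colour of y is only blocked through an out-neighbour of x
  in that colour, so y and w have different colours; the path then leads out of y. Reversing all
  arcs gives the claim about z.
\<close>

lemma low_colouring:
  assumes x: "A `` {x} = {y, w}" and y: "A\<inverse> `` {y} = {x, z}" and c: "proper_col c (ind A (- {x}))"
  shows "c y \<noteq> c w" "c z \<noteq> c y"
    "\<exists>b. (b, x) \<in> A \<and> c b = c y \<and> (y, b) \<in> (mono_arcs c (ind A (- {x})))\<^sup>*"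
proof -
  have A: "\<exists>b. (b, x) \<in> A \<and> c' b = c' y \<and> (y, b) \<in> (mono_arcs c' (ind A (- {x})))\<^sup>* \<and> c' y = (\<not> c' w)"
    if "proper_col c' (ind A (- {x}))" for c'
  proof -
    obtain a b where ab: "(x, a) \<in> A" "(b, x) \<in> A" "c' a = (\<not> c' w)" "c' b = (\<not> c' w)"
        "(a, b) \<in> (mono_arcs c' (ind A (- {x})))\<^sup>*"
      using blocked[OF ncol irr \<open>proper_col c' (ind A (- {x}))\<close>, of "\<not> c' w"] by blast
    then have "a = y" using out2[OF x] by auto
    then show ?thesis using ab by auto
  qed
  show "c y \<noteq> c w" using A[OF c] by auto
  show "\<exists>b. (b, x) \<in> A \<and> c b = c y \<and> (y, b) \<in> (mono_arcs c (ind A (- {x})))\<^sup>*" using A[OF c] by blast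
  show "c z \<noteq> c y"
  proof
    assume zy: "c z = c y"
    let ?c = "c(y := c w)"
    have "proper_col ?c (ind (ind A (- {x})) (- {y}))"
    proof -
      have "mono_arcs ?c (ind (ind A (- {x})) (- {y})) \<subseteq> mono_arcs c (ind A (- {x}))" by auto
      then show ?thesis using c acyclic_subset unfolding proper_col_def by blast
    qed
    then have "proper_col ?c (ind A (- {x}))"
      by (rule proper_col_ignore) (use irrefl_ind irr in2[OF y] zy \<open>c y \<noteq> c w\<close> noloop in auto)
    then show False using A[of ?c] x noloop by auto
  qed
qed

text \<open>
  Delete x and y and join w and z by a digon: a colouring extends by giving x the colour of z
  and y the colour of w. Both new arcs are used in a critical part B, by the bounds for sets
  missing two vertices. Restoring the five arcs at x and y gives a set of potential at most 4,
  so at most one vertex v is missing. If none is missing, x and y are adjacent vertices of type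
  2. If one is missing, a colouring without v alternates along a bidirected path from x to y,
  the arc from x to y is its only monochromatic arc, and v is not blocked in the other colour.
\<close>

lemma no_double_digon_distinct:
  assumes x: "A `` {x} = {y, w}" "y \<noteq> w" and y: "A\<inverse> `` {y} = {x, z}" "x \<noteq> z"
    and yz: "(y, z) \<in> A" and wx: "(w, x) \<in> A" and wz: "w \<noteq> z"
  shows False
proof -
  note ox = out2[OF x(1)] and iy = in2[OF y(1)]
  have ne: "x \<noteq> y" "w \<noteq> x" "z \<noteq> y" using ox iy noloop by metis+
  have ne2: "w \<noteq> y" "z \<noteq> x" using x(2) y(2) by auto
  have inV: "x \<in> V" "y \<in> V" "w \<in> V" "z \<in> V" using ox iy arcV by metis+
  let ?A = "ind A (- {x, y}) \<union> dig w z"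
  have nc: "\<not> colourable ?A"
  proof
    assume "colourable ?A"
    then obtain c where c: "proper_col c ?A" unfolding colourable_def by blast
    have cwz: "c w \<noteq> c z" using proper_col_digon[OF c, of w z] by auto
    let ?c = "c(x := c z, y := c w)"
    have "proper_col ?c (ind (ind A (- {x})) (- {y}))"
    proof -
      have "mono_arcs ?c (ind (ind A (- {x})) (- {y})) \<subseteq> mono_arcs c ?A" by auto
      then show ?thesis using c acyclic_subset unfolding proper_col_def by blast
    qed
    then have "proper_col ?c (ind A (- {x}))"
      by (rule proper_col_ignore) (use irrefl_ind irr iy ne cwz ne2 in auto)
    then have "proper_col ?c A"
      by (rule proper_col_ignore) (use irr ox ne cwz ne2 in auto)
    then show False using ncol unfolding colourable_def by blast
  qed
  have "finite ?A" "irrefl ?A" using fin wz noloop unfolding irrefl_def by auto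
  then obtain B where B: "B \<subseteq> ?A" "crit B" using nc by (rule crit_subE)
  have FB: "Field B \<subseteq> V - {x, y}"
    using mono_Field[OF B(1)] Field_ind[of A "- {x, y}"] inV ne ne2 by (auto simp: Field_Un)
  have finB: "finite B" "irrefl B" "\<not> colourable B" using critD[OF B(2)] by auto
  have finF: "finite (Field B)" using finB(1) finite_Field by blast
  have "card (Field B) \<le> card (V - {x, y})" by (rule card_mono) (use finV FB in auto)
  then have card: "card (Field B) + 2 \<le> card V"
    using inV ne finV card_mono[of V "{x, y}"] by (simp add: card_Diff_subset)
  then have small: "card (Field B) < card V" by simp
  note trich = IH[OF B(2) small]
  have new: "dig w z \<subseteq> B" "dig w z \<inter> A = {}"
  proof -
    have False if "B - A \<subseteq> {(u, v)}" for u v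
    proof -
      have "cyc B \<and> pot A (Field B) = 4" using one_arc[OF B(2) small _ that] FB by blast
      then show False using pot_ge5[of "Field B"] cyc_card3[of B] card FB by auto
    qed
    note no = this
    have "B - A \<subseteq> dig w z" using B(1) by auto
    show "dig w z \<subseteq> B" "dig w z \<inter> A = {}"
      using no[of w z] no[of z w] \<open>B - A \<subseteq> dig w z\<close> by blast+
  qed
  have wzF: "w \<in> Field B" "z \<in> Field B" using new(1) unfolding Field_def by auto
  have NBA: "B - A = dig w z" using new B(1) by auto
  let ?T = "Field B \<union> {x, y}"
  let ?E = "{(x, y)} \<union> dig x w \<union> dig y z"
  have cE: "card ?E = 5" using ne wz ne2 by (auto simp: card_insert_if)
  have ET: "?E \<subseteq> ind A ?T" using wzF ox iy yz wx by auto
  have mT: "finite (ind A ?T)" using fin by simp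
  have BT: "B - dig w z \<subseteq> ind A ?T"
  proof (rule sub_indI)
    show "B - dig w z \<subseteq> A" using NBA by blast
    show "Field (B - dig w z) \<subseteq> ?T" using mono_Field[of "B - dig w z" B] by blast
  qed
  \<comment> \<open>a matching that misses w or z gains the digon there\<close>
  have gain1: "pm (ind B (- {t})) + 1 \<le> pm (ind A ?T)" if "t \<in> {w, z}" for t
  proof -
    have sub: "ind B (- {t}) \<subseteq> ind A ?T" using BT that by auto
    have nF: "x \<notin> Field (ind B (- {t}))" "y \<notin> Field (ind B (- {t}))" "t \<notin> Field (ind B (- {t}))"
      using Field_ind[of B "- {t}"] FB by auto
    from that have "t = w \<or> t = z" by blast
    then show ?thesis
    proof
      assume t: "t = w"
      show ?thesis by (rule pm_edge[OF mT sub, of x w]) (use ET nF t in auto)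
    next
      assume t: "t = z"
      show ?thesis by (rule pm_edge[OF mT sub, of y z]) (use ET nF t in auto)
    qed
  qed
  have gain2: "pm (ind B (- {w, z})) + 2 \<le> pm (ind A ?T)"
  proof -
    let ?C = "ind B (- {w, z}) \<union> dig x w"
    have sub: "?C \<subseteq> ind A ?T" using BT ET by auto
    have F: "Field (ind B (- {w, z})) \<subseteq> Field B - {w, z}" using Field_ind[of B "- {w, z}"] by blast
    have "pm (ind B (- {w, z})) + 1 \<le> pm ?C"
      by (rule pm_edge[of _ _ x w]) (use finB F FB in auto)
    moreover have "pm ?C + 1 \<le> pm (ind A ?T)"
      by (rule pm_edge[OF mT sub, of y z]) (use ET F FB ne wz ne2 in \<open>auto simp: Field_Un\<close>)
    ultimately show ?thesis by simp
  qed
  have pm0: "pm B \<le> pm (ind A ?T)"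
  proof -
    have "pm (B - dig w z) \<le> pm (ind A ?T)" using mT BT by (rule pm_mono)
    then show ?thesis using pm_rec_digon[OF finB(1), of w z] gain2 by linarith
  qed
  have pm1: "pm B + 1 \<le> pm (ind A ?T)" if ex: "cyc B \<or> wheel B"
  proof -
    have "(w, z) \<in> B" "(z, w) \<in> B" using new by auto
    then obtain t where "t \<in> {w, z}" "pm B \<le> pm (ind B (- {t}))" using exceptional_miss[OF ex] by blast
    then show ?thesis using gain1[of t] by simp
  qed
  have TV: "?T \<subseteq> V" using FB inV by blast
  have base: "pot A ?T \<le> rho B + 14 + 6 - 3 * int (card E0) + 2 * (int (pm B) - int (pm (ind A ?T)))"
    if "E0 \<subseteq> ind A ?T" "E0 \<inter> B = {}" for E0
  proof -
    have "card {x, y} = 2" "card (B - A) = 2" unfolding NBA using ne wz by auto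
    moreover have "{x, y} \<inter> Field B = {}" using FB by blast
    ultimately show ?thesis using add_pot[OF fin finB(1) _ _ that, of ] by simp
  qed
  have EB: "e \<notin> B" if "fst e = x \<or> snd e = x \<or> fst e = y \<or> snd e = y" for e
    using that FB unfolding Field_def by (cases e) auto
  have E_B: "?E \<inter> B = {}" using EB by auto
  have val: "rho B + 2 * (int (pm B) - int (pm (ind A ?T))) \<le> -1 \<and>
      (\<not> cyc B \<longrightarrow> rho B + 2 * (int (pm B) - int (pm (ind A ?T))) \<le> -2)"
    using trich
  proof (elim disjE)
    assume "cyc B"
    then show ?thesis using pm1 cyc_basic[of B] by auto
  next
    assume "wheel B"
    then show ?thesis using pm1 wheel_basic[of B] by auto
  next
    assume "rho B \<le> -2"
    then show ?thesis using pm0 by auto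
  qed
  have more: "pot A ?T \<le> 5 + (rho B + 2 * (int (pm B) - int (pm (ind A ?T)))) - 3 * int (card E1)"
    if "E1 \<subseteq> ind A ?T" "E1 \<inter> ?E = {}" "\<And>e. e \<in> E1 \<Longrightarrow> fst e = x \<or> snd e = x \<or> fst e = y \<or> snd e = y" for E1
  proof -
    have "finite E1" using finite_subset[OF that(1) mT] .
    then have "card (?E \<union> E1) = 5 + card E1" using that(2) cE card_Un_disjoint[of ?E E1] by auto
    moreover have "(?E \<union> E1) \<inter> B = {}" using E_B EB that(3) by blast
    ultimately show ?thesis using base[of "?E \<union> E1"] ET that(1) by auto
  qed
  have c2: "2 \<le> card ?T" using card_mono[of ?T "{x, y}"] finF ne by auto
  show False
  proof (cases "?T = V")
    case True
    obtain s where s: "(s, x) \<in> A" "s \<noteq> w" using in_ex[OF inV(1)] by blast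
    obtain t where t: "(y, t) \<in> A" "t \<noteq> z" using out_ex[OF inV(2)] by blast
    have two: False if "(s, x) \<in> A" "s \<noteq> w" "(y, t) \<in> A" "t \<noteq> z" "(s, x) \<noteq> (y, t)" for s t
    proof -
      have "pot A ?T \<le> 5 + (rho B + 2 * (int (pm B) - int (pm (ind A ?T)))) - 3 * int (card {(s, x), (y, t)})"
        by (rule more) (use that True arcV ne ne2 noloop in auto)
      then have "pot A ?T \<le> -2" using val that(5) by simp
      then show False using pot_neg[OF TV c2] by simp
    qed
    have st: "s = y" "t = x" using two[OF s t] by auto
    have "(s', x) \<in> A \<longleftrightarrow> s' = y \<or> s' = w" for s'
      using two[of s' t] s t st wx by auto
    moreover have "(y, t') \<in> A \<longleftrightarrow> t' = x \<or> t' = z" for t'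
      using two[of s t'] s t st yz by auto
    ultimately have "A\<inverse> `` {x} = {y, w}" "A `` {y} = {x, z}" by auto
    then have "type2 A x y w" "type2 A y x z" using x y unfolding type2_def by (simp_all add: insert_commute)
    then show False by (rule no_adjacent_type2)
  next
    case False
    have "?T \<subset> V" using False TV by blast
    then have ltT: "card ?T < card V" by (rule psubset_card_mono[OF finV])
    have pT4: "4 \<le> pot A ?T" by (rule pot_ge4[OF TV c2 ltT])
    have le5: "pot A ?T \<le> 5 + (rho B + 2 * (int (pm B) - int (pm (ind A ?T))))"
      using more[of "{}"] by simp
    have cyc: "cyc B"
    proof (rule ccontr)
      assume "\<not> cyc B"
      then show False using val le5 pT4 by simp
    qed
    have cT: "card ?T = card (Field B) + 2"
      using FB finF ne by (subst card_Un_disjoint) auto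
    have "\<not> card ?T + 2 \<le> card V"
    proof
      assume "card ?T + 2 \<le> card V"
      then have "5 \<le> pot A ?T" using pot_ge5[OF TV] cyc_card3[OF cyc] cT by simp
      then show False using le5 val by simp
    qed
    then have "card (V - ?T) = 1" using ltT finV TV by (simp add: card_Diff_subset finF)
    then obtain v where v: "V - ?T = {v}" by (auto simp: card_1_singleton_iff)
    have vV: "v \<in> V" "v \<notin> ?T" "v \<noteq> x" "v \<noteq> y" "v \<notin> Field B" using v by auto
    have Tv: "u \<in> ?T" if "u \<in> V" "u \<noteq> v" for u using v that by blast
    have noextra: "e \<in> ?E" if "e \<in> ind A ?T" "fst e = x \<or> snd e = x \<or> fst e = y \<or> snd e = y" for e
    proof (rule ccontr)
      assume "e \<notin> ?E"
      then have "pot A ?T \<le> 5 + (rho B + 2 * (int (pm B) - int (pm (ind A ?T)))) - 3 * int (card {e})"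
        by (intro more) (use that in auto)
      then show False using val pT4 by simp
    qed
    have in_x: "s = w \<or> s = v" if "(s, x) \<in> A" for s
    proof (rule ccontr)
      assume no: "\<not> (s = w \<or> s = v)"
      then have "(s, x) \<in> ind A ?T" using that Tv arcV by auto
      then show False using noextra[of "(s, x)"] no ne ne2 wz by auto
    qed
    have out_y: "t = z \<or> t = v" if "(y, t) \<in> A" for t
    proof (rule ccontr)
      assume no: "\<not> (t = z \<or> t = v)"
      then have "(y, t) \<in> ind A ?T" using that Tv arcV by auto
      then show False using noextra[of "(y, t)"] no ne ne2 wz by auto
    qed
    have vx: "(v, x) \<in> A" using in_ex[OF inV(1), of w] in_x by blast
    have yv: "(y, v) \<in> A" using out_ex[OF inV(2), of z] out_y by blast
    obtain t where t: "(v, t) \<in> A" "t \<noteq> x" using out_ex[OF vV(1)] by blast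
    obtain s where s: "(s, v) \<in> A" "s \<noteq> y" using in_ex[OF vV(1)] by blast
    have eq4: "pot A ?T = 4" using pT4 le5 val by simp
    have degv: False if E1: "E1 \<subseteq> A" "\<forall>e\<in>E1. fst e = v \<or> snd e = v" "card E1 = 5" for E1
    proof -
      have "pot A (?T \<union> {v}) \<le> pot A ?T + 7 * int (card {v}) - 3 * int (card E1) - 2 * int 0"
      proof (rule pot_add[OF fin])
        show "finite ?T" using finF by simp
        have "?T \<union> {v} = V" using v TV by blast
        then show "E1 \<subseteq> ind A (?T \<union> {v})" "pm (ind A ?T) + 0 \<le> pm (ind A (?T \<union> {v}))"
          using E1(1) pm_mono[OF fin, of "ind A ?T"] by (auto simp: ind_Field ind_subset)
        show "E1 \<inter> ind A ?T = {}" using E1(2) vV(2) by fastforce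
      qed (use vV in auto)
      then have "pot A (?T \<union> {v}) \<le> -4" using eq4 E1(3) by simp
      moreover have "?T \<union> {v} = V" using v TV by blast
      ultimately show False using rho pot_Field[of A] by simp
    qed
    have vs: "v \<noteq> t" "v \<noteq> s" using t s noloop by auto
    have nvy: "(v, y) \<notin> A" using iy vV wzF by auto
    have nxv: "(x, v) \<notin> A" using ox vV wzF by auto
    then have "t \<noteq> y" "s \<noteq> x" using t s nvy by auto
    have out_v: "t' = x \<or> t' = t" if "(v, t') \<in> A" for t'
    proof (rule ccontr)
      assume "\<not> (t' = x \<or> t' = t)"
      then have "card {(v, x), (v, t), (v, t'), (y, v), (s, v)} = 5"
        using t s vV vs that noloop by (auto simp: card_insert_if)
      then show False using degv[of "{(v, x), (v, t), (v, t'), (y, v), (s, v)}"] vx t s yv that by auto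
    qed
    have in_v: "s' = y \<or> s' = s" if "(s', v) \<in> A" for s'
    proof (rule ccontr)
      assume "\<not> (s' = y \<or> s' = s)"
      then have "card {(v, x), (v, t), (s', v), (y, v), (s, v)} = 5"
        using t s vV vs that noloop by (auto simp: card_insert_if)
      then show False using degv[of "{(v, x), (v, t), (s', v), (y, v), (s, v)}"] vx t s yv that by auto
    qed
    have Av: "A `` {v} = {x, t}" "A\<inverse> `` {v} = {y, s}" using out_v in_v vx t s yv by auto
    show False
    proof (cases "s = t")
      case True
      have "type1 A v x y t" unfolding type1_def using Av True t s ne by auto
      then show False by (rule no_type1)
    next
      case st: False
      obtain c where c: "proper_col c (ind A (- {v}))"
        using crit_del[OF crit vV(1)] unfolding colourable_def by blast
      have Tv2: "ind A (- {v}) = ind A ?T"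
      proof (rule set_eqI)
        fix e :: "'a \<times> 'a" obtain a b where e: "e = (a, b)" by (cases e)
        show "e \<in> ind A (- {v}) \<longleftrightarrow> e \<in> ind A ?T" unfolding e using arcV[of a b] Tv vV by auto
      qed
      have cardT: "card (ind A ?T) \<le> card (B - dig w z \<union> ?E)"
      proof -
        have "pot A ?T = rho B + 14 - 3 * (int (card (ind A ?T)) - int (card B)) + 2 * (int (pm B) - int (pm (ind A ?T)))"
          unfolding pot_def rho_def cT by simp
        then have "int (card (ind A ?T)) \<le> int (card B) + 3" using eq4 val by auto
        moreover have "card (B - dig w z) + 2 = card B"
        proof -
          have "card (dig w z) \<le> card B" by (rule card_mono) (use finB new in auto)
          moreover have "card (B - dig w z) = card B - card (dig w z)" by (rule card_Diff_subset) (use new in auto)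
          moreover have "card (dig w z) = 2" using wz by simp
          ultimately show ?thesis by simp
        qed
        moreover have "card (B - dig w z \<union> ?E) = card (B - dig w z) + card ?E"
          by (rule card_Un_disjoint) (use finB E_B in auto)
        ultimately show ?thesis using cE by simp
      qed
      have "B - dig w z \<union> ?E = ind A ?T"
        by (rule card_seteq[OF mT _ cardT]) (use BT ET in blast)
      then have iT: "ind A (- {v}) = B - dig w z \<union> ?E" using Tv2 by simp
      have mono: "mono_arcs c (ind A (- {v})) \<subseteq> {(x, y)}"
      proof
        fix e assume e: "e \<in> mono_arcs c (ind A (- {v}))"
        obtain a b where ab: "e = (a, b)" by (cases e)
        have "(a, b) \<in> ind A (- {v})" "c a = c b" using e ab by auto
        moreover have "(b, a) \<notin> ind A (- {v})" using proper_col_digon[OF c] calculation by blast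
        ultimately show "e \<in> {(x, y)}" using ab cyc_digon[OF cyc] unfolding iT by auto
      qed
      have "c x = k" for k
      proof -
        obtain a b where ab: "(v, a) \<in> A" "(b, v) \<in> A" "c a = k" "c b = k"
          "(a, b) \<in> (mono_arcs c (ind A (- {v})))\<^sup>*" using blocked[OF ncol irr c, of k] by blast
        have "a \<noteq> b" using out_v[OF ab(1)] in_v[OF ab(2)] st ne \<open>t \<noteq> y\<close> \<open>s \<noteq> x\<close> by auto
        then have "(a, b) \<in> (mono_arcs c (ind A (- {v})))\<^sup>+" using ab(5) by (meson rtranclD)
        then obtain d where "(a, d) \<in> mono_arcs c (ind A (- {v}))" by (meson tranclD)
        then have "a = x" using mono by blast
        then show ?thesis using ab(3) by simp
      qed
      then show False by (metis (full_types))
    qed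
  qed
qed

text \<open>
  Delete y and let x inherit the other out-arcs of y. As x and w have different colours in every
  colouring, y could take the colour of x. Restoring y, and w if it is missing, in a critical
  part gives a set of too small potential, unless y is of type 1.
\<close>

lemma no_double_digon_same:
  assumes x: "A `` {x} = {y, w}" "y \<noteq> w" and y: "A\<inverse> `` {y} = {x, w}" "x \<noteq> w"
    and yw: "(y, w) \<in> A" and wx: "(w, x) \<in> A"
  shows False
proof -
  note ox = out2[OF x(1)] and iy = in2[OF y(1)]
  have ne: "x \<noteq> y" using ox noloop by metis
  have inV: "x \<in> V" "y \<in> V" "w \<in> V" using ox iy arcV by metis+
  have nyx: "(y, x) \<notin> A"
  proof
    assume "(y, x) \<in> A"
    then show False using no_triangle[of x y w] ne x(2) y(2) yw wx ox iy by auto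
  qed
  define NU where "NU = A `` {y} - {w}"
  have NU: "u \<in> NU \<longleftrightarrow> (y, u) \<in> A \<and> u \<noteq> w" for u unfolding NU_def by auto
  have nNU: "x \<notin> NU" "y \<notin> NU" "w \<notin> NU" using NU nyx noloop by auto
  have NUV: "NU \<subseteq> V" using NU arcV by blast
  let ?A = "ind A (- {y}) \<union> {x} \<times> NU"
  have nc: "\<not> colourable ?A"
  proof
    assume "colourable ?A"
    then obtain c where c: "proper_col c ?A" unfolding colourable_def by blast
    have sub: "proper_col c (ind A (- {y}))" using c by (rule proper_col_subset) simp
    have cxw: "c x \<noteq> c w" using proper_col_digon[OF sub, of x w] ox wx ne x(2) y(2) by auto
    obtain a b where ab: "(y, a) \<in> A" "(b, y) \<in> A" "c a = c x" "c b = c x"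
      "(a, b) \<in> (mono_arcs c (ind A (- {y})))\<^sup>*" using blocked[OF ncol irr sub, of "c x"] by blast
    have "b = x" using ab(2,4) iy cxw by auto
    have "a \<in> NU" using ab(1,3) NU cxw by auto
    then have "(x, a) \<in> ?A" by simp
    moreover have "mono_arcs c (ind A (- {y})) \<subseteq> mono_arcs c ?A" by auto
    then have "(a, x) \<in> (mono_arcs c ?A)\<^sup>*" using ab(5) \<open>b = x\<close> rtrancl_mono by blast
    ultimately show False using proper_col_path[OF c, of a x] ab(3) by simp
  qed
  have "finite ?A" using fin finite_subset[OF NUV finV] by simp
  moreover have "irrefl ?A" using noloop nNU unfolding irrefl_def by auto
  ultimately obtain B where B: "B \<subseteq> ?A" "crit B" using nc by (rule crit_subE)
  have FA: "Field ?A \<subseteq> V - {y}"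
  proof -
    have "Field ({x} \<times> NU) \<subseteq> insert x NU" unfolding Field_def by auto
    then show ?thesis using Field_ind[of A "- {y}"] NUV nNU(2) inV ne unfolding Field_Un by blast
  qed
  then have FB: "Field B \<subseteq> V - {y}" using mono_Field[OF B(1)] by blast
  have finB: "finite B" "irrefl B" "\<not> colourable B" using critD[OF B(2)] by auto
  have finF: "finite (Field B)" using finB(1) finite_Field by blast
  have small: "card (Field B) < card V" by (rule psubset_card_mono[OF finV]) (use FB inV in blast)
  note trich = IH[OF B(2) small]
  define H where "H = {u. (x, u) \<in> B - A}"
  have N: "B - A = {x} \<times> H" using B(1) unfolding H_def by auto
  then have NA: "(a, b) \<in> A \<or> a = x \<and> b \<in> H" if "(a, b) \<in> B" for a b using that by blast
  have HNU: "H \<subseteq> NU" using B(1) unfolding H_def by auto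
  have finH: "finite H" by (rule finite_subset[OF HNU finite_subset[OF NUV finV]])
  have "\<not> B \<subseteq> A" using sub_all finB(3) small by blast
  then have "H \<noteq> {}" using N by auto
  then have xF: "x \<in> Field B" using N unfolding Field_def by auto
  have HF: "H \<subseteq> Field B" using N unfolding Field_def by auto
  have cN: "card (B - A) = card H" unfolding N by (simp add: card_cartesian_product)
  have EB: "e \<notin> B" if "fst e = y \<or> snd e = y" for e
    using that FB unfolding Field_def by (cases e) auto
  have wH: "w \<notin> H" "x \<notin> H" "y \<notin> H" using HNU nNU by auto
  have Bx: "ind B (- {x}) \<subseteq> ind A T" if "Field B \<subseteq> T" for T
  proof (rule sub_indI)
    show "ind B (- {x}) \<subseteq> A" by (auto dest: NA)
    show "Field (ind B (- {x})) \<subseteq> T" using Field_ind[of B "- {x}"] that by blast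
  qed
  have loss: "pm B \<le> pm (ind B (- {x})) + 1" by (rule pm_del1[OF finB(1)])
  show False
  proof (cases "w \<in> Field B")
    case True
    let ?T = "Field B \<union> {y}"
    have TV: "?T \<subseteq> V" using FB inV by blast
    have mT: "finite (ind A ?T)" using fin by simp
    have c2: "2 \<le> card ?T" using card_mono[of ?T "{x, y}"] finF xF ne by auto
    let ?E = "{(x, y)} \<union> dig y w \<union> {y} \<times> H"
    have cE: "card ?E = 3 + card H"
    proof -
      have "card ?E = card ({(x, y)} \<union> dig y w) + card ({y} \<times> H)"
        by (rule card_Un_disjoint) (use finH ne wH x(2) in auto)
      then show ?thesis using ne x(2) y(2) by (simp add: card_insert_if card_cartesian_product)
    qed
    have ET: "?E \<subseteq> ind A ?T" using ox iy yw True xF HF[THEN subsetD] HNU[THEN subsetD] NU by auto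
    have base: "pot A ?T \<le> rho B - 2 - 3 * int (card E1) + 2 * (int (pm B) - int (pm (ind A ?T)))"
      if "E1 \<subseteq> ind A ?T" "E1 \<inter> B = {}" "E1 \<inter> ?E = {}" for E1
    proof -
      have "finite E1" using finite_subset[OF that(1) mT] .
      then have "card (?E \<union> E1) = card ?E + card E1" by (intro card_Un_disjoint) (use finH that(3) in auto)
      moreover have "(?E \<union> E1) \<inter> B = {}" using EB that(2) by auto
      moreover have "pot A ?T \<le> rho B + 7 * int (card {y}) + 3 * int (card (B - A)) - 3 * int (card (?E \<union> E1))
          + 2 * (int (pm B) - int (pm (ind A ?T)))"
        by (rule add_pot[OF fin finB(1)]) (use FB ET that calculation(2) in auto)
      ultimately show ?thesis using cE cN by simp
    qed
    have mx: "pm (ind B (- {x})) \<le> pm (ind A ?T)" using mT Bx[of ?T] by (intro pm_mono) auto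
    have xw: "(x, w) \<in> B \<and> (w, x) \<in> B"
    proof (rule ccontr)
      assume "\<not> ?thesis"
      then obtain e where e: "e = (x, w) \<or> e = (w, x)" "e \<notin> B" by blast
      have "pot A ?T \<le> rho B - 2 - 3 * int (card {e}) + 2 * (int (pm B) - int (pm (ind A ?T)))"
      proof (rule base)
        have "(x, w) \<in> A" "(w, x) \<in> A" using ox wx by auto
        then show "{e} \<subseteq> ind A ?T" using e(1) xF True by auto
        show "{e} \<inter> B = {}" using e(2) by simp
        show "{e} \<inter> ?E = {}" using e(1) ne x(2) y(2) wH by auto
      qed
      then have "pot A ?T \<le> rho B - 5 + 2 * (int (pm B) - int (pm (ind A ?T)))" by simp
      moreover have "rho B \<le> 1" using trich cyc_basic[of B] wheel_basic[of B] by auto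
      ultimately have "pot A ?T \<le> -2" using loss mx by simp
      then show False using pot_neg[OF TV c2] by simp
    qed
    have mxw: "pm (ind B (- {x, w})) + 1 \<le> pm (ind A ?T)"
    proof (rule pm_edge[OF mT])
      show "ind B (- {x, w}) \<subseteq> ind A ?T"
        using Bx[of ?T] ind_mono[of B B "- {x, w}" "- {x}"] by blast
      show "(x, w) \<in> ind A ?T" "(w, x) \<in> ind A ?T" using ox wx xF True by auto
      show "x \<notin> Field (ind B (- {x, w}))" "w \<notin> Field (ind B (- {x, w}))"
        using Field_ind[of B "- {x, w}"] by auto
    qed
    have exl: "pm B \<le> pm (ind A ?T)" if ex: "cyc B \<or> wheel B"
    proof -
      obtain t where t: "t \<in> {x, w}" "pm B \<le> pm (ind B (- {t}))" using exceptional_miss[OF ex] xw by blast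
      show ?thesis
      proof (cases "t = x")
        case True
        then show ?thesis using t mx by simp
      next
        case False
        then have "pm B \<le> pm (ind (ind B (- {w})) (- {x})) + 1"
          using t pm_del1[of "ind B (- {w})" x] finB(1) by (auto intro: order_trans)
        moreover have "ind (ind B (- {w})) (- {x}) = ind B (- {x, w})" by auto
        ultimately show ?thesis using mxw by simp
      qed
    qed
    have le: "pot A ?T \<le> rho B - 2 + 2 * (int (pm B) - int (pm (ind A ?T)))" using base[of "{}"] by simp
    have "cyc B"
    proof (rule ccontr)
      assume "\<not> cyc B"
      then have "pot A ?T \<le> -2" using trich le exl wheel_basic[of B] loss mx by auto
      then show False using pot_neg[OF TV c2] by simp
    qed
    have r1: "rho B = 1" using cyc_basic \<open>cyc B\<close> by blast
    then have "pot A ?T \<le> -1" using le exl \<open>cyc B\<close> by simp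
    then have TVeq: "?T = V" using pot_le3[OF TV c2] by simp
    have outy: "u = w \<or> u \<in> H" if "(y, u) \<in> A" for u
    proof (rule ccontr)
      assume no: "\<not> (u = w \<or> u \<in> H)"
      have "pot A ?T \<le> rho B - 2 - 3 * int (card {(y, u)}) + 2 * (int (pm B) - int (pm (ind A ?T)))"
        by (rule base) (use no that EB arcV TVeq ne x(2) y(2) noloop in auto)
      then have "pot A ?T \<le> -2" using r1 exl \<open>cyc B\<close> by simp
      then show False using pot_neg[OF TV c2] by simp
    qed
    have od: "outdeg B x = 2" by (rule cyc_outdeg[OF \<open>cyc B\<close> xF])
    obtain u' where u': "B `` {x} = {w, u'}" "w \<noteq> u'" using xw by (elim conjE) (rule outdeg2E[OF od])
    have "H \<subseteq> B `` {x}" unfolding H_def by auto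
    then have "H \<subseteq> {w, u'}" using u'(1) by simp
    then have "\<exists>u. H = {u}" using wH(1) \<open>H \<noteq> {}\<close> by auto
    then obtain u where u: "H = {u}" by blast
    have "(y, u) \<in> A" using u HNU NU by auto
    then have "A `` {y} = {u, w}" using outy yw u by auto
    then have "type1 A y u x w" unfolding type1_def using y u wH by auto
    then show False by (rule no_type1)
  next
    case False
    let ?T = "Field B \<union> {y, w}"
    have TV: "?T \<subseteq> V" using FB inV by blast
    have mT: "finite (ind A ?T)" using fin by simp
    have c2: "2 \<le> card ?T" using card_mono[of ?T "{x, y}"] finF xF ne by auto
    let ?E = "{(x, y)} \<union> dig y w \<union> dig x w \<union> {y} \<times> H"
    have "card ?E = card ({(x, y)} \<union> dig y w \<union> dig x w) + card ({y} \<times> H)"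
      by (rule card_Un_disjoint) (use finH ne wH x(2) y(2) in auto)
    then have cE: "card ?E = 5 + card H"
      using ne x(2) y(2) by (simp add: card_insert_if card_cartesian_product)
    have ET: "?E \<subseteq> ind A ?T" using ox iy yw wx xF HF[THEN subsetD] HNU[THEN subsetD] NU by auto
    have EB': "e \<notin> B" if "fst e = w \<or> snd e = w" for e
      using that False unfolding Field_def by (cases e) auto
    have "pot A ?T \<le> rho B + 7 * int (card {y, w}) + 3 * int (card (B - A)) - 3 * int (card ?E)
        + 2 * (int (pm B) - int (pm (ind A ?T)))"
    proof (rule add_pot[OF fin finB(1)])
      show "?E \<inter> B = {}" using EB EB' by auto
      show "{y, w} \<inter> Field B = {}" using FB False by auto
    qed (use ET in auto)
    then have le: "pot A ?T \<le> rho B - 1 + 2 * (int (pm B) - int (pm (ind A ?T)))"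
      using cE cN x(2) by simp
    have "pm (ind B (- {x})) + 1 \<le> pm (ind A ?T)"
    proof (rule pm_edge[OF mT])
      show "ind B (- {x}) \<subseteq> ind A ?T" by (rule Bx) auto
      show "(y, w) \<in> ind A ?T" "(w, y) \<in> ind A ?T" using yw iy by auto
      show "y \<notin> Field (ind B (- {x}))" "w \<notin> Field (ind B (- {x}))"
        using Field_ind[of B "- {x}"] FB False by auto
    qed
    then have "pot A ?T \<le> -2" using trich le loss cyc_pm_del[of B x] cyc_basic[of B] wheel_basic[of B] by auto
    then show False using pot_neg[OF TV c2] by simp
  qed
qed

lemma no_double_digon:
  assumes "low A x y w z" "(y, z) \<in> A" "(w, x) \<in> A"
  shows False
  using assms no_double_digon_distinct[of x y w z] no_double_digon_same[of x y w]
  unfolding low_def by (cases "w = z") auto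

end

section \<open>Cores of low arcs\<close>

lemma coreD:
  assumes "core A y z U J B"
  shows "cyc B \<or> wheel B" "crit B" "U \<subseteq> Field A" "Field B = U - {y}" "y \<in> U" "z \<in> U"
     "z \<noteq> y" "2 \<le> card J" "J = B `` {z}" "J = B\<inverse> `` {z}"
     "\<And>u. u \<in> J \<Longrightarrow> outdeg B u = 2" "\<And>u. u \<in> J \<Longrightarrow> indeg B u = 2"
     "card J = 2 \<Longrightarrow> (\<exists>u\<in>J. \<exists>v. v \<noteq> z \<and> (u, v) \<in> B \<and> (v, u) \<in> B)"
     "ind A U = (B - {z} \<times> J) \<union> {(z, y)} \<union> {y} \<times> J"
  using assms unfolding core_def by - (elim conjE, (assumption | blast))+

lemma core_arc:
  assumes "core A y z U J B" "a \<in> U" "b \<in> U"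
  shows "(a, b) \<in> A \<longleftrightarrow> (a, b) \<in> B \<and> a \<noteq> z \<or> a = z \<and> b = y \<or> a = y \<and> b \<in> J"
proof -
  note T = coreD[OF assms(1)]
  have "(a, b) \<in> A \<longleftrightarrow> (a, b) \<in> ind A U" using assms(2,3) by simp
  also have "\<dots> \<longleftrightarrow> (a, b) \<in> B \<and> (a, b) \<notin> {z} \<times> J \<or> a = z \<and> b = y \<or> a = y \<and> b \<in> J"
    unfolding T(14) by auto
  also have "\<dots> \<longleftrightarrow> (a, b) \<in> B \<and> a \<noteq> z \<or> a = z \<and> b = y \<or> a = y \<and> b \<in> J"
    using T(9) by auto
  finally show ?thesis .
qed

lemma core_J:
  assumes "core A y z U J B" "u \<in> J"
  shows "u \<in> U" "u \<noteq> y" "u \<noteq> z" "(z, u) \<in> B" "(u, z) \<in> B" "(u, z) \<in> A" "(y, u) \<in> A" "(z, u) \<notin> A"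
proof -
  note T = coreD[OF assms(1)]
  have irr: "irrefl B" using T(2) unfolding crit_def by blast
  show B: "(z, u) \<in> B" "(u, z) \<in> B" using assms(2) T(9,10) by auto
  then have "u \<in> Field B" unfolding Field_def by auto
  then show u: "u \<in> U" "u \<noteq> y" using T(4) by auto
  show "u \<noteq> z" using B irr unfolding irrefl_def by auto
  then show "(u, z) \<in> A" "(y, u) \<in> A" "(z, u) \<notin> A"
    using core_arc[OF assms(1) u(1) T(6)] core_arc[OF assms(1) T(5) u(1)] core_arc[OF assms(1) T(6) u(1)] B assms(2) u T(7) by auto
qed

lemma core_nbrs:
  assumes "core A y z U J B"
  shows "v \<in> U \<Longrightarrow> (z, v) \<in> A \<longleftrightarrow> v = y" "v \<in> U \<Longrightarrow> (v, y) \<in> A \<longleftrightarrow> v = z"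
    "v \<in> U \<Longrightarrow> (v, z) \<in> A \<longleftrightarrow> v \<in> J" "v \<in> U \<Longrightarrow> (y, v) \<in> A \<longleftrightarrow> v \<in> J"
proof -
  note T = coreD[OF assms(1)]
  have irr: "irrefl B" using T(2) unfolding crit_def by blast
  have yB: "(y, v) \<notin> B" "(v, y) \<notin> B" for v using T(4) unfolding Field_def by auto
  have J: "v \<in> J \<longleftrightarrow> (v, z) \<in> B" for v using T(10) by auto
  have zz: "(z, z) \<notin> B" using irr unfolding irrefl_def by auto
  show "v \<in> U \<Longrightarrow> (z, v) \<in> A \<longleftrightarrow> v = y" using core_arc[OF assms T(6)] T(7) by auto
  have "y \<notin> J" using J yB by auto
  then show "v \<in> U \<Longrightarrow> (v, y) \<in> A \<longleftrightarrow> v = z" using core_arc[OF assms _ T(5)] yB T(7) by auto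
  have "z \<notin> J" using J zz by auto
  then show "v \<in> U \<Longrightarrow> (v, z) \<in> A \<longleftrightarrow> v \<in> J" using core_arc[OF assms _ T(6)] yB T(7) J zz by auto
  show "v \<in> U \<Longrightarrow> (y, v) \<in> A \<longleftrightarrow> v \<in> J" using core_arc[OF assms T(5)] yB T(7) by auto
qed

text \<open>
  Removing the arc from z to u makes B colourable, and then u and z agree. Besides z, the vertex
  u has one in-neighbour and one out-neighbour in B; they have the opposite colour, since u
  could be recoloured otherwise.
\<close>

lemma core_colour:
  assumes "core A y z U J B" "u \<in> J"
  obtains c where "proper_col c (B - {(z, u)})" "c u = c z" "\<And>u'. u' \<in> J \<Longrightarrow> u' \<noteq> u \<Longrightarrow> c u' \<noteq> c z"
    "\<And>v. (u, v) \<in> B \<Longrightarrow> v \<noteq> z \<Longrightarrow> c v \<noteq> c u" "\<And>v. (v, u) \<in> B \<Longrightarrow> v \<noteq> z \<Longrightarrow> c v \<noteq> c u"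
proof -
  note T = coreD[OF assms(1)] and J = core_J[OF assms]
  have B: "irrefl B" "\<not> colourable B" "finite B" using T(2) unfolding crit_def by auto
  let ?B = "B - {(z, u)}"
  obtain c where c: "proper_col c ?B" using T(2) J(4) unfolding crit_def colourable_def by blast
  have nB: "\<not> proper_col c' B" for c' using B(2) unfolding colourable_def by blast
  have cu: "c u = c z"
  proof (rule ccontr)
    assume "c u \<noteq> c z"
    then have "mono_arcs c B = mono_arcs c ?B" by auto
    then show False using c nB[of c] unfolding proper_col_def by simp
  qed
  have flip: False if "(\<forall>v. (u, v) \<in> B \<longrightarrow> v \<noteq> z \<longrightarrow> c v = c u) \<or> (\<forall>v. (v, u) \<in> B \<longrightarrow> v \<noteq> z \<longrightarrow> c v = c u)"
  proof -
    let ?c = "c(u := \<not> c u)"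
    have pc: "proper_col ?c (ind B (- {u}))"
    proof -
      have "mono_arcs ?c (ind B (- {u})) \<subseteq> mono_arcs c ?B" by auto
      then show ?thesis using c acyclic_subset unfolding proper_col_def by blast
    qed
    have "(u, u) \<notin> B" using irreflD[OF B(1)] .
    then have di: "(\<forall>v. (u, v) \<in> B \<longrightarrow> ?c v \<noteq> ?c u) \<or> (\<forall>v. (v, u) \<in> B \<longrightarrow> ?c v \<noteq> ?c u)"
      using that
    proof (elim disjE)
      assume *: "\<forall>v. (u, v) \<in> B \<longrightarrow> v \<noteq> z \<longrightarrow> c v = c u"
      have "?c v \<noteq> ?c u" if "(u, v) \<in> B" for v
      proof -
        have "v \<noteq> u" using that \<open>(u, u) \<notin> B\<close> by auto
        moreover have "c v = c u" using * that cu by (cases "v = z") (simp, blast)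
        ultimately show ?thesis by simp
      qed
      then show ?thesis by blast
    next
      assume *: "\<forall>v. (v, u) \<in> B \<longrightarrow> v \<noteq> z \<longrightarrow> c v = c u"
      have "?c v \<noteq> ?c u" if "(v, u) \<in> B" for v
      proof -
        have "v \<noteq> u" using that \<open>(u, u) \<notin> B\<close> by auto
        moreover have "c v = c u" using * that cu by (cases "v = z") (simp, blast)
        ultimately show ?thesis by simp
      qed
      then show ?thesis by blast
    qed
    have "proper_col ?c B" by (rule proper_col_ignore[OF pc B(1) di])
    then show False using nB by blast
  qed
  have one_out: "v = v'" if "(u, v) \<in> B" "v \<noteq> z" "(u, v') \<in> B" "v' \<noteq> z" for v v'
  proof -
    obtain b where "B `` {u} = {z, b}" using outdeg2E[OF T(11)[OF assms(2)] J(5)] by metis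
    then show ?thesis using that by auto
  qed
  have one_in: "v = v'" if "(v, u) \<in> B" "v \<noteq> z" "(v', u) \<in> B" "v' \<noteq> z" for v v'
  proof -
    obtain b where "B\<inverse> `` {u} = {z, b}" using indeg2E[OF T(12)[OF assms(2)] J(4)] by metis
    then show ?thesis using that by auto
  qed
  show ?thesis
  proof (rule that[OF c cu])
    show "c u' \<noteq> c z" if "u' \<in> J" "u' \<noteq> u" for u'
      using proper_col_digon[OF c, of u' z] core_J[OF assms(1) that(1)] that(2) J(3) by auto
    show "c v \<noteq> c u" if "(u, v) \<in> B" "v \<noteq> z" for v using flip one_out[OF that] by metis
    show "c v \<noteq> c u" if "(v, u) \<in> B" "v \<noteq> z" for v using flip one_in[OF that] by metis
  qed
qed

lemma pm_no_digon_vertex: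
  assumes "finite G" "\<And>u. (u, v) \<in> G \<Longrightarrow> (v, u) \<notin> G"
  shows "pm G \<le> pm (ind G (- {v}))"
  using pm_rec_vertex[OF assms(1), of v] assms(2) by auto

text \<open>
  In a cycle all arcs at z are then missing in A. In a wheel, a maximum matching without the
  missing arcs loses an edge only if z is on the even side, and a digon at z that survives in A
  would restore this edge. So every digon at z has lost an arc.
\<close>

lemma exceptional_core:
  assumes ex: "cyc B \<or> wheel B" and N: "B - A = {z} \<times> H" "2 \<le> card H" "finite H"
    and w: "wheel B \<Longrightarrow> pm (ind A U) < pm B" and U: "Field B \<subseteq> U" "pm (ind B (- {z})) \<le> pm (ind A U)" "finite A"
  shows "H = B `` {z}" "H = B\<inverse> `` {z}" "\<forall>u\<in>H. outdeg B u = 2 \<and> indeg B u = 2"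
    "card H = 2 \<longrightarrow> (\<exists>u\<in>H. \<exists>v. v \<noteq> z \<and> (u, v) \<in> B \<and> (v, u) \<in> B)"
proof -
  have finB: "finite B" using ex cyc_basic wheel_basic by blast
  have NA: "(a, b) \<in> A \<or> a = z \<and> b \<in> H" if "(a, b) \<in> B" for a b using that N(1) by blast
  have HB: "H \<subseteq> B `` {z}" using N(1) by auto
  have fo: "finite (B `` {z})" by (rule finite_nbrs(1)[OF finB])
  have "H \<noteq> {}" using N(2) by auto
  then have zF: "z \<in> Field B" using HB unfolding Field_def by auto
  have FH: "u \<in> Field B" if "u \<in> H" for u using that HB unfolding Field_def by auto
  have "H = B `` {z} \<and> H = B\<inverse> `` {z} \<and> (\<forall>u\<in>H. outdeg B u = 2 \<and> indeg B u = 2) \<and>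
    (card H = 2 \<longrightarrow> (\<exists>u\<in>H. \<exists>v. v \<noteq> z \<and> (u, v) \<in> B \<and> (v, u) \<in> B))"
    using ex
  proof
    assume c: "cyc B"
    have "card (B `` {z}) = 2" using cyc_outdeg[OF c zF] unfolding outdeg_def .
    then have 1: "H = B `` {z}" using HB N(2) fo by (intro card_seteq) auto
    moreover have "B `` {z} = B\<inverse> `` {z}" using cyc_basic[OF c] by simp
    moreover have d: "\<forall>u\<in>H. outdeg B u = 2 \<and> indeg B u = 2" using cyc_outdeg[OF c] cyc_indeg[OF c] FH by blast
    moreover have "\<exists>u\<in>H. \<exists>v. v \<noteq> z \<and> (u, v) \<in> B \<and> (v, u) \<in> B"
    proof -
      obtain u where u: "u \<in> H" using \<open>H \<noteq> {}\<close> by blast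
      then have "(u, z) \<in> B" using HB cyc_digon[OF c] by blast
      moreover have "outdeg B u = 2" using d u by blast
      ultimately obtain v where "B `` {u} = {z, v}" "z \<noteq> v" using outdeg2E by metis
      then have "v \<noteq> z" "(u, v) \<in> B" by auto
      then show ?thesis using u cyc_digon[OF c] by blast
    qed
    ultimately show ?thesis by simp
  next
    assume wh: "wheel B"
    then obtain E where E: "even_side B E" using wheel_basic by blast
    note ED = even_sideD[OF E]
    have pmE: "pm B \<le> card E" by (rule pm_even_side[OF E finB])
    have zE: "z \<in> E"
    proof (rule ccontr)
      assume "z \<notin> E"
      then have "card E \<le> pm (ind B (- {z}))" using ED(3)[OF zF] by blast
      then show False using pmE U(2) w[OF wh] by simp
    qed
    have sym: "B `` {z} = B\<inverse> `` {z}" by (rule ED(4)[OF zE])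
    have nE: "u \<notin> E \<and> u \<in> Field B" if "(z, u) \<in> B" for u
    proof -
      have "(u, z) \<in> B" using that sym by blast
      then show ?thesis using ED(2)[OF that] zE that unfolding Field_def by auto
    qed
    have zz: "(z, z) \<notin> B" using nE[of z] zE by blast
    have "u \<in> H" if zu: "(z, u) \<in> B" for u
    proof (rule ccontr)
      assume "u \<notin> H"
      then have r: "(z, u) \<in> A" "u \<noteq> z" using NA[OF zu] zu zz by auto
      have uz: "(u, z) \<in> B" using zu sym by blast
      then have r2: "(u, z) \<in> A" using NA[OF uz] r(2) by auto
      have "pm B \<le> pm (ind B (- {u}))" using pmE ED(3)[of u] nE[OF zu] by simp
      also have "\<dots> \<le> pm (ind (ind B (- {u})) (- {z})) + 1" by (rule pm_del1) (use finB in simp)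
      also have "ind (ind B (- {u})) (- {z}) = ind B (- {u, z})" by auto
      also have "pm (ind B (- {u, z})) + 1 \<le> pm (ind A U)"
      proof (rule pm_edge)
        show "ind B (- {u, z}) \<subseteq> ind A U"
        proof (rule sub_indI)
          show "ind B (- {u, z}) \<subseteq> A" by (auto dest: NA)
          show "Field (ind B (- {u, z})) \<subseteq> U" using Field_ind[of B "- {u, z}"] U(1) by blast
        qed
        show "(u, z) \<in> ind A U" "(z, u) \<in> ind A U" using r r2 U(1) zF nE[OF zu] by auto
        show "u \<notin> Field (ind B (- {u, z}))" "z \<notin> Field (ind B (- {u, z}))"
          using Field_ind[of B "- {u, z}"] by auto
      qed (use U(3) in simp)
      finally show False using w[OF wh] by simp
    qed
    then have 1: "H = B `` {z}" using HB by auto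
    moreover have "\<forall>u\<in>H. outdeg B u = 2 \<and> indeg B u = 2"
      using nE ED(3) HB by blast
    moreover have "\<exists>u\<in>H. \<exists>v. v \<noteq> z \<and> (u, v) \<in> B \<and> (v, u) \<in> B" if "card H = 2"
    proof -
      have "outdeg B z = 2" using that 1 unfolding outdeg_def by simp
      then obtain u v where "(z, u) \<in> B" "(u, v) \<in> B" "(v, u) \<in> B" "v \<noteq> z" using ED(5)[OF zE] by blast
      then show ?thesis using 1 by blast
    qed
    ultimately show ?thesis using sym by simp
  qed
  then show "H = B `` {z}" "H = B\<inverse> `` {z}" "\<forall>u\<in>H. outdeg B u = 2 \<and> indeg B u = 2"
    "card H = 2 \<longrightarrow> (\<exists>u\<in>H. \<exists>v. v \<noteq> z \<and> (u, v) \<in> B \<and> (v, u) \<in> B)" by blast+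
qed

context minimal_counterexample
begin

text \<open>
  The only out-neighbours of z and in-neighbours of y are x, y and z, so y and z lie on no
  monochromatic cycle.
\<close>

lemma swap_colours:
  assumes c: "proper_col c (ind A (- {x}))" and yz: "c y \<noteq> c z" "y \<noteq> z" "x \<noteq> y" "x \<noteq> z"
    and z: "\<And>v. (z, v) \<in> A \<Longrightarrow> v = x \<or> v = y" and y: "\<And>v. (v, y) \<in> A \<Longrightarrow> v = x \<or> v = z"
  shows "proper_col (c(y := c z, z := c y)) (ind A (- {x}))"
proof -
  let ?c = "c(y := c z, z := c y)"
  have "proper_col ?c (ind (ind (ind A (- {x})) (- {z})) (- {y}))"
  proof -
    have "mono_arcs ?c (ind (ind (ind A (- {x})) (- {z})) (- {y})) \<subseteq> mono_arcs c (ind A (- {x}))" by auto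
    then show ?thesis using c acyclic_subset unfolding proper_col_def by blast
  qed
  then have "proper_col ?c (ind (ind A (- {x})) (- {z}))"
    by (rule proper_col_ignore[OF _ irrefl_ind[OF irrefl_ind[OF irr]]]) (use noloop yz in \<open>auto dest: y\<close>)
  then show ?thesis
    by (rule proper_col_ignore[OF _ irrefl_ind[OF irr]]) (use noloop yz in \<open>auto dest: z\<close>)
qed

text \<open>
  Delete x and y and let z take over the out-arcs of y. A colouring would extend to y with the
  colour of z, which \<open>low_colouring\<close> forbids. A critical part B uses at least two
  new arcs. Adding y to its vertices gives a set U of potential at most \<open>rho B +
  4\<close>, plus 2 for a lost matching edge. If U misses another vertex besides x, its
  potential is at least 5, so B is a cycle or a wheel and U is a core. Otherwise B cannot be
  exceptional, and the bounds are so tight that the degrees around x are determined.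
\<close>

lemma low_arc_core:
  assumes low: "low A x y w z" and yz: "(y, z) \<notin> A"
  shows "spanning_low A x y w \<or> (\<exists>U J B. tight_core A y z U J B \<and> x \<notin> U)"
proof -
  have x: "A `` {x} = {y, w}" "y \<noteq> w" and y: "A\<inverse> `` {y} = {x, z}" "x \<noteq> z"
    using low unfolding low_def by auto
  note ox = out2[OF x(1)] and iy = in2[OF y(1)]
  have ne: "x \<noteq> y" "z \<noteq> y" "w \<noteq> x" using ox iy noloop by metis+
  have inV: "x \<in> V" "y \<in> V" "w \<in> V" "z \<in> V" using ox iy arcV by metis+
  define NU where "NU = A `` {y} - {x}"
  have NU: "u \<in> NU \<longleftrightarrow> (y, u) \<in> A \<and> u \<noteq> x" for u unfolding NU_def by auto
  have nNU: "x \<notin> NU" "y \<notin> NU" "z \<notin> NU" using NU yz noloop by auto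
  have NUV: "NU \<subseteq> V" using NU arcV by blast
  let ?A = "ind A (- {x, y}) \<union> {z} \<times> NU"
  have nc: "\<not> colourable ?A"
  proof
    assume "colourable ?A"
    then obtain c where c: "proper_col c ?A" unfolding colourable_def by blast
    let ?G = "ind A (- {x})" and ?c = "c(y := c z)"
    have eq: "ind ?G (- {y}) = ind A (- {x, y})" by auto
    have sub: "proper_col c (ind ?G (- {y}))" unfolding eq using c by (rule proper_col_subset) simp
    have "proper_col ?c ?G"
    proof (rule ccontr)
      assume no: "\<not> proper_col ?c ?G"
      obtain a b where ab: "(y, a) \<in> ?G" "(b, y) \<in> ?G" "c a = c z" "c b = c z"
        "(a, b) \<in> (mono_arcs c (ind ?G (- {y})))\<^sup>*" using extend_or_path[OF irrefl_ind[OF irr] sub no] by blast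
      have "b = z" using ab(2) iy by auto
      have "(z, a) \<in> ?A" using ab(1) NU by auto
      moreover have "mono_arcs c (ind ?G (- {y})) \<subseteq> mono_arcs c ?A" by auto
      then have "(a, z) \<in> (mono_arcs c ?A)\<^sup>*" using ab(5) \<open>b = z\<close> rtrancl_mono by blast
      ultimately show False using proper_col_path[OF c, of a z] ab(3) by simp
    qed
    then show False using low_colouring(2)[OF x(1) y(1), of ?c] ne by simp
  qed
  have "finite ?A" using fin finite_subset[OF NUV finV] by simp
  moreover have "irrefl ?A" using noloop nNU unfolding irrefl_def by auto
  ultimately obtain B where B: "B \<subseteq> ?A" "crit B" using nc by (rule crit_subE)
  have FA: "Field ?A \<subseteq> V - {x, y}"
  proof -
    have "Field ({z} \<times> NU) \<subseteq> insert z NU" unfolding Field_def by auto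
    then show ?thesis using Field_ind[of A "- {x, y}"] NUV nNU inV ne y(2) unfolding Field_Un by blast
  qed
  then have FB: "Field B \<subseteq> V - {x, y}" using mono_Field[OF B(1)] by blast
  have finB: "finite B" "irrefl B" "\<not> colourable B" using critD[OF B(2)] by auto
  have finF: "finite (Field B)" using finB(1) finite_Field by blast
  have "card (Field B) \<le> card (V - {x, y})" by (rule card_mono) (use finV FB in auto)
  then have cardF: "card (Field B) + 2 \<le> card V"
    using inV ne finV card_mono[of V "{x, y}"] by (simp add: card_Diff_subset)
  then have small: "card (Field B) < card V" by simp
  note trich = IH[OF B(2) small]
  define H where "H = {u. (z, u) \<in> B - A}"
  have N: "B - A = {z} \<times> H" using B(1) unfolding H_def by auto
  then have NA: "(a, b) \<in> A \<or> a = z \<and> b \<in> H" if "(a, b) \<in> B" for a b using that by blast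
  have HNU: "H \<subseteq> NU" using B(1) unfolding H_def by auto
  have finH: "finite H" by (rule finite_subset[OF HNU finite_subset[OF NUV finV]])
  have H2: "2 \<le> card H"
  proof (rule ccontr)
    assume "\<not> 2 \<le> card H"
    then have "\<forall>a\<in>H. \<forall>b\<in>H. a = b" using card_le_Suc0_iff_eq[OF finH] by simp
    then obtain u where "H \<subseteq> {u}" by blast
    then have "B - A \<subseteq> {(z, u)}" using N by auto
    then have "cyc B \<and> pot A (Field B) = 4" using one_arc[OF B(2) small] FB by blast
    then show False using pot_ge5[of "Field B"] cyc_card3[of B] cardF FB by auto
  qed
  then have "H \<noteq> {}" by auto
  then have zF: "z \<in> Field B" using N unfolding Field_def by auto
  have HF: "H \<subseteq> Field B" using N unfolding Field_def by auto
  have cN: "card (B - A) = card H" unfolding N by (simp add: card_cartesian_product)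
  have yF: "y \<notin> Field B" "x \<notin> Field B" using FB by auto
  have EB: "e \<notin> B" if "fst e = y \<or> snd e = y" for e
    using that yF unfolding Field_def by (cases e) auto
  have nH: "x \<notin> H" "y \<notin> H" "z \<notin> H" using HNU nNU by auto
  let ?U = "Field B \<union> {y}"
  have UV: "?U \<subseteq> V - {x}" using FB inV ne by blast
  have xU: "x \<notin> ?U" using UV by blast
  have mU: "finite (ind A ?U)" using fin by simp
  have finU: "finite ?U" using finF by simp
  have Bz: "ind B (- {z}) \<subseteq> ind A ?U"
  proof (rule sub_indI)
    show "ind B (- {z}) \<subseteq> A" by (auto dest: NA)
    show "Field (ind B (- {z})) \<subseteq> ?U" using Field_ind[of B "- {z}"] by blast
  qed
  have mz: "pm (ind B (- {z})) \<le> pm (ind A ?U)" by (rule pm_mono[OF mU Bz])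
  have loss: "pm B \<le> pm (ind A ?U) + 1" using pm_del1[OF finB(1), of z] mz by simp
  let ?E = "{(z, y)} \<union> {y} \<times> H"
  have "card ?E = card {(z, y)} + card ({y} \<times> H)"
    by (rule card_Un_disjoint) (use finH ne in auto)
  then have cE: "card ?E = 1 + card H" by (simp add: card_cartesian_product)
  have EU: "?E \<subseteq> ind A ?U" using iy zF HF[THEN subsetD] HNU[THEN subsetD] NU by auto
  have base: "pot A ?U \<le> rho B + 4 - 3 * int (card E1) + 2 * (int (pm B) - int (pm (ind A ?U)))"
    if "E1 \<subseteq> ind A ?U" "E1 \<inter> B = {}" "E1 \<inter> ?E = {}" for E1
  proof -
    have "finite E1" using finite_subset[OF that(1) mU] .
    then have "card (?E \<union> E1) = card ?E + card E1" by (intro card_Un_disjoint) (use finH that(3) in auto)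
    moreover have "(?E \<union> E1) \<inter> B = {}" using EB that(2) by auto
    moreover have "pot A ?U \<le> rho B + 7 * int (card {y}) + 3 * int (card (B - A)) - 3 * int (card (?E \<union> E1))
        + 2 * (int (pm B) - int (pm (ind A ?U)))"
      by (rule add_pot[OF fin finB(1)]) (use yF EU that calculation(2) in auto)
    ultimately show ?thesis using cE cN by simp
  qed
  have exval: "rho B + 4 + 2 * (int (pm B) - int (pm (ind A ?U))) \<le> 5 \<and> (wheel B \<longrightarrow> pm (ind A ?U) \<ge> pm B \<longrightarrow>
       rho B + 4 + 2 * (int (pm B) - int (pm (ind A ?U))) \<le> 3)" if "cyc B \<or> wheel B"
    using that
  proof
    assume c: "cyc B"
    then have "pm B \<le> pm (ind A ?U)" "rho B = 1" using cyc_pm_del[OF c, of z] mz cyc_basic by auto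
    moreover have "\<not> wheel B" using wheel_basic[of B] calculation(2) by auto
    ultimately show ?thesis by simp
  next
    assume "wheel B"
    then show ?thesis using wheel_basic[of B] loss by auto
  qed
  have core: "core A y z ?U H B" if ex: "cyc B \<or> wheel B" and p4: "4 \<le> pot A ?U"
  proof -
    have none: "e \<in> B \<or> e \<in> ?E" if "e \<in> ind A ?U" for e
    proof (rule ccontr)
      assume no: "\<not> (e \<in> B \<or> e \<in> ?E)"
      have "pot A ?U \<le> rho B + 4 - 3 * int (card {e}) + 2 * (int (pm B) - int (pm (ind A ?U)))"
        by (rule base) (use no that in auto)
      then show False using exval[OF ex] p4 by simp
    qed
    have w: "pm (ind A ?U) < pm B" if "wheel B"
      using exval[OF ex] that p4 base[of "{}"] by (cases "pm B \<le> pm (ind A ?U)") auto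
    note S = exceptional_core[OF ex N H2 finH w _ mz fin]
    have HB: "H = B `` {z}" "H = B\<inverse> `` {z}" "\<forall>u\<in>H. outdeg B u = 2 \<and> indeg B u = 2"
      "card H = 2 \<longrightarrow> (\<exists>u\<in>H. \<exists>v. v \<noteq> z \<and> (u, v) \<in> B \<and> (v, u) \<in> B)"
      using S by auto
    have "ind A ?U = (B - {z} \<times> H) \<union> {(z, y)} \<union> {y} \<times> H"
    proof
      show "ind A ?U \<subseteq> (B - {z} \<times> H) \<union> {(z, y)} \<union> {y} \<times> H"
      proof
        fix e assume e: "e \<in> ind A ?U"
        then have "e \<in> A" using ind_subset by blast
        then have "e \<notin> {z} \<times> H" using N by blast
        then show "e \<in> (B - {z} \<times> H) \<union> {(z, y)} \<union> {y} \<times> H" using none[OF e] by blast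
      qed
      have "B - {z} \<times> H \<subseteq> ind A ?U"
      proof (rule sub_indI)
        show "B - {z} \<times> H \<subseteq> A" using N by blast
        show "Field (B - {z} \<times> H) \<subseteq> ?U" using mono_Field[of "B - {z} \<times> H" B] by blast
      qed
      then show "(B - {z} \<times> H) \<union> {(z, y)} \<union> {y} \<times> H \<subseteq> ind A ?U" using EU by blast
    qed
    moreover have "?U \<subseteq> V" using UV by blast
    moreover have "Field B = ?U - {y}" using yF by auto
    ultimately show ?thesis unfolding core_def
      by (intro conjI) (use ex B(2) HB H2 zF ne in auto)
  qed
  have c3: "3 \<le> card ?U"
  proof -
    have "card (insert y (insert z H)) = card H + 2" using finH nH ne by simp
    moreover have "card (insert y (insert z H)) \<le> card ?U" using finU HF zF by (intro card_mono) auto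
    ultimately show ?thesis using H2 by simp
  qed
  have le: "pot A ?U \<le> rho B + 4 + 2 * (int (pm B) - int (pm (ind A ?U)))" using base[of "{}"] by simp
  show ?thesis
  proof (cases "card ?U + 2 \<le> card V")
    case True
    then have p5: "5 \<le> pot A ?U" using pot_ge5[of ?U] UV c3 by blast
    have ex: "cyc B \<or> wheel B"
    proof (rule ccontr)
      assume "\<not> (cyc B \<or> wheel B)"
      then show False using trich p5 le loss by auto
    qed
    have "pot A ?U = 5" using p5 le exval[OF ex] by simp
    then have "tight_core A y z ?U H B" using core[OF ex] True unfolding tight_core_def by simp
    then show ?thesis using xU by blast
  next
    case False
    have "card (V - {x}) \<le> card ?U" using False inV(1) finV by simp
    then have Ueq: "?U = V - {x}" using card_seteq[OF _ UV] finV by auto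
    then have Uin: "v \<in> ?U \<longleftrightarrow> v \<in> V \<and> v \<noteq> x" for v by auto
    have VU: "?U \<union> {x} = V" using Ueq inV by auto
    define Ax where "Ax = {x} \<times> A `` {x} \<union> A\<inverse> `` {x} \<times> {x}"
    have cAx: "card Ax = 2 + indeg A x"
    proof -
      have "card Ax = card ({x} \<times> A `` {x}) + card (A\<inverse> `` {x} \<times> {x})"
        unfolding Ax_def by (rule card_Un_disjoint) (use finite_nbrs[OF fin] noloop in auto)
      then show ?thesis using x unfolding indeg_def by (simp add: card_cartesian_product)
    qed
    have ext: "-1 \<le> pot A ?U + 7 - 3 * (2 + int (indeg A x)) - 2 * int m"
      if "pm (ind A ?U) + m \<le> pm A" for m
    proof -
      have "pot A (?U \<union> {x}) \<le> pot A ?U + 7 * int (card {x}) - 3 * int (card Ax) - 2 * int m"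
      proof (rule pot_add[OF fin finU])
        show "{x} \<inter> ?U = {}" using xU by blast
        show "Ax \<subseteq> ind A (?U \<union> {x})" unfolding VU Ax_def using arcV by auto
        show "Ax \<inter> ind A ?U = {}" unfolding Ax_def using xU by auto
        show "pm (ind A ?U) + m \<le> pm (ind A (?U \<union> {x}))" unfolding VU using that by (simp add: ind_Field)
      qed simp
      then show ?thesis unfolding VU pot_Field cAx using rho by simp
    qed
    have in2x: "2 \<le> indeg A x" by (rule crit_indeg[OF crit inV(1)])
    have p4: "4 \<le> pot A ?U" using ext[of 0] in2x pm_mono[OF fin ind_subset, of ?U] by simp
    have gain: False if "(x, v) \<in> A" "(v, x) \<in> A" and nod: "\<And>u. u \<in> ?U \<Longrightarrow> (u, v) \<in> A \<Longrightarrow> (v, u) \<notin> A"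
      and le5: "pot A ?U \<le> 5" for v
    proof -
      have "pm (ind A ?U) \<le> pm (ind (ind A ?U) (- {v}))"
        by (rule pm_no_digon_vertex[OF mU]) (use nod in auto)
      moreover have "pm (ind (ind A ?U) (- {v})) + 1 \<le> pm A"
      proof (rule pm_edge[OF fin _ that(1,2)])
        show "ind (ind A ?U) (- {v}) \<subseteq> A" by auto
        show "x \<notin> Field (ind (ind A ?U) (- {v}))" "v \<notin> Field (ind (ind A ?U) (- {v}))"
          using Field_ind[of "ind A ?U" "- {v}"] Field_ind[of A ?U] xU by auto
      qed
      ultimately have "pm (ind A ?U) + 1 \<le> pm A" by simp
      then show False using ext[of 1] in2x le5 by simp
    qed
    obtain c where c: "proper_col c (ind A (- {x}))"
      using crit_del[OF crit inV(1)] unfolding colourable_def by blast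
    \<comment> \<open>exchanging the colours of y and z keeps the colouring proper, but y and w differ before and after\<close>
    have nex: "\<not> (cyc B \<or> wheel B)"
    proof
      assume ex: "cyc B \<or> wheel B"
      have T: "core A y z ?U H B" by (rule core[OF ex p4])
      note nb = core_nbrs[OF T]
      have zout: "v = x \<or> v = y" if "(z, v) \<in> A" for v
        using nb(1)[of v] that arcV[OF that] Uin[of v] by blast
      have cs: "proper_col (c(y := c z, z := c y)) (ind A (- {x}))"
        by (rule swap_colours[OF c]) (use low_colouring(2)[OF x(1) y(1) c] ne y(2) zout iy in auto)
      have "w = z"
      proof (rule ccontr)
        assume "w \<noteq> z"
        then show False
          using low_colouring(1)[OF x(1) y(1) cs] low_colouring(1)[OF x(1) y(1) c]
            low_colouring(2)[OF x(1) y(1) c] x(2) ne by auto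
      qed
      then have "(x, z) \<in> A" using ox by simp
      moreover obtain v where "(z, v) \<in> A" "v \<noteq> y" using out_ex[OF inV(4)] by blast
      then have "(z, x) \<in> A" using zout by auto
      ultimately show False
      proof (rule gain)
        show "(z, u) \<notin> A" if "u \<in> ?U" "(u, z) \<in> A" for u
          using nb(1)[OF that(1)] that(2) yz by auto
        show "pot A ?U \<le> 5" using le exval[OF ex] by simp
      qed
    qed
    then have other: "rho B \<le> -2" using trich by blast
    then have le4: "pot A ?U \<le> 4" using le loss by simp
    have ix: "indeg A x = 2" using ext[of 0] le4 in2x pm_mono[OF fin ind_subset, of ?U] by simp
    have none: "e \<in> B \<or> e \<in> ?E" if "e \<in> ind A ?U" for e
    proof (rule ccontr)
      assume no: "\<not> (e \<in> B \<or> e \<in> ?E)"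
      have "pot A ?U \<le> rho B + 4 - 3 * int (card {e}) + 2 * (int (pm B) - int (pm (ind A ?U)))"
        by (rule base) (use no that in auto)
      then show False using p4 other loss by simp
    qed
    have nyx: "(y, x) \<notin> A"
    proof
      assume "(y, x) \<in> A"
      moreover have "(x, y) \<in> A" using ox by simp
      ultimately show False
        using gain[of y] iy yz le4 xU by fastforce
    qed
    have nwx: "(w, x) \<notin> A"
    proof
      assume wx: "(w, x) \<in> A"
      obtain s where s: "A\<inverse> `` {x} = {w, s}" "w \<noteq> s" using indeg2E[OF ix wx] by metis
      then have "(s, x) \<in> A" by auto
      then have "s \<noteq> y" using nyx by auto
      have "type1 A x y s w" unfolding type1_def using x s \<open>s \<noteq> y\<close> by auto
      then show False by (rule no_type1)
    qed
    have outs: "3 \<le> outdeg A s" if sx: "(s, x) \<in> A" for s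
    proof (cases "s = z")
      case False
      have "s \<noteq> y" using sx nyx by auto
      then have sF: "s \<in> Field B" using Uin[of s] arcV[OF sx] sx noloop by auto
      have "B `` {s} \<subseteq> A `` {s}" using False by (auto dest: NA)
      then have "insert x (B `` {s}) \<subseteq> A `` {s}" using sx by auto
      then have "card (insert x (B `` {s})) \<le> outdeg A s"
        unfolding outdeg_def by (intro card_mono finite_nbrs fin)
      moreover have "x \<notin> B `` {s}" using yF unfolding Field_def by auto
      moreover have "2 \<le> card (B `` {s})" using crit_outdeg[OF B(2) sF] unfolding outdeg_def .
      ultimately show ?thesis using finite_nbrs(1)[OF finB(1), of s] by simp
    next
      case True
      show ?thesis
      proof (rule ccontr)
        assume "\<not> 3 \<le> outdeg A s"
        then have "outdeg A z = 2" using crit_outdeg[OF crit inV(4)] True by simp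
        moreover have "(z, y) \<in> A" using iy by simp
        ultimately obtain v where v: "A `` {z} = {y, v}" using outdeg2E by metis
        then have "x = v" using sx True ne by auto
        have zout: "u = x \<or> u = y" if "(z, u) \<in> A" for u using that v \<open>x = v\<close> by auto
        have cs: "proper_col (c(y := c z, z := c y)) (ind A (- {x}))"
          by (rule swap_colours[OF c]) (use low_colouring(2)[OF x(1) y(1) c] ne y(2) zout iy in auto)
        have "w = z"
        proof (rule ccontr)
          assume "w \<noteq> z"
          then show False
            using low_colouring(1)[OF x(1) y(1) cs] low_colouring(1)[OF x(1) y(1) c]
              low_colouring(2)[OF x(1) y(1) c] x(2) ne by auto
        qed
        then show False using sx True nwx by simp
      qed
    qed
    have "3 \<le> indeg A w"
    proof -
      have wF: "w \<in> Field B" using Uin[of w] inV ne x(2) by auto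
      let ?I = "B\<inverse> `` {w}"
      have i2: "2 \<le> card ?I" using crit_indeg[OF B(2) wF] unfolding indeg_def .
      have fI: "finite ?I" by (rule finite_nbrs(2)[OF finB(1)])
      have xw: "(x, w) \<in> A" using ox by simp
      show ?thesis
      proof (cases "w \<in> H")
        case False
        then have "insert x ?I \<subseteq> A\<inverse> `` {w}" using xw by (auto dest: NA)
        then have "card (insert x ?I) \<le> indeg A w"
          unfolding indeg_def by (intro card_mono finite_nbrs fin)
        moreover have "x \<notin> ?I" using yF unfolding Field_def by auto
        ultimately show ?thesis using i2 fI by simp
      next
        case True
        then have "(y, w) \<in> A" using HNU NU by auto
        then have "insert x (insert y (?I - {z})) \<subseteq> A\<inverse> `` {w}" using xw by (auto dest: NA)
        then have "card (insert x (insert y (?I - {z}))) \<le> indeg A w"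
          unfolding indeg_def by (intro card_mono finite_nbrs fin)
        moreover have "x \<notin> ?I" "y \<notin> ?I" using yF unfolding Field_def by auto
        moreover have "card ?I \<le> card (?I - {z}) + 1"
          using card_Suc_Diff1[OF fI, of z] by (cases "z \<in> ?I") auto
        ultimately show ?thesis using i2 fI ne by simp
      qed
    qed
    then have "spanning_low A x y w" unfolding spanning_low_def using ix nwx nyx outs by blast
    then show ?thesis ..
  qed
qed

end

section \<open>Degrees around a core\<close>

text \<open>
  The colourings of a core obtained by removing one of its arcs at z.
\<close>

definition ucol :: "'a \<Rightarrow> 'a \<Rightarrow> 'a set \<Rightarrow> 'a rel \<Rightarrow> ('a \<Rightarrow> bool) \<Rightarrow> bool" where
  "ucol z u J B c \<longleftrightarrow> proper_col c (B - {(z, u)}) \<and> c u = c z \<and> (\<forall>u'\<in>J. u' \<noteq> u \<longrightarrow> c u' \<noteq> c z) \<and>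
    (\<forall>v. (u, v) \<in> B \<longrightarrow> v \<noteq> z \<longrightarrow> c v \<noteq> c u) \<and> (\<forall>v. (v, u) \<in> B \<longrightarrow> v \<noteq> z \<longrightarrow> c v \<noteq> c u)"

lemma ucol_ex: "core A y z U J B \<Longrightarrow> u \<in> J \<Longrightarrow> \<exists>c. ucol z u J B c"
  unfolding ucol_def by (rule core_colour) blast+

lemma ucolD:
  assumes "ucol z u J B c"
  shows "proper_col c (B - {(z, u)})" "c u = c z" "\<And>u'. u' \<in> J \<Longrightarrow> u' \<noteq> u \<Longrightarrow> c u' \<noteq> c z"
    "\<And>v. (u, v) \<in> B \<Longrightarrow> v \<noteq> z \<Longrightarrow> c v \<noteq> c u" "\<And>v. (v, u) \<in> B \<Longrightarrow> v \<noteq> z \<Longrightarrow> c v \<noteq> c u"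
  using assms unfolding ucol_def by blast+

context minimal_counterexample
begin

text \<open>
  The three arcs would lower the potential to 3.
\<close>

lemma tight_core_add3:
  assumes T: "tight_core A y z U J B" and v: "v \<in> V" "v \<notin> U" and E: "E \<subseteq> ind A (U \<union> {v})" "E \<inter> ind A U = {}" "card E = 3"
  shows False
proof -
  have U: "U \<subseteq> V" "card U + 2 \<le> card V" "pot A U = 5" using T unfolding tight_core_def core_def by auto
  have finU: "finite U" by (rule finite_subset[OF U(1) finV])
  have "pot A (U \<union> {v}) \<le> pot A U + 7 * int (card {v}) - 3 * int (card E) - 2 * int 0"
    by (rule pot_add[OF fin finU _ _ E(1,2)]) (use v in \<open>auto intro: pm_ind_mono[OF fin]\<close>)
  then have p3: "pot A (U \<union> {v}) \<le> 3" using U E(3) by simp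
  have c: "card (U \<union> {v}) = card U + 1" using v(2) finU by simp
  have sub: "U \<union> {v} \<subseteq> V" using U v by blast
  have "2 \<le> card (U \<union> {v})"
  proof -
    have "core A y z U J B" using T unfolding tight_core_def by blast
    then have "{y, z} \<subseteq> U" "y \<noteq> z" using coreD[of A y z U J B] by auto
    then have "card {y, z} \<le> card U" by (intro card_mono finU)
    then show ?thesis using c \<open>y \<noteq> z\<close> by simp
  qed
  then have "U \<union> {v} = V" using pot_le3[OF sub _ p3] by blast
  then show False using c U(2) by simp
qed

text \<open>
  Suppose that u has only two in-neighbours. Colour the core so that both of them differ from u.
  Fold the core onto u, y and z: the colour class of u, without z, becomes u and the other one
  becomes y, and y is joined to u and z by digons. The result is not colourable, because u may
  be ignored. By the usual estimates its critical part is a bidirected odd cycle through all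
  vertices outside the core, and this leads to a vertex of type 1 or to two adjacent vertices of
  type 2.
\<close>

lemma core_indeg:
  assumes T0: "tight_core A y z U J B" and uJ: "u \<in> J"
  shows "3 \<le> indeg A u"
proof (rule ccontr)
  assume low: "\<not> 3 \<le> indeg A u"
  have TC: "core A y z U J B" and cU: "card U + 2 \<le> card V" and p5: "pot A U = 5"
    using T0 unfolding tight_core_def by auto
  note T = coreD[OF TC] and uu = core_J[OF TC uJ] and nb = core_nbrs[OF TC]
  have UV: "U \<subseteq> V" by (rule T(3))
  have finU: "finite U" by (rule finite_subset[OF UV finV])
  have zy: "z \<noteq> y" "y \<noteq> z" using T(7) by auto
  have uV: "u \<in> V" using uu(1) UV by blast
  have iu: "indeg A u = 2" using low crit_indeg[OF crit uV] by simp
  obtain r where r: "B\<inverse> `` {u} = {z, r}" "z \<noteq> r" by (rule indeg2E[OF T(12)[OF uJ] uu(4)])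
  have ruB: "(r, u) \<in> B" using r by auto
  have rF: "r \<in> U" "r \<noteq> y" using ruB T(4) unfolding Field_def by auto
  have ruA: "(r, u) \<in> A" using core_arc[OF TC rF(1) uu(1)] ruB r(2) by auto
  obtain r' where "A\<inverse> `` {u} = {y, r'}" by (rule indeg2E[OF iu uu(7)])
  then have in_u0: "(v, u) \<in> A \<longleftrightarrow> v = y \<or> v = r'" for v by auto
  then have "r' = r" using ruA rF(2) by blast
  then have in_u: "v = y \<or> v = r" if "(v, u) \<in> A" for v using that in_u0 by blast
  obtain c where "ucol z u J B c" using ucol_ex[OF TC uJ] by blast
  note c = ucolD[OF this]
  have cr: "c r \<noteq> c z" using c(5)[OF ruB] r(2) c(2) by auto
  let ?cc = "c(y := \<not> c z)"
  have pcc: "proper_col ?cc (ind A U)"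
  proof (rule proper_col_ignore[where v = y])
    have "mono_arcs ?cc (ind (ind A U) (- {y})) \<subseteq> mono_arcs c (B - {(z, u)})"
    proof
      fix e assume e: "e \<in> mono_arcs ?cc (ind (ind A U) (- {y}))"
      obtain a b where ab: "e = (a, b)" by (cases e)
      then have *: "(a, b) \<in> A" "a \<in> U" "b \<in> U" "a \<noteq> y" "b \<noteq> y" "c a = c b" using e by auto
      then have "(a, b) \<in> B \<and> a \<noteq> z" using core_arc[OF TC *(2,3)] by auto
      then show "e \<in> mono_arcs c (B - {(z, u)})" using * ab by auto
    qed
    then show "proper_col ?cc (ind (ind A U) (- {y}))" using c(1) acyclic_subset unfolding proper_col_def by blast
    show "irrefl (ind A U)" by (rule irrefl_ind[OF irr])
    show "(\<forall>a. (y, a) \<in> ind A U \<longrightarrow> ?cc a \<noteq> ?cc y) \<or> (\<forall>a. (a, y) \<in> ind A U \<longrightarrow> ?cc a \<noteq> ?cc y)"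
      using nb(2) zy by auto
  qed
  \<comment> \<open>the vertex z is kept apart, so that its arcs to vertices outside the core are seen\<close>
  define f where "f v = (if v \<in> U then if v = z then z else if ?cc v = c z then u else y else v)" for v
  have fo: "f v = v" if "v \<notin> U" for v using that unfolding f_def by simp
  have fs: "f z = z" "f u = u" "f y = y" "f r = y"
    using T(5,6,7) uu rF cr c(2) r(2) zy unfolding f_def by auto
  have fU: "f v \<in> {u, y, z}" if "v \<in> U" for v using that unfolding f_def by auto
  have fz: "v = z" if "f v = z" for v using that uu zy T(6) unfolding f_def by (auto split: if_splits)
  have fcc: "?cc v = c z \<longleftrightarrow> f v = u" if "v \<in> U" "v \<noteq> z" for v
    using that uu unfolding f_def by (auto split: if_splits)
  let ?X = "{u, y, z}" and ?Y = "{u, y}"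
  let ?D = "dig u y \<union> dig z y"
  let ?G = "map_prod f f ` (A - ind A U) \<union> ?D"
  have uyz: "u \<noteq> y" "u \<noteq> z" "y \<noteq> u" "z \<noteq> u" using uu by auto
  have XU: "?X \<subseteq> U" using uu T(5,6) by auto
  have nc: "\<not> colourable ?G"
  proof
    assume "colourable ?G"
    then obtain k where k: "proper_col k ?G" unfolding colourable_def by blast
    have kuy: "k u \<noteq> k y" "k z \<noteq> k y" using proper_col_digon[OF k, of u y] proper_col_digon[OF k, of z y] by auto
    then have kzu: "k z = k u" by auto
    let ?k = "\<lambda>v. k (f v)"
    have "proper_col ?k (ind A (- {u}))"
      unfolding proper_col_def
    proof (rule acyclic_lex[where f = f])
      show "acyclic (mono_arcs k ?G)" using k unfolding proper_col_def .
      show "acyclic (mono_arcs ?cc (ind A U))" using pcc unfolding proper_col_def .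
      fix a b assume "(a, b) \<in> mono_arcs ?k (ind A (- {u}))"
      then have ab: "(a, b) \<in> A" "a \<noteq> u" "b \<noteq> u" "k (f a) = k (f b)" by auto
      show "(f a, f b) \<in> mono_arcs k ?G \<or> f a = f b \<and> (a, b) \<in> mono_arcs ?cc (ind A U)"
      proof (cases "a \<in> U \<and> b \<in> U")
        case False
        then have "(a, b) \<in> A - ind A U" using ab by auto
        then have "map_prod f f (a, b) \<in> ?G" by blast
        then show ?thesis using ab by simp
      next
        case True
        have az: "a \<noteq> z"
        proof
          assume "a = z"
          then have "b = y" using nb(1)[of b] ab True by auto
          then show False using ab(4) fs kuy \<open>a = z\<close> by simp
        qed
        have bz: "b \<noteq> z"
        proof
          assume "b = z"
          then have "a \<in> J" using nb(3)[of a] ab True by auto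
          then have "c a \<noteq> c z" "a \<noteq> y" using c(3)[OF _ ab(2)] core_J[OF TC] by auto
          then have "f a = y" using True az unfolding f_def by auto
          then show False using ab(4) fs kuy \<open>b = z\<close> by simp
        qed
        have "f a \<noteq> z" "f b \<noteq> z" using fz az bz by auto
        then have "f a = u \<or> f a = y" "f b = u \<or> f b = y" using fU True by auto
        then have "f a = f b" using ab(4) kuy by auto
        moreover from this have "?cc a = ?cc b" using fcc[of a] fcc[of b] True az bz by auto
        ultimately show ?thesis using ab True by auto
      qed
    qed
    then have "proper_col ?k A"
    proof (rule proper_col_ignore[OF _ irr])
      have "?k v \<noteq> ?k u" if "(v, u) \<in> A" for v using in_u[OF that] fs kuy by auto
      then show "(\<forall>a. (u, a) \<in> A \<longrightarrow> ?k a \<noteq> ?k u) \<or> (\<forall>a. (a, u) \<in> A \<longrightarrow> ?k a \<noteq> ?k u)" by blast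
    qed
    then show False using ncol unfolding colourable_def by blast
  qed
  have irrG: "irrefl ?G"
  proof -
    have "f a \<noteq> f b" if "(a, b) \<in> A" "\<not> (a \<in> U \<and> b \<in> U)" for a b
      using that fo[of a] fo[of b] fU[of a] fU[of b] XU noloop by (cases "a \<in> U"; cases "b \<in> U") auto
    then show ?thesis using uyz zy unfolding irrefl_def by auto
  qed
  have "finite ?G" using fin by simp
  then obtain B3 where B3: "B3 \<subseteq> ?G" "crit B3" using irrG nc by (rule crit_subE)
  interpret fo: folding A U f ?X B3 ?D
    by standard (use fin finU fo fU XU B3 in auto)
  have finB3: "finite B3" "irrefl B3" "\<not> colourable B3" using critD[OF B3(2)] by auto
  have W_sub: "Field B3 - ?X \<subseteq> V - U" by (rule fo.W_sub)
  have c4: "4 \<le> card U"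
  proof -
    have "J \<subseteq> U - {y, z}" using core_J[OF TC] by auto
    then have "card J \<le> card (U - {y, z})" by (intro card_mono) (use finU in auto)
    then show ?thesis using T(5-8) zy finU by (simp add: card_Diff_subset)
  qed
  have cVU: "card (V - U) = card V - card U" by (rule card_Diff_subset[OF finU UV])
  have small: "card (Field B3) < card V"
  proof -
    have "card (Field B3) \<le> card (?X \<union> (V - U))" by (rule card_mono) (use W_sub finV in auto)
    also have "\<dots> \<le> card ?X + card (V - U)" by (rule card_Un_le)
    finally have "card (Field B3) \<le> card ?X + card (V - U)" .
    moreover have "card ?X \<le> 3" by (simp add: card_insert_if)
    ultimately show ?thesis using c4 cVU cU by linarith
  qed
  note trich = IH[OF B3(2) small]
  let ?T = "U \<union> (Field B3 - ?X)" and ?I = "ind B3 ?X"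
  let ?Q = "ind A ?T - ind A U"
  have TV: "?T \<subseteq> V" using UV W_sub by blast
  have T2: "2 \<le> card ?T"
    using c4 card_mono[of ?T U] finU finite_Field[OF finB3(1)] by auto
  have pmz: "pm (ind A U) \<le> pm (ind A (U - {z}))"
  proof -
    have "pm (ind A U) \<le> pm (ind (ind A U) (- {z}))"
      by (rule pm_no_digon_vertex) (use fin nb(1) nb(2) core_nbrs(4)[OF TC T(6)] core_J(3)[OF TC, of z] in auto)
    also have "ind (ind A U) (- {z}) = ind A (U - {z})" by auto
    finally show ?thesis .
  qed
  have fY: "f v = v" if "f v \<notin> ?Y" for v using that unfolding f_def by (auto split: if_splits)
  have main: "pot A ?T + 3 * int (card ?Q) \<le> 5 + rho B3 - 7 * int (card (?X \<inter> Field B3)) + 3 * int (card ?I)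
      + 2 * int (pm B3) - 2 * int (pm (ind B3 (- ?Y))) + 3 * int (card (B3 - ?I))"
  proof -
    have D2: "a \<in> ?Y \<or> b \<in> ?Y" if "(a, b) \<in> ?D" for a b using that by auto
    have "?X - ?Y = {z}" using uyz zy by auto
    then show ?thesis using fo.fold_pot[OF _ fY D2] pmz p5 by auto
  qed
  have Qc: "card (B3 - ?I) \<le> card ?Q" by (rule fo.outer_card)
  have I_D: "?I \<subseteq> ?D"
  proof
    fix e assume e: "e \<in> ?I"
    obtain a b where ab: "e = (a, b)" by (cases e)
    then have *: "(a, b) \<in> B3" "a \<in> ?X" "b \<in> ?X" using e by auto
    show "e \<in> ?D"
    proof (rule ccontr)
      assume "e \<notin> ?D"
      then obtain a' b' where "(a', b') \<in> A" "a = f a'" "b = f b'" "\<not> (a' \<in> U \<and> b' \<in> U)"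
        using fo.lift[OF *(1)] ab by metis
      then show False using fo[of a'] fo[of b'] * XU by auto
    qed
  qed
  have cD: "card ?D = 4" using uyz zy by (simp add: card_insert_if)
  have cI: "card ?I \<le> 4" using card_mono[OF _ I_D] cD by simp
  have ind_F: "ind B3 (- (?Y \<inter> Field B3)) = ind B3 (- ?Y)" unfolding ind_def Field_def by auto
  have loss: "pm B3 \<le> pm (ind B3 (- ?Y)) + card (?Y \<inter> Field B3)"
    using pm_del[OF finB3(1), of "?Y \<inter> Field B3"] unfolding ind_F by simp
  have loss_ex: "pm B3 \<le> pm (ind B3 (- ?Y)) + 1" if ex: "cyc B3 \<or> wheel B3" and d: "dig u y \<subseteq> B3"
  proof -
    obtain t where t: "t \<in> ?Y" "pm B3 \<le> pm (ind B3 (- {t}))" using exceptional_miss[OF ex, of u y] d by auto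
    then obtain t' where t': "?Y = {t, t'}" by auto
    have "pm (ind B3 (- {t})) \<le> pm (ind (ind B3 (- {t})) (- {t'})) + 1" by (rule pm_del1) (use finB3 in simp)
    moreover have "ind (ind B3 (- {t})) (- {t'}) = ind B3 (- ?Y)" unfolding t' by auto
    ultimately show ?thesis using t(2) by simp
  qed
  have YF: "?Y \<inter> Field B3 \<noteq> {}"
  proof
    assume no: "?Y \<inter> Field B3 = {}"
    have "B3 \<subseteq> A"
    proof
      fix e assume e: "e \<in> B3"
      obtain a b where ab: "e = (a, b)" by (cases e)
      have "a \<in> Field B3" "b \<in> Field B3" using e ab unfolding Field_def by auto
      then have n: "a \<notin> ?Y" "b \<notin> ?Y" using no by auto
      then have "(a, b) \<notin> ?D" by auto
      then obtain a' b' where "(a', b') \<in> A" "a = f a'" "b = f b'"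
        using fo.lift[of a b] e ab by metis
      then show "e \<in> A" using fY[of a'] fY[of b'] n ab by auto
    qed
    then have "B3 = A" using sub_all finB3(3) by blast
    then show False using small by simp
  qed
  have r1: "rho B3 \<le> 1" using trich cyc_basic[of B3] wheel_basic[of B3] by auto
  have Icase: "e \<in> {(u, y), (y, u), (z, y), (y, z)} \<and> fst e \<in> Field B3 \<and> snd e \<in> Field B3" if "e \<in> ?I" for e
  proof
    show "e \<in> {(u, y), (y, u), (z, y), (y, z)}" using I_D that by blast
    have "e \<in> B3" using that ind_subset by blast
    then show "fst e \<in> Field B3 \<and> snd e \<in> Field B3" unfolding Field_def by (cases e) auto
  qed
  \<comment> \<open>the vertex z has an arc to a vertex outside the core\<close>
  obtain w' where w': "(z, w') \<in> A" "w' \<noteq> y" using out_ex[of z y] T(6) UV by blast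
  have w'U: "w' \<notin> U" using nb(1) w' by blast
  show False
  proof (cases "z \<in> Field B3")
    case zF: False
    have I2: "?I \<subseteq> dig u y"
    proof
      fix e assume "e \<in> ?I"
      from Icase[OF this] zF show "e \<in> dig u y" by auto
    qed
    have cXY: "?X \<inter> Field B3 = ?Y \<inter> Field B3" using zF by auto
    have val: "5 + rho B3 - 7 * int (card (?X \<inter> Field B3)) + 3 * int (card ?I)
        + 2 * int (pm B3) - 2 * int (pm (ind B3 (- ?Y))) \<le> 1"
    proof (cases "?Y \<subseteq> Field B3")
      case True
      then have c2: "card (?Y \<inter> Field B3) = 2" using uyz by (simp add: Int_absorb2)
      show ?thesis
      proof (cases "?I = dig u y")
        case d: True
        then have "card ?I = 2" using uyz by simp
        moreover have "dig u y \<subseteq> B3" using d ind_subset[of B3 ?X] by simp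
        ultimately show ?thesis using loss_ex loss c2 trich r1 unfolding cXY by auto
      next
        case False
        then have "card ?I < card (dig u y)" using I2 by (intro psubset_card_mono) auto
        then have "card ?I \<le> 1" using uyz by simp
        then show ?thesis using loss c2 r1 unfolding cXY by simp
      qed
    next
      case False
      have "?I = {}"
      proof (rule equals0I)
        fix e assume "e \<in> ?I"
        from Icase[OF this] zF False show False by auto
      qed
      moreover have "card (?Y \<inter> Field B3) = 1"
      proof -
        have "?Y \<inter> Field B3 = {u} \<or> ?Y \<inter> Field B3 = {y}" using False YF by auto
        then show ?thesis by auto
      qed
      ultimately show ?thesis using loss r1 unfolding cXY by simp
    qed
    then have "pot A ?T \<le> 1" using main Qc by linarith
    then have TVeq: "?T = V" using pot_le3[OF TV T2] by simp
    have zw: "(z, w') \<in> ?Q" unfolding TVeq using w' w'U arcV[OF w'(1)] by auto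
    have "B3 - ?I \<subseteq> map_prod f f ` (?Q - {(z, w')})"
    proof
      fix e assume e: "e \<in> B3 - ?I"
      from subsetD[OF fo.outer_image e] obtain q where q: "e = map_prod f f q" "q \<in> ?Q"
        by (rule imageE)
      have "q \<noteq> (z, w')"
      proof
        assume "q = (z, w')"
        then have "(z, f w') \<in> B3" using q e fs by auto
        then show False using zF unfolding Field_def by auto
      qed
      then have "q \<in> ?Q - {(z, w')}" using q(2) by blast
      then show "e \<in> map_prod f f ` (?Q - {(z, w')})" unfolding q(1) by (rule imageI)
    qed
    then have "card (B3 - ?I) \<le> card (?Q - {(z, w')})"
      using fin by (meson card_image_le card_mono finite_Diff finite_imageI finite_ind le_trans)
    moreover have "card (?Q - {(z, w')}) + 1 = card ?Q" using card_Suc_Diff1[OF _ zw] fin by simp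
    ultimately have "card (B3 - ?I) + 1 \<le> card ?Q" by simp
    then have "pot A ?T \<le> -2" using main val by linarith
    then show False using pot_neg[OF TV T2] by simp
  next
    case zF: True
    show False
    proof (cases "y \<in> Field B3")
      case False
      have "?I = {}"
      proof (rule equals0I)
        fix e assume "e \<in> ?I"
        from Icase[OF this] False show False by auto
      qed
      moreover have "?Y \<inter> Field B3 = {u}" using YF False by auto
      moreover from this have "?X \<inter> Field B3 = {u, z}" using zF False by auto
      ultimately have "pot A ?T \<le> -2" using main loss r1 Qc uyz by auto
      then show False using pot_neg[OF TV T2] by simp
    next
      case yF: True
      show False
      proof (cases "u \<in> Field B3")
        case False
        have "?I \<subseteq> dig z y"
        proof
          fix e assume "e \<in> ?I"
          from Icase[OF this] False show "e \<in> dig z y" by auto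
        qed
        then have "card ?I \<le> card (dig z y)" by (intro card_mono) auto
        then have "card ?I \<le> 2" using zy by simp
        moreover have "?Y \<inter> Field B3 = {y}" "?X \<inter> Field B3 = {y, z}" using yF zF False by auto
        moreover have "ind B3 (- ?Y) = ind B3 (- {y})" using ind_F calculation(2) by simp
        moreover have "cyc B3 \<Longrightarrow> pm B3 \<le> pm (ind B3 (- {y}))" by (rule cyc_pm_del)
        ultimately have "pot A ?T \<le> -2"
          using main loss trich cyc_basic[of B3] wheel_basic[of B3] Qc zy by auto
        then show False using pot_neg[OF TV T2] by simp
      next
        case uF: True
        have c3: "card (?X \<inter> Field B3) = 3"
        proof -
          have "?X \<inter> Field B3 = ?X" using uF yF zF by auto
          then show ?thesis using uyz zy by simp
        qed
        have c2: "card (?Y \<inter> Field B3) \<le> 2" using card_mono[of ?Y "?Y \<inter> Field B3"] uyz by simp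
        have key: "cyc B3 \<and> ?I = ?D"
        proof (rule ccontr)
          assume no: "\<not> (cyc B3 \<and> ?I = ?D)"
          have "pot A ?T \<le> -2"
          proof (cases "?I = ?D")
            case True
            then have "dig u y \<subseteq> B3" "card ?I = 4" using ind_subset[of B3 ?X] cD by auto
            then show ?thesis using no True main loss loss_ex trich wheel_basic[of B3] Qc c3 c2 by auto
          next
            case False
            then have "card ?I < card ?D" using I_D by (intro psubset_card_mono) auto
            then show ?thesis using main loss r1 Qc c3 c2 cD by auto
          qed
          then show False using pot_neg[OF TV T2] by simp
        qed
        then have cyc: "cyc B3" and I: "?I = ?D" by auto
        have d: "dig u y \<subseteq> B3" "dig z y \<subseteq> B3" using I ind_subset[of B3 ?X] by auto
        have l1: "pm B3 \<le> pm (ind B3 (- ?Y)) + 1" using loss_ex cyc d by blast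
        have cI4: "card ?I = 4" using I cD by simp
        have r1': "rho B3 = 1" using cyc_basic cyc by blast
        have m1: "pot A ?T + 3 * int (card ?Q) \<le> -1 + 3 * int (card (B3 - ?I))"
          using main l1 cI4 r1' c3 by auto
        then have "pot A ?T \<le> -1" using Qc by linarith
        then have TVeq: "?T = V" using pot_le3[OF TV T2] by simp
        then have "pot A ?T \<ge> -1" using rho pot_Field[of A] by simp
        then have Qle: "card ?Q \<le> card (B3 - ?I)" using m1 by linarith
        have QA: "?Q = A - ind A U" unfolding TVeq by (simp add: ind_Field)
        have im: "map_prod f f ` (A - ind A U) = B3 - ?I"
        proof (rule card_seteq[symmetric])
          show "finite (map_prod f f ` (A - ind A U))" using fin by simp
          show "B3 - ?I \<subseteq> map_prod f f ` (A - ind A U)" using fo.outer_image unfolding QA .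
          have "card (map_prod f f ` (A - ind A U)) \<le> card (A - ind A U)" using fin by (simp add: card_image_le)
          then show "card (map_prod f f ` (A - ind A U)) \<le> card (B3 - ?I)" using Qle unfolding QA by simp
        qed
        have inj: "inj_on (map_prod f f) (A - ind A U)"
          by (rule eq_card_imp_inj_on) (use fin im Qle Qc QA in auto)
        have WV: "Field B3 - ?X = V - U" using TVeq UV W_sub by blast
        \<comment> \<open>the cycle runs through u, y, z and then through at least two vertices outside the core\<close>
        obtain vs0 where "cyc_list vs0 B3" using cyc_imp_list[OF cyc] by blast
        moreover have "(y, u) \<in> B3" using d by auto
        ultimately obtain vs where vs: "cyc_list vs B3" "hd vs = y" "last vs = u"
          using cyc_list_edge by metis
        have dist: "distinct vs" and odd: "odd (length vs)" and l3: "3 \<le> length vs" using vs(1) unfolding cyc_list_def by auto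
        have FBvs: "Field B3 = set vs"
        proof -
          have "B3 = pd vs \<union> dig u y" using vs unfolding cyc_list_def by auto
          moreover have "u \<in> set vs" "y \<in> set vs" using vs l3 by (auto intro: hd_in_set last_in_set)
          ultimately show ?thesis using Field_pd[of vs] l3 by (auto simp: Field_Un)
        qed
        have "card (Field B3) = card (V - U) + card ?X"
        proof -
          have e: "Field B3 = (V - U) \<union> ?X" using WV uF yF zF by blast
          have disj: "(V - U) \<inter> ?X = {}" using XU by blast
          show ?thesis unfolding e by (rule card_Un_disjoint[OF _ _ disj]) (use finV in auto)
        qed
        then have "length vs = card (V - U) + 3" using FBvs distinct_card[OF dist] uyz zy by simp
        then have "5 \<le> length vs" using cVU cU by simp
        then obtain z' p p2 q r' where "vs = hd vs # z' # p # p2 # q # r'"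
          by (auto simp: numeral_eq_Suc Suc_le_length_iff)
        then have vs': "vs = y # z' # p # p2 # q # r'" using vs(2) by simp
        have lq: "last (q # r') = u" using vs(3) vs' by simp
        then have uq: "u \<in> set (q # r')" using last_in_set[of "q # r'"] by simp
        have "z' = z"
        proof -
          have "(y, z) \<in> B3" using d by auto
          then have "(y, z) \<in> pd vs" using vs uyz unfolding cyc_list_def by auto
          moreover have "(y, z) \<notin> pd (z' # p # p2 # q # r')" using pd_set[of y z "z' # p # p2 # q # r'"] dist vs' by auto
          ultimately show ?thesis using vs' by auto
        qed
        have rot: "cyc_list (z # p # p2 # q # r' @ [y]) B3"
          using cyc_list_rotate[of "[y]" "z # p # p2 # q # r'" B3] vs(1) vs' \<open>z' = z\<close> by simp
        have rot2: "cyc_list (p # p2 # q # r' @ [y, z]) B3"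
          using cyc_list_rotate[of "[z]" "p # p2 # q # r' @ [y]" B3] rot by simp
        have Bp: "B3 `` {p} = {z, p2}" using cyc_list_nbrs[of z p p2 "q # r' @ [y]" B3] rot by simp
        have Bp2: "B3 `` {p2} = {p, q}" using cyc_list_nbrs[of p p2 q "r' @ [y, z]" B3] rot2 by simp
        have Binv: "B3\<inverse> = B3" using cyc_basic cyc by blast
        have dp: "p \<noteq> u" "p \<noteq> y" "p \<noteq> z" "p2 \<noteq> u" "p2 \<noteq> y" "p2 \<noteq> z" "p \<noteq> q" "p \<noteq> p2" "z \<noteq> p2" "q \<noteq> y" "q \<noteq> z" "p2 \<noteq> q"
          using dist vs' \<open>z' = z\<close> uq by auto
        have out: "v \<notin> U" if "v \<in> set vs" "v \<noteq> u" "v \<noteq> y" "v \<noteq> z" for v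
          using that WV unfolding FBvs[symmetric] by blast
        have pU: "p \<notin> U" "p2 \<notin> U" using out[of p] out[of p2] dp vs' by auto
        have fw: "a = w" if "f a = w" "w \<notin> U" for a w
          using that fU[of a] XU fo[of a] by (cases "a \<in> U") auto
        note np = fold_nbrs[OF im inj pU(1) _ fo[OF pU(1)] fw[OF _ pU(1)]]
        note np2 = fold_nbrs[OF im inj pU(2) _ fo[OF pU(2)] fw[OF _ pU(2)]]
        have pX: "p \<notin> ?X" "p2 \<notin> ?X" using pU XU by auto
        have t2: "type2 A p p2 z"
        proof -
          have 1: "f ` (A `` {p}) = {z, p2}" using np(1)[OF pX(1)] Bp by simp
          have 2: "f ` (A\<inverse> `` {p}) = {z, p2}" using np(3)[OF pX(1)] Bp Binv by simp
          have "A `` {p} = {z, p2}"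
          proof -
            obtain g h where gh: "A `` {p} = {g, h}" "f g = z" "f h = p2"
              by (rule image_pair[OF 1 np(2)[OF pX(1)] dp(9)])
            have "g = z" "h = p2" using fz[OF gh(2)] fw[OF gh(3) pU(2)] by auto
            then show ?thesis using gh(1) by simp
          qed
          moreover have "A\<inverse> `` {p} = {z, p2}"
          proof -
            obtain g h where gh: "A\<inverse> `` {p} = {g, h}" "f g = z" "f h = p2"
              by (rule image_pair[OF 2 np(4)[OF pX(1)] dp(9)])
            have "g = z" "h = p2" using fz[OF gh(2)] fw[OF gh(3) pU(2)] by auto
            then show ?thesis using gh(1) by simp
          qed
          ultimately show ?thesis using dp unfolding type2_def by auto
        qed
        have 1: "f ` (A `` {p2}) = {p, q}" using np2(1)[OF pX(2)] Bp2 by simp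
        have 2: "f ` (A\<inverse> `` {p2}) = {p, q}" using np2(3)[OF pX(2)] Bp2 Binv by simp
        obtain b where b: "A `` {p2} = {b, p}" "f b = q"
        proof -
          obtain g h where gh: "A `` {p2} = {g, h}" "f g = p" "f h = q"
            by (rule image_pair[OF 1 np2(2)[OF pX(2)] dp(7)])
          have "g = p" by (rule fw[OF gh(2) pU(1)])
          then have "A `` {p2} = {h, p}" using gh(1) by auto
          then show ?thesis using gh(3) by (rule that)
        qed
        obtain a where a: "A\<inverse> `` {p2} = {a, p}" "f a = q"
        proof -
          obtain g h where gh: "A\<inverse> `` {p2} = {g, h}" "f g = p" "f h = q"
            by (rule image_pair[OF 2 np2(4)[OF pX(2)] dp(7)])
          have "g = p" by (rule fw[OF gh(2) pU(1)])
          then have "A\<inverse> `` {p2} = {h, p}" using gh(1) by auto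
          then show ?thesis using gh(3) by (rule that)
        qed
        have nep: "a \<noteq> p" "b \<noteq> p" using a(2) b(2) fo[OF pU(1)] dp by auto
        show False
        proof (cases "a = b")
          case True
          then have "type2 A p2 p b" using a(1) b(1) nep unfolding type2_def by auto
          then show False using no_adjacent_type2[OF t2] by blast
        next
          case False
          then have "type1 A p2 b a p" using a(1) b(1) nep unfolding type1_def by auto
          then show False by (rule no_type1)
        qed
      qed
    qed
  qed
qed

text \<open>
  If y and u have out-degree 2, then the core has a colouring in which y and u agree while the
  other out-neighbours of both have the opposite colour. Contracting it without the arc from x
  to y already gives a digraph that is not colourable, and this one arc decreases the potential
  by another three.
\<close>

lemma core_outdeg:
  assumes low: "low A x y w z" and T0: "tight_core A y z U J B" and xU: "x \<notin> U" and dy: "outdeg A y = 2" and uJ: "u \<in> J"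
  shows "3 \<le> outdeg A u"
proof (rule ccontr)
  assume nlow: "\<not> 3 \<le> outdeg A u"
  have TC: "core A y z U J B" and cU: "card U + 2 \<le> card V" and p5: "pot A U = 5"
    using T0 unfolding tight_core_def by auto
  note T = coreD[OF TC] and uu = core_J[OF TC uJ] and nb = core_nbrs[OF TC]
  have x: "A `` {x} = {y, w}" "y \<noteq> w" and y: "A\<inverse> `` {y} = {x, z}" "x \<noteq> z"
    using low unfolding low_def by auto
  note ox = out2[OF x(1)] and iy = in2[OF y(1)]
  have UV: "U \<subseteq> V" by (rule T(3))
  have finU: "finite U" by (rule finite_subset[OF UV finV])
  have zy: "z \<noteq> y" "y \<noteq> z" "x \<noteq> y" using T(5,7) xU by auto
  have uV: "u \<in> V" using uu(1) UV by blast
  have ou: "outdeg A u = 2" using nlow crit_outdeg[OF crit uV] by simp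
  have AyJ: "A `` {y} = J"
  proof -
    have "J \<subseteq> A `` {y}" using core_J(7)[OF TC] by auto
    then show ?thesis using dy T(8) finite_nbrs(1)[OF fin, of y] unfolding outdeg_def
      by (intro card_seteq[symmetric]) auto
  qed
  then have "outdeg A y = card J" unfolding outdeg_def by simp
  then have cJ: "card J = 2" using dy by simp
  then obtain u' where J: "J = {u, u'}" "u \<noteq> u'" using uJ by (auto simp: card_2_iff)
  have u'J: "u' \<in> J" using J by simp
  note uu' = core_J[OF TC u'J]
  obtain v where v: "B `` {u} = {z, v}" "z \<noteq> v" by (rule outdeg2E[OF T(11)[OF uJ] uu(5)])
  have uvB: "(u, v) \<in> B" using v by auto
  have vU: "v \<in> U" "v \<noteq> y" using uvB T(4) unfolding Field_def by auto
  have uvA: "(u, v) \<in> A" using core_arc[OF TC uu(1) vU(1)] uvB uu(3) by auto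
  obtain v' where v': "A `` {u} = {z, v'}" by (rule outdeg2E[OF ou uu(6)])
  then have out_u0: "(u, t) \<in> A \<longleftrightarrow> t = z \<or> t = v'" for t by auto
  then have "v' = v" using out_u0[of v] uvA v(2) by auto
  then have out_u: "t = z \<or> t = v" if "(u, t) \<in> A" for t using that out_u0 by blast
  have ovt: "t = y \<or> t = u \<or> t = u'" if "(y, t) \<in> A" for t using that AyJ J by auto
  obtain c where "ucol z u J B c" using ucol_ex[OF TC uJ] by blast
  note c = ucolD[OF this]
  have cv: "c v \<noteq> c z" using c(4)[OF uvB] v(2) c(2) by auto
  have cu': "c u' \<noteq> c z" using c(3)[OF u'J] J by auto
  let ?c = "c(y := c z, z := \<not> c z)"
  have pc: "proper_col ?c (ind A U)"
  proof (rule proper_col_ignore[where v = z])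
    show "irrefl (ind A U)" by (rule irrefl_ind[OF irr])
    show "(\<forall>a. (z, a) \<in> ind A U \<longrightarrow> ?c a \<noteq> ?c z) \<or> (\<forall>a. (a, z) \<in> ind A U \<longrightarrow> ?c a \<noteq> ?c z)"
      using nb(1) zy by auto
    show "proper_col ?c (ind (ind A U) (- {z}))"
    proof (rule proper_col_ignore[where v = y])
      show "irrefl (ind (ind A U) (- {z}))" by (rule irrefl_ind[OF irrefl_ind[OF irr]])
      show "(\<forall>a. (y, a) \<in> ind (ind A U) (- {z}) \<longrightarrow> ?c a \<noteq> ?c y) \<or>
        (\<forall>a. (a, y) \<in> ind (ind A U) (- {z}) \<longrightarrow> ?c a \<noteq> ?c y)"
        using nb(2) zy by auto
      have "mono_arcs ?c (ind (ind (ind A U) (- {z})) (- {y})) \<subseteq> mono_arcs c (B - {(z, u)})"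
      proof
        fix e assume e: "e \<in> mono_arcs ?c (ind (ind (ind A U) (- {z})) (- {y}))"
        obtain a b where ab: "e = (a, b)" by (cases e)
        then have *: "(a, b) \<in> A" "a \<in> U" "b \<in> U" "a \<noteq> y" "b \<noteq> y" "a \<noteq> z" "b \<noteq> z" "c a = c b" using e by auto
        then have "(a, b) \<in> B" using core_arc[OF TC *(2,3)] by auto
        then show "e \<in> mono_arcs c (B - {(z, u)})" using * ab by auto
      qed
      then show "proper_col ?c (ind (ind (ind A U) (- {z})) (- {y}))"
        using c(1) acyclic_subset unfolding proper_col_def by blast
    qed
  qed
  \<comment> \<open>the contraction may even leave out the arc from x to y: the only out-neighbour of y in its own colour is u, and u has no out-neighbour in that colour\<close>
  let ?A0 = "A - {(x, y)}"
  let ?x1 = z and ?x2 = u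
  define f where "f = cmap U ?c u z"
  have fU: "f a = (if ?c a then u else z)" if "a \<in> U" for a using that unfolding f_def cmap_def by simp
  have nc: "\<not> colourable (contr ?A0 U ?c u z)"
  proof
    assume "colourable (contr ?A0 U ?c u z)"
    then obtain k where k: "proper_col k (contr ?A0 U ?c u z)" unfolding colourable_def by blast
    have "(u, z) \<in> contr ?A0 U ?c u z" "(z, u) \<in> contr ?A0 U ?c u z" unfolding contr_def by auto
    then have kx: "k u \<noteq> k z" using proper_col_digon[OF k] by blast
    let ?k = "\<lambda>v. k (f v)"
    have kU: "?k a = ?k b \<longleftrightarrow> ?c a = ?c b" if "a \<in> U" "b \<in> U" for a b
      using fU[OF that(1)] fU[OF that(2)] kx by auto
    have pk0: "proper_col ?k ?A0"
      unfolding proper_col_def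
    proof (rule acyclic_lex[where f = f])
      show "acyclic (mono_arcs k (contr ?A0 U ?c u z))" using k unfolding proper_col_def .
      show "acyclic (mono_arcs ?c (ind A U))" using pc unfolding proper_col_def .
      fix a b assume "(a, b) \<in> mono_arcs ?k ?A0"
      then have ab: "(a, b) \<in> ?A0" "k (f a) = k (f b)" by auto
      show "(f a, f b) \<in> mono_arcs k (contr ?A0 U ?c u z) \<or> f a = f b \<and> (a, b) \<in> mono_arcs ?c (ind A U)"
      proof (cases "f a = f b")
        case True
        have "a \<noteq> b" using ab(1) noloop by auto
        then have "a \<in> U" "b \<in> U" using True uu(1) T(6) unfolding f_def cmap_def by (auto split: if_splits)
        moreover from this have "?c a = ?c b" using kU ab(2) by blast
        ultimately show ?thesis using ab True by auto
      next
        case False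
        then show ?thesis using ab contr_mem[OF ab(1)] unfolding f_def by simp
      qed
    qed
    have kyu': "?k u' \<noteq> ?k y" using kU[OF uu'(1) T(5)] cu' uu' zy by auto
    have kuz: "?k z \<noteq> ?k u" using kU[OF T(6) uu(1)] c(2) uu zy by auto
    have kuv: "?k v \<noteq> ?k u" using kU[OF vU(1) uu(1)] cv vU v(2) uu c(2) by auto
    have "proper_col ?k (ind (ind A (- {u})) (- {y}))"
      by (rule proper_col_subset[OF pk0]) auto
    then have "proper_col ?k (ind A (- {u}))"
    proof (rule proper_col_ignore[OF _ irrefl_ind[OF irr]])
      have "?k t \<noteq> ?k y" if "(y, t) \<in> ind A (- {u})" for t
        using ovt[of t] that kyu' noloop by auto
      then show "(\<forall>a. (y, a) \<in> ind A (- {u}) \<longrightarrow> ?k a \<noteq> ?k y) \<or> (\<forall>a. (a, y) \<in> ind A (- {u}) \<longrightarrow> ?k a \<noteq> ?k y)"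
        by blast
    qed
    then have "proper_col ?k A"
    proof (rule proper_col_ignore[OF _ irr])
      have "?k t \<noteq> ?k u" if "(u, t) \<in> A" for t using out_u[OF that] kuz kuv by auto
      then show "(\<forall>a. (u, a) \<in> A \<longrightarrow> ?k a \<noteq> ?k u) \<or> (\<forall>a. (a, u) \<in> A \<longrightarrow> ?k a \<noteq> ?k u)" by blast
    qed
    then show False using ncol unfolding colourable_def by blast
  qed
  have cU3: "3 \<le> card U"
  proof -
    have "card {y, z, u} \<le> card U" by (rule card_mono[OF finU]) (use T(5,6) uu in auto)
    then show ?thesis using uu zy by simp
  qed
  let ?X = "{u, z}"
  have cUlt: "card U < card V" using cU by simp
  obtain B3 where B3: "crit B3" "B3 \<subseteq> contr ?A0 U ?c u z" "Field B3 - ?X \<noteq> {}" "Field B3 - ?X \<subseteq> V - U"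
    "pot A (U \<union> (Field B3 - ?X)) + 3 * int (card (ind A (U \<union> (Field B3 - ?X)) - ind A U))
      \<le> pot A U + gain B3 ?X + 3 * int (card (B3 - ind B3 ?X))" "gain B3 ?X \<le> -5"
    "gain B3 ?X \<ge> -5 \<longrightarrow> cyc B3 \<and> (u, z) \<in> B3 \<and> (z, u) \<in> B3"
    by (rule contract_core[OF UV cU3 cUlt uu(1) T(6) uu(3) Diff_subset nc])
  let ?T = "U \<union> (Field B3 - ?X)"
  let ?Q = "ind A ?T - ind A U"
  have TV: "?T \<subseteq> V" using UV B3(4) by blast
  have T2: "2 \<le> card ?T"
    using card_mono[of ?T U] cU3 finite_subset[OF TV finV] by auto
  have f_eq: "f = cmap U ?c u z" unfolding f_def ..
  interpret fo: folding ?A0 U f ?X B3 "dig u z"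
    unfolding f_eq by (rule contr_folding[OF _ B3(2) uu(1) T(6) finU]) (use fin in simp)
  have sub: "B3 - ind B3 ?X \<subseteq> map_prod f f ` (?Q - {(x, y)})"
  proof -
    have "ind ?A0 ?T - ind ?A0 U \<subseteq> ?Q - {(x, y)}" by auto
    then show ?thesis using fo.outer_image by blast
  qed
  have le: "card (B3 - ind B3 ?X) \<le> card (?Q - {(x, y)})"
    using sub fin by (meson card_image_le card_mono finite_Diff finite_imageI finite_ind le_trans)
  also have "\<dots> \<le> card ?Q" using fin by (intro card_mono) auto
  finally have "pot A ?T \<le> 0" using B3(5,6) p5 by linarith
  then have TVeq: "?T = V" using pot_le3[OF TV T2] by simp
  have "(x, y) \<in> A" using ox by simp
  then have "(x, y) \<in> ?Q" unfolding TVeq using xU arcV[of x y] by auto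
  then have "card (?Q - {(x, y)}) + 1 = card ?Q" using card_Suc_Diff1[of ?Q "(x, y)"] fin by simp
  then have "card (B3 - ind B3 ?X) + 1 \<le> card ?Q" using le by simp
  then have "pot A ?T \<le> -3" using B3(5,6) p5 by linarith
  then show False using pot_neg[OF TV T2] by simp
qed

lemma low_arc_core_dual:
  assumes "low A x y w z" "(w, x) \<notin> A"
  shows "spanning_low (A\<inverse>) y x z \<or> (\<exists>U J B. tight_core (A\<inverse>) x w U J B \<and> y \<notin> U)"
  using minimal_counterexample.low_arc_core[OF minimal_counterexample_converse, of y x z w] assms by simp

text \<open>
  Delete y and let x take over its two out-arcs. The vertex z now has out-degree one, so it is
  not in a critical part B. If B is a cycle or wheel, then x is joined to both elements of J by
  digons, and x could be added to the core. Otherwise B with y has potential at most 4, so only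
  z is missing, and z has in-degree 2. Then the arc from z to y is low too, and its reversal has
  a core containing J, to which y could be added.
\<close>

lemma core_tail_outdeg:
  assumes low: "low A x y w z" and T0: "tight_core A y z U J B" and xU: "x \<notin> U" and dy: "outdeg A y = 2"
  shows "3 \<le> outdeg A z"
proof (rule ccontr)
  assume nlow: "\<not> 3 \<le> outdeg A z"
  have TC: "core A y z U J B" and cU: "card U + 2 \<le> card V" and p5: "pot A U = 5"
    using T0 unfolding tight_core_def by auto
  note T = coreD[OF TC] and nb = core_nbrs[OF TC]
  have x: "A `` {x} = {y, w}" "y \<noteq> w" and y: "A\<inverse> `` {y} = {x, z}" "x \<noteq> z"
    using low unfolding low_def by auto
  note ox = out2[OF x(1)] and iy = in2[OF y(1)]
  have UV: "U \<subseteq> V" by (rule T(3))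
  have inV: "x \<in> V" "y \<in> V" "z \<in> V" using ox iy arcV by metis+
  have zy: "z \<noteq> y" "y \<noteq> z" "x \<noteq> y" "y \<noteq> x" using T(5,7) xU by auto
  have oz: "outdeg A z = 2" using nlow crit_outdeg[OF crit inV(3)] by simp
  have AyJ: "A `` {y} = J"
  proof -
    have "J \<subseteq> A `` {y}" using core_J(7)[OF TC] by auto
    then show ?thesis using dy T(8) finite_nbrs(1)[OF fin, of y] unfolding outdeg_def
      by (intro card_seteq[symmetric]) auto
  qed
  then have "outdeg A y = card J" unfolding outdeg_def by simp
  then have cJ: "card J = 2" using dy by simp
  then obtain u1 u2 where J: "J = {u1, u2}" "u1 \<noteq> u2" by (auto simp: card_2_iff)
  have uJ: "u1 \<in> J" "u2 \<in> J" using J by auto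
  note U1 = core_J[OF TC uJ(1)] and U2 = core_J[OF TC uJ(2)]
  have xJ: "x \<notin> J" "y \<notin> J" "z \<notin> J" using core_J[OF TC] xU by auto
  have zyA: "(z, y) \<in> A" using iy by simp
  obtain v where v: "A `` {z} = {y, v}" "y \<noteq> v" by (rule outdeg2E[OF oz zyA])
  have vU: "v \<notin> U" using nb(1)[of v] v by auto
  let ?A = "ind A (- {y}) \<union> {x} \<times> J"
  have nc: "\<not> colourable ?A"
  proof
    assume "colourable ?A"
    then obtain c where c: "proper_col c ?A" unfolding colourable_def by blast
    have sub: "proper_col c (ind A (- {y}))" using c by (rule proper_col_subset) simp
    obtain k where k: "\<And>b. (b, y) \<in> A \<Longrightarrow> c b = k \<Longrightarrow> b = x"
      using iy by (cases "c z = c x") (metis (full_types))+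
    obtain a b where ab: "(y, a) \<in> A" "(b, y) \<in> A" "c a = k" "c b = k"
      "(a, b) \<in> (mono_arcs c (ind A (- {y})))\<^sup>*" using blocked[OF ncol irr sub, of k] by blast
    have "b = x" using ab(2,4) k by blast
    have "a \<in> J" using ab(1) AyJ by auto
    then have "(x, a) \<in> ?A" by simp
    moreover have "mono_arcs c (ind A (- {y})) \<subseteq> mono_arcs c ?A" by auto
    then have "(a, x) \<in> (mono_arcs c ?A)\<^sup>*" using ab(5) \<open>b = x\<close> rtrancl_mono by blast
    ultimately show False using proper_col_path[OF c, of a x] ab(3,4) \<open>b = x\<close> by simp
  qed
  have finJ: "finite J" using J by simp
  have "finite ?A" using fin finJ by simp
  moreover have "irrefl ?A" using noloop xJ unfolding irrefl_def by auto
  ultimately obtain B2 where B: "B2 \<subseteq> ?A" "crit B2" using nc by (rule crit_subE)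
  have JV: "J \<subseteq> V" using J U1(1) U2(1) UV by auto
  have FA: "Field ?A \<subseteq> V - {y}"
  proof -
    have "Field ({x} \<times> J) \<subseteq> insert x J" unfolding Field_def by auto
    then show ?thesis using Field_ind[of A "- {y}"] JV xJ inV zy unfolding Field_Un by blast
  qed
  have zF: "z \<notin> Field B2"
  proof
    assume "z \<in> Field B2"
    then have "2 \<le> card (B2 `` {z})" using crit_outdeg[OF B(2)] unfolding outdeg_def by blast
    moreover have "B2 `` {z} \<subseteq> {v}"
    proof
      fix u assume "u \<in> B2 `` {z}"
      then have "(z, u) \<in> ?A" using B(1) by auto
      then have "(z, u) \<in> A" "u \<noteq> y" using y(2) by auto
      then show "u \<in> {v}" using v(1) by auto
    qed
    then have "card (B2 `` {z}) \<le> card {v}" by (intro card_mono) auto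
    ultimately show False by simp
  qed
  have FB: "Field B2 \<subseteq> V - {y, z}" using mono_Field[OF B(1)] FA zF by blast
  have finB: "finite B2" "irrefl B2" "\<not> colourable B2" using critD[OF B(2)] by auto
  have finF: "finite (Field B2)" using finB(1) finite_Field by blast
  have "card (Field B2) \<le> card (V - {y, z})" by (rule card_mono) (use finV FB in auto)
  then have cardF: "card (Field B2) + 2 \<le> card V"
    using inV zy finV card_mono[of V "{y, z}"] by (simp add: card_Diff_subset)
  then have small: "card (Field B2) < card V" by simp
  note trich = IH[OF B(2) small]
  have two: "(x, u1) \<in> B2" "(x, u1) \<notin> A" "(x, u2) \<in> B2" "(x, u2) \<notin> A"
  proof -
    have no: False if one: "B2 - A \<subseteq> {(x, u)}" for u
    proof -
      have FV: "Field B2 \<subseteq> V" using FB by blast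
      have "cyc B2 \<and> pot A (Field B2) = 4" using one_arc[OF B(2) small FV one] by simp
      then show False using pot_ge5[of "Field B2"] cyc_card3[of B2] cardF FB by auto
    qed
    have sub: "B2 - A \<subseteq> {(x, u1), (x, u2)}"
    proof
      fix e assume e: "e \<in> B2 - A"
      then have "e \<in> {x} \<times> J" using B(1) ind_subset by blast
      then show "e \<in> {(x, u1), (x, u2)}" unfolding J(1) by auto
    qed
    have "(x, u1) \<in> B2 - A"
    proof (rule ccontr)
      assume "(x, u1) \<notin> B2 - A"
      then have "B2 - A \<subseteq> {(x, u2)}" using sub by auto
      then show False by (rule no)
    qed
    moreover have "(x, u2) \<in> B2 - A"
    proof (rule ccontr)
      assume "(x, u2) \<notin> B2 - A"
      then have "B2 - A \<subseteq> {(x, u1)}" using sub by auto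
      then show False by (rule no)
    qed
    ultimately show "(x, u1) \<in> B2" "(x, u1) \<notin> A" "(x, u2) \<in> B2" "(x, u2) \<notin> A" by auto
  qed
  have NA: "(a, b) \<in> A \<or> a = x \<and> b \<in> J" if "(a, b) \<in> B2" for a b
  proof -
    have "(a, b) \<in> ?A" using that B(1) by blast
    then show ?thesis by auto
  qed
  have N: "B2 - A = {(x, u1), (x, u2)}"
  proof
    show "B2 - A \<subseteq> {(x, u1), (x, u2)}"
    proof
      fix e assume e: "e \<in> B2 - A"
      obtain a b where "e = (a, b)" by (cases e)
      then show "e \<in> {(x, u1), (x, u2)}" using e NA[of a b] J(1) by auto
    qed
  qed (use two in auto)
  have inF: "x \<in> Field B2" "u1 \<in> Field B2" "u2 \<in> Field B2" using two unfolding Field_def by auto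
  let ?U = "Field B2 \<union> {y}"
  have zU': "z \<notin> ?U" using zF zy by auto
  have UV': "?U \<subseteq> V" using FB inV by blast
  have mU: "finite (ind A ?U)" using fin by simp
  have Bx: "ind B2 (- {x}) \<subseteq> ind A ?U"
  proof (rule sub_indI)
    show "ind B2 (- {x}) \<subseteq> A" by (auto dest: NA)
    show "Field (ind B2 (- {x})) \<subseteq> ?U" using Field_ind[of B2 "- {x}"] by blast
  qed
  have mx: "pm (ind B2 (- {x})) \<le> pm (ind A ?U)" by (rule pm_mono[OF mU Bx])
  have loss: "pm B2 \<le> pm (ind A ?U) + 1" using pm_del1[OF finB(1), of x] mx by simp
  have le: "pot A ?U \<le> rho B2 + 4 + 2 * (int (pm B2) - int (pm (ind A ?U)))"
  proof -
    let ?E = "{(x, y), (y, u1), (y, u2)}"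
    have "pot A ?U \<le> rho B2 + 7 * int (card {y}) + 3 * int (card (B2 - A)) - 3 * int (card ?E)
        + 2 * (int (pm B2) - int (pm (ind A ?U)))"
    proof (rule add_pot[OF fin finB(1)])
      show "{y} \<inter> Field B2 = {}" using FB by blast
      show "?E \<subseteq> ind A ?U" using inF ox U1(7) U2(7) by auto
      show "?E \<inter> B2 = {}" using FB unfolding Field_def by auto
    qed simp
    moreover have "card ?E = 3" "card (B2 - A) = 2" unfolding N using J zy by auto
    ultimately show ?thesis by simp
  qed
  have c3: "3 \<le> card ?U"
  proof -
    have "card {x, u1, u2} \<le> card ?U" by (rule card_mono) (use finF inF in auto)
    then show ?thesis using J xJ by auto
  qed
  have sub: "?U \<noteq> V" using zU' inV by blast
  have p4: "4 \<le> pot A ?U" using pot_le3[OF UV'] c3 sub by fastforce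
  have nex: "\<not> (cyc B2 \<or> wheel B2)"
  proof
    assume ex: "cyc B2 \<or> wheel B2"
    have "(u1, x) \<in> B2 \<and> (u2, x) \<in> B2"
      using ex
    proof
      assume "cyc B2"
      then show ?thesis using two cyc_digon[of B2 x u1] cyc_digon[of B2 x u2] by simp
    next
      assume wh: "wheel B2"
      then obtain E where E: "even_side B2 E" using wheel_basic by blast
      have pmE: "pm B2 \<le> card E" by (rule pm_even_side[OF E finB(1)])
      have "x \<in> E"
      proof (rule ccontr)
        assume "x \<notin> E"
        then have "pm B2 \<le> pm (ind A ?U)" using even_sideD(3)[OF E inF(1)] pmE mx by simp
        then show False using le wheel_basic[OF wh] p4 by simp
      qed
      then have "B2 `` {x} = B2\<inverse> `` {x}" by (rule even_sideD(4)[OF E])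
      then have "u \<in> B2 `` {x} \<longleftrightarrow> u \<in> B2\<inverse> `` {x}" for u by simp
      then show ?thesis using two by simp
    qed
    then have ux: "(u1, x) \<in> A" "(u2, x) \<in> A" using NA[of u1 x] NA[of u2 x] xJ by auto
    have "{(x, y), (u1, x), (u2, x)} \<subseteq> ind A (U \<union> {x})" using ux ox U1(1) U2(1) T(5) by auto
    moreover have "{(x, y), (u1, x), (u2, x)} \<inter> ind A U = {}" using xU by auto
    moreover have "card {(x, y), (u1, x), (u2, x)} = 3" using J xJ zy uJ by auto
    ultimately show False by (rule tight_core_add3[OF T0 inV(1) xU])
  qed
  then have r2: "rho B2 \<le> -2" using trich by blast
  then have le4: "pot A ?U \<le> 4" using le loss by simp
  have "\<not> card ?U + 2 \<le> card V" using pot_ge5[OF UV' c3] le4 by auto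
  moreover have "card (V - ?U) = card V - card ?U" by (rule card_Diff_subset) (use finF UV' in auto)
  moreover have "z \<in> V - ?U" using zU' inV by blast
  ultimately have "card (V - ?U) \<le> 1" by simp
  then have "\<forall>a\<in>V - ?U. \<forall>b\<in>V - ?U. a = b" using finV by (simp add: card_le_Suc0_iff_eq)
  then have VU: "V - ?U = {z}" using \<open>z \<in> V - ?U\<close> by blast
  then have VUz: "?U \<union> {z} = V" using UV' by blast
  define Az where "Az = {z} \<times> A `` {z} \<union> A\<inverse> `` {z} \<times> {z}"
  have cAz: "card Az = 2 + indeg A z"
  proof -
    have "card Az = card ({z} \<times> A `` {z}) + card (A\<inverse> `` {z} \<times> {z})"
      unfolding Az_def by (rule card_Un_disjoint) (use finite_nbrs[OF fin] noloop in auto)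
    then show ?thesis using oz unfolding indeg_def outdeg_def by (simp add: card_cartesian_product)
  qed
  have "pot A (?U \<union> {z}) \<le> pot A ?U + 7 * int (card {z}) - 3 * int (card Az) - 2 * int 0"
  proof (rule pot_add[OF fin])
    show "{z} \<inter> ?U = {}" using zU' by blast
    show "Az \<subseteq> ind A (?U \<union> {z})" unfolding VUz Az_def using arcV by auto
    show "Az \<inter> ind A ?U = {}" unfolding Az_def using zU' by auto
  qed (use finF in \<open>auto intro: pm_ind_mono[OF fin]\<close>)
  then have "-1 \<le> 4 + 7 - 3 * (2 + int (indeg A z))" unfolding VUz pot_Field cAz using rho le4 by simp
  then have "indeg A z \<le> 2" by simp
  then have iz: "A\<inverse> `` {z} = J"
  proof -
    have "J \<subseteq> A\<inverse> `` {z}" using core_J(6)[OF TC] by auto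
    then show ?thesis using \<open>indeg A z \<le> 2\<close> cJ finite_nbrs(2)[OF fin, of z] unfolding indeg_def
      by (intro card_seteq[symmetric]) auto
  qed
  \<comment> \<open>now the arc from z to y is low as well, and its reversal is studied\<close>
  have low': "low A z y v x" unfolding low_def using v y zy by auto
  have "(v, z) \<notin> A"
  proof
    assume "(v, z) \<in> A"
    then have "v \<in> J" using iz by auto
    then show False using vU core_J(1)[OF TC] by blast
  qed
  from low_arc_core_dual[OF low' this] show False
  proof
    assume "spanning_low (A\<inverse>) y z x"
    then have "3 \<le> outdeg A x" unfolding spanning_low_def by simp
    then show False using x unfolding outdeg_def by simp
  next
    assume "\<exists>U J B. tight_core (A\<inverse>) z v U J B \<and> y \<notin> U"
    then obtain U' J' B' where T': "tight_core (A\<inverse>) z v U' J' B'" "y \<notin> U'" by blast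
    interpret C: minimal_counterexample "A\<inverse>" by (rule minimal_counterexample_converse)
    have TC': "core (A\<inverse>) z v U' J' B'" using T' unfolding tight_core_def by blast
    have "J' \<subseteq> J" using core_J(7)[OF TC'] iz by auto
    then have "J' = J" using coreD(8)[OF TC'] cJ finJ by (intro card_seteq) auto
    then have uU: "u1 \<in> U'" "u2 \<in> U'" using core_J(1)[OF TC'] uJ by auto
    have "{(y, z), (u1, y), (u2, y)} \<subseteq> ind (A\<inverse>) (U' \<union> {y})"
      using uU U1(7) U2(7) zyA coreD(5)[OF TC'] by auto
    moreover have "{(y, z), (u1, y), (u2, y)} \<inter> ind (A\<inverse>) U' = {}" using T'(2) by auto
    moreover have "card {(y, z), (u1, y), (u2, y)} = 3" using J xJ zy uJ by auto
    moreover have "y \<in> Field (A\<inverse>)" using inV by simp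
    ultimately show False using C.tight_core_add3[OF T'(1) _ T'(2)] by blast
  qed
qed

end

section \<open>Charging low arcs\<close>

text \<open>
  Arcs are classified by the out-degree of their tail and the in-degree of their head. Counting
  arcs by tails and by heads expresses the potential by the numbers of low and high arcs.
\<close>

definition low_arcs :: "'a rel \<Rightarrow> 'a rel" where "low_arcs A = {(x, y) \<in> A. outdeg A x = 2 \<and> indeg A y = 2}"
definition high_arcs :: "'a rel \<Rightarrow> 'a rel" where "high_arcs A = {(x, y) \<in> A. 3 \<le> outdeg A x \<and> 3 \<le> indeg A y}"

definition headed_core :: "'a rel \<Rightarrow> 'a \<Rightarrow> 'a \<Rightarrow> 'a \<Rightarrow> 'a set \<Rightarrow> bool" where
  "headed_core A x y z J \<longleftrightarrow> (\<exists>w U B. low A x y w z \<and> tight_core A y z U J B \<and> x \<notin> U)"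

definition low_out :: "'a rel \<Rightarrow> 'a \<Rightarrow> nat" where "low_out A x = outdeg (low_arcs A) x"
definition low_in :: "'a rel \<Rightarrow> 'a \<Rightarrow> nat" where "low_in A y = indeg (low_arcs A) y"

definition paired :: "'a rel \<Rightarrow> 'a \<Rightarrow> 'a \<Rightarrow> bool" where
  "paired A x y \<longleftrightarrow> low_out A x = 1 \<and> low_in A x = 0 \<and> low_in A y = 1 \<and> low_out A y = 0 \<and> outdeg A y = 2 \<and> indeg A x = 2"

definition core_arcs :: "'a rel \<Rightarrow> 'a rel" where "core_arcs A = {(x, y). \<exists>z J. headed_core A x y z J}"

lemma low_arcs_converse[simp]: "low_arcs (A\<inverse>) = (low_arcs A)\<inverse>" unfolding low_arcs_def by auto
lemma high_arcs_converse[simp]: "high_arcs (A\<inverse>) = (high_arcs A)\<inverse>" unfolding high_arcs_def by auto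

lemma low_out_converse[simp]: "low_out (A\<inverse>) v = low_in A v" and low_in_converse[simp]: "low_in (A\<inverse>) v = low_out A v"
  unfolding low_out_def low_in_def by simp_all

context minimal_counterexample
begin

lemma degs: "v \<in> V \<Longrightarrow> 2 \<le> outdeg A v" "v \<in> V \<Longrightarrow> 2 \<le> indeg A v"
  using crit_outdeg[OF crit] crit_indeg[OF crit] by auto

lemma low_arcsD: "(x, y) \<in> low_arcs A \<Longrightarrow> (x, y) \<in> A \<and> outdeg A x = 2 \<and> indeg A y = 2" unfolding low_arcs_def by auto

lemma low_arcs_low:
  assumes "(x, y) \<in> low_arcs A"
  obtains w z where "low A x y w z"
proof -
  note L = low_arcsD[OF assms]
  obtain w where w: "A `` {x} = {y, w}" "y \<noteq> w" using L by (elim conjE) (rule outdeg2E)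
  obtain z where z: "A\<inverse> `` {y} = {x, z}" "x \<noteq> z" using L by (elim conjE) (rule indeg2E)
  show ?thesis using that w z unfolding low_def by blast
qed

lemma low_in_low_arcs: "low A x y w z \<Longrightarrow> (x, y) \<in> low_arcs A"
  unfolding low_def low_arcs_def outdeg_def indeg_def by auto

lemma finite_low_high: "finite (low_arcs A)" "finite (high_arcs A)" using fin unfolding low_arcs_def high_arcs_def by (auto intro: finite_subset)

lemma low_out_0: "(\<And>y. (x, y) \<notin> low_arcs A) \<Longrightarrow> low_out A x = 0"
proof -
  assume "\<And>y. (x, y) \<notin> low_arcs A"
  then have "low_arcs A `` {x} = {}" by blast
  then show ?thesis unfolding low_out_def outdeg_def by simp
qed

lemma low_in_0: "(\<And>x. (x, y) \<notin> low_arcs A) \<Longrightarrow> low_in A y = 0"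
proof -
  assume "\<And>x. (x, y) \<notin> low_arcs A"
  then have "(low_arcs A)\<inverse> `` {y} = {}" by blast
  then show ?thesis unfolding low_in_def indeg_def by simp
qed

lemma low_out_1: "(x, y) \<in> low_arcs A \<Longrightarrow> (\<And>y'. (x, y') \<in> low_arcs A \<Longrightarrow> y' = y) \<Longrightarrow> low_out A x = 1"
proof -
  assume "(x, y) \<in> low_arcs A" "\<And>y'. (x, y') \<in> low_arcs A \<Longrightarrow> y' = y"
  then have "low_arcs A `` {x} = {y}" by blast
  then show ?thesis unfolding low_out_def outdeg_def by simp
qed

lemma low_in_1: "(x, y) \<in> low_arcs A \<Longrightarrow> (\<And>x'. (x', y) \<in> low_arcs A \<Longrightarrow> x' = x) \<Longrightarrow> low_in A y = 1"
proof -
  assume "(x, y) \<in> low_arcs A" "\<And>x'. (x', y) \<in> low_arcs A \<Longrightarrow> x' = x"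
  then have "(low_arcs A)\<inverse> `` {y} = {x}" by blast
  then show ?thesis unfolding low_in_def indeg_def by simp
qed

lemma low_out_bounds: "(x, y) \<in> low_arcs A \<Longrightarrow> 1 \<le> low_out A x \<and> low_out A x \<le> 2"
proof -
  assume xy: "(x, y) \<in> low_arcs A"
  have "low_arcs A `` {x} \<subseteq> A `` {x}" unfolding low_arcs_def by auto
  then have "low_out A x \<le> outdeg A x" unfolding low_out_def outdeg_def by (intro card_mono finite_nbrs fin)
  moreover have "y \<in> low_arcs A `` {x}" using xy by simp
  then have "1 \<le> low_out A x" unfolding low_out_def outdeg_def
    using finite_nbrs(1)[OF finite_low_high(1), of x] by (simp add: card_gt_0_iff Suc_le_eq) blast
  ultimately show ?thesis using low_arcsD[OF xy] by simp
qed

lemma low_in_bounds: "(x, y) \<in> low_arcs A \<Longrightarrow> 1 \<le> low_in A y \<and> low_in A y \<le> 2"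
proof -
  assume xy: "(x, y) \<in> low_arcs A"
  have "(low_arcs A)\<inverse> `` {y} \<subseteq> A\<inverse> `` {y}" unfolding low_arcs_def by auto
  then have "low_in A y \<le> indeg A y" unfolding low_in_def indeg_def by (intro card_mono finite_nbrs fin)
  moreover have "x \<in> (low_arcs A)\<inverse> `` {y}" using xy by simp
  then have "1 \<le> low_in A y" unfolding low_in_def indeg_def
    using finite_nbrs(2)[OF finite_low_high(1), of y] by (simp add: card_gt_0_iff Suc_le_eq) blast
  ultimately show ?thesis using low_arcsD[OF xy] by simp
qed

text \<open>
  The reduction at the arc needs that y and z span no digon, and its reversal needs the same of
  x and w; by \<open>no_double_digon\<close> one of them is available. If there is one digon,
  the available reduction gives a core. If there is none and no core arises, both reductions
  determine the degrees around the arc.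
\<close>

lemma low_arc_kinds:
  assumes L: "(x, y) \<in> low_arcs A"
  shows "(x, y) \<in> core_arcs A \<or> (y, x) \<in> core_arcs (A\<inverse>) \<or> paired A x y"
proof -
  obtain w z where low: "low A x y w z" by (rule low_arcs_low[OF L])
  have x: "A `` {x} = {y, w}" "y \<noteq> w" and y: "A\<inverse> `` {y} = {x, z}" "x \<noteq> z"
    using low unfolding low_def by auto
  have 1: "(y, z) \<notin> A \<Longrightarrow> spanning_low A x y w \<or> (x, y) \<in> core_arcs A"
    using low_arc_core[OF low] low unfolding core_arcs_def headed_core_def by blast
  have 2: "(w, x) \<notin> A \<Longrightarrow> spanning_low (A\<inverse>) y x z \<or> (y, x) \<in> core_arcs (A\<inverse>)"
  proof -
    assume "(w, x) \<notin> A"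
    moreover have "low (A\<inverse>) y x z w" using low by simp
    ultimately show ?thesis using low_arc_core_dual[OF low] unfolding core_arcs_def headed_core_def by blast
  qed
  have 3: "(y, z) \<notin> A \<or> (w, x) \<notin> A" using no_double_digon[OF low] by blast
  have S: "spanning_low A x y w \<Longrightarrow> (w, x) \<notin> A" unfolding spanning_low_def by blast
  have S': "spanning_low (A\<inverse>) y x z \<Longrightarrow> (y, z) \<notin> A" unfolding spanning_low_def by auto
  have "paired A x y" if s: "spanning_low A x y w" and s': "spanning_low (A\<inverse>) y x z"
  proof -
    have "indeg A x = 2" "outdeg A y = 2" using s s' unfolding spanning_low_def by auto
    moreover have "low_out A x = 1"
    proof (rule low_out_1[OF L])
      fix y' assume "(x, y') \<in> low_arcs A"
      then have "y' = y \<or> y' = w" "indeg A y' = 2" using low_arcsD[of x y'] x by auto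
      moreover have "3 \<le> indeg A w" using s unfolding spanning_low_def by auto
      ultimately show "y' = y" by auto
    qed
    moreover have "low_in A y = 1"
    proof (rule low_in_1[OF L])
      fix x' assume "(x', y) \<in> low_arcs A"
      then have "x' = x \<or> x' = z" "outdeg A x' = 2" using low_arcsD[of x' y] y by auto
      moreover have "3 \<le> outdeg A z" using s' unfolding spanning_low_def by auto
      ultimately show "x' = x" by auto
    qed
    moreover have "low_in A x = 0"
      by (rule low_in_0) (use s in \<open>auto simp: spanning_low_def dest!: low_arcsD\<close>)
    moreover have "low_out A y = 0"
      by (rule low_out_0) (use s' in \<open>auto simp: spanning_low_def dest!: low_arcsD\<close>)
    ultimately show ?thesis unfolding paired_def by blast
  qed
  then show ?thesis using 1 2 3 S S' by blast
qed

lemma headed_coreD: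
  assumes "headed_core A x y z J"
  shows "(x, y) \<in> low_arcs A" "A\<inverse> `` {y} = {x, z}" "x \<noteq> z" "2 \<le> card J" "finite J"
    "\<And>u. u \<in> J \<Longrightarrow> (y, u) \<in> A" "\<And>u. u \<in> J \<Longrightarrow> (u, z) \<in> A" "\<And>u. u \<in> J \<Longrightarrow> 3 \<le> indeg A u"
    "card J = 2 \<Longrightarrow> \<exists>u\<in>J. \<exists>v. v \<noteq> z \<and> v \<noteq> y \<and> (u, v) \<in> A \<and> (v, u) \<in> A"
proof -
  obtain w U B where D: "low A x y w z" "tight_core A y z U J B" "x \<notin> U" using assms unfolding headed_core_def by blast
  have TC: "core A y z U J B" using D unfolding tight_core_def by blast
  note T = coreD[OF TC]
  show "(x, y) \<in> low_arcs A" by (rule low_in_low_arcs[OF D(1)])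
  show "A\<inverse> `` {y} = {x, z}" "x \<noteq> z" using D(1) unfolding low_def by auto
  show c: "2 \<le> card J" by (rule T(8))
  show "finite J" using c by (metis card.infinite not_numeral_le_zero)
  show "(y, u) \<in> A" "(u, z) \<in> A" "3 \<le> indeg A u" if "u \<in> J" for u
    using core_J[OF TC that] core_indeg[OF D(2) that] by auto
  show "\<exists>u\<in>J. \<exists>v. v \<noteq> z \<and> v \<noteq> y \<and> (u, v) \<in> A \<and> (v, u) \<in> A" if c2: "card J = 2"
  proof -
    obtain u v where uv: "u \<in> J" "v \<noteq> z" "(u, v) \<in> B" "(v, u) \<in> B" using T(13)[OF c2] by blast
    have "v \<in> Field B" using uv unfolding Field_def by auto
    then have v: "v \<in> U" "v \<noteq> y" using T(4) by auto
    note u = core_J[OF TC uv(1)]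
    have "(u, v) \<in> A" "(v, u) \<in> A"
      using core_arc[OF TC u(1) v(1)] core_arc[OF TC v(1) u(1)] uv u(3) by auto
    then show ?thesis using uv v by blast
  qed
qed

text \<open>
  Two common elements of the cores would let x be added to the core of the arc from x to y.
\<close>

lemma headed_core_two_tails:
  assumes "headed_core A x y z J" "headed_core A z y x J'"
  shows "card (J \<inter> J') \<le> 1"
proof (rule ccontr)
  assume "\<not> card (J \<inter> J') \<le> 1"
  moreover have "finite (J \<inter> J')" using headed_coreD(5)[OF assms(1)] by simp
  ultimately have "\<not> (\<forall>a\<in>J \<inter> J'. \<forall>b\<in>J \<inter> J'. a = b)" using card_le_Suc0_iff_eq[of "J \<inter> J'"] by simp
  then obtain u u' where u: "u \<in> J" "u' \<in> J" "u \<in> J'" "u' \<in> J'" "u \<noteq> u'" by blast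
  obtain w U B where D: "low A x y w z" "tight_core A y z U J B" "x \<notin> U" using assms unfolding headed_core_def by blast
  have TC: "core A y z U J B" using D unfolding tight_core_def by blast
  have ux: "(u, x) \<in> A" "(u', x) \<in> A" using headed_coreD(7)[OF assms(2)] u by auto
  have xy: "(x, y) \<in> A" using low_arcsD[OF headed_coreD(1)[OF assms(1)]] by blast
  have nx: "u \<noteq> x" "u' \<noteq> x" "x \<noteq> y" using ux xy noloop by auto
  have "{(x, y), (u, x), (u', x)} \<subseteq> ind A (U \<union> {x})"
    using ux xy core_J(1)[OF TC] u coreD(5)[OF TC] by auto
  moreover have "{(x, y), (u, x), (u', x)} \<inter> ind A U = {}" using D(3) by auto
  moreover have "card {(x, y), (u, x), (u', x)} = 3" using u nx by auto
  ultimately show False using tight_core_add3[OF D(2) _ D(3)] arcV[OF xy] by blast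
qed

text \<open>
  J consists of all out-neighbours of y. By the degree bounds for cores, no further low arc is
  incident with y.
\<close>

lemma headed_core_out2:
  assumes "headed_core A x y z J" "outdeg A y = 2"
  shows "A `` {y} = J" "card J = 2" "\<And>u. u \<in> J \<Longrightarrow> 3 \<le> outdeg A u" "3 \<le> outdeg A z"
    "low_out A y = 0" "low_in A y = 1" "indeg A y = 2"
proof -
  obtain w U B where D: "low A x y w z" "tight_core A y z U J B" "x \<notin> U" using assms unfolding headed_core_def by blast
  note T = headed_coreD[OF assms(1)]
  have "J \<subseteq> A `` {y}" using T(6) by auto
  then show AyJ: "A `` {y} = J" using assms(2) T(4) finite_nbrs(1)[OF fin, of y] unfolding outdeg_def
    by (intro card_seteq[symmetric]) auto
  then show "card J = 2" using assms(2) unfolding outdeg_def by simp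
  show "3 \<le> outdeg A u" if "u \<in> J" for u by (rule core_outdeg[OF D assms(2) that])
  show z: "3 \<le> outdeg A z" by (rule core_tail_outdeg[OF D assms(2)])
  show "low_out A y = 0"
  proof (rule low_out_0)
    fix u show "(y, u) \<notin> low_arcs A"
    proof
      assume "(y, u) \<in> low_arcs A"
      then have "u \<in> J" "indeg A u = 2" using low_arcsD[of y u] AyJ by auto
      then show False using T(8)[of u] by simp
    qed
  qed
  show "low_in A y = 1"
  proof (rule low_in_1[OF T(1)])
    fix x' assume "(x', y) \<in> low_arcs A"
    then have "x' = x \<or> x' = z" "outdeg A x' = 2" using low_arcsD[of x' y] T(2) by auto
    then show "x' = x" using z by auto
  qed
  show "indeg A y = 2" using low_arcsD[OF T(1)] by blast
qed

text \<open>
  Otherwise the second head could be added to the first core.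
\<close>

lemma headed_core_same_tail:
  assumes "headed_core A x y z J" "headed_core A x' y' z J'" "outdeg A y = 2" "outdeg A y' = 2" "indeg A z = 2"
  shows "y = y'"
proof (rule ccontr)
  assume ne: "y \<noteq> y'"
  obtain w U B where D: "low A x y w z" "tight_core A y z U J B" "x \<notin> U" using assms unfolding headed_core_def by blast
  have TC: "core A y z U J B" using D unfolding tight_core_def by blast
  note T = headed_coreD[OF assms(1)] and T' = headed_coreD[OF assms(2)]
  have zy': "(z, y') \<in> A" "(z, y) \<in> A" using T(2) T'(2) by auto
  have y'U: "y' \<notin> U" using core_nbrs(1)[OF TC, of y'] zy' ne by auto
  have Jz: "J'' = A\<inverse> `` {z}" if "headed_core A x'' y'' z J''" for x'' y'' J''
  proof -
    note T'' = headed_coreD[OF that]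
    have "J'' \<subseteq> A\<inverse> `` {z}" using T''(7) by auto
    then show ?thesis using assms(5) T''(4) finite_nbrs(2)[OF fin, of z] unfolding indeg_def
      by (intro card_seteq) auto
  qed
  have "J' = J" using Jz[OF assms(1)] Jz[OF assms(2)] by simp
  have "card J = 2" by (rule headed_core_out2(2)[OF assms(1,3)])
  then obtain u1 u2 where J: "J = {u1, u2}" "u1 \<noteq> u2" by (auto simp: card_2_iff)
  have a: "(y', u1) \<in> A" "(y', u2) \<in> A" using T'(6) \<open>J' = J\<close> J by auto
  have "{(z, y'), (y', u1), (y', u2)} \<subseteq> ind A (U \<union> {y'})"
    using a zy' core_J(1)[OF TC] J coreD(6)[OF TC] by auto
  moreover have "{(z, y'), (y', u1), (y', u2)} \<inter> ind A U = {}" using y'U by auto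
  moreover have "z \<noteq> y'" using zy'(1) noloop by metis
  then have "card {(z, y'), (y', u1), (y', u2)} = 3" using J(2) by auto
  ultimately show False using tight_core_add3[OF D(2) _ y'U] arcV[OF zy'(1)] by blast
qed

end

section \<open>Counting arcs by their ends\<close>

lemma sum_by_tail:
  fixes f :: "'a \<Rightarrow> int"
  assumes "finite G" "finite S" "Domain G \<subseteq> S"
  shows "(\<Sum>e\<in>G. f (fst e)) = (\<Sum>v\<in>S. int (outdeg G v) * f v)"
proof -
  have G: "G = Sigma S (\<lambda>v. G `` {v})" using assms(3) by auto
  have "(\<Sum>v\<in>S. \<Sum>u\<in>G `` {v}. f v) = (\<Sum>(v, u)\<in>Sigma S (\<lambda>v. G `` {v}). f v)"
    by (rule sum.Sigma) (use assms finite_nbrs in auto)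
  also have "\<dots> = (\<Sum>e\<in>G. f (fst e))" unfolding G[symmetric] by (rule sum.cong) auto
  finally show ?thesis unfolding outdeg_def by simp
qed

lemma sum_by_head:
  fixes f :: "'a \<Rightarrow> int"
  assumes "finite G" "finite S" "Range G \<subseteq> S"
  shows "(\<Sum>e\<in>G. f (snd e)) = (\<Sum>v\<in>S. int (indeg G v) * f v)"
proof -
  have "(\<Sum>e\<in>G. f (snd e)) = (\<Sum>e\<in>G\<inverse>. f (fst e))"
    by (rule sum.reindex_bij_witness[of _ prod.swap prod.swap]) auto
  also have "\<dots> = (\<Sum>v\<in>S. int (outdeg (G\<inverse>) v) * f v)"
    by (rule sum_by_tail) (use assms in auto)
  finally show ?thesis by simp
qed

lemma card_by_tail: "finite G \<Longrightarrow> finite S \<Longrightarrow> Domain G \<subseteq> S \<Longrightarrow> int (card G) = (\<Sum>v\<in>S. int (outdeg G v))"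
  using sum_by_tail[of G S "\<lambda>_. 1"] by simp

lemma card_by_head: "finite G \<Longrightarrow> finite S \<Longrightarrow> Range G \<subseteq> S \<Longrightarrow> int (card G) = (\<Sum>v\<in>S. int (indeg G v))"
  using sum_by_head[of G S "\<lambda>_. 1"] by simp

lemma card_fibres:
  assumes "finite S" "finite T" "g ` S \<subseteq> T"
  shows "int (card S) = (\<Sum>t\<in>T. int (card {s \<in> S. g s = t}))"
  using sum.group[OF assms, of "\<lambda>_. 1 :: int"] by simp

lemma card_as_sum: "finite S \<Longrightarrow> int (card {v \<in> S. P v}) = (\<Sum>v\<in>S. if P v then 1 else 0)"
  by (simp add: sum.If_cases Int_def)

definition high_out :: "'a rel \<Rightarrow> 'a \<Rightarrow> nat" where "high_out A v = outdeg (high_arcs A) v"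
definition high_in :: "'a rel \<Rightarrow> 'a \<Rightarrow> nat" where "high_in A v = indeg (high_arcs A) v"
definition excess :: "'a rel \<Rightarrow> 'a \<Rightarrow> nat" where "excess A v = outdeg A v - 3"
text \<open>
  Core arcs are treated differently according to whether the out-neighbours of the head all
  belong to the core.
\<close>

definition slim_arcs :: "'a rel \<Rightarrow> 'a rel" where "slim_arcs A = {e \<in> core_arcs A. outdeg A (snd e) = 2}"
definition wide_arcs :: "'a rel \<Rightarrow> 'a rel" where "wide_arcs A = {e \<in> core_arcs A. outdeg A (snd e) \<noteq> 2}"
definition paired_arcs :: "'a rel \<Rightarrow> 'a rel" where "paired_arcs A = low_arcs A - core_arcs A - (core_arcs (A\<inverse>))\<inverse>"
definition second_tail :: "'a rel \<Rightarrow> 'a \<times> 'a \<Rightarrow> 'a" where "second_tail A e = (SOME z. \<exists>J. headed_core A (fst e) (snd e) z J)"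
definition core_set :: "'a rel \<Rightarrow> 'a \<times> 'a \<Rightarrow> 'a set" where "core_set A e = (SOME J. headed_core A (fst e) (snd e) (second_tail A e) J)"
text \<open>
  The part of the eight units of a low arc that is not covered by its tail and its head: each of
  them carries 2 units, shared by the low arcs there, that is 3 - k units for each of k \<in>
  {1, 2} low arcs.
\<close>

definition cost :: "'a rel \<Rightarrow> 'a \<times> 'a \<Rightarrow> int" where "cost A e = 2 + int (low_out A (fst e)) + int (low_in A (snd e))"

lemma high_out_converse[simp]: "high_out (A\<inverse>) v = high_in A v" and high_in_converse[simp]: "high_in (A\<inverse>) v = high_out A v"
  unfolding high_out_def high_in_def by simp_all

lemma headed_core_of: "e \<in> core_arcs A \<Longrightarrow> headed_core A (fst e) (snd e) (second_tail A e) (core_set A e)"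
proof -
  assume "e \<in> core_arcs A"
  then have "\<exists>z J. headed_core A (fst e) (snd e) z J" by (cases e) (simp add: core_arcs_def)
  then have "\<exists>J. headed_core A (fst e) (snd e) (second_tail A e) J" unfolding second_tail_def by (rule someI_ex)
  then show ?thesis unfolding core_set_def by (rule someI_ex)
qed

lemma paired_arcs_converse: "paired_arcs (A\<inverse>) = (paired_arcs A)\<inverse>" unfolding paired_arcs_def by auto

context minimal_counterexample
begin

lemma core_arcs_low: "e \<in> core_arcs A \<Longrightarrow> e \<in> low_arcs A"
  using headed_coreD(1)[OF headed_core_of] by simp

lemma finT: "finite (core_arcs A)" "finite (slim_arcs A)" "finite (wide_arcs A)"
proof -
  have "core_arcs A \<subseteq> low_arcs A" using core_arcs_low by blast
  then show "finite (core_arcs A)" using finite_low_high(1) finite_subset by blast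
  then show "finite (slim_arcs A)" "finite (wide_arcs A)" unfolding slim_arcs_def wide_arcs_def by auto
qed

lemma low_arcs_V: "e \<in> low_arcs A \<Longrightarrow> fst e \<in> V \<and> snd e \<in> V"
  using arcV[of "fst e" "snd e"] low_arcsD[of "fst e" "snd e"] by simp

lemma core_arcs_card:
  assumes "e \<in> core_arcs A" "pm A = 0"
  shows "3 \<le> card (core_set A e)"
proof (rule ccontr)
  note T = headed_coreD[OF headed_core_of[OF assms(1)]]
  assume "\<not> 3 \<le> card (core_set A e)"
  then have "card (core_set A e) = 2" using T(4) by simp
  then obtain u v where "(u, v) \<in> A" "(v, u) \<in> A" using T(9) by blast
  then show False using pm_1I[OF fin] assms(2) by fastforce
qed

lemma core_arcs_high:
  assumes "e \<in> wide_arcs A"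
  shows "core_set A e \<subseteq> high_arcs A `` {snd e}" "card (core_set A e) \<le> high_out A (snd e)"
proof -
  have e: "e \<in> core_arcs A" "outdeg A (snd e) \<noteq> 2" using assms unfolding wide_arcs_def by auto
  note T = headed_coreD[OF headed_core_of[OF e(1)]]
  have "3 \<le> outdeg A (snd e)" using degs(1)[of "snd e"] low_arcs_V[OF core_arcs_low[OF e(1)]] e(2) by simp
  then show s: "core_set A e \<subseteq> high_arcs A `` {snd e}" using T(6,8) unfolding high_arcs_def by auto
  show "card (core_set A e) \<le> high_out A (snd e)" unfolding high_out_def outdeg_def
    by (rule card_mono[OF finite_nbrs(1)[OF finite_low_high(2)] s])
qed

lemma cost_le6: "e \<in> low_arcs A \<Longrightarrow> cost A e \<le> 6"
  using low_out_bounds[of "fst e" "snd e"] low_in_bounds[of "fst e" "snd e"] unfolding cost_def by simp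

text \<open>
  The arcs from y to J are high and pay for the at most two low arcs into y. One low arc costs
  at most 6, and J has at least two elements. Two low arcs cost at most 12 together, and their
  sets J overlap in at most one element, so there are at least three high arcs. Without digons
  every set J has at least three elements, which gives the sharper constants: 5 * 6 \<le> 12 * 3
  and 5 * 12 \<le> 12 * 5.
\<close>

lemma wide_arcs_cost:
  fixes y
  defines "S \<equiv> {e \<in> wide_arcs A. snd e = y}"
  shows "sum (cost A) S \<le> 4 * int (high_out A y)" "pm A = 0 \<Longrightarrow> 5 * sum (cost A) S \<le> 12 * int (high_out A y)"
    "pm A = 0 \<Longrightarrow> S \<noteq> {} \<Longrightarrow> 3 \<le> high_out A y"
proof -
  have "sum (cost A) S \<le> 4 * int (high_out A y) \<and> (pm A = 0 \<longrightarrow> 5 * sum (cost A) S \<le> 12 * int (high_out A y)) \<and>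
    (pm A = 0 \<longrightarrow> S \<noteq> {} \<longrightarrow> 3 \<le> high_out A y)"
  proof (cases "S = {}")
    case True
    then show ?thesis by simp
  next
    case False
    then obtain x where e: "(x, y) \<in> wide_arcs A" unfolding S_def by auto
    define z where "z = second_tail A (x, y)"
    define J where "J = core_set A (x, y)"
    have eT: "(x, y) \<in> core_arcs A" using e unfolding wide_arcs_def by auto
    have headed_core: "headed_core A x y z J" using headed_core_of[OF eT] unfolding z_def J_def by simp
    note T = headed_coreD[OF headed_core]
    have JH: "J \<subseteq> high_arcs A `` {y}" "card J \<le> high_out A y" using core_arcs_high[OF e] unfolding J_def by auto
    have J3: "pm A = 0 \<Longrightarrow> 3 \<le> card J" using core_arcs_card[OF eT] unfolding J_def by simp
    have S: "e' = (x, y) \<or> e' = (z, y)" if "e' \<in> S" for e'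
    proof -
      have "e' \<in> low_arcs A" "snd e' = y" using that core_arcs_low unfolding S_def wide_arcs_def by auto
      then have "(fst e', y) \<in> A" using low_arcsD[of "fst e'" y] by (metis prod.collapse)
      then have "fst e' = x \<or> fst e' = z" using T(2) by auto
      then show ?thesis using \<open>snd e' = y\<close> by (metis prod.collapse)
    qed
    have xyS: "(x, y) \<in> S" using e unfolding S_def by simp
    show ?thesis
    proof (cases "(z, y) \<in> S")
      case False
      then have "S = {(x, y)}" using S xyS by blast
      then show ?thesis using cost_le6[OF T(1)] JH(2) T(4) J3 by auto
    next
      case True
      then have e2: "(z, y) \<in> wide_arcs A" unfolding S_def by simp
      then have e2T: "(z, y) \<in> core_arcs A" unfolding wide_arcs_def by auto
      define z2 where "z2 = second_tail A (z, y)"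
      define J2 where "J2 = core_set A (z, y)"
      have TT2: "headed_core A z y z2 J2" using headed_core_of[OF e2T] unfolding z2_def J2_def by simp
      note T2 = headed_coreD[OF TT2]
      have "z2 = x" using T(2,3) T2(2,3) by (metis doubleton_eq_iff)
      then have "card (J \<inter> J2) \<le> 1" using headed_core_two_tails[OF headed_core] TT2 by simp
      moreover have "card J + card J2 = card (J \<union> J2) + card (J \<inter> J2)"
        by (rule card_Un_Int[OF T(5) T2(5)])
      moreover have "J2 \<subseteq> high_arcs A `` {y}" using core_arcs_high(1)[OF e2] unfolding J2_def by simp
      then have "card (J \<union> J2) \<le> high_out A y" unfolding high_out_def outdeg_def
        using JH(1) by (intro card_mono finite_nbrs(1)[OF finite_low_high(2)]) auto
      moreover have "pm A = 0 \<Longrightarrow> 3 \<le> card J2" using core_arcs_card[OF e2T] unfolding J2_def by simp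
      moreover have "S = {(x, y), (z, y)}" using S xyS True by blast
      then have "sum (cost A) S = cost A (x, y) + cost A (z, y)" using T(3) by simp
      then have "sum (cost A) S \<le> 12" using cost_le6[OF T(1)] cost_le6[OF T2(1)] by simp
      ultimately show ?thesis using T(4) T2(4) J3 by auto
    qed
  qed
  then show "sum (cost A) S \<le> 4 * int (high_out A y)" "pm A = 0 \<Longrightarrow> 5 * sum (cost A) S \<le> 12 * int (high_out A y)"
    "pm A = 0 \<Longrightarrow> S \<noteq> {} \<Longrightarrow> 3 \<le> high_out A y" by blast+
qed

lemma slim_arcsD:
  assumes "e \<in> slim_arcs A"
  shows "headed_core A (fst e) (snd e) (second_tail A e) (core_set A e)" "outdeg A (snd e) = 2" "e \<in> low_arcs A"
proof -
  have e: "e \<in> core_arcs A" using assms unfolding slim_arcs_def by auto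
  show "headed_core A (fst e) (snd e) (second_tail A e) (core_set A e)" "e \<in> low_arcs A" by (rule headed_core_of[OF e], rule core_arcs_low[OF e])
  show "outdeg A (snd e) = 2" using assms unfolding slim_arcs_def by auto
qed

lemma low_in_1_unique:
  assumes "low_in A y = 1" "(x, y) \<in> low_arcs A" "(x', y) \<in> low_arcs A"
  shows "x = x'"
proof -
  have "card ((low_arcs A)\<inverse> `` {y}) = 1" using assms(1) unfolding low_in_def indeg_def .
  then obtain a where "(low_arcs A)\<inverse> `` {y} = {a}" by (auto simp: card_1_singleton_iff)
  moreover have "x \<in> (low_arcs A)\<inverse> `` {y}" "x' \<in> (low_arcs A)\<inverse> `` {y}" using assms(2,3) by auto
  ultimately show ?thesis by simp
qed

lemma slim_arcs_head: "e \<in> slim_arcs A \<Longrightarrow> low_in A (snd e) = 1 \<and> low_out A (snd e) = 0 \<and> indeg A (snd e) = 2"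
  using headed_core_out2[OF slim_arcsD(1,2)] by blast

lemma slim_arcs_cost: "e \<in> slim_arcs A \<Longrightarrow> cost A e \<le> 5"
  using slim_arcs_head[of e] low_out_bounds[of "fst e" "snd e"] slim_arcsD(3)[of e] unfolding cost_def by simp

lemma paired_arcsD: "e \<in> paired_arcs A \<Longrightarrow> e \<in> low_arcs A \<and> paired A (fst e) (snd e)"
  using low_arc_kinds[of "fst e" "snd e"] unfolding paired_arcs_def by (cases e) auto

lemma paired_arcs_cost: "e \<in> paired_arcs A \<Longrightarrow> cost A e = 4"
  using paired_arcsD[of e] unfolding cost_def paired_def by simp

lemma inj_snd:
  assumes "\<And>e. e \<in> S \<Longrightarrow> e \<in> low_arcs A \<and> low_in A (snd e) = 1"
  shows "inj_on snd S"
proof (rule inj_onI)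
  fix e f assume ef: "e \<in> S" "f \<in> S" "snd e = snd f"
  have e: "(fst e, snd e) \<in> low_arcs A" and "(fst f, snd f) \<in> low_arcs A" using assms[OF ef(1)] assms[OF ef(2)] by simp_all
  then have "(fst e, snd e) \<in> low_arcs A" "(fst f, snd e) \<in> low_arcs A" by (simp_all only: ef(3))
  then have "fst e = fst f" using low_in_1_unique assms[OF ef(1)] by blast
  then show "e = f" using ef(3) by (simp add: prod_eq_iff)
qed

lemma inj_snd_slim_arcs: "inj_on snd (slim_arcs A)"
  by (rule inj_snd) (use slim_arcs_head slim_arcsD(3) in auto)

text \<open>
  Different arcs have different heads, and these heads have no low out-arc, so their out-ends
  are free to pay.
\<close>

lemma pair_heads: "card (paired_arcs A) + card (slim_arcs A) \<le> card {v \<in> V. outdeg A v = 2 \<and> indeg A v = 2 \<and> low_out A v = 0}"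
proof -
  have disj: "paired_arcs A \<inter> slim_arcs A = {}" unfolding paired_arcs_def slim_arcs_def by auto
  have finP: "finite (paired_arcs A)" using finite_low_high(1) unfolding paired_arcs_def by simp
  have mem: "e \<in> low_arcs A \<and> low_in A (snd e) = 1 \<and> low_out A (snd e) = 0 \<and> outdeg A (snd e) = 2"
    if "e \<in> paired_arcs A \<union> slim_arcs A" for e
    using that paired_arcsD[of e] slim_arcsD(2,3)[of e] slim_arcs_head[of e] unfolding paired_def by auto
  have "inj_on snd (paired_arcs A \<union> slim_arcs A)" by (rule inj_snd) (use mem in blast)
  moreover have "snd ` (paired_arcs A \<union> slim_arcs A) \<subseteq> {v \<in> V. outdeg A v = 2 \<and> indeg A v = 2 \<and> low_out A v = 0}"
  proof
    fix v assume "v \<in> snd ` (paired_arcs A \<union> slim_arcs A)"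
    then obtain e where e: "e \<in> paired_arcs A \<union> slim_arcs A" "v = snd e" by blast
    then show "v \<in> {v \<in> V. outdeg A v = 2 \<and> indeg A v = 2 \<and> low_out A v = 0}"
      using mem[OF e(1)] low_arcs_V[of e] low_arcsD[of "fst e" "snd e"] by auto
  qed
  ultimately have "card (paired_arcs A \<union> slim_arcs A) \<le> card {v \<in> V. outdeg A v = 2 \<and> indeg A v = 2 \<and> low_out A v = 0}"
    by (rule card_inj_on_le) (use finV in simp)
  then show ?thesis using card_Un_disjoint[OF finP finT(2) disj] by simp
qed

text \<open>
  The second in-neighbour of the head has in-degree 2 and no low in-arc, and it serves only one
  core arc.
\<close>

lemma second_tail_low:
  "card {e \<in> slim_arcs A. indeg A (second_tail A e) = 2} \<le> card {v \<in> V. indeg A v = 2 \<and> 3 \<le> outdeg A v \<and> low_in A v = 0}"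
proof (rule card_inj_on_le)
  let ?L = "{e \<in> slim_arcs A. indeg A (second_tail A e) = 2}"
  show "inj_on (second_tail A) ?L"
  proof (rule inj_onI)
    fix e f assume ef: "e \<in> ?L" "f \<in> ?L" "second_tail A e = second_tail A f"
    have m: "e \<in> slim_arcs A" "f \<in> slim_arcs A" "indeg A (second_tail A e) = 2" using ef by auto
    have "headed_core A (fst f) (snd f) (second_tail A e) (core_set A f)" using slim_arcsD(1)[OF m(2)] ef(3) by simp
    then have "snd e = snd f"
      by (rule headed_core_same_tail[OF slim_arcsD(1)[OF m(1)] _ slim_arcsD(2)[OF m(1)] slim_arcsD(2)[OF m(2)] m(3)])
    then show "e = f" using inj_onD[OF inj_snd_slim_arcs] ef by blast
  qed
  show "second_tail A ` ?L \<subseteq> {v \<in> V. indeg A v = 2 \<and> 3 \<le> outdeg A v \<and> low_in A v = 0}"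
  proof
    fix z assume "z \<in> second_tail A ` ?L"
    then obtain e where e: "e \<in> slim_arcs A" "indeg A (second_tail A e) = 2" "z = second_tail A e" by blast
    note T = headed_coreD[OF slim_arcsD(1)[OF e(1)]] and O = headed_core_out2[OF slim_arcsD(1,2)[OF e(1)]]
    have "core_set A e \<subseteq> A\<inverse> `` {z}" using T(7) e(3) by auto
    then have Jz: "core_set A e = A\<inverse> `` {z}"
      using e(2,3) O(2) finite_nbrs(2)[OF fin, of z] unfolding indeg_def by (intro card_seteq) auto
    have "low_in A z = 0"
    proof (rule low_in_0)
      fix u show "(u, z) \<notin> low_arcs A"
      proof
        assume "(u, z) \<in> low_arcs A"
        then have "u \<in> core_set A e" "outdeg A u = 2" using low_arcsD[of u z] Jz by auto
        then show False using O(3)[of u] by simp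
      qed
    qed
    moreover have "(z, snd e) \<in> A" using T(2) e(3) by auto
    ultimately show "z \<in> {v \<in> V. indeg A v = 2 \<and> 3 \<le> outdeg A v \<and> low_in A v = 0}"
      using e O(4) arcV by auto
  qed
qed (use finV in simp)

text \<open>
  All arcs from the core to z are high, at least two of them, and the arcs from z to the heads
  show that the number of heads is at most the out-degree of z.
\<close>

lemma second_tail_high:
  "2 * int (card {e \<in> {e \<in> slim_arcs A. indeg A (second_tail A e) \<noteq> 2}. second_tail A e = z})
    \<le> (if 3 \<le> outdeg A z then 4 * int (high_in A z) + 2 * int (excess A z) else 0)"
proof (cases "{e \<in> {e \<in> slim_arcs A. indeg A (second_tail A e) \<noteq> 2}. second_tail A e = z} = {}")
  case True
  then show ?thesis by (simp only: True card.empty) simp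
next
  case False
  let ?S = "{e \<in> {e \<in> slim_arcs A. indeg A (second_tail A e) \<noteq> 2}. second_tail A e = z}"
  from False obtain e where e: "e \<in> slim_arcs A" "indeg A z \<noteq> 2" "z = second_tail A e" by blast
  note T = headed_coreD[OF slim_arcsD(1)[OF e(1)]] and O = headed_core_out2[OF slim_arcsD(1,2)[OF e(1)]]
  have zy: "(z, snd f) \<in> A" if "f \<in> ?S" for f
    using that headed_coreD(2)[OF slim_arcsD(1), of f] by auto
  have zV: "z \<in> V" using zy[of e] e arcV by blast
  then have iz: "3 \<le> indeg A z" using degs(2)[OF zV] e(2) by simp
  have oz: "3 \<le> outdeg A z" using O(4) e(3) by simp
  have "core_set A e \<subseteq> (high_arcs A)\<inverse> `` {z}" using T(7) O(3) iz e(3) unfolding high_arcs_def by auto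
  then have "card (core_set A e) \<le> high_in A z" unfolding high_in_def indeg_def
    by (intro card_mono finite_nbrs(2)[OF finite_low_high(2)])
  then have h2: "2 \<le> high_in A z" using O(2) by simp
  have "card ?S \<le> outdeg A z"
    unfolding outdeg_def
  proof (rule card_inj_on_le)
    show "inj_on snd ?S" by (rule inj_on_subset[OF inj_snd_slim_arcs]) auto
    show "snd ` ?S \<subseteq> A `` {z}" using zy by blast
  qed (rule finite_nbrs(1)[OF fin])
  then show ?thesis using h2 oz unfolding excess_def by simp
qed

lemma slim_arcs_no_digon: "pm A = 0 \<Longrightarrow> slim_arcs A = {}"
proof (rule ccontr)
  assume pm: "pm A = 0" and "slim_arcs A \<noteq> {}"
  then obtain e where e: "e \<in> slim_arcs A" by blast
  then have "card (core_set A e) = 2" using headed_core_out2(2)[OF slim_arcsD(1,2)] by blast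
  moreover have "e \<in> core_arcs A" using e unfolding slim_arcs_def by auto
  ultimately show False using core_arcs_card[OF _ pm] by fastforce
qed

text \<open>
  Every high arc whose tail is the head of a wide core arc spends 4 units there.
\<close>

lemma tail_payment:
  "sum (cost A) (wide_arcs A) \<le> (\<Sum>v\<in>V. if indeg A v = 2 then 4 * int (high_out A v) else 0)"
  "pm A = 0 \<Longrightarrow> 5 * sum (cost A) (wide_arcs A) \<le> 12 * int (card (high_arcs A))"
proof -
  have im: "snd ` wide_arcs A \<subseteq> V" using low_arcs_V core_arcs_low unfolding wide_arcs_def by blast
  have grp: "sum (cost A) (wide_arcs A) = (\<Sum>v\<in>V. sum (cost A) {e \<in> wide_arcs A. snd e = v})"
    by (rule sum.group[OF finT(3) finV im, symmetric])
  show "sum (cost A) (wide_arcs A) \<le> (\<Sum>v\<in>V. if indeg A v = 2 then 4 * int (high_out A v) else 0)"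
    unfolding grp
  proof (rule sum_mono)
    fix v assume "v \<in> V"
    show "sum (cost A) {e \<in> wide_arcs A. snd e = v} \<le> (if indeg A v = 2 then 4 * int (high_out A v) else 0)"
    proof (cases "{e \<in> wide_arcs A. snd e = v} = {}")
      case True
      then show ?thesis by (simp only: True sum.empty) simp
    next
      case False
      then obtain e where e: "e \<in> core_arcs A" "snd e = v" unfolding wide_arcs_def by auto
      have "(fst e, snd e) \<in> low_arcs A" using core_arcs_low[OF e(1)] by simp
      then have "indeg A v = 2" using low_arcsD[of "fst e" "snd e"] e(2) by blast
      then show ?thesis using wide_arcs_cost(1)[of v] by simp
    qed
  qed
  assume pm: "pm A = 0"
  have "5 * sum (cost A) (wide_arcs A) = (\<Sum>v\<in>V. 5 * sum (cost A) {e \<in> wide_arcs A. snd e = v})"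
    unfolding grp by (rule sum_distrib_left)
  also have "\<dots> \<le> (\<Sum>v\<in>V. 12 * int (high_out A v))" by (rule sum_mono) (use wide_arcs_cost(2)[OF pm] in auto)
  also have "\<dots> = 12 * int (card (high_arcs A))"
  proof -
    have "Domain (high_arcs A) \<subseteq> V" using arcV unfolding high_arcs_def by blast
    then have "int (card (high_arcs A)) = (\<Sum>v\<in>V. int (high_out A v))"
      unfolding high_out_def by (rule card_by_tail[OF finite_low_high(2) finV])
    then show ?thesis by (simp add: sum_distrib_left)
  qed
  finally show "5 * sum (cost A) (wide_arcs A) \<le> 12 * int (card (high_arcs A))" .
qed

text \<open>
  Every high arc whose head is the second tail of a slim core arc spends 4 units there.
\<close>

lemma second_tail_payment:
  "2 * int (card {e \<in> slim_arcs A. indeg A (second_tail A e) \<noteq> 2})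
    \<le> (\<Sum>v\<in>V. if 3 \<le> outdeg A v then 4 * int (high_in A v) + 2 * int (excess A v) else 0)"
proof -
  let ?S = "{e \<in> slim_arcs A. indeg A (second_tail A e) \<noteq> 2}"
  have "second_tail A ` ?S \<subseteq> V"
  proof
    fix z assume "z \<in> second_tail A ` ?S"
    then obtain e where "e \<in> slim_arcs A" "z = second_tail A e" by blast
    then have "(z, snd e) \<in> A" using headed_coreD(2)[OF slim_arcsD(1), of e] by auto
    then show "z \<in> V" using arcV by blast
  qed
  then have "int (card ?S) = (\<Sum>v\<in>V. int (card {e \<in> ?S. second_tail A e = v}))"
    by (intro card_fibres) (use finT finV in auto)
  then have "2 * int (card ?S) = (\<Sum>v\<in>V. 2 * int (card {e \<in> ?S. second_tail A e = v}))"
    by (simp add: sum_distrib_left)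
  also have "\<dots> \<le> (\<Sum>v\<in>V. if 3 \<le> outdeg A v then 4 * int (high_in A v) + 2 * int (excess A v) else 0)"
    by (rule sum_mono) (rule second_tail_high)
  finally show ?thesis .
qed

text \<open>
  For k \<in> {1, 2} low arcs at a tail the sum is k * (3 - k) = 2.
\<close>

lemma low_ends: "(\<Sum>e\<in>low_arcs A. 3 - int (low_out A (fst e))) = 2 * int (card {v \<in> V. outdeg A v = 2 \<and> low_out A v \<noteq> 0})"
proof -
  have "Domain (low_arcs A) \<subseteq> V" using low_arcs_V by force
  then have "(\<Sum>e\<in>low_arcs A. 3 - int (low_out A (fst e))) = (\<Sum>v\<in>V. int (outdeg (low_arcs A) v) * (3 - int (low_out A v)))"
    by (rule sum_by_tail[OF finite_low_high(1) finV])
  also have "\<dots> = (\<Sum>v\<in>V. 2 * (if outdeg A v = 2 \<and> low_out A v \<noteq> 0 then 1 else 0))"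
  proof (rule sum.cong)
    fix v assume "v \<in> V"
    show "int (outdeg (low_arcs A) v) * (3 - int (low_out A v)) = 2 * (if outdeg A v = 2 \<and> low_out A v \<noteq> 0 then 1 else 0)"
    proof (cases "\<exists>y. (v, y) \<in> low_arcs A")
      case True
      then obtain y where y: "(v, y) \<in> low_arcs A" by blast
      then have "low_out A v = 1 \<or> low_out A v = 2" "outdeg A v = 2" using low_out_bounds[OF y] low_arcsD[OF y] by auto
      then show ?thesis unfolding low_out_def by auto
    next
      case False
      then have "low_out A v = 0" by (intro low_out_0) auto
      then show ?thesis unfolding low_out_def by simp
    qed
  qed simp
  also have "\<dots> = 2 * int (card {v \<in> V. outdeg A v = 2 \<and> low_out A v \<noteq> 0})"
    unfolding sum_distrib_left[symmetric] card_as_sum[OF finV] ..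
  finally show ?thesis .
qed

lemma sum_deg: "int (card A) + int (card {v \<in> V. outdeg A v = 2}) = 3 * int (card V) + (\<Sum>v\<in>V. int (excess A v))"
proof -
  have "int (card A) = (\<Sum>v\<in>V. int (outdeg A v))"
    by (rule card_by_tail[OF fin finV]) (use arcV in blast)
  then have "int (card A) + int (card {v \<in> V. outdeg A v = 2})
      = (\<Sum>v\<in>V. int (outdeg A v) + (if outdeg A v = 2 then 1 else 0))"
    unfolding card_as_sum[OF finV] by (simp add: sum.distrib)
  also have "\<dots> = (\<Sum>v\<in>V. 3 + int (excess A v))"
    by (rule sum.cong) (use degs(1) in \<open>force simp: excess_def\<close>)+
  finally show ?thesis by (simp add: sum.distrib)
qed

lemma low_tails: "int (card {e \<in> A. outdeg A (fst e) = 2}) = 2 * int (card {v \<in> V. outdeg A v = 2})"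
proof -
  let ?G = "{e \<in> A. outdeg A (fst e) = 2}"
  have "?G \<subseteq> A" by auto
  then have "int (card ?G) = (\<Sum>v\<in>V. int (outdeg ?G v))"
    using arcV by (intro card_by_tail finV) (auto intro: finite_subset[OF _ fin])
  also have "\<dots> = (\<Sum>v\<in>V. 2 * (if outdeg A v = 2 then 1 else 0))"
  proof (rule sum.cong)
    fix v
    have "?G `` {v} = (if outdeg A v = 2 then A `` {v} else {})" by auto
    then show "int (outdeg ?G v) = 2 * (if outdeg A v = 2 then 1 else 0)"
      unfolding outdeg_def[of ?G] by (simp add: outdeg_def)
  qed simp
  finally show ?thesis unfolding sum_distrib_left[symmetric] card_as_sum[OF finV] .
qed

end

section \<open>Digons in cores\<close>

context minimal_counterexample
begin

definition digon_verts :: "'a set" where "digon_verts = {u \<in> V. \<exists>v. (u, v) \<in> A \<and> (v, u) \<in> A}"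

text \<open>
  A core of this kind has two elements in J, so one of them lies on a digon of the core; choose
  it.
\<close>

definition chosen :: "'a \<times> 'a \<Rightarrow> 'a" where
  "chosen e = (SOME u. u \<in> core_set A e \<and> (\<exists>v. v \<noteq> second_tail A e \<and> (u, v) \<in> A \<and> (v, u) \<in> A))"

lemma chosen:
  assumes "e \<in> slim_arcs A"
  shows "chosen e \<in> core_set A e" "\<exists>v. v \<noteq> second_tail A e \<and> (chosen e, v) \<in> A \<and> (v, chosen e) \<in> A"
proof -
  have "\<exists>u\<in>core_set A e. \<exists>v. v \<noteq> second_tail A e \<and> v \<noteq> snd e \<and> (u, v) \<in> A \<and> (v, u) \<in> A"
    by (rule headed_coreD(9)[OF slim_arcsD(1)[OF assms]]) (rule headed_core_out2(2)[OF slim_arcsD(1,2)[OF assms]])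
  then have "\<exists>u. u \<in> core_set A e \<and> (\<exists>v. v \<noteq> second_tail A e \<and> (u, v) \<in> A \<and> (v, u) \<in> A)" by blast
  from someI_ex[OF this] show "chosen e \<in> core_set A e" "\<exists>v. v \<noteq> second_tail A e \<and> (chosen e, v) \<in> A \<and> (v, chosen e) \<in> A"
    unfolding chosen_def by blast+
qed

lemma J_no_arc_to_head:
  assumes "headed_core A x y z J" "u \<in> J"
  shows "(u, y) \<notin> A"
proof -
  obtain w U B where D: "low A x y w z" "tight_core A y z U J B" "x \<notin> U" using assms(1) unfolding headed_core_def by blast
  have TC: "core A y z U J B" using D unfolding tight_core_def by blast
  show ?thesis using core_nbrs(2)[OF TC core_J(1)[OF TC assms(2)]] core_J(3)[OF TC assms(2)] by simp
qed

text \<open>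
  The heads of the arcs choosing u are in-neighbours of u that form no digon with u; the partner
  of u on its digon, and any in-neighbour of in-degree at least 3, is different from these
  heads.
\<close>

lemma chosen_count:
  fixes u
  defines "n \<equiv> card {e \<in> slim_arcs A. chosen e = u}"
  assumes pos: "0 < n"
  shows "n + 1 \<le> indeg A u" "3 \<le> indeg A u" "3 \<le> outdeg A u"
    "\<exists>z. (u, z) \<in> A \<and> 3 \<le> outdeg A z \<and> (\<exists>v. v \<noteq> z \<and> (u, v) \<in> A \<and> (v, u) \<in> A)"
    "\<And>w v. (w, u) \<in> A \<Longrightarrow> 3 \<le> indeg A w \<Longrightarrow> v \<noteq> w \<Longrightarrow> (u, v) \<in> A \<Longrightarrow> (v, u) \<in> A \<Longrightarrow> n + 2 \<le> indeg A u"
proof -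
  let ?S = "{e \<in> slim_arcs A. chosen e = u}"
  have "?S \<noteq> {}" using pos unfolding n_def by (metis card.empty less_irrefl)
  then obtain e where e: "e \<in> slim_arcs A" "chosen e = u" by blast
  have uJ: "u \<in> core_set A f" if "f \<in> ?S" for f using that chosen(1)[of f] by auto
  note T = headed_coreD[OF slim_arcsD(1)[OF e(1)]] and O = headed_core_out2[OF slim_arcsD(1,2)[OF e(1)]]
  have ue: "u \<in> core_set A e" using chosen(1)[OF e(1)] e(2) by simp
  show "3 \<le> indeg A u" "3 \<le> outdeg A u" using T(8)[OF ue] O(3)[OF ue] by auto
  obtain v where v: "v \<noteq> second_tail A e" "(u, v) \<in> A" "(v, u) \<in> A" using chosen(2)[OF e(1)] e(2) by auto
  show "\<exists>z. (u, z) \<in> A \<and> 3 \<le> outdeg A z \<and> (\<exists>v. v \<noteq> z \<and> (u, v) \<in> A \<and> (v, u) \<in> A)"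
    using T(7)[OF ue] O(4) v by blast
  have img: "snd ` ?S \<subseteq> A\<inverse> `` {u} - {v. (u, v) \<in> A}" "snd ` ?S \<subseteq> {y. indeg A y = 2}"
  proof -
    have "(snd f, u) \<in> A \<and> (u, snd f) \<notin> A \<and> indeg A (snd f) = 2" if "f \<in> ?S" for f
    proof -
      have f: "f \<in> slim_arcs A" using that by blast
      show ?thesis using headed_coreD(6)[OF slim_arcsD(1)[OF f] uJ[OF that]] J_no_arc_to_head[OF slim_arcsD(1)[OF f] uJ[OF that]]
          slim_arcs_head[OF f] by simp
    qed
    then show "snd ` ?S \<subseteq> A\<inverse> `` {u} - {v. (u, v) \<in> A}" "snd ` ?S \<subseteq> {y. indeg A y = 2}" by auto
  qed
  have n: "n = card (snd ` ?S)" unfolding n_def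
    by (rule card_image[symmetric, OF inj_on_subset[OF inj_snd_slim_arcs]]) auto
  have fI: "finite (A\<inverse> `` {u})" by (rule finite_nbrs(2)[OF fin])
  have less: "n + card X \<le> indeg A u" if "X \<subseteq> A\<inverse> `` {u}" "snd ` ?S \<inter> X = {}" for X
  proof -
    have "finite X" using that(1) fI finite_subset by blast
    moreover have "finite (snd ` ?S)" using finT(2) by simp
    ultimately have "n + card X = card (snd ` ?S \<union> X)" unfolding n using that(2) by (simp add: card_Un_disjoint)
    also have "\<dots> \<le> indeg A u" unfolding indeg_def by (rule card_mono[OF fI]) (use img that(1) in blast)
    finally show ?thesis .
  qed
  show "n + 1 \<le> indeg A u" using less[of "{v}"] v img by auto
  show "n + 2 \<le> indeg A u" if "(w, u) \<in> A" "3 \<le> indeg A w" "v \<noteq> w" "(u, v) \<in> A" "(v, u) \<in> A" for w v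
  proof -
    have "w \<notin> snd ` ?S" using img(2) that(2) by auto
    moreover have "v \<notin> snd ` ?S" using img(1) that(4) by auto
    ultimately show ?thesis using less[of "{v, w}"] that by auto
  qed
qed

lemma chosen_digon_verts: "chosen ` slim_arcs A \<subseteq> digon_verts"
proof
  fix u assume "u \<in> chosen ` slim_arcs A"
  then obtain e where "e \<in> slim_arcs A" "u = chosen e" by blast
  then obtain v where "(u, v) \<in> A" "(v, u) \<in> A" using chosen(2) by blast
  then show "u \<in> digon_verts" unfolding digon_verts_def using arcV by blast
qed

text \<open>
  A maximum matching leaves few vertices on digons uncovered: two uncovered vertices joined to
  different ends of one matching edge would augment it.
\<close>

lemma card_digon_verts: "int (card digon_verts) \<le> 4 * int (pm A) + (\<Sum>v\<in>V. int (excess A v))"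
proof -
  obtain M where M: "matching (dg A) M" "card M = pm A" by (rule pm_obtain[OF fin])
  have finM: "finite M" by (rule matching_finite[OF fin M(1)])
  define C where "C = \<Union>M"
  have edge: "\<exists>c d. e = {c, d} \<and> c \<noteq> d \<and> (c, d) \<in> A \<and> (d, c) \<in> A" if "e \<in> M" for e
  proof -
    have "e \<in> dg A" using M(1) that unfolding matching_def by blast
    then obtain c d where "e = {c, d}" "(c, d) \<in> A" "(d, c) \<in> A" unfolding dg_def by blast
    then show ?thesis using noloop by metis
  qed
  have CV: "C \<subseteq> V" using edge arcV unfolding C_def by blast
  have finC: "finite C" by (rule finite_subset[OF CV finV])
  define N where "N c = {u. u \<notin> C \<and> (u, c) \<in> A \<and> (c, u) \<in> A}" for c
  have finN: "finite (N c)" for c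
    by (rule finite_subset[of _ V]) (use arcV finV in \<open>auto simp: N_def\<close>)
  have cover: "digon_verts \<subseteq> C \<union> (\<Union>e\<in>M. \<Union>c\<in>e. N c)"
  proof
    fix u assume "u \<in> digon_verts"
    then obtain v where v: "(u, v) \<in> A" "(v, u) \<in> A" unfolding digon_verts_def by blast
    show "u \<in> C \<union> (\<Union>e\<in>M. \<Union>c\<in>e. N c)"
    proof (rule ccontr)
      assume no: "\<not> ?thesis"
      then have u: "u \<notin> C" "\<And>e c. e \<in> M \<Longrightarrow> c \<in> e \<Longrightarrow> u \<notin> N c" by auto
      have vC: "v \<notin> C"
      proof
        assume "v \<in> C"
        then obtain e where "e \<in> M" "v \<in> e" unfolding C_def by blast
        then show False using u(2)[of e v] u(1) v unfolding N_def by blast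
      qed
      have dis: "disjnt e {u, v}" if "e \<in> M" for e
        using that u(1) vC unfolding C_def disjnt_def by blast
      have "{u, v} \<in> dg A" using v unfolding dg_def by blast
      moreover have "M \<subseteq> dg A" "pairwise disjnt M" using M(1) unfolding matching_def by auto
      ultimately have "matching (dg A) (insert {u, v} M)"
        unfolding matching_def using dis by (auto simp: pairwise_insert disjnt_sym)
      moreover have "{u, v} \<notin> M" using u(1) unfolding C_def by blast
      ultimately show False using pm_ge[OF fin, of "insert {u, v} M"] M(2) finM by simp
    qed
  qed
  have few: "int (card (\<Union>c\<in>e. N c)) \<le> 2 + (\<Sum>c\<in>e. int (excess A c))" if e: "e \<in> M" for e
  proof -
    obtain c d where cd: "e = {c, d}" "c \<noteq> d" "(c, d) \<in> A" "(d, c) \<in> A" using edge[OF e] by blast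
    have inC: "c \<in> C" "d \<in> C" using e cd unfolding C_def by auto
    have one: "int (card (N a)) \<le> 2 + int (excess A a)" if "a \<in> C" "b \<in> C" "(a, b) \<in> A" for a b
    proof -
      have "insert b (N a) \<subseteq> A `` {a}" using that unfolding N_def by auto
      then have "card (insert b (N a)) \<le> outdeg A a" unfolding outdeg_def
        by (rule card_mono[OF finite_nbrs(1)[OF fin]])
      moreover have "b \<notin> N a" using that unfolding N_def by blast
      ultimately show ?thesis using finN[of a] unfolding excess_def by simp
    qed
    have same: "u = u'" if "u \<in> N c" "u' \<in> N d" for u u'
    proof (rule ccontr)
      assume ne: "u \<noteq> u'"
      let ?M0 = "M - {e}" and ?e1 = "{u, c}" and ?e2 = "{u', d}"
      have uC: "u \<notin> C" "u' \<notin> C" using that unfolding N_def by auto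
      have dis0: "disjnt f e" if "f \<in> ?M0" for f
      proof -
        have "pairwise disjnt M" using M(1) unfolding matching_def by blast
        then show ?thesis using pairwiseD[of disjnt M f e] that e by auto
      qed
      have dis: "disjnt f ?e1" "disjnt f ?e2" if "f \<in> ?M0" for f
        using dis0[OF that] that uC unfolding cd(1) disjnt_def C_def by auto
      have dis12: "disjnt ?e1 ?e2" using ne cd(2) uC inC unfolding disjnt_def by auto
      have sub: "?M0 \<subseteq> dg A" "pairwise disjnt ?M0" using M(1) unfolding matching_def pairwise_def by auto
      have "?e1 \<in> dg A" "?e2 \<in> dg A" using that unfolding dg_def N_def by blast+
      then have "matching (dg A) (insert ?e1 (insert ?e2 ?M0))"
        unfolding matching_def using sub dis dis12 by (auto simp: pairwise_insert disjnt_sym)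
      moreover have "?e1 \<notin> insert ?e2 ?M0" "?e2 \<notin> ?M0"
        using dis12 uC unfolding C_def disjnt_def by auto
      then have "card (insert ?e1 (insert ?e2 ?M0)) = card M + 1"
        using finM card_Suc_Diff1[OF finM e] by (simp del: card_Diff_singleton_if card_Diff_singleton card_Diff_insert)
      ultimately show False using pm_ge[OF fin] M(2) by fastforce
    qed
    have U: "(\<Union>c\<in>e. N c) = N c \<union> N d" unfolding cd(1) by auto
    have S: "(\<Sum>c\<in>e. int (excess A c)) = int (excess A c) + int (excess A d)" unfolding cd(1) using cd(2) by simp
    show ?thesis
    proof (cases "N c = {} \<or> N d = {}")
      case True
      then show ?thesis unfolding U S using one[OF inC cd(3)] one[OF inC(2,1) cd(4)] by auto
    next
      case False
      then obtain u where "u \<in> N c" by blast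
      then have "N d \<subseteq> {u}" using same by blast
      then have "N d = {u}" using False by auto
      then have "N c \<subseteq> {u}" using same by blast
      then have "N c \<union> N d = {u}" using \<open>N d = {u}\<close> by auto
      then show ?thesis unfolding U S by simp
    qed
  qed
  have disjM: "\<And>e f. e \<in> M \<Longrightarrow> f \<in> M \<Longrightarrow> e \<noteq> f \<Longrightarrow> e \<inter> f = {}"
    using M(1) unfolding matching_def pairwise_def disjnt_def by blast
  have cC: "card C \<le> 2 * card M"
  proof -
    have "card C \<le> (\<Sum>e\<in>M. card e)" unfolding C_def by (rule card_Union_le_sum_card)
    also have "\<dots> \<le> (\<Sum>e\<in>M. 2)"
    proof (rule sum_mono)
      fix e assume "e \<in> M"
      then obtain c d where "e = {c, d}" using edge by blast
      then show "card e \<le> 2" by (simp add: card_insert_if)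
    qed
    finally show ?thesis by simp
  qed
  have fine: "finite e" if "e \<in> M" for e using edge[OF that] by auto
  have "card digon_verts \<le> card (C \<union> (\<Union>e\<in>M. \<Union>c\<in>e. N c))"
    by (rule card_mono[OF _ cover]) (use finC finM fine finN in auto)
  also have "\<dots> \<le> card C + card (\<Union>e\<in>M. \<Union>c\<in>e. N c)" by (rule card_Un_le)
  also have "\<dots> \<le> 2 * card M + (\<Sum>e\<in>M. card (\<Union>c\<in>e. N c))"
    using cC card_UN_le[OF finM, of "\<lambda>e. \<Union>c\<in>e. N c"] by simp
  finally have "int (card digon_verts) \<le> 2 * int (card M) + (\<Sum>e\<in>M. int (card (\<Union>c\<in>e. N c)))"
    by (metis (mono_tags, lifting) of_nat_add of_nat_le_iff of_nat_mult of_nat_numeral of_nat_sum sum.cong)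
  also have "\<dots> \<le> 2 * int (card M) + (\<Sum>e\<in>M. 2 + (\<Sum>c\<in>e. int (excess A c)))"
    using sum_mono[of M "\<lambda>e. int (card (\<Union>c\<in>e. N c))" "\<lambda>e. 2 + (\<Sum>c\<in>e. int (excess A c))"] few by simp
  also have "\<dots> = 4 * int (card M) + (\<Sum>e\<in>M. \<Sum>c\<in>e. int (excess A c))" by (simp add: sum.distrib)
  also have "(\<Sum>e\<in>M. \<Sum>c\<in>e. int (excess A c)) = (\<Sum>c\<in>C. int (excess A c))"
    unfolding C_def by (subst sum.Union_disjoint) (use fine disjM in auto)
  also have "(\<Sum>c\<in>C. int (excess A c)) \<le> (\<Sum>c\<in>V. int (excess A c))"
    by (rule sum_mono2[OF finV CV]) auto
  finally show ?thesis using M(2) by simp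
qed

text \<open>
  At most 2 + d arcs choose u, in both directions together, where d is the excess of the degrees
  at u over 3, and the vertices on digons are few by \<open>card_digon_verts\<close>.
\<close>

lemma slim_arcs_count:
  "int (card (slim_arcs A)) + int (card (slim_arcs (A\<inverse>))) \<le>
    8 * int (pm A) + 3 * ((\<Sum>v\<in>V. int (excess A v)) + (\<Sum>v\<in>V. int (excess (A\<inverse>) v)))"
proof -
  interpret C: minimal_counterexample "A\<inverse>" by (rule minimal_counterexample_converse)
  have dvC: "C.digon_verts = digon_verts" unfolding C.digon_verts_def digon_verts_def by auto
  have dvV: "digon_verts \<subseteq> V" unfolding digon_verts_def by auto
  have findv: "finite digon_verts" by (rule finite_subset[OF dvV finV])
  let ?n = "\<lambda>u. card {e \<in> slim_arcs A. chosen e = u}" and ?m = "\<lambda>u. card {e \<in> slim_arcs (A\<inverse>). C.chosen e = u}"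
  have c1: "int (card (slim_arcs A)) = (\<Sum>u\<in>digon_verts. int (?n u))"
    by (rule card_fibres[OF finT(2) findv chosen_digon_verts])
  have c2: "int (card (slim_arcs (A\<inverse>))) = (\<Sum>u\<in>digon_verts. int (?m u))"
    by (rule card_fibres[OF C.finT(2) findv]) (use C.chosen_digon_verts dvC in simp)
  have "int (?n u) + int (?m u) \<le> 2 + int (excess A u) + int (excess (A\<inverse>) u)" for u
  proof (cases "?n u = 0")
    case n0: True
    show ?thesis
    proof (cases "?m u = 0")
      case True
      then show ?thesis using n0 by simp
    next
      case False
      then have "0 < ?m u" by simp
      note m = C.chosen_count[OF this]
      show ?thesis using m(1,2) n0 unfolding excess_def by simp
    qed
  next
    case False
    then have npos: "0 < ?n u" by simp
    note n = chosen_count[OF npos]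
    show ?thesis
    proof (cases "?m u = 0")
      case True
      then show ?thesis using n(1,2) unfolding excess_def by simp
    next
      case False
      then have mpos: "0 < ?m u" by simp
      note m = C.chosen_count[OF mpos]
      obtain z v where "(u, z) \<in> A" "3 \<le> outdeg A z" "v \<noteq> z" "(u, v) \<in> A" "(v, u) \<in> A" using n(4) by blast
      then have "?m u + 2 \<le> outdeg A u" using m(5)[of z v] by simp
      moreover obtain z' v' where "(z', u) \<in> A" "3 \<le> indeg A z'" "v' \<noteq> z'" "(u, v') \<in> A" "(v', u) \<in> A"
        using m(4) by auto
      then have "?n u + 2 \<le> indeg A u" using n(5)[of z' v'] by simp
      ultimately show ?thesis unfolding excess_def by simp
    qed
  qed
  then have "(\<Sum>u\<in>digon_verts. int (?n u)) + (\<Sum>u\<in>digon_verts. int (?m u)) \<le> (\<Sum>u\<in>digon_verts. 2 + int (excess A u) + int (excess (A\<inverse>) u))"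
    unfolding sum.distrib[symmetric] by (intro sum_mono)
  also have "\<dots> = 2 * int (card digon_verts) + (\<Sum>u\<in>digon_verts. int (excess A u)) + (\<Sum>u\<in>digon_verts. int (excess (A\<inverse>) u))"
    by (simp add: sum.distrib)
  also have "\<dots> \<le> 2 * int (card digon_verts) + (\<Sum>u\<in>V. int (excess A u)) + (\<Sum>u\<in>V. int (excess (A\<inverse>) u))"
    using sum_mono2[OF finV dvV, of "\<lambda>u. int (excess A u)"] sum_mono2[OF finV dvV, of "\<lambda>u. int (excess (A\<inverse>) u)"] by simp
  finally have "int (card (slim_arcs A)) + int (card (slim_arcs (A\<inverse>))) \<le>
      2 * int (card digon_verts) + (\<Sum>u\<in>V. int (excess A u)) + (\<Sum>u\<in>V. int (excess (A\<inverse>) u))" unfolding c1 c2 .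
  moreover have "0 \<le> (\<Sum>v\<in>V. int (excess (A\<inverse>) v))" by (rule sum_nonneg) simp
  ultimately show ?thesis using card_digon_verts unfolding distrib_left by linarith
qed

section \<open>The counting argument\<close>

text \<open>
  Each low arc gets eight units. They are paid by the tails and heads with degree 2 and by the
  high arcs, up to one unit for each slim core arc. Digons are expensive in the potential;
  without digons there are no slim core arcs, and the bound for the wide ones can be used as it
  stands.
\<close>

lemma count:
  defines "E \<equiv> (\<Sum>v\<in>V. int (excess A v)) + (\<Sum>v\<in>V. int (excess (A\<inverse>) v))"
    and "h \<equiv> int (card (high_arcs A))"
    and "S \<equiv> sum (cost A) (wide_arcs A)" and "S' \<equiv> sum (cost (A\<inverse>)) (wide_arcs (A\<inverse>))"
    and "n \<equiv> int (card (slim_arcs A))" and "n' \<equiv> int (card (slim_arcs (A\<inverse>)))"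
  shows "12 * rho A \<le> n + n' - 12 * E - 24 * int (pm A)"
    "pm A = 0 \<Longrightarrow> 12 * rho A \<le> S + S' - 8 * h - 14 * E"
proof -
  interpret C: minimal_counterexample "A\<inverse>" by (rule minimal_counterexample_converse)
  define a where "a = int (card {v \<in> V. outdeg A v = 2})"
  define b where "b = int (card {v \<in> V. indeg A v = 2})"
  define a1 where "a1 = int (card {v \<in> V. outdeg A v = 2 \<and> low_out A v \<noteq> 0})"
  define b1 where "b1 = int (card {v \<in> V. indeg A v = 2 \<and> low_in A v \<noteq> 0})"
  define a0 where "a0 = int (card {v \<in> V. outdeg A v = 2 \<and> low_out A v = 0})"
  define b0 where "b0 = int (card {v \<in> V. indeg A v = 2 \<and> low_in A v = 0})"
  define L where "L = int (card (low_arcs A))"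
  define p where "p = int (card (paired_arcs A))"
  have split: "card {v \<in> V. P v} = card {v \<in> V. P v \<and> Q v} + card {v \<in> V. P v \<and> \<not> Q v}" for P Q :: "'a \<Rightarrow> bool"
    by (subst card_Un_disjoint[symmetric]) (use finV in \<open>auto intro: arg_cong[where f = card]\<close>)
  have a: "a = a0 + a1" unfolding a_def a0_def a1_def using split[of "\<lambda>v. outdeg A v = 2" "\<lambda>v. low_out A v = 0"] by simp
  have b: "b = b0 + b1" unfolding b_def b0_def b1_def using split[of "\<lambda>v. indeg A v = 2" "\<lambda>v. low_in A v = 0"] by simp
  have D1: "int (card A) + a = 3 * int (card V) + (\<Sum>v\<in>V. int (excess A v))" unfolding a_def by (rule sum_deg)
  have D2: "int (card A) + b = 3 * int (card V) + (\<Sum>v\<in>V. int (excess (A\<inverse>) v))"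
    using C.sum_deg unfolding b_def by (simp add: card_inverse)
  have D3: "int (card A) + L = 2 * a + 2 * b + h"
  proof -
    let ?P = "{e \<in> A. outdeg A (fst e) = 2}" and ?Q = "{e \<in> A. indeg A (snd e) = 2}"
    have fPQ: "finite ?P" "finite ?Q" using fin by auto
    have P: "int (card ?P) = 2 * a" unfolding a_def by (rule low_tails)
    have "card {e \<in> A\<inverse>. outdeg (A\<inverse>) (fst e) = 2} = card ?Q"
      by (rule bij_betw_same_card[of prod.swap]) (auto simp: bij_betw_def inj_on_def image_iff)
    then have Q: "int (card ?Q) = 2 * b" using C.low_tails unfolding b_def by simp
    have PQ: "?P \<inter> ?Q = low_arcs A" unfolding low_arcs_def by auto
    have "A = (?P \<union> ?Q) \<union> high_arcs A"
    proof
      show "A \<subseteq> (?P \<union> ?Q) \<union> high_arcs A"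
      proof
        fix e assume e: "e \<in> A"
        obtain u v where uv: "e = (u, v)" by (cases e)
        have "2 \<le> outdeg A u" "2 \<le> indeg A v" using degs arcV e uv by auto
        then show "e \<in> (?P \<union> ?Q) \<union> high_arcs A" using e uv unfolding high_arcs_def by auto
      qed
    qed (auto simp: high_arcs_def)
    then have "card A = card ((?P \<union> ?Q) \<union> high_arcs A)" by simp
    also have "\<dots> = card (?P \<union> ?Q) + card (high_arcs A)"
      by (rule card_Un_disjoint) (use fPQ finite_low_high in \<open>auto simp: high_arcs_def\<close>)
    finally have "card A + card (low_arcs A) = card ?P + card ?Q + card (high_arcs A)"
      using card_Un_Int[OF fPQ] unfolding PQ by simp
    then show ?thesis using P Q unfolding L_def h_def by linarith
  qed
  have Eeq: "E = (\<Sum>v\<in>V. int (excess A v)) + (\<Sum>v\<in>V. int (excess (A\<inverse>) v))" by (simp add: E_def)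
  \<comment> \<open>eliminate the numbers of vertices and arcs\<close>
  have rho_eq: "12 * rho A = 8 * L - 2 * a - 2 * b - 8 * h - 14 * E - 24 * int (pm A)"
  proof -
    have "12 * rho A = 84 * int (card V) - 36 * int (card A) - 24 * int (pm A)" unfolding rho_def by simp
    then show ?thesis using D1 D2 D3 Eeq by linarith
  qed
  \<comment> \<open>each low arc splits its eight units between its tail, its head and the rest\<close>
  have costs: "8 * L = 2 * a1 + 2 * b1 + sum (cost A) (low_arcs A)"
  proof -
    have 1: "(\<Sum>e\<in>low_arcs A. 3 - int (low_out A (fst e))) = 2 * a1" unfolding a1_def by (rule low_ends)
    have "(\<Sum>e\<in>low_arcs A. 3 - int (low_in A (snd e))) = (\<Sum>e\<in>low_arcs (A\<inverse>). 3 - int (low_out (A\<inverse>) (fst e)))"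
      by (rule sum.reindex_bij_witness[of _ prod.swap prod.swap]) auto
    then have 2: "(\<Sum>e\<in>low_arcs A. 3 - int (low_in A (snd e))) = 2 * b1"
      using C.low_ends unfolding b1_def by simp
    have "8 * L = (\<Sum>e\<in>low_arcs A. (3 - int (low_out A (fst e))) + (3 - int (low_in A (snd e))) + cost A e)"
      unfolding L_def cost_def by simp
    also have "\<dots> = (\<Sum>e\<in>low_arcs A. 3 - int (low_out A (fst e))) + (\<Sum>e\<in>low_arcs A. 3 - int (low_in A (snd e))) + sum (cost A) (low_arcs A)"
      by (simp only: sum.distrib)
    finally show ?thesis unfolding 1 2 .
  qed
  have swap_cost: "sum (cost A) (X\<inverse>) = sum (cost (A\<inverse>)) X" for X
    by (rule sum.reindex_bij_witness[of _ prod.swap prod.swap]) (auto simp: cost_def)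
  have cpos: "0 \<le> cost A e" for e unfolding cost_def by simp
  have finP: "finite (paired_arcs A)" using finite_low_high(1) unfolding paired_arcs_def by simp
  have T_split: "sum (cost A) (core_arcs A) = sum (cost A) (slim_arcs A) + S"
  proof -
    have "core_arcs A = slim_arcs A \<union> wide_arcs A" "slim_arcs A \<inter> wide_arcs A = {}" unfolding slim_arcs_def wide_arcs_def by auto
    then show ?thesis unfolding S_def using finT by (simp add: sum.union_disjoint)
  qed
  have T_split': "sum (cost (A\<inverse>)) (core_arcs (A\<inverse>)) = sum (cost (A\<inverse>)) (slim_arcs (A\<inverse>)) + S'"
  proof -
    have "core_arcs (A\<inverse>) = slim_arcs (A\<inverse>) \<union> wide_arcs (A\<inverse>)" "slim_arcs (A\<inverse>) \<inter> wide_arcs (A\<inverse>) = {}" unfolding slim_arcs_def wide_arcs_def by auto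
    then show ?thesis unfolding S'_def using C.finT by (simp add: sum.union_disjoint)
  qed
  have "sum (cost A) (low_arcs A) \<le> sum (cost A) (paired_arcs A \<union> (core_arcs A \<union> (core_arcs (A\<inverse>))\<inverse>))"
    by (rule sum_mono2) (use finP finT C.finT cpos in \<open>auto simp: paired_arcs_def\<close>)
  also have "\<dots> \<le> sum (cost A) (paired_arcs A) + (sum (cost A) (core_arcs A) + sum (cost A) ((core_arcs (A\<inverse>))\<inverse>))"
  proof -
    have le: "sum (cost A) (X \<union> Y) \<le> sum (cost A) X + sum (cost A) Y" if "finite X" "finite Y" for X Y
      using sum.union_inter[OF that, of "cost A"] sum_nonneg[of "X \<inter> Y" "cost A"] cpos by simp
    show ?thesis
      using le[of "paired_arcs A" "core_arcs A \<union> (core_arcs (A\<inverse>))\<inverse>"] le[of "core_arcs A" "(core_arcs (A\<inverse>))\<inverse>"] finP finT C.finT by simp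
  qed
  also have "sum (cost A) (paired_arcs A) = 4 * p" unfolding p_def using paired_arcs_cost by simp
  finally have tot: "sum (cost A) (low_arcs A) \<le> 4 * p + sum (cost A) (slim_arcs A) + S + sum (cost (A\<inverse>)) (slim_arcs (A\<inverse>)) + S'"
    using T_split T_split' swap_cost[of "core_arcs (A\<inverse>)"] by simp
  have V5: "sum (cost A) (slim_arcs A) \<le> 5 * n" unfolding n_def
    using sum_bounded_above[of "slim_arcs A" "cost A" 5] slim_arcs_cost by (simp add: mult.commute)
  have V5': "sum (cost (A\<inverse>)) (slim_arcs (A\<inverse>)) \<le> 5 * n'" unfolding n'_def
    using sum_bounded_above[of "slim_arcs (A\<inverse>)" "cost (A\<inverse>)" 5] C.slim_arcs_cost by (simp add: mult.commute)
  let ?VL = "{e \<in> slim_arcs A. indeg A (second_tail A e) = 2}" and ?VH = "{e \<in> slim_arcs A. indeg A (second_tail A e) \<noteq> 2}"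
  let ?VL' = "{e \<in> slim_arcs (A\<inverse>). outdeg A (second_tail (A\<inverse>) e) = 2}" and ?VH' = "{e \<in> slim_arcs (A\<inverse>). outdeg A (second_tail (A\<inverse>) e) \<noteq> 2}"
  have nLH: "n = int (card ?VL) + int (card ?VH)"
  proof -
    have "slim_arcs A = ?VL \<union> ?VH" "?VL \<inter> ?VH = {}" by auto
    then show ?thesis unfolding n_def using finT(2) card_Un_disjoint[of ?VL ?VH] by simp
  qed
  have nLH': "n' = int (card ?VL') + int (card ?VH')"
  proof -
    have "slim_arcs (A\<inverse>) = ?VL' \<union> ?VH'" "?VL' \<inter> ?VH' = {}" by auto
    then show ?thesis unfolding n'_def using C.finT(2) card_Un_disjoint[of ?VL' ?VH'] by simp
  qed
  have pc: "card (paired_arcs (A\<inverse>)) = card (paired_arcs A)" unfolding paired_arcs_converse by (simp add: card_inverse)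
  have A0: "p + n + int (card ?VL') \<le> a0"
  proof -
    have 1: "card (paired_arcs A) + card (slim_arcs A) \<le> card {v \<in> V. outdeg A v = 2 \<and> indeg A v = 2 \<and> low_out A v = 0}" by (rule pair_heads)
    have 2: "card ?VL' \<le> card {v \<in> V. outdeg A v = 2 \<and> 3 \<le> indeg A v \<and> low_out A v = 0}" using C.second_tail_low by simp
    have "card ({v \<in> V. outdeg A v = 2 \<and> indeg A v = 2 \<and> low_out A v = 0} \<union> {v \<in> V. outdeg A v = 2 \<and> 3 \<le> indeg A v \<and> low_out A v = 0})
        \<le> card {v \<in> V. outdeg A v = 2 \<and> low_out A v = 0}" by (rule card_mono) (use finV in auto)
    moreover have "card ({v \<in> V. outdeg A v = 2 \<and> indeg A v = 2 \<and> low_out A v = 0} \<union> {v \<in> V. outdeg A v = 2 \<and> 3 \<le> indeg A v \<and> low_out A v = 0})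
       = card {v \<in> V. outdeg A v = 2 \<and> indeg A v = 2 \<and> low_out A v = 0} + card {v \<in> V. outdeg A v = 2 \<and> 3 \<le> indeg A v \<and> low_out A v = 0}"
      by (rule card_Un_disjoint) (use finV in auto)
    ultimately show ?thesis using 1 2 unfolding p_def n_def a0_def by linarith
  qed
  have B0: "p + n' + int (card ?VL) \<le> b0"
  proof -
    have 1: "card (paired_arcs A) + card (slim_arcs (A\<inverse>)) \<le> card {v \<in> V. indeg A v = 2 \<and> outdeg A v = 2 \<and> low_in A v = 0}"
      using C.pair_heads unfolding pc by simp
    have 2: "card ?VL \<le> card {v \<in> V. indeg A v = 2 \<and> 3 \<le> outdeg A v \<and> low_in A v = 0}" by (rule second_tail_low)
    have "card ({v \<in> V. indeg A v = 2 \<and> outdeg A v = 2 \<and> low_in A v = 0} \<union> {v \<in> V. indeg A v = 2 \<and> 3 \<le> outdeg A v \<and> low_in A v = 0})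
        \<le> card {v \<in> V. indeg A v = 2 \<and> low_in A v = 0}" by (rule card_mono) (use finV in auto)
    moreover have "card ({v \<in> V. indeg A v = 2 \<and> outdeg A v = 2 \<and> low_in A v = 0} \<union> {v \<in> V. indeg A v = 2 \<and> 3 \<le> outdeg A v \<and> low_in A v = 0})
       = card {v \<in> V. indeg A v = 2 \<and> outdeg A v = 2 \<and> low_in A v = 0} + card {v \<in> V. indeg A v = 2 \<and> 3 \<le> outdeg A v \<and> low_in A v = 0}"
      by (rule card_Un_disjoint) (use finV in auto)
    ultimately show ?thesis using 1 2 unfolding p_def n'_def b0_def by linarith
  qed
  have hsum: "h = (\<Sum>v\<in>V. int (high_out A v))" "h = (\<Sum>v\<in>V. int (high_in A v))"
  proof -
    have "Domain (high_arcs A) \<subseteq> V" "Range (high_arcs A) \<subseteq> V" using arcV unfolding high_arcs_def by blast+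
    then show "h = (\<Sum>v\<in>V. int (high_out A v))" "h = (\<Sum>v\<in>V. int (high_in A v))"
      unfolding h_def high_out_def high_in_def using card_by_tail[OF finite_low_high(2) finV] card_by_head[OF finite_low_high(2) finV] by auto
  qed
  have head: "2 * int (card ?VH) + S' \<le> 4 * h + 2 * (\<Sum>v\<in>V. int (excess A v))"
  proof -
    have "2 * int (card ?VH) \<le> (\<Sum>v\<in>V. if 3 \<le> outdeg A v then 4 * int (high_in A v) + 2 * int (excess A v) else 0)" by (rule second_tail_payment)
    moreover have "S' \<le> (\<Sum>v\<in>V. if outdeg A v = 2 then 4 * int (high_in A v) else 0)"
      unfolding S'_def using C.tail_payment(1) by (simp cong: if_cong)
    moreover have "(\<Sum>v\<in>V. if 3 \<le> outdeg A v then 4 * int (high_in A v) + 2 * int (excess A v) else 0) +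
        (\<Sum>v\<in>V. if outdeg A v = 2 then 4 * int (high_in A v) else 0) \<le> (\<Sum>v\<in>V. 4 * int (high_in A v) + 2 * int (excess A v))"
      unfolding sum.distrib[symmetric] by (rule sum_mono) auto
    moreover have "(\<Sum>v\<in>V. 4 * int (high_in A v) + 2 * int (excess A v)) = 4 * h + 2 * (\<Sum>v\<in>V. int (excess A v))"
      unfolding hsum(2) by (simp add: sum.distrib sum_distrib_left)
    ultimately show ?thesis by linarith
  qed
  have tail: "2 * int (card ?VH') + S \<le> 4 * h + 2 * (\<Sum>v\<in>V. int (excess (A\<inverse>) v))"
  proof -
    have "2 * int (card ?VH') \<le> (\<Sum>v\<in>V. if 3 \<le> indeg A v then 4 * int (high_out A v) + 2 * int (excess (A\<inverse>) v) else 0)"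
      using C.second_tail_payment by (simp cong: if_cong)
    moreover have "S \<le> (\<Sum>v\<in>V. if indeg A v = 2 then 4 * int (high_out A v) else 0)"
      unfolding S_def by (rule tail_payment(1))
    moreover have "(\<Sum>v\<in>V. if 3 \<le> indeg A v then 4 * int (high_out A v) + 2 * int (excess (A\<inverse>) v) else 0) +
        (\<Sum>v\<in>V. if indeg A v = 2 then 4 * int (high_out A v) else 0) \<le> (\<Sum>v\<in>V. 4 * int (high_out A v) + 2 * int (excess (A\<inverse>) v))"
      unfolding sum.distrib[symmetric] by (rule sum_mono) auto
    moreover have "(\<Sum>v\<in>V. 4 * int (high_out A v) + 2 * int (excess (A\<inverse>) v)) = 4 * h + 2 * (\<Sum>v\<in>V. int (excess (A\<inverse>) v))"
      unfolding hsum(1) by (simp add: sum.distrib sum_distrib_left)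
    ultimately show ?thesis by linarith
  qed
  show "12 * rho A \<le> n + n' - 12 * E - 24 * int (pm A)"
    using rho_eq costs tot V5 V5' nLH nLH' A0 B0 head tail a b Eeq by linarith
  show "12 * rho A \<le> S + S' - 8 * h - 14 * E" if pm: "pm A = 0"
  proof -
    have V: "slim_arcs A = {}" "slim_arcs (A\<inverse>) = {}" using slim_arcs_no_digon[OF pm] C.slim_arcs_no_digon pm by auto
    have s0: "sum (cost A) (slim_arcs A) = 0" "sum (cost (A\<inverse>)) (slim_arcs (A\<inverse>)) = 0" unfolding V by auto
    have "n = 0" "n' = 0" unfolding n_def n'_def V by auto
    then show ?thesis using rho_eq costs tot s0 A0 B0 a b pm by linarith
  qed
qed

text \<open>
  The units missing for slim core arcs, 8 for each matching edge, are outweighed by the 24 units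
  that a matching edge takes from the potential.
\<close>

lemma pm_zero: "pm A = 0"
proof (rule ccontr)
  assume "pm A \<noteq> 0"
  then have "1 \<le> int (pm A)" by simp
  moreover have "0 \<le> (\<Sum>v\<in>V. int (excess A v))" "0 \<le> (\<Sum>v\<in>V. int (excess (A\<inverse>) v))" by (auto intro: sum_nonneg)
  ultimately show False using count(1)[unfolded distrib_left] slim_arcs_count[unfolded distrib_left] rho by linarith
qed

text \<open>
  A wide core arc comes with at least three high arcs at its head, and the payments 5 S \<le> 12
  h in both directions leave too little for the potential. Without core arcs 12 rho \<le> - 8 h
  - 14 E, and rho \<ge> -1.
\<close>

lemma few_high_arcs: "core_arcs A = {}" "core_arcs (A\<inverse>) = {}" "card (high_arcs A) \<le> 1"
    "\<And>v. v \<in> V \<Longrightarrow> outdeg A v \<le> 3 \<and> indeg A v \<le> 3"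
proof -
  interpret C: minimal_counterexample "A\<inverse>" by (rule minimal_counterexample_converse)
  define E where "E = (\<Sum>v\<in>V. int (excess A v)) + (\<Sum>v\<in>V. int (excess (A\<inverse>) v))"
  define h where "h = int (card (high_arcs A))"
  define S where "S = sum (cost A) (wide_arcs A)"
  define S' where "S' = sum (cost (A\<inverse>)) (wide_arcs (A\<inverse>))"
  have pmC: "pm (A\<inverse>) = 0" using pm_zero by simp
  have E0: "0 \<le> E" unfolding E_def by (intro add_nonneg_nonneg sum_nonneg) auto
  have main: "12 * rho A \<le> S + S' - 8 * h - 14 * E"
    using count(2)[OF pm_zero] unfolding S_def S'_def h_def E_def .
  have AT: "wide_arcs A = core_arcs A" using slim_arcs_no_digon[OF pm_zero] unfolding wide_arcs_def slim_arcs_def by blast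
  have AT': "wide_arcs (A\<inverse>) = core_arcs (A\<inverse>)" using C.slim_arcs_no_digon[OF pmC] unfolding wide_arcs_def slim_arcs_def by blast
  have 1: "5 * S \<le> 12 * h" unfolding S_def h_def by (rule tail_payment(2)[OF pm_zero])
  have 2: "5 * S' \<le> 12 * h" unfolding S'_def h_def using C.tail_payment(2)[OF pmC] by (simp add: card_inverse)
  have T1: "\<exists>y. 3 \<le> high_out A y" if ne: "wide_arcs A \<noteq> {}"
  proof -
    obtain e where "e \<in> wide_arcs A" using ne by blast
    then have "{f \<in> wide_arcs A. snd f = snd e} \<noteq> {}" by blast
    then show ?thesis using wide_arcs_cost(3)[OF pm_zero] by blast
  qed
  have T2: "\<exists>x. 3 \<le> high_in A x" if ne: "wide_arcs (A\<inverse>) \<noteq> {}"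
  proof -
    obtain e where "e \<in> wide_arcs (A\<inverse>)" using ne by blast
    then have "{f \<in> wide_arcs (A\<inverse>). snd f = snd e} \<noteq> {}" by blast
    then have "3 \<le> high_out (A\<inverse>) (snd e)" by (rule C.wide_arcs_cost(3)[OF pmC])
    then show ?thesis by auto
  qed
  have ho_le: "int (high_out A y) \<le> h" and hi_le: "int (high_in A x) \<le> h" for x y
  proof -
    have "card ({y} \<times> (high_arcs A `` {y})) \<le> card (high_arcs A)" by (rule card_mono[OF finite_low_high(2)]) auto
    then show "int (high_out A y) \<le> h" unfolding high_out_def outdeg_def h_def by (simp add: card_cartesian_product)
    have "card (((high_arcs A)\<inverse> `` {x}) \<times> {x}) \<le> card (high_arcs A)" by (rule card_mono[OF finite_low_high(2)]) auto
    then show "int (high_in A x) \<le> h" unfolding high_in_def indeg_def h_def by (simp add: card_cartesian_product)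
  qed
  \<comment> \<open>at most the arc from y to x is counted on both sides\<close>
  have both: "int (high_out A y) + int (high_in A x) \<le> h + 1" for x y
  proof -
    let ?P = "{y} \<times> (high_arcs A `` {y})" and ?Q = "((high_arcs A)\<inverse> `` {x}) \<times> {x}"
    have f: "finite ?P" "finite ?Q" using finite_nbrs[OF finite_low_high(2)] by auto
    have "card (?P \<inter> ?Q) \<le> card {(y, x)}" by (rule card_mono) auto
    moreover have "card (?P \<union> ?Q) \<le> card (high_arcs A)" by (rule card_mono[OF finite_low_high(2)]) auto
    ultimately show ?thesis using card_Un_Int[OF f] unfolding high_out_def high_in_def outdeg_def indeg_def h_def
      by (simp add: card_cartesian_product)
  qed
  have empty: "wide_arcs A = {} \<and> wide_arcs (A\<inverse>) = {}"
  proof (rule ccontr)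
    assume no: "\<not> ?thesis"
    show False
    proof (cases "wide_arcs A = {}")
      case True
      then have "wide_arcs (A\<inverse>) \<noteq> {}" using no by blast
      then obtain x where "3 \<le> high_in A x" using T2 by blast
      then have "3 \<le> h" using hi_le[of x] by linarith
      moreover have "S = 0" unfolding S_def True by simp
      ultimately show False using main 2 E0 rho by linarith
    next
      case ne: False
      then obtain y where y: "3 \<le> high_out A y" using T1 by blast
      then have h3: "3 \<le> h" using ho_le[of y] by linarith
      show False
      proof (cases "wide_arcs (A\<inverse>) = {}")
        case True
        then have "S' = 0" unfolding S'_def by simp
        then show False using main 1 E0 rho h3 by linarith
      next
        case False
        then obtain x where "3 \<le> high_in A x" using T2 by blast
        then have "5 \<le> h" using both[of y x] y by linarith
        then show False using main 1 2 E0 rho by linarith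
      qed
    qed
  qed
  then show "core_arcs A = {}" "core_arcs (A\<inverse>) = {}" using AT AT' by auto
  have "S = 0" "S' = 0" unfolding S_def S'_def using empty by auto
  then have "8 * h + 14 * E \<le> 12" using main rho by linarith
  moreover have "0 \<le> h" unfolding h_def by simp
  ultimately have "h \<le> 1" "E = 0" using E0 by linarith+
  then show "card (high_arcs A) \<le> 1" unfolding h_def by simp
  have "(\<Sum>v\<in>V. int (excess A v)) = 0" "(\<Sum>v\<in>V. int (excess (A\<inverse>) v)) = 0"
    using \<open>E = 0\<close> sum_nonneg[of V "\<lambda>v. int (excess A v)"] sum_nonneg[of V "\<lambda>v. int (excess (A\<inverse>) v)"] unfolding E_def by auto
  then have "\<forall>v\<in>V. int (excess A v) = 0" "\<forall>v\<in>V. int (excess (A\<inverse>) v) = 0"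
    using finV by (subst (asm) sum_nonneg_eq_0_iff; simp)+
  then show "outdeg A v \<le> 3 \<and> indeg A v \<le> 3" if "v \<in> V" for v using that unfolding excess_def by auto
qed

end

section \<open>The final colouring\<close>

text \<open>
  No path has length two.
\<close>

lemma acyclic_no_chain:
  assumes "\<And>a b d. (a, b) \<in> r \<Longrightarrow> (b, d) \<notin> r"
  shows "acyclic r"
proof -
  have "(a, b) \<in> r \<and> a \<noteq> b" if "(a, b) \<in> r\<^sup>+" for a b
    using that assms by (induction) metis+
  then show ?thesis unfolding acyclic_def by blast
qed

lemma acyclic_disjoint_Un:
  assumes "acyclic r" "acyclic s" "Field r \<inter> Field s = {}"
  shows "acyclic (r \<union> s)"
proof -
  have "(a, b) \<in> r\<^sup>+ \<or> (a, b) \<in> s\<^sup>+" if "(a, b) \<in> (r \<union> s)\<^sup>+" for a b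
    using that
  proof induction
    case (base b)
    then show ?case by auto
  next
    case (step b d)
    from step.IH show ?case
    proof
      assume r: "(a, b) \<in> r\<^sup>+"
      then have "b \<in> Field r" using trancl_range[of r] unfolding Field_def by (metis Range.intros UnI2)
      then have "b \<notin> Field s" using assms(3) by blast
      then have "(b, d) \<in> r" using step(2) unfolding Field_def by auto
      then show ?thesis using r by (meson trancl.trancl_into_trancl)
    next
      assume s: "(a, b) \<in> s\<^sup>+"
      then have "b \<in> Field s" using trancl_range[of s] unfolding Field_def by (metis Range.intros UnI2)
      then have "b \<notin> Field r" using assms(3) by blast
      then have "(b, d) \<in> s" using step(2) unfolding Field_def by auto
      then show ?thesis using s by (meson trancl.trancl_into_trancl)
    qed
  qed
  then show ?thesis using assms(1,2) unfolding acyclic_def by blast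
qed

context minimal_counterexample
begin

lemma part_colouring:
  assumes "ind A R \<noteq> A"
  obtains c where "proper_col c (ind A R)" "c v"
proof -
  have "colourable (ind A R)" using sub_all[OF ind_subset] assms by blast
  then obtain c where c: "proper_col c (ind A R)" unfolding colourable_def by blast
  show ?thesis
  proof (cases "c v")
    case True
    then show ?thesis using that c by blast
  next
    case False
    have "mono_arcs (\<lambda>u. \<not> c u) (ind A R) = mono_arcs c (ind A R)" by auto
    then have "proper_col (\<lambda>u. \<not> c u) (ind A R)" using c unfolding proper_col_def by simp
    then show ?thesis using that[of "\<lambda>u. \<not> c u"] False by blast
  qed
qed

text \<open>
  All degrees are 2 or 3. Let P be the vertices with out-degree 2 and in-degree 3, let Q be
  those with the opposite degrees, and let V4 and V6 be those with both degrees 2 and both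
  degrees 3. Low arcs only join vertices of V4 and form no path of length two, and there is at
  most one high arc. The sets P and Q are proper, as out-degrees and in-degrees have the same
  sum, so they can be coloured; let V4 have the first colour and V6 the second. An arc from P or
  V4 to Q or V4 is low, and an arc from Q or V6 to P or V6 is high. So, up to the high arc, all
  arcs of the first class respect the order Q, V4, P of its parts, and those of the second class
  the order P, V6, Q. The high arc is made harmless by giving its ends the first colour if they
  are in P or Q.
\<close>

theorem contradiction: False
proof -
  note few = few_high_arcs
  define P where "P = {v \<in> V. outdeg A v = 2 \<and> indeg A v = 3}"
  define Q where "Q = {v \<in> V. outdeg A v = 3 \<and> indeg A v = 2}"
  define V4 where "V4 = {v \<in> V. outdeg A v = 2 \<and> indeg A v = 2}"
  define V6 where "V6 = {v \<in> V. outdeg A v = 3 \<and> indeg A v = 3}"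
  have four: "v \<in> P \<or> v \<in> Q \<or> v \<in> V4 \<or> v \<in> V6" if "v \<in> V" for v
  proof -
    have "outdeg A v = 2 \<or> outdeg A v = 3" "indeg A v = 2 \<or> indeg A v = 3"
      using degs[OF that] few(4)[OF that] by linarith+
    then show ?thesis using that unfolding P_def Q_def V4_def V6_def by blast
  qed
  have excl: "v \<in> P \<Longrightarrow> v \<notin> Q \<and> v \<notin> V4 \<and> v \<notin> V6" "v \<in> Q \<Longrightarrow> v \<notin> V4 \<and> v \<notin> V6" "v \<in> V4 \<Longrightarrow> v \<notin> V6" for v
    unfolding P_def Q_def V4_def V6_def by simp_all
  have low_V4: "x \<in> V4 \<and> y \<in> V4 \<and> low_out A y = 0" if "(x, y) \<in> low_arcs A" for x y
  proof -
    have "paired A x y" using low_arc_kinds[OF that] few(1,2) by blast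
    then show ?thesis using low_arcsD[OF that] arcV unfolding paired_def V4_def by blast
  qed
  have out_low: "v \<in> P \<union> V4 \<Longrightarrow> outdeg A v = 2" and in_low: "v \<in> Q \<union> V4 \<Longrightarrow> indeg A v = 2"
    and out_high: "v \<in> Q \<union> V6 \<Longrightarrow> outdeg A v = 3" and in_high: "v \<in> P \<union> V6 \<Longrightarrow> indeg A v = 3" for v
    unfolding P_def Q_def V4_def V6_def by (simp; blast)+
  have nolow: "\<not> (a \<in> P \<union> V4 \<and> b \<in> Q \<union> V4 \<and> \<not> (a \<in> V4 \<and> b \<in> V4))" if "(a, b) \<in> A" for a b
  proof
    assume nl: "a \<in> P \<union> V4 \<and> b \<in> Q \<union> V4 \<and> \<not> (a \<in> V4 \<and> b \<in> V4)"
    then have "(a, b) \<in> low_arcs A" using that out_low[of a] in_low[of b] unfolding low_arcs_def by simp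
    then show False using low_V4[of a b] nl by blast
  qed
  have high: "(a, b) \<in> high_arcs A" if "(a, b) \<in> A" "a \<in> Q \<union> V6" "b \<in> P \<union> V6" for a b
    using that out_high[of a] in_high[of b] unfolding high_arcs_def by simp
  have oneh: "e = f" if "e \<in> high_arcs A" "f \<in> high_arcs A" for e f
    using few(3) finite_low_high(2) that by (simp add: card_le_Suc0_iff_eq)
  obtain t0 h0 where th: "\<And>a b. (a, b) \<in> high_arcs A \<Longrightarrow> a = t0 \<and> b = h0"
  proof (cases "high_arcs A = {}")
    case True
    then show ?thesis using that by blast
  next
    case False
    then obtain a b where "(a, b) \<in> high_arcs A" by (metis equals0I surj_pair)
    then show ?thesis using that[of a b] oneh by blast
  qed
  have sumeq: "(\<Sum>v\<in>V. int (outdeg A v)) = (\<Sum>v\<in>V. int (indeg A v))"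
  proof -
    have "Domain A \<subseteq> V" "Range A \<subseteq> V" unfolding Field_def by auto
    then show ?thesis using card_by_tail[OF fin finV] card_by_head[OF fin finV] by simp
  qed
  have Vne: "V \<noteq> {}"
  proof
    assume "V = {}"
    then have "A = {}" unfolding Field_def by auto
    then have "proper_col (\<lambda>_. True) A" unfolding proper_col_def mono_arcs_def by (auto simp: acyclic_empty)
    then show False using ncol unfolding colourable_def by blast
  qed
  have "ind A P \<noteq> A"
  proof
    assume "ind A P = A"
    then have "V \<subseteq> P" using Field_ind[of A P] by simp
    then have "\<And>v. v \<in> V \<Longrightarrow> int (outdeg A v) < int (indeg A v)" unfolding P_def by auto
    then have "(\<Sum>v\<in>V. int (outdeg A v)) < (\<Sum>v\<in>V. int (indeg A v))" by (rule sum_strict_mono[OF finV Vne])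
    then show False using sumeq by simp
  qed
  then obtain cP where cP: "proper_col cP (ind A P)" "cP h0" by (rule part_colouring)
  have "ind A Q \<noteq> A"
  proof
    assume "ind A Q = A"
    then have "V \<subseteq> Q" using Field_ind[of A Q] by simp
    then have "\<And>v. v \<in> V \<Longrightarrow> int (indeg A v) < int (outdeg A v)" unfolding Q_def by auto
    then have "(\<Sum>v\<in>V. int (indeg A v)) < (\<Sum>v\<in>V. int (outdeg A v))" by (rule sum_strict_mono[OF finV Vne])
    then show False using sumeq by simp
  qed
  then obtain cQ where cQ: "proper_col cQ (ind A Q)" "cQ t0" by (rule part_colouring)
  \<comment> \<open>the ends of the only high arc, if there is one, have the first colour in P and in Q\<close>
  define c where "c v = (if v \<in> P then cP v else if v \<in> Q then cQ v else v \<in> V4)" for v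
  \<comment> \<open>the first class is ordered Q, V4, P and the second class P, V6, Q\<close>
  define l :: "'a \<Rightarrow> nat" where "l v = (if v \<in> P then if c v then 2 else 0 else if v \<in> Q then if c v then 0 else 2 else 1)" for v
  let ?M = "ind A V4 \<union> ind A V6"
  let ?t = "(mono_arcs cP (ind A P) \<union> mono_arcs cQ (ind A Q)) \<union> ?M"
  have acM: "acyclic ?M"
  proof (rule acyclic_no_chain)
    fix a b d assume ab: "(a, b) \<in> ?M"
    show "(b, d) \<notin> ?M"
    proof
      assume bd: "(b, d) \<in> ?M"
      have same: "a \<in> V4 \<and> b \<in> V4 \<and> d \<in> V4 \<or> a \<in> V6 \<and> b \<in> V6 \<and> d \<in> V6" using ab bd excl by auto
      have A: "(a, b) \<in> A" "(b, d) \<in> A" using ab bd by auto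
      from same show False
      proof
        assume 4: "a \<in> V4 \<and> b \<in> V4 \<and> d \<in> V4"
        then have L: "(a, b) \<in> low_arcs A" "(b, d) \<in> low_arcs A" using A out_low in_low unfolding low_arcs_def by simp_all
        then have "low_out A b = 0" using low_V4 by blast
        then show False using low_out_bounds[OF L(2)] by simp
      next
        assume 6: "a \<in> V6 \<and> b \<in> V6 \<and> d \<in> V6"
        then have "(a, b) \<in> high_arcs A" "(b, d) \<in> high_arcs A" using A high by blast+
        then have "a = b" using oneh by blast
        then show False using A noloop by simp
      qed
    qed
  qed
  have Fsub: "Field (mono_arcs cP (ind A P)) \<subseteq> P" "Field (mono_arcs cQ (ind A Q)) \<subseteq> Q" "Field ?M \<subseteq> V4 \<union> V6"
    unfolding Field_def by auto
  have PQ: "P \<inter> Q = {}" "(P \<union> Q) \<inter> (V4 \<union> V6) = {}" using excl by auto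
  have act: "acyclic ?t"
  proof (rule acyclic_disjoint_Un[OF acyclic_disjoint_Un acM])
    show "acyclic (mono_arcs cP (ind A P))" "acyclic (mono_arcs cQ (ind A Q))"
      using cP(1) cQ(1) unfolding proper_col_def .
    show "Field (mono_arcs cP (ind A P)) \<inter> Field (mono_arcs cQ (ind A Q)) = {}" using Fsub PQ by blast
    show "Field (mono_arcs cP (ind A P) \<union> mono_arcs cQ (ind A Q)) \<inter> Field ?M = {}"
    proof -
      have "Field (mono_arcs cP (ind A P) \<union> mono_arcs cQ (ind A Q)) \<subseteq> P \<union> Q"
        unfolding Field_Un using Fsub(1,2) by (rule Un_mono)
      then show ?thesis using PQ(2) Fsub(3) by (metis Int_mono subset_empty)
    qed
  qed
  have acl: "acyclic {(i, j). i < (j :: nat)}"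
  proof -
    have "(i, j) \<in> {(i, j). i < (j :: nat)}\<^sup>+ \<Longrightarrow> i < j" for i j by (induction rule: trancl_induct) auto
    then show ?thesis unfolding acyclic_def by blast
  qed
  have "acyclic (mono_arcs c A)"
  proof (rule acyclic_lex[where f = l, OF acl act])
    fix a b assume "(a, b) \<in> mono_arcs c A"
    then have ab: "(a, b) \<in> A" "c a = c b" by auto
    have inV: "a \<in> V" "b \<in> V" using arcV[OF ab(1)] by auto
    note nl = nolow[OF ab(1)]
    have hh: "a = t0 \<and> b = h0" if "a \<in> Q \<union> V6" "b \<in> P \<union> V6" using th high[OF ab(1) that] by blast
    have cv: "v \<in> V4 \<Longrightarrow> c v" "v \<in> V6 \<Longrightarrow> \<not> c v" "v \<in> P \<Longrightarrow> c v = cP v" "v \<in> Q \<Longrightarrow> c v = cQ v" for v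
      using excl[of v] unfolding c_def by auto
    have lv: "v \<in> V4 \<Longrightarrow> l v = 1" "v \<in> V6 \<Longrightarrow> l v = 1" "v \<in> P \<Longrightarrow> l v = (if c v then 2 else 0)" "v \<in> Q \<Longrightarrow> l v = (if c v then 0 else 2)" for v
      using excl[of v] unfolding l_def by auto
    let ?goal = "(l a, l b) \<in> {(i, j). i < j} \<or> l a = l b \<and> (a, b) \<in> ?t"
    have less: ?goal if "l a < l b" using that by simp
    have tie: ?goal if "l a = l b" "(a, b) \<in> ?t" using that by blast
    consider (P) "a \<in> P" | (Q) "a \<in> Q" | (V4) "a \<in> V4" | (V6) "a \<in> V6" using four[OF inV(1)] by blast
    then show ?goal
    proof cases
      case P
      then consider (PP) "b \<in> P" | (PV6) "b \<in> V6" using four[OF inV(2)] nl excl by blast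
      then show ?thesis
      proof cases
        case PP
        then have "(a, b) \<in> mono_arcs cP (ind A P)" using P ab cv(3)[OF P] cv(3)[OF PP] by simp
        then show ?thesis using ab(2) lv(3)[OF P] lv(3)[OF PP] by (intro tie) (simp, blast)
      next
        case PV6
        show ?thesis using ab(2) cv(2)[OF PV6] lv(2)[OF PV6] lv(3)[OF P] by (intro less) simp
      qed
    next
      case Q
      consider (QP) "b \<in> P" | (QQ) "b \<in> Q" | (QV4) "b \<in> V4" | (QV6) "b \<in> V6" using four[OF inV(2)] by blast
      then show ?thesis
      proof cases
        case QP
        then have "b = h0" using hh Q by blast
        then show ?thesis using ab(2) cv(3)[OF QP] cP(2) lv(3)[OF QP] lv(4)[OF Q] by (intro less) simp
      next
        case QQ
        then have "(a, b) \<in> mono_arcs cQ (ind A Q)" using Q ab cv(4)[OF Q] cv(4)[OF QQ] by simp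
        then show ?thesis using ab(2) lv(4)[OF Q] lv(4)[OF QQ] by (intro tie) (simp, blast)
      next
        case QV4
        show ?thesis using ab(2) cv(1)[OF QV4] lv(1)[OF QV4] lv(4)[OF Q] by (intro less) simp
      next
        case QV6
        then have "a = t0" using hh Q by blast
        then have "c a" using cv(4)[OF Q] cQ(2) by simp
        then show ?thesis using cv(2)[OF QV6] ab(2) by simp
      qed
    next
      case V4
      consider (V4P) "b \<in> P" | (V4V4) "b \<in> V4" | (V4V6) "b \<in> V6" using four[OF inV(2)] nl V4 excl by blast
      then show ?thesis
      proof cases
        case V4P
        show ?thesis using ab(2) cv(1)[OF V4] lv(1)[OF V4] lv(3)[OF V4P] by (intro less) simp
      next
        case V4V4
        then have "(a, b) \<in> ?M" using V4 ab(1) by simp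
        then show ?thesis using lv(1)[OF V4] lv(1)[OF V4V4] by (intro tie) (simp, blast)
      next
        case V4V6
        then show ?thesis using ab(2) cv(1)[OF V4] cv(2)[OF V4V6] by simp
      qed
    next
      case V6
      consider (V6P) "b \<in> P" | (V6Q) "b \<in> Q" | (V6V4) "b \<in> V4" | (V6V6) "b \<in> V6" using four[OF inV(2)] by blast
      then show ?thesis
      proof cases
        case V6P
        then have "b = h0" using hh V6 by blast
        then have "c b" using cv(3)[OF V6P] cP(2) by simp
        then show ?thesis using cv(2)[OF V6] ab(2) by simp
      next
        case V6Q
        show ?thesis using ab(2) cv(2)[OF V6] lv(2)[OF V6] lv(4)[OF V6Q] by (intro less) simp
      next
        case V6V4
        then show ?thesis using ab(2) cv(2)[OF V6] cv(1)[OF V6V4] by simp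
      next
        case V6V6
        then have "(a, b) \<in> ?M" using V6 ab(1) by simp
        then show ?thesis using lv(2)[OF V6] lv(2)[OF V6V6] by (intro tie) (simp, blast)
      qed
    qed
  qed
  then show False using ncol unfolding colourable_def proper_col_def by blast
qed

end

text \<open>
  Strong induction on the number of vertices: a violation is a minimal counterexample.
\<close>

theorem crit_potential: "crit A \<Longrightarrow> cyc A \<or> wheel A \<or> rho A \<le> -2"
proof (induction "card (Field A)" arbitrary: A rule: less_induct)
  case less
  show ?case
  proof (rule ccontr)
    assume no: "\<not> (cyc A \<or> wheel A \<or> rho A \<le> -2)"
    interpret minimal_counterexample A
      by standard (use no less in auto)
    show False by (rule contradiction)
  qed
qed

section \<open>Dicritical digraphs as sets of arcs\<close>

text \<open>A closed walk contains a cycle, so cycles in the sense of walks and cycles of the arc relation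
  exist together.\<close>

lemma (in wf_digraph) acyclic_digraph_iff: "acyclic_digraph G \<longleftrightarrow> acyclic (arcs_ends G)"
proof -
  have "(\<exists>p. cycle p) \<longleftrightarrow> (\<exists>p. closed_w p)"
    using closed_w_imp_cycle cycle_altdef by blast
  also have "\<dots> \<longleftrightarrow> (\<exists>u. (u, u) \<in> (arcs_ends G)\<^sup>+)"
    unfolding closed_w_def reachable1_awalk by auto
  finally show ?thesis unfolding acyclic_digraph_def acyclic_def by blast
qed

lemma dicolouring_iff:
  assumes "pair_wf_digraph D"
  shows "dicolouring D k c \<longleftrightarrow> (\<forall>v\<in>pverts D. c v \<in> {1..k}) \<and>
           (\<forall>i\<in>{1..k}. acyclic (ind (parcs D) {v \<in> pverts D. c v = i}))"
proof -
  have "acyclic_digraph (with_proj D \<restriction> S) \<longleftrightarrow> acyclic (ind (parcs D) S)" for S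
  proof -
    have "wf_digraph (with_proj D \<restriction> S)" by unfold_locales auto
    moreover have "arcs_ends (with_proj D \<restriction> S) = ind (parcs D) S"
      unfolding arcs_ends_conv ind_def by auto
    ultimately show ?thesis using wf_digraph.acyclic_digraph_iff by metis
  qed
  then show ?thesis unfolding dicolouring_def by simp
qed

lemma ex_dicolouring:
  assumes "pair_digraph D"
  shows "\<exists>k c. dicolouring D k c"
proof -
  interpret pair_digraph D by fact
  obtain h where h: "bij_betw h (pverts D) {0..<card (pverts D)}"
    using ex_bij_betw_finite_nat[OF pair_finite_verts] by blast
  have "ind (parcs D) {v \<in> pverts D. Suc (h v) = i} = {}" for i
  proof -
    have "\<not> (a \<in> pverts D \<and> b \<in> pverts D \<and> Suc (h a) = i \<and> Suc (h b) = i)" if "(a, b) \<in> parcs D" for a b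
      using pair_no_loops[OF that] inj_onD[OF bij_betw_imp_inj_on[OF h], of a b] by auto
    then show ?thesis unfolding ind_def by auto
  qed
  moreover have "Suc (h v) \<in> {1..card (pverts D)}" if "v \<in> pverts D" for v
    using bij_betwE[OF h] that by auto
  ultimately have "dicolouring D (card (pverts D)) (\<lambda>v. Suc (h v))"
    unfolding dicolouring_iff[OF pair_wf_digraph_axioms] by (simp add: acyclic_empty)
  then show ?thesis by blast
qed

lemma dichromatic_le_2_iff:
  assumes "pair_digraph D"
  shows "dichromatic_number D \<le> 2 \<longleftrightarrow> colourable (parcs D)"
proof -
  interpret pair_digraph D by fact
  let ?A = "parcs D"
  note iff = dicolouring_iff[OF pair_wf_digraph_axioms]
  have ends: "a \<in> pverts D" "b \<in> pverts D" if "(a, b) \<in> ?A" for a b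
    using that in_arcsD1 in_arcsD2 by blast+
  show ?thesis
  proof
    assume le: "dichromatic_number D \<le> 2"
    obtain c where "dicolouring D (dichromatic_number D) c"
      using LeastI_ex[OF ex_dicolouring[OF assms]] unfolding dichromatic_number_def by blast
    then have c: "\<And>v. v \<in> pverts D \<Longrightarrow> c v \<in> {1..dichromatic_number D}"
      "\<And>i. i \<in> {1..dichromatic_number D} \<Longrightarrow> acyclic (ind ?A {v \<in> pverts D. c v = i})"
      unfolding iff by blast+
    have ac: "acyclic (ind ?A {v \<in> pverts D. c v = i})" for i
    proof (cases "i \<in> {1..dichromatic_number D}")
      case False
      then have "{v \<in> pverts D. c v = i} = {}" using c(1) by blast
      then have "ind ?A {v \<in> pverts D. c v = i} = {}" unfolding ind_def by auto
      then show ?thesis by (simp add: acyclic_empty)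
    qed (rule c(2))
    let ?t = "\<lambda>i. ind ?A {v \<in> pverts D. c v = i}"
    have F: "Field (?t i) \<subseteq> {v. c v = i}" for i unfolding Field_def by auto
    have "{v. c v = 1} \<inter> {v. c v = 2} = {}" by auto
    then have "Field (?t 1) \<inter> Field (?t 2) = {}" using Int_mono[OF F[of 1] F[of 2]] by simp
    then have "acyclic (?t 1 \<union> ?t 2)" by (rule acyclic_disjoint_Un[OF ac ac])
    moreover have "mono_arcs (\<lambda>v. c v = 1) ?A \<subseteq> ?t 1 \<union> ?t 2"
    proof
      fix e assume "e \<in> mono_arcs (\<lambda>v. c v = 1) ?A"
      then obtain a b where e: "e = (a, b)" "(a, b) \<in> ?A" "(c a = 1) = (c b = 1)" by (cases e) auto
      have "c a \<in> {1..2}" "c b \<in> {1..2}" using c(1)[OF ends(1)[OF e(2)]] c(1)[OF ends(2)[OF e(2)]] le by auto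
      then have "c a = 1 \<and> c b = 1 \<or> c a = 2 \<and> c b = 2" using e(3) by auto
      then show "e \<in> ?t 1 \<union> ?t 2" using e ends[OF e(2)] by auto
    qed
    ultimately show "colourable ?A" unfolding colourable_def proper_col_def by (meson acyclic_subset)
  next
    assume "colourable ?A"
    then obtain b where b: "acyclic (mono_arcs b ?A)" unfolding colourable_def proper_col_def by blast
    let ?c = "\<lambda>v. if b v then 1 else 2 :: nat"
    have "ind ?A {v \<in> pverts D. ?c v = i} \<subseteq> mono_arcs b ?A" for i
      by (auto split: if_splits)
    then have "acyclic (ind ?A {v \<in> pverts D. ?c v = i})" for i using b by (meson acyclic_subset)
    then have "dicolouring D 2 ?c" unfolding iff by simp
    then show "dichromatic_number D \<le> 2" unfolding dichromatic_number_def
      by (intro Least_le[where P = "\<lambda>k. \<exists>c. dicolouring D k c"] exI)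
  qed
qed

lemma proper_subdigraphI:
  assumes "pair_digraph D" "pair_digraph H" "pverts H \<subseteq> pverts D" "parcs H \<subseteq> parcs D"
    and "pverts H \<noteq> pverts D \<or> parcs H \<noteq> parcs D"
  shows "proper_subdigraph H D"
proof -
  interpret D: pair_digraph D by fact
  interpret H: pair_digraph H by fact
  have "subgraph (with_proj H) (with_proj D)"
    unfolding subgraph_def compatible_def using assms(3,4) D.wf_digraph_axioms H.wf_digraph_axioms by simp
  then show ?thesis unfolding proper_subdigraph_def using assms(5) by blast
qed

text \<open>Deleting an isolated vertex keeps the arcs and hence the dichromatic number, so a dicritical
  digraph is determined by its arcs.\<close>

lemma dicritical_crit:
  assumes "pair_digraph D" "dicritical 3 D"
  shows "crit (parcs D)" "Field (parcs D) = pverts D"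
proof -
  interpret pair_digraph D by fact
  let ?A = "parcs D"
  have ends: "a \<in> pverts D \<and> b \<in> pverts D" if "(a, b) \<in> ?A" for a b
    using that in_arcsD1 in_arcsD2 by blast
  have ncol: "\<not> colourable ?A"
    using dichromatic_le_2_iff[OF assms(1)] assms(2) unfolding dicritical_def by simp
  have sub: "colourable (parcs H)" if "pair_digraph H" "proper_subdigraph H D" for H
    using that dichromatic_le_2_iff[OF that(1)] assms(2) unfolding dicritical_def by fastforce
  have "colourable (?A - {e})" if "e \<in> ?A" for e
  proof -
    let ?H = "\<lparr> pverts = pverts D, parcs = ?A - {e} \<rparr>"
    have H: "pair_digraph ?H"
      using pair_finite_verts pair_finite_arcs ends pair_no_loops by unfold_locales fastforce+
    have "proper_subdigraph ?H D" using that by (intro proper_subdigraphI[OF assms(1) H]) auto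
    then show ?thesis using sub[OF H] by simp
  qed
  moreover have "irrefl ?A" using pair_no_loops unfolding irrefl_def by fastforce
  ultimately show "crit ?A" unfolding crit_def using ncol pair_finite_arcs by blast
  have "Field ?A \<subseteq> pverts D" using ends unfolding Field_def by blast
  moreover have "v \<in> Field ?A" if "v \<in> pverts D" for v
  proof (rule ccontr)
    assume "v \<notin> Field ?A"
    then have nv: "a \<noteq> v \<and> b \<noteq> v" if "(a, b) \<in> ?A" for a b using that unfolding Field_def by blast
    let ?H = "\<lparr> pverts = pverts D - {v}, parcs = ?A \<rparr>"
    have H: "pair_digraph ?H"
      using pair_finite_verts pair_finite_arcs ends nv pair_no_loops by unfold_locales fastforce+
    have "proper_subdigraph ?H D" using that by (intro proper_subdigraphI[OF assms(1) H]) auto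
    then show False using sub[OF H] ncol by simp
  qed
  ultimately show "Field ?A = pverts D" by blast
qed

lemma digons_cycle_edges: "digons (cycle_edges vs) = pd vs \<union> dig (last vs) (hd vs)"
  unfolding cycle_edges_def digons_insert digons_path_edges by blast

lemma bidirected_odd_cycle_iff:
  assumes "Field (parcs D) = pverts D"
  shows "bidirected_odd_cycle D \<longleftrightarrow> cyc (parcs D)"
proof
  assume "bidirected_odd_cycle D"
  then obtain vs where "distinct vs" "3 \<le> length vs" "odd (length vs)"
    "D = \<lparr> pverts = set vs, parcs = digons (cycle_edges vs) \<rparr>"
    unfolding bidirected_odd_cycle_def by blast
  then have "cyc_list vs (parcs D)" unfolding cyc_list_def by (simp add: digons_cycle_edges)
  then show "cyc (parcs D)" by (rule list_imp_cyc)
next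
  assume "cyc (parcs D)"
  then obtain vs where vs: "cyc_list vs (parcs D)" using cyc_imp_list by blast
  then have l: "distinct vs" "3 \<le> length vs" "odd (length vs)" "parcs D = pd vs \<union> dig (last vs) (hd vs)"
    unfolding cyc_list_def by auto
  have "vs \<noteq> []" using l(2) by auto
  then have "Field (dig (last vs) (hd vs)) \<subseteq> set vs" unfolding Field_def by auto
  moreover have "Field (pd vs) = set vs" using Field_pd[of vs] l(2) by simp
  ultimately have "pverts D = set vs" unfolding assms[symmetric] l(4) Field_Un by blast
  then have "D = \<lparr> pverts = set vs, parcs = digons (cycle_edges vs) \<rparr>"
    using l(4) digons_cycle_edges[of vs] by (cases D) simp
  then show "bidirected_odd_cycle D" unfolding bidirected_odd_cycle_def using l(1,2,3) by blast
qed

lemma odd_3_wheel_iff: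
  assumes "Field (parcs D) = pverts D"
  shows "odd_3_wheel D \<longleftrightarrow> wheel (parcs D)"
proof -
  have "odd_3_wheel D \<longleftrightarrow> (\<exists>c x y z P Q R. wheel_list c x y z P Q R (parcs D))"
  proof
    assume "odd_3_wheel D"
    then obtain c x y z P Q R where w: "distinct [x, y, z]"
      "odd_path c P x" "odd_path c Q y" "odd_path c R z"
      "set P \<inter> set Q = {c}" "set P \<inter> set R = {c}" "set Q \<inter> set R = {c}"
      "set P \<inter> {x, y, z} = {x}" "set Q \<inter> {x, y, z} = {y}" "set R \<inter> {x, y, z} = {z}"
      and D: "D = \<lparr> pverts = set P \<union> set Q \<union> set R,
        parcs = {(x, y), (y, z), (z, x)} \<union> digons (path_edges P \<union> path_edges Q \<union> path_edges R) \<rparr>"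
      unfolding odd_3_wheel_def by (elim exE conjE) (rule that)
    have "parcs D = {(x, y), (y, z), (z, x)} \<union> (pd P \<union> pd Q \<union> pd R)"
      unfolding D by (simp add: digons_Un digons_path_edges)
    then have "wheel_list c x y z P Q R (parcs D)" unfolding wheel_list_def using w by (intro conjI)
    then show "\<exists>c x y z P Q R. wheel_list c x y z P Q R (parcs D)" by blast
  next
    assume "\<exists>c x y z P Q R. wheel_list c x y z P Q R (parcs D)"
    then obtain c x y z P Q R where w: "wheel_list c x y z P Q R (parcs D)" by blast
    have "pverts D = set P \<union> set Q \<union> set R" using Field_wheel_list[OF w] assms by simp
    moreover have "parcs D = {(x, y), (y, z), (z, x)} \<union> digons (path_edges P \<union> path_edges Q \<union> path_edges R)"
      using w unfolding wheel_list_def digons_Un digons_path_edges by blast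
    ultimately have "D = \<lparr> pverts = set P \<union> set Q \<union> set R,
        parcs = {(x, y), (y, z), (z, x)} \<union> digons (path_edges P \<union> path_edges Q \<union> path_edges R) \<rparr>"
      by (cases D) simp
    then show "odd_3_wheel D" using w unfolding odd_3_wheel_def wheel_list_def
      by (intro exI[of _ c] exI[of _ x] exI[of _ y] exI[of _ z] exI[of _ P] exI[of _ Q] exI[of _ R]) (elim conjE, intro conjI)
  qed
  then show ?thesis using list_imp_wheel wheel_imp_list by metis
qed

lemma potential_eq_rho:
  assumes "Field (parcs D) = pverts D"
  shows "potential D = rho (parcs D)"
  unfolding potential_def rho_def digon_matching_number_def digon_edges_def pm_def dg_def assms ..

theorem theorem1p5:
  fixes D :: "'a pair_pre_digraph"
  assumes "pair_digraph D"
    and "dicritical 3 D"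
  shows "(bidirected_odd_cycle D \<longrightarrow> potential D = 1) \<and>
         (odd_3_wheel D \<longrightarrow> potential D = -1) \<and>
         (\<not> bidirected_odd_cycle D \<and> \<not> odd_3_wheel D \<longrightarrow> potential D \<le> -2)"
proof -
  note crit = dicritical_crit[OF assms]
  show ?thesis
    unfolding bidirected_odd_cycle_iff[OF crit(2)] odd_3_wheel_iff[OF crit(2)] potential_eq_rho[OF crit(2)]
    using cyc_basic wheel_basic crit_potential[OF crit(1)] by blast
qed

end
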